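(* For every $n$-gon $D$ whose convex hull $\hat D$ has $\hat n\ge 3$ sides, there is at least one proportional system of triangles $\{T_i\}_{i=1}^m$ (in particular, admissible for $D$), with $\hat n\le m\le n$, that covers $D$, i.e. $$\bigcup_{i=1}^m\overline{T}_i\supset D.$$ In particular, $\sum_{i=1}^m\operatorname{Area}T_i\ge\operatorname{Area}D$.
   Context: An $n$-gon ($n\ge3$) is a simply connected Jordan domain in $\mathbb{C}$ (not necessarily convex) whose boundary consists of $n$ rectilinear segments, called its sides. "Triangle" means a usual (bounded) Euclidean triangle with one distinguished side called its base; the opposite vertex and the angle there are called the base vertex and the base angle. Let $T$ be a triangle with base $[a_1,a_2]$ and base vertex $a_0$. Let $V$ be the smallest infinite sector with vertex at $a_0$ that contains $T$. The infinite triangle $S=V\setminus\overline{T}$ (with base $[a_1,a_2]$ and base vertex $\infty$) is called the sector associated with $T$; its sides are its two boundary rays starting at $a_1$ and $a_2$. The triangle $T$ is called admissible for $D$ if $T\cap D\ne\emptyset$, the base of $T$ lies on $\partial D$ (it need not be an entire side of $D$), $S\cap D=\emptyset$, and each closed side (not the base) of $S$ contains at least one vertex of $D$. A system of triangles $\{T_i\}_{i=1}^m$ is called admissible for $D$ if each $T_i$ is admissible for $D$, the associated sectors $S_i$ are pairwise disjoint, and $\bigcup_{i=1}^m\overline{S}_i$ covers the complement of the convex hull $\hat D$ of $D$. An admissible system is called proportional if the quotient $\alpha_i/\sigma_i$ is the same for all $i=1,\ldots,m$, where $\alpha_i$ and $\sigma_i$ are the base angle and the area of $T_i$. *)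

theory Defs
  imports "HOL-Analysis.Analysis"
begin

definition jordan_domain :: "complex set \<Rightarrow> bool" where
  "jordan_domain D \<longleftrightarrow>
     (\<exists>\<gamma>. simple_path \<gamma> \<and> pathfinish \<gamma> = pathstart \<gamma> \<and> D = inside (path_image \<gamma>))"

definition side_ends :: "complex list \<Rightarrow> nat \<Rightarrow> complex set" where
  "side_ends vs i = {vs ! i, vs ! (Suc i mod length vs)}"

definition side :: "complex list \<Rightarrow> nat \<Rightarrow> complex set" where
  "side vs i = closed_segment (vs ! i) (vs ! (Suc i mod length vs))"

text \<open>
  The list \<open>vs\<close> enumerates the vertices of the domain \<open>D\<close> in cyclic order. Consecutive
  sides may be collinear, i.e. a vertex with interior angle \<open>pi\<close> is allowed.
\<close>

definition ngon :: "nat \<Rightarrow> complex list \<Rightarrow> complex set \<Rightarrow> bool" where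
  "ngon n vs D \<longleftrightarrow>
     3 \<le> n \<and> length vs = n \<and> distinct vs \<and>
     (\<forall>i<n. \<forall>j<n. i \<noteq> j \<longrightarrow> side vs i \<inter> side vs j = side_ends vs i \<inter> side_ends vs j) \<and>
     jordan_domain D \<and> simply_connected D \<and>
     frontier D = (\<Union>i<n. side vs i)"

text \<open>The domain \<open>D\<close> is open, so its hull is closed up before its edges are taken.\<close>

definition hull_sides :: "complex set \<Rightarrow> complex set set" where
  "hull_sides D = {e. e edge_of closure (convex hull D)}"

datatype triangle =
  Triangle (base_vertex: complex) (base_end1: complex) (base_end2: complex)

definition nondegenerate :: "triangle \<Rightarrow> bool" where
  "nondegenerate T \<longleftrightarrow> \<not> collinear {base_vertex T, base_end1 T, base_end2 T}"

text \<open>Triangles, like domains and sectors, are open sets.\<close>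

definition region :: "triangle \<Rightarrow> complex set" where
  "region T = interior (convex hull {base_vertex T, base_end1 T, base_end2 T})"

definition base :: "triangle \<Rightarrow> complex set" where
  "base T = closed_segment (base_end1 T) (base_end2 T)"

definition base_angle :: "triangle \<Rightarrow> real" where
  "base_angle T =
     (let u = base_end1 T - base_vertex T; v = base_end2 T - base_vertex T
      in arccos ((u \<bullet> v) / (norm u * norm v)))"

definition area :: "complex set \<Rightarrow> real" where
  "area A = measure lebesgue A"

definition infinite_sector :: "complex \<Rightarrow> complex set \<Rightarrow> bool" where
  "infinite_sector a W \<longleftrightarrow>
     (\<exists>\<phi> \<psi>. \<phi> < \<psi> \<and> \<psi> \<le> \<phi> + 2 * pi \<and>
        W = {a + complex_of_real r * cis \<theta> | r \<theta>. 0 < r \<and> \<phi> < \<theta> \<and> \<theta> < \<psi>})"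

text \<open>
  For a nondegenerate triangle the intersection is itself an infinite sector, hence the
  smallest one that contains the triangle.
\<close>

definition spanned_sector :: "triangle \<Rightarrow> complex set" where
  "spanned_sector T = \<Inter>{W. infinite_sector (base_vertex T) W \<and> region T \<subseteq> W}"

definition assoc_sector :: "triangle \<Rightarrow> complex set" where
  "assoc_sector T = spanned_sector T - closure (region T)"

text \<open>The closed ray from \<open>p\<close> pointing away from \<open>a\<close>.\<close>

definition ray_away :: "complex \<Rightarrow> complex \<Rightarrow> complex set" where
  "ray_away a p = {p + t *\<^sub>R (p - a) | t. 0 \<le> t}"

definition sector_side1 :: "triangle \<Rightarrow> complex set" where
  "sector_side1 T = ray_away (base_vertex T) (base_end1 T)"

definition sector_side2 :: "triangle \<Rightarrow> complex set" where
  "sector_side2 T = ray_away (base_vertex T) (base_end2 T)"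

definition admissible_triangle :: "complex list \<Rightarrow> complex set \<Rightarrow> triangle \<Rightarrow> bool" where
  "admissible_triangle vs D T \<longleftrightarrow>
     nondegenerate T \<and>
     region T \<inter> D \<noteq> {} \<and>
     base T \<subseteq> frontier D \<and>
     assoc_sector T \<inter> D = {} \<and>
     sector_side1 T \<inter> set vs \<noteq> {} \<and>
     sector_side2 T \<inter> set vs \<noteq> {}"

definition admissible_system ::
    "complex list \<Rightarrow> complex set \<Rightarrow> nat \<Rightarrow> (nat \<Rightarrow> triangle) \<Rightarrow> bool" where
  "admissible_system vs D m T \<longleftrightarrow>
     (\<forall>i\<in>{1..m}. admissible_triangle vs D (T i)) \<and>
     (\<forall>i\<in>{1..m}. \<forall>j\<in>{1..m}. i \<noteq> j \<longrightarrow> assoc_sector (T i) \<inter> assoc_sector (T j) = {}) \<and>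
     - (convex hull D) \<subseteq> (\<Union>i\<in>{1..m}. closure (assoc_sector (T i)))"

definition proportional_system ::
    "complex list \<Rightarrow> complex set \<Rightarrow> nat \<Rightarrow> (nat \<Rightarrow> triangle) \<Rightarrow> bool" where
  "proportional_system vs D m T \<longleftrightarrow>
     admissible_system vs D m T \<and>
     (\<exists>c. \<forall>i\<in>{1..m}. base_angle (T i) / area (region (T i)) = c)"

end

theory Submission
  imports Defs
begin

text \<open>
  Record a triangle by its base and the directions of the two boundary rays of its sector.
  A system is then a cyclic list of triangles whose consecutive sectors share a line and whose
  directions turn by a full angle. Call it neutral if no point lies strictly on the same side of all
  these directed lines; then every point, in particular every point of \<open>D\<close>, lies in a closed
  infinite sector spanned by one of the triangles, hence in the closed triangle if it lies in \<open>D\<close>.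

  Casting the triangles from an interior point towards the farthest boundary points yields a
  neutral system. By compactness some neutral system minimises the largest ratio of base
  angle to area; take one in which this maximum \<open>M\<close> is attained by as few triangles as possible. If
  the ratios were not all equal, consider a maximal run of triangles with ratio \<open>M\<close>. At both
  ends of the run replace the shared line by a pair of slightly rotated lines, so that the
  triangles at the ends of the run shrink in angle and grow in base, and fill the thin gap by
  triangles cast from a point far away, whose ratios are small. The two rotations push the system
  out of neutrality in opposite directions, so for a suitable proportion of them it stays neutral,
  and fewer triangles attain \<open>M\<close>: a contradiction.

  No side of \<open>D\<close> carries two bases, because both sectors would lie on the same side of it and
  \<open>D\<close> would be disconnected; hence \<open>m \<le> n\<close>. Every extreme point of the hull is the outermost vertex on
  a line shared by two consecutive sectors; hence \<open>nhat \<le> m\<close>.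
\<close>

section \<open>Directed lines and cyclic chains of triangles\<close>

text \<open>The balancing of the two rotations is an intermediate value argument. It rests on two
  facts: no system has both a point left of all its lines and a point right of all of them, since
  the directions go round once and base angles stay below pi; and each rotation alone can tip a
  neutral system to one side only. The triangles that fill a gap need not vary continuously with the
  rotation, so sidedness is tested on the other lines alone.

  Compactness needs control of the ratios from both sides. The upper bound keeps base angles away
  from pi and prevents a triangle of positive angle from collapsing. The lower bound forces a
  triangle whose angle tends to 0 to flatten onto its line, after which it can be deleted. Hence the
  distance of the far casting points is fixed once for all systems: the new ratios then stay above
  one common bound and below the largest ratio of every system. That largest ratio is bounded below
  because at most \<open>n\<close> triangles share the full angle.\<close>

definition crs :: "complex \<Rightarrow> complex \<Rightarrow> real" where
  "crs z w = Re z * Im w - Im z * Re w"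

lemma crs_add_right: "crs z (x + y) = crs z x + crs z y"
  and crs_diff_right: "crs z (x - y) = crs z x - crs z y"
  and crs_add_left: "crs (x + y) z = crs x z + crs y z"
  and crs_diff_left: "crs (x - y) z = crs x z - crs y z"
  and crs_scale_right: "crs z (r *\<^sub>R x) = r * crs z x"
  and crs_scale_left: "crs (r *\<^sub>R x) z = r * crs x z"
  and crs_minus_right: "crs z (- x) = - crs z x"
  and crs_minus_left: "crs (- x) z = - crs x z"
  by (simp_all add: crs_def algebra_simps)

lemma crs_self [simp]: "crs z z = 0" and crs_zero [simp]: "crs z 0 = 0" "crs 0 z = 0"
  by (simp_all add: crs_def)

lemma crs_commute: "crs z w = - crs w z"
  by (simp add: crs_def)

lemma crs_cis: "crs (cis s) (cis t) = sin (t - s)"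
  by (simp add: crs_def sin_diff)

lemmas crs_simps = crs_add_right crs_diff_right crs_add_left crs_diff_left
  crs_scale_right crs_scale_left crs_minus_right crs_minus_left

text \<open>Three-term Pluecker relation for four plane vectors; it settles signs when two
  directions and a base vector are compared with a fourth vector.\<close>

lemma crs_plucker:
  "crs u v * crs d y - crs u d * crs v y + crs u y * crs v d = 0"
  by (simp add: crs_def algebra_simps)

text \<open>Cramer's rule: the coordinates of \<open>y\<close> with respect to \<open>d\<close> and
  \<open>u\<close>, multiplied by the determinant.\<close>

lemma crs_expand: "crs d u *\<^sub>R y = crs y u *\<^sub>R d + crs d y *\<^sub>R u"
  by (simp add: complex_eq_iff crs_def algebra_simps)

lemma continuous_on_crs [continuous_intros]:
  "continuous_on S f \<Longrightarrow> continuous_on S g \<Longrightarrow> continuous_on S (\<lambda>x. crs (f x) (g x))"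
  unfolding crs_def by (intro continuous_intros)

lemma tendsto_crs [tendsto_intros]:
  "(f \<longlongrightarrow> a) F \<Longrightarrow> (g \<longlongrightarrow> b) F \<Longrightarrow> ((\<lambda>x. crs (f x) (g x)) \<longlongrightarrow> crs a b) F"
  unfolding crs_def by (intro tendsto_intros)

lemma tendsto_cis [tendsto_intros]:
  "(f \<longlongrightarrow> a) F \<Longrightarrow> ((\<lambda>x. cis (f x)) \<longlongrightarrow> cis a) F"
  unfolding cis_conv_exp by (intro tendsto_intros)

lemma cis_add_2pi [simp]: "cis (t + 2 * pi) = cis t"
  by (simp add: complex_eq_iff)

lemma crs_eq_0_scale:
  assumes "crs u y = 0" "u \<noteq> 0"
  obtains r where "y = r *\<^sub>R u"
proof -
  let ?r = "(Re u * Re y + Im u * Im y) / (Re u ^ 2 + Im u ^ 2)"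
  have n: "Re u ^ 2 + Im u ^ 2 \<noteq> 0"
    using assms(2) by (simp add: complex_eq_iff sum_power2_eq_zero_iff)
  have "y = ?r *\<^sub>R u"
    using assms(1) n by (auto simp: complex_eq_iff crs_def field_simps power2_eq_square)
  then show ?thesis using that by blast
qed

text \<open>Positive on the left of the line through \<open>p\<close> with direction \<open>cis t\<close>.\<close>

definition lf :: "complex \<Rightarrow> real \<Rightarrow> complex \<Rightarrow> real" where
  "lf p t x = crs (cis t) (x - p)"

lemma lf_2pi [simp]: "lf p (t + 2 * pi) x = lf p t x"
  by (simp add: lf_def)

lemma lf_cong: "lf p t q = 0 \<Longrightarrow> lf q t x = lf p t x"
  by (simp add: lf_def crs_simps)

lemma lf_sym: "lf p t q = 0 \<Longrightarrow> lf q t p = 0"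
  by (simp add: lf_def crs_simps)

lemma lf_self [simp]: "lf p t p = 0"
  by (simp add: lf_def)

lemma lf_move: "lf p t (x + r *\<^sub>R cis s) = lf p t x + r * sin (s - t)"
  by (simp add: lf_def crs_simps crs_cis)

lemma lf_base_move: "lf (p + r *\<^sub>R cis t) t x = lf p t x"
  by (simp add: lf_def crs_simps)

lemma lf_zeroE:
  assumes "lf p t x = 0" obtains r where "x = p + r *\<^sub>R cis t"
  using crs_eq_0_scale[of "cis t" "x - p"] assms unfolding lf_def
  by (metis add_diff_cancel_left' cis_neq_zero diff_add_cancel add.commute)

text \<open>The base runs from \<open>pa\<close> to \<open>pb\<close> with the associated sector on its right; the sides of the sector
  leave \<open>pa\<close> and \<open>pb\<close> in the directions \<open>t1\<close> and \<open>t2\<close>. These are reals rather than angles modulo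
  \<open>2 * pi\<close>, so that \<open>t2 - t1\<close> is the base angle and the total turning of a chain can be stated.\<close>

datatype tri = Tri (pa: complex) (pb: complex) (t1: real) (t2: real)

text \<open>A chain joins two directed lines: \<open>p\<close> and \<open>p'\<close> count only up
  to sliding along their lines. Consecutive triangles need not share an endpoint of their bases, and
  a chain may be empty, as is required for a gap of width zero.\<close>

primrec chain :: "complex \<Rightarrow> real \<Rightarrow> tri list \<Rightarrow> complex \<Rightarrow> real \<Rightarrow> bool" where
  "chain p t [] p' t' \<longleftrightarrow> t = t' \<and> lf p t p' = 0"
| "chain p t (T # ts) p' t' \<longleftrightarrow> t1 T = t \<and> lf p t (pa T) = 0 \<and> chain (pb T) (t2 T) ts p' t'"

lemma chain_cong_start:
  assumes "lf p t q = 0" shows "chain p t ts p' t' \<longleftrightarrow> chain q t ts p' t'"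
  using lf_cong[OF assms] by (cases ts) auto

lemma chain_cong_end:
  assumes "lf p' t' q = 0" shows "chain p t ts p' t' \<longleftrightarrow> chain p t ts q t'"
proof (induction ts arbitrary: p t)
  case Nil
  have "lf p t' p' = 0 \<longleftrightarrow> lf p t' q = 0"
    using assms by (auto simp: lf_def crs_simps)
  then show ?case by auto
qed auto

lemma chain_append:
  "chain p t (xs @ ys) p' t' \<longleftrightarrow> (\<exists>q s. chain p t xs q s \<and> chain q s ys p' t')"
proof (induction xs arbitrary: p t)
  case Nil
  show ?case using chain_cong_start[of p t _ ys p' t'] by (auto intro: exI[of _ p])
qed auto

lemma chain_2pi: "chain p t ts p' t' \<Longrightarrow>
  chain p (t + 2 * pi) (map (\<lambda>T. Tri (pa T) (pb T) (t1 T + 2 * pi) (t2 T + 2 * pi)) ts) p' (t' + 2 * pi)"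
  by (induction ts arbitrary: p t) auto

text \<open>Discrete intermediate value principle: neighbours share a line, so the side on which
  \<open>x\<close> lies can change only between the two lines of one triangle.\<close>

lemma chain_right_to_left:
  assumes "chain p t ts p' t'" "lf p t x < 0" "lf p' t' x > 0"
  shows "\<exists>T\<in>set ts. lf (pa T) (t1 T) x < 0 \<and> lf (pb T) (t2 T) x \<ge> 0"
  using assms
proof (induction ts arbitrary: p t)
  case Nil
  then show ?case using lf_cong[of p t p' x] by auto
next
  case (Cons T ts)
  have "lf (pa T) (t1 T) x < 0" using Cons.prems lf_cong[of p t "pa T" x] by auto
  then show ?case using Cons by (cases "lf (pb T) (t2 T) x < 0") auto
qed

lemma chain_angles:
  assumes "chain p t ts p' t'" "\<forall>T\<in>set ts. t1 T \<le> t2 T"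
  shows "t \<le> t'" "\<And>T. T \<in> set ts \<Longrightarrow> t \<le> t1 T \<and> t2 T \<le> t'"
proof -
  have "t \<le> t' \<and> (\<forall>T\<in>set ts. t \<le> t1 T \<and> t2 T \<le> t')"
    using assms by (induction ts arbitrary: p t) fastforce+
  then show "t \<le> t'" "\<And>T. T \<in> set ts \<Longrightarrow> t \<le> t1 T \<and> t2 T \<le> t'" by auto
qed

lemma chain_direction:
  assumes "chain p t ts p' t'" "t \<le> w" "w < t'"
  shows "\<exists>T\<in>set ts. t1 T \<le> w \<and> w < t2 T"
  using assms
proof (induction ts arbitrary: p t)
  case (Cons T ts)
  then show ?case by (cases "w < t2 T") auto
qed auto

lemma chain_sum:
  assumes "chain p t ts p' t'" shows "(\<Sum>T\<leftarrow>ts. t2 T - t1 T) = t' - t"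
  using assms by (induction ts arbitrary: p t) fastforce+

text \<open>Since directions are real numbers, the increment \<open>2 * pi\<close> fixes the turning
  number as one. That the starting point recurs says only that the last line is the first line
  again.\<close>

definition closed_chain :: "tri list \<Rightarrow> bool" where
  "closed_chain ts \<longleftrightarrow> ts \<noteq> [] \<and>
     chain (pa (hd ts)) (t1 (hd ts)) ts (pa (hd ts)) (t1 (hd ts) + 2 * pi)"

lemma closed_chainI:
  assumes "chain p t ts p (t + 2 * pi)" shows "closed_chain ts"
proof -
  have ne: "ts \<noteq> []" using assms by auto
  then obtain T us where ts: "ts = T # us" by (cases ts) auto
  have "t1 T = t" "lf p t (pa T) = 0" using assms ts by auto
  then show ?thesis unfolding closed_chain_def
    using assms ts chain_cong_start[of p t "pa T" ts p "t + 2 * pi"]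
      chain_cong_end[of p "t + 2*pi" "pa T" "pa T" t ts] by auto
qed

definition turn :: "tri \<Rightarrow> tri" where
  "turn T = Tri (pa T) (pb T) (t1 T + 2 * pi) (t2 T + 2 * pi)"

lemma turn_sel [simp]: "pa (turn T) = pa T" "pb (turn T) = pb T"
  "t1 (turn T) = t1 T + 2 * pi" "t2 (turn T) = t2 T + 2 * pi"
  by (simp_all add: turn_def)

text \<open>The initial segment moved to the end has its directions raised by a full angle, which
  changes no point, line or sector.\<close>

lemma closed_chain_rotate:
  assumes "closed_chain (xs @ ys)" shows "closed_chain (ys @ map turn xs)"
proof -
  obtain p t where c: "chain p t (xs @ ys) p (t + 2 * pi)"
    using assms unfolding closed_chain_def by blast
  then obtain q s where "chain p t xs q s" "chain q s ys p (t + 2 * pi)"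
    using chain_append by blast
  moreover have "chain p (t + 2 * pi) (map turn xs) q (s + 2 * pi)"
    using chain_2pi[OF \<open>chain p t xs q s\<close>] unfolding turn_def .
  ultimately have "chain q s (ys @ map turn xs) q (s + 2 * pi)"
    using chain_append by blast
  then show ?thesis by (rule closed_chainI)
qed

text \<open>Otherwise being weakly left of one line would propagate to being strictly left of the
  next. One turn brings this back to the first line and a second turn reaches every line, although
  \<open>x\<close> is weakly right of some line. The triangle found spans a closed infinite sector
  that contains \<open>x\<close>.\<close>

lemma exists_left_right:
  assumes c: "closed_chain ts"
    and nl: "\<exists>T\<in>set ts. lf (pa T) (t1 T) x \<le> 0"
    and nr: "\<exists>T\<in>set ts. lf (pa T) (t1 T) x \<ge> 0"
  shows "\<exists>T\<in>set ts. lf (pa T) (t1 T) x \<ge> 0 \<and> lf (pb T) (t2 T) x \<le> 0"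
proof (rule ccontr)
  assume "\<not> ?thesis"
  then have step: "lf (pb T) (t2 T) x > 0" if "T \<in> set ts" "lf (pa T) (t1 T) x \<ge> 0" for T
    using that by force
  have gen: "(lf p t x \<ge> 0 \<or> (\<exists>T\<in>set us. lf (pa T) (t1 T) x \<ge> 0) \<longrightarrow> us \<noteq> [] \<longrightarrow> lf p' t' x > 0) \<and>
     (lf p t x > 0 \<longrightarrow> (\<forall>T\<in>set us. lf (pa T) (t1 T) x > 0))"
    if "chain p t us p' t'" "set us \<subseteq> set ts" for us p t p' t'
    using that
  proof (induction us arbitrary: p t)
    case (Cons T us)
    have e: "lf (pa T) (t1 T) x = lf p t x" using Cons.prems lf_cong by auto
    have ch: "chain (pb T) (t2 T) us p' t'" using Cons.prems by auto
    note IH = Cons.IH[OF ch]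
    have n: "us = [] \<Longrightarrow> lf p' t' x = lf (pb T) (t2 T) x"
      using ch lf_cong by auto
    show ?case using IH e step[of T] n Cons.prems(2) by (cases "us = []") force+
  qed auto
  define p t where "p = pa (hd ts)" and "t = t1 (hd ts)"
  have ch: "chain p t ts p (t + 2 * pi)" and ne: "ts \<noteq> []"
    using c unfolding closed_chain_def p_def t_def by auto
  note G = gen[OF ch subset_refl]
  have "lf p t x > 0" using G nr ne by auto
  then show False using G nl by force
qed

text \<open>The half-open angle ranges of the triangles tile a full turn, and the one that contains
  the direction of \<open>z\<close> is shorter than \<open>pi\<close>. This yields neutrality of
  concurrent lines, and it excludes that one system has points on both extreme sides.\<close>

lemma no_common_side:
  assumes c: "closed_chain ts" and "\<forall>T\<in>set ts. t2 T < t1 T + pi" "z \<noteq> 0"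
  shows "\<exists>T\<in>set ts. crs (cis (t1 T)) z \<ge> 0"
proof -
  define t where "t = t1 (hd ts)"
  define n where "n = \<lfloor>(Arg z - t) / (2 * pi)\<rfloor>"
  define w where "w = Arg z - 2 * pi * n"
  have "of_int n \<le> (Arg z - t) / (2 * pi)" "(Arg z - t) / (2 * pi) < of_int n + 1"
    unfolding n_def by linarith+
  then have "t \<le> w" "w < t + 2 * pi" unfolding w_def by (simp_all add: field_simps)
  then obtain T where T: "T \<in> set ts" "t1 T \<le> w" "w < t2 T"
    using chain_direction[of _ t ts _ "t + 2*pi" w] c unfolding closed_chain_def t_def by blast
  have "z = cmod z *\<^sub>R cis (Arg z)"
    by (metis assms(3) cis_Arg complex_sgn_def scaleR_scaleR norm_eq_zero right_inverse scaleR_one)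
  also have "cis (Arg z) = cis w"
    unfolding w_def by (simp add: complex_eq_iff cos_diff sin_diff)
  finally have "crs (cis (t1 T)) z = cmod z * sin (w - t1 T)"
    by (metis crs_scale_right crs_cis)
  moreover have "sin (w - t1 T) \<ge> 0" using T assms(2) by (intro sin_ge_zero) force+
  ultimately show ?thesis using T(1) by (metis mult_nonneg_nonneg norm_ge_zero)
qed

section \<open>Triangles on the boundary of a polygon\<close>

text \<open>The associated sector.\<close>

definition sreg :: "tri \<Rightarrow> complex set" where
  "sreg T = {x. lf (pa T) (t1 T) x > 0 \<and> lf (pb T) (t2 T) x < 0 \<and> crs (pb T - pa T) (x - pa T) < 0}"

text \<open>The two cross products are the distances from the apex to \<open>pb T\<close> and to
  \<open>pa T\<close>, multiplied by \<open>sin (t2 T - t1 T)\<close>; their positivity places the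
  apex behind the base.\<close>

definition shape :: "tri \<Rightarrow> bool" where
  "shape T \<longleftrightarrow> t1 T < t2 T \<and> t2 T < t1 T + pi \<and>
     crs (cis (t1 T)) (pb T - pa T) > 0 \<and> crs (cis (t2 T)) (pb T - pa T) > 0"

lemma open_sreg: "open (sreg T)"
  unfolding sreg_def lf_def
  by (intro open_Collect_conj open_Collect_less continuous_intros)

lemma sreg_turn [simp]: "sreg (turn T) = sreg T"
  by (simp add: sreg_def)

lemma shape_turn [simp]: "shape (turn T) = shape T"
  by (auto simp add: shape_def)

lemma lf_convex:
  assumes "0 \<le> s" shows "lf p t ((1 - s) *\<^sub>R x + s *\<^sub>R y) = (1 - s) * lf p t x + s * lf p t y"
  unfolding lf_def crs_def by (simp add: algebra_simps)

lemma convex_sreg: "convex (sreg T)"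
proof -
  have e: "crs (pb T - pa T) (x - pa T) = crs (pb T - pa T) x - crs (pb T - pa T) (pa T)" for x
    by (simp add: crs_simps)
  have h: "convex {x. crs u x < c}" "convex {x. crs u x > c}" for u c
  proof -
    have "crs u x = inner (Complex (- Im u) (Re u)) x" for x
      by (simp add: crs_def inner_complex_def)
    then show "convex {x. crs u x < c}" "convex {x. crs u x > c}"
      using convex_halfspace_lt convex_halfspace_gt by auto
  qed
  have "sreg T = {x. crs (cis (t1 T)) x > crs (cis (t1 T)) (pa T)} \<inter>
     ({x. crs (cis (t2 T)) x < crs (cis (t2 T)) (pb T)} \<inter>
      {x. crs (pb T - pa T) x < crs (pb T - pa T) (pa T)})"
    by (auto simp: sreg_def lf_def crs_simps)
  then show ?thesis using h convex_Int by metis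
qed

text \<open>By the Pluecker relation \<open>cis w\<close> is a nonnegative combination of the two
  boundary directions, and both of these point to the right of the base.\<close>

lemma shape_direction:
  assumes "shape T" "t1 T \<le> w" "w \<le> t2 T"
  shows "crs (pb T - pa T) (cis w) < 0"
proof -
  let ?d = "pb T - pa T"
  have pos: "sin (t2 T - t1 T) > 0"
    using assms by (intro sin_gt_zero) (auto simp: shape_def)
  have "sin (t2 T - t1 T) * crs (cis w) ?d =
      sin (t2 T - w) * crs (cis (t1 T)) ?d + sin (w - t1 T) * crs (cis (t2 T)) ?d"
    using crs_plucker[of "cis (t1 T)" "cis (t2 T)" "cis w" ?d]
    by (simp add: crs_cis) (smt (verit, best) crs_cis crs_commute mult.commute sin_minus minus_diff_eq mult_minus_left)
  moreover have "sin (t2 T - w) \<ge> 0" "sin (w - t1 T) \<ge> 0"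
    using assms by (auto intro!: sin_ge_zero simp: shape_def)
  moreover have "sin (t2 T - w) > 0 \<or> sin (w - t1 T) > 0"
    using assms sin_gt_zero[of "t2 T - w"] sin_gt_zero[of "w - t1 T"]
    by (cases "w < t2 T") (auto simp: shape_def)
  moreover have "crs (cis (t1 T)) ?d > 0" "crs (cis (t2 T)) ?d > 0"
    using assms(1) by (auto simp: shape_def)
  ultimately have "sin (t2 T - t1 T) * crs (cis w) ?d > 0"
    by (smt (verit) mult_nonneg_nonneg mult_pos_pos)
  then have "crs (cis w) ?d > 0" using pos zero_less_mult_pos by blast
  then show ?thesis using crs_commute by (metis neg_less_0_iff_less)
qed

text \<open>The closed angle of \<open>T\<close> belongs to the recession cone of the
  sector.\<close>

lemma sreg_move:
  assumes "shape T" "x \<in> sreg T" "t1 T \<le> w" "w \<le> t2 T" "0 \<le> r"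
  shows "x + r *\<^sub>R cis w \<in> sreg T"
proof -
  have "sin (w - t1 T) \<ge> 0" using assms by (auto intro!: sin_ge_zero simp: shape_def)
  moreover have "sin (w - t2 T) \<le> 0"
    using assms sin_ge_zero[of "t2 T - w"] sin_minus[of "t2 T - w"] by (auto simp: shape_def)
  moreover have "crs (pb T - pa T) (cis w) < 0" using shape_direction assms by blast
  moreover have "crs (pb T - pa T) (x + r *\<^sub>R cis w - pa T)
      = crs (pb T - pa T) (x - pa T) + r * crs (pb T - pa T) (cis w)"
    by (simp add: crs_simps)
  ultimately show ?thesis using assms
    by (auto simp: sreg_def lf_move)
       (smt (verit) mult_nonneg_nonneg mult_nonneg_nonpos)+
qed

lemma sreg_base_move:
  assumes "shape T" "0 < m" "m < 1" "t1 T \<le> w" "w \<le> t2 T" "0 < r"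
  shows "pa T + m *\<^sub>R (pb T - pa T) + r *\<^sub>R cis w \<in> sreg T"
proof -
  let ?d = "pb T - pa T"
  have "lf (pa T) (t1 T) (pa T + m *\<^sub>R ?d + r *\<^sub>R cis w) = m * crs (cis (t1 T)) ?d + r * sin (w - t1 T)"
    by (simp add: lf_move) (simp add: lf_def crs_simps)
  moreover have "lf (pb T) (t2 T) (pa T + m *\<^sub>R ?d + r *\<^sub>R cis w) = - ((1 - m) * crs (cis (t2 T)) ?d) + r * sin (w - t2 T)"
    by (simp add: lf_move) (simp add: lf_def crs_simps algebra_simps)
  moreover have "crs ?d (pa T + m *\<^sub>R ?d + r *\<^sub>R cis w - pa T) = r * crs ?d (cis w)"
    by (simp add: crs_simps)
  moreover have "sin (w - t1 T) \<ge> 0" using assms by (auto intro!: sin_ge_zero simp: shape_def)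
  moreover have "sin (w - t2 T) \<le> 0"
    using assms sin_ge_zero[of "t2 T - w"] sin_minus[of "t2 T - w"] by (auto simp: shape_def)
  moreover have "crs ?d (cis w) < 0" using shape_direction assms by blast
  moreover have "m * crs (cis (t1 T)) ?d > 0" "(1 - m) * crs (cis (t2 T)) ?d > 0"
    using assms by (auto simp: shape_def)
  ultimately show ?thesis using assms
    unfolding sreg_def mem_Collect_eq
    by (smt (verit) mult_nonneg_nonneg mult_nonneg_nonpos mult_pos_neg)
qed

text \<open>A point beyond the base line that fails both conditions would mean that the two lines
  cross in front of the base; the signs in the Pluecker relation forbid it. The lemma is needed when
  both lines of one triangle are moved.\<close>

lemma shape_beyond_base:
  assumes "shape T" "crs (pb T - pa T) (x - pa T) < 0"
  shows "lf (pa T) (t1 T) x > 0 \<or> lf (pb T) (t2 T) x < 0"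
proof (rule ccontr)
  let ?u = "cis (t1 T)" and ?v = "cis (t2 T)" and ?d = "pb T - pa T" and ?y = "x - pa T"
  assume "\<not> ?thesis"
  then have 1: "crs ?u ?y \<le> 0" and 2: "crs ?v ?y - crs ?v ?d \<ge> 0"
    by (auto simp: lf_def crs_simps)
  have s: "crs ?u ?v > 0" using assms by (auto simp: crs_cis shape_def intro: sin_gt_zero)
  have 3: "crs ?u ?d > 0" "crs ?v ?d > 0" using assms by (auto simp: shape_def)
  have "crs ?u ?v * crs ?d ?y < 0" using s assms by (simp add: mult_pos_neg)
  moreover have "crs ?u ?d * crs ?v ?y > 0" using 2 3 by simp
  moreover have "crs ?u ?y * crs ?v ?d \<le> 0" using 1 3 by (simp add: mult_nonpos_nonneg)
  ultimately show False using crs_plucker[of ?u ?v ?d ?y] by linarith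
qed

lemma polar_from:
  obtains w where "s \<le> w" "w < s + 2 * pi" "z = cmod z *\<^sub>R cis w"
proof -
  define n where "n = \<lfloor>(Arg z - s) / (2 * pi)\<rfloor>"
  define w where "w = Arg z - 2 * pi * n"
  have "of_int n \<le> (Arg z - s) / (2 * pi)" "(Arg z - s) / (2 * pi) < of_int n + 1"
    unfolding n_def by linarith+
  then have "s \<le> w" "w < s + 2 * pi" unfolding w_def by (simp_all add: field_simps)
  moreover have "z = cmod z *\<^sub>R cis (Arg z)"
    by (metis cis_Arg complex_sgn_def scaleR_scaleR norm_eq_zero right_inverse scaleR_one scaleR_zero_left)
  moreover have "cis (Arg z) = cis w"
    unfolding w_def by (simp add: complex_eq_iff cos_diff sin_diff)
  ultimately show ?thesis using that by metis
qed

lemma between_directions: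
  assumes "crs (cis s) z > 0" "crs (cis t) z < 0" "s < t" "t < s + pi"
  obtains w where "s < w" "w < t" "z = cmod z *\<^sub>R cis w" "cmod z > 0"
proof -
  obtain w where w: "s \<le> w" "w < s + 2 * pi" "z = cmod z *\<^sub>R cis w" using polar_from by blast
  have z: "cmod z > 0" using assms by auto
  have "crs (cis s) z = cmod z * sin (w - s)" "crs (cis t) z = cmod z * sin (w - t)"
    using w(3) by (metis crs_scale_right crs_cis)+
  then have s: "sin (w - s) > 0" "sin (w - t) < 0"
    using assms z by (auto simp: zero_less_mult_iff mult_less_0_iff)
  have 1: "w < s + pi"
  proof (rule ccontr)
    assume "\<not> ?thesis"
    then have "sin (w - s - pi) \<ge> 0" using w by (intro sin_ge_zero) auto
    then show False using s by (simp add: sin_diff)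
  qed
  have "w \<noteq> s" using s by auto
  moreover have "w < t"
  proof (rule ccontr)
    assume "\<not> ?thesis"
    then have "sin (w - t) \<ge> 0" using 1 assms by (intro sin_ge_zero) auto
    then show False using s by simp
  qed
  ultimately show ?thesis using that[of w] w z by linarith
qed

text \<open>Such an \<open>x\<close> lies in the cone opposite to the sector, from which
  \<open>pa T\<close> is seen forwards along a direction of the angle of \<open>T\<close>.\<close>

lemma base_behind_apex:
  assumes "shape T" "lf (pa T) (t1 T) x < 0" "lf (pb T) (t2 T) x \<ge> 0"
  obtains w r where "t1 T < w" "w < t2 T" "r > 0" "pa T = x + r *\<^sub>R cis w"
proof -
  have "crs (cis (t1 T)) (pa T - x) > 0"
    using assms by (auto simp: lf_def crs_simps)
  moreover have "crs (cis (t2 T)) (pa T - x) < 0"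
    using assms by (auto simp: lf_def crs_simps shape_def)
  ultimately obtain w where w: "t1 T < w" "w < t2 T" "pa T - x = cmod (pa T - x) *\<^sub>R cis w" "cmod (pa T - x) > 0"
    using between_directions assms by (metis shape_def)
  have "pa T = x + cmod (pa T - x) *\<^sub>R cis w" using w(3) by (simp add: algebra_simps)
  then show ?thesis using that w by blast
qed

text \<open>The boundary is described by the incidence of its edges together with its connectedness.
  This form is preserved by reflection in the real axis, so a result for one sense of rotation
  transfers to the other.\<close>

locale polygon =
  fixes n :: nat and P Q :: "nat \<Rightarrow> complex" and D :: "complex set"
  fixes edge :: "nat \<Rightarrow> complex set" and verts bd :: "complex set"
  defines "edge \<equiv> \<lambda>i. closed_segment (P i) (Q i)"
    and "verts \<equiv> P ` {..<n} \<union> Q ` {..<n}"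
    and "bd \<equiv> (\<Union>i<n. edge i)"
  assumes PQ: "i < n \<Longrightarrow> P i \<noteq> Q i"
    and meet: "\<lbrakk>i < n; j < n; i \<noteq> j; x \<in> edge i; x \<in> edge j\<rbrakk> \<Longrightarrow> x \<in> verts"
    and vert: "\<lbrakk>i < n; x \<in> verts; x \<in> edge i\<rbrakk> \<Longrightarrow> x = P i \<or> x = Q i"
    and open_D: "open D" and connected_D: "connected D" and bounded_D: "bounded D"
    and D_ne: "D \<noteq> {}"
    and frontier_D: "frontier D = bd" and connected_bd: "connected bd"
begin

text \<open>Admissibility of a single triangle in terms of its base and the two rays. That the
  sector misses \<open>D\<close> and that the triangle meets \<open>D\<close> are
  consequences.\<close>

definition good :: "tri \<Rightarrow> bool" where
  "good T \<longleftrightarrow> shape T \<and> (\<exists>i<n. pa T \<in> edge i \<and> pb T \<in> edge i) \<and> sreg T \<inter> bd = {} \<and>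
     (\<exists>r\<ge>0. pa T + r *\<^sub>R cis (t1 T) \<in> verts) \<and> (\<exists>r\<ge>0. pb T + r *\<^sub>R cis (t2 T) \<in> verts)"

lemma good_shape: "good T \<Longrightarrow> shape T"
  by (simp add: good_def)

lemma good_turn [simp]: "good (turn T) = good T"
  by (simp add: good_def)

lemma finite_verts: "finite verts"
  unfolding verts_def by simp

lemma verts_bd: "verts \<subseteq> bd"
  unfolding verts_def bd_def edge_def by auto

lemma edge_bd: "i < n \<Longrightarrow> edge i \<subseteq> bd"
  unfolding bd_def by auto

lemma compact_edge: "compact (edge i)"
  unfolding edge_def by simp

lemma compact_bd: "compact bd"
  unfolding bd_def by (intro compact_UN) (auto simp: compact_edge)

lemma good_bd: "good T \<Longrightarrow> pa T \<in> bd \<and> pb T \<in> bd"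
  unfolding good_def using edge_bd by blast

text \<open>A connected set without boundary points that meets \<open>D\<close> lies in
  \<open>D\<close>; but the sector is unbounded.\<close>

lemma sreg_D:
  assumes "good T" shows "sreg T \<inter> D = {}"
proof (rule ccontr)
  assume ne: "sreg T \<inter> D \<noteq> {}"
  have "sreg T \<inter> frontier D = {}" using assms frontier_D by (simp add: good_def)
  then have sub: "sreg T \<subseteq> D"
    using connected_Int_frontier[OF convex_connected[OF convex_sreg]] ne by blast
  obtain x where x: "x \<in> sreg T" using ne by auto
  obtain B where B: "\<And>y. y \<in> D \<Longrightarrow> norm y \<le> B" "B > 0"
    using bounded_D bounded_pos by metis
  let ?y = "x + (B + norm x + 1) *\<^sub>R cis (t1 T)"
  have "?y \<in> D"
    using sub sreg_move[OF good_shape[OF assms] x] B assms by (force simp: good_def shape_def)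
  moreover have "norm ?y \<ge> norm ((B + norm x + 1) *\<^sub>R cis (t1 T)) - norm x"
    by (metis add.commute norm_diff_ineq)
  ultimately show False using B by force
qed

text \<open>For a common point \<open>x\<close>, both arcs of the cycle between the two triangles contain a base that \<open>x\<close> sees
  in a direction of its own angle. The middle rays of the two sectors, started at \<open>x\<close>, avoid \<open>bd\<close> and
  separate these two bases, although \<open>bd\<close> is connected.\<close>

lemma disjoint_first:
  assumes c: "closed_chain (T1 # ys @ T2 # zs)" and g: "\<forall>T\<in>set (T1 # ys @ T2 # zs). good T"
  shows "sreg T1 \<inter> sreg T2 = {}"
proof (rule ccontr)
  assume "sreg T1 \<inter> sreg T2 \<noteq> {}"
  then obtain x where x1: "x \<in> sreg T1" and x2: "x \<in> sreg T2" by auto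
  have sh1: "shape T1" and sh2: "shape T2" using g by (auto simp: good_def)
  have sy: "\<forall>T\<in>set ys. t1 T \<le> t2 T" and sz: "\<forall>T\<in>set zs. t1 T \<le> t2 T"
    using g by (auto simp: good_def shape_def less_imp_le)
  obtain q s where cy: "chain (pb T1) (t2 T1) ys q s" and s: "s = t1 T2" "lf q s (pa T2) = 0"
    and cz: "chain (pb T2) (t2 T2) zs (pa T1) (t1 T1 + 2 * pi)"
    using c unfolding closed_chain_def by (auto simp: chain_append)
  have "lf (pb T1) (t2 T1) x < 0" "lf q s x > 0"
    using x1 x2 s lf_cong[of q s "pa T2" x] by (auto simp: sreg_def)
  then obtain U where U: "U \<in> set ys" "lf (pa U) (t1 U) x < 0" "lf (pb U) (t2 U) x \<ge> 0"
    using chain_right_to_left[OF cy] by blast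
  obtain w r where w: "t1 U < w" "w < t2 U" "r > 0" "pa U = x + r *\<^sub>R cis w"
    using base_behind_apex[of U x] U g by (auto simp: good_def)
  have wb: "t2 T1 < w" "w < t1 T2" using w chain_angles(2)[OF cy sy U(1)] s by auto
  have "lf (pb T2) (t2 T2) x < 0" "lf (pa T1) (t1 T1 + 2 * pi) x > 0"
    using x1 x2 by (auto simp: sreg_def)
  then obtain U' where U': "U' \<in> set zs" "lf (pa U') (t1 U') x < 0" "lf (pb U') (t2 U') x \<ge> 0"
    using chain_right_to_left[OF cz] by blast
  obtain w' r' where w': "t1 U' < w'" "w' < t2 U'" "r' > 0" "pa U' = x + r' *\<^sub>R cis w'"
    using base_behind_apex[of U' x] U' g by (auto simp: good_def)
  have wb': "t2 T2 < w'" "w' < t1 T1 + 2 * pi" using w' chain_angles(2)[OF cz sz U'(1)] by auto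
  define m1 m2 where "m1 = (t1 T1 + t2 T1) / 2" and "m2 = (t1 T2 + t2 T2) / 2"
  have m1: "t1 T1 < m1" "m1 < t2 T1" and m2: "t1 T2 < m2" "m2 < t2 T2"
    using sh1 sh2 by (auto simp: m1_def m2_def shape_def)
  \<comment> \<open>The angle at \<open>x\<close>, counted from the middle ray of \<open>T1\<close>,
    is continuous on \<open>bd\<close> because that ray misses \<open>bd\<close>. Its connected
    image contains values on both sides of the angle of the other middle ray, hence that angle
    itself.\<close>
  define f where "f y = Arg2pi ((y - x) / cis m1)" for y
  have fval: "f (x + r *\<^sub>R cis w) = w - m1" if "r > 0" "m1 \<le> w" "w < m1 + 2 * pi" for r w
    unfolding f_def
  proof (rule Arg2pi_unique)
    show "of_real r * exp (\<i> * of_real (w - m1)) = (x + r *\<^sub>R cis w - x) / cis m1"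
      by (simp add: scaleR_conv_of_real cis_conv_exp exp_diff algebra_simps)
  qed (use that in auto)
  have notin: "x + r *\<^sub>R cis w \<notin> bd" if "r \<ge> 0" "w = m1 \<or> w = m2" for r w
  proof -
    have "x + r *\<^sub>R cis w \<in> sreg T1 \<or> x + r *\<^sub>R cis w \<in> sreg T2"
      using that sreg_move[OF sh1 x1, of m1 r] sreg_move[OF sh2 x2, of m2 r] m1 m2 by auto
    then show ?thesis using g by (auto simp: good_def)
  qed
  have cont: "continuous_on bd f"
  proof (rule continuous_at_imp_continuous_on, rule ballI)
    fix y assume y: "y \<in> bd"
    have "(y - x) / cis m1 \<notin> \<real>\<^sub>\<ge>\<^sub>0"
    proof
      assume "(y - x) / cis m1 \<in> \<real>\<^sub>\<ge>\<^sub>0"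
      then obtain r where "r \<ge> 0" "(y - x) / cis m1 = of_real r" by (auto simp: nonneg_Reals_def)
      then have "y = x + r *\<^sub>R cis m1" by (simp add: field_simps scaleR_conv_of_real)
      then show False using notin[of r m1] \<open>r \<ge> 0\<close> y by auto
    qed
    then have "isCont Arg2pi ((y - x) / cis m1)" by (rule continuous_at_Arg2pi)
    moreover have "isCont (\<lambda>y. (y - x) / cis m1) y" by (intro continuous_intros) auto
    ultimately show "isCont f y" unfolding f_def using isCont_o2 by blast
  qed
  have con: "connected (f ` bd)" using connected_continuous_image cont connected_bd by blast
  have "pa U \<in> bd" "pa U' \<in> bd" using U(1) U'(1) g good_bd by auto
  moreover have "f (pa U) = w - m1" using fval[of r w] w wb m1 m2 wb' by auto
  moreover have "f (pa U') = w' - m1" using fval[of r' w'] w' wb m1 m2 wb' by auto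
  ultimately have "w - m1 \<in> f ` bd" "w' - m1 \<in> f ` bd" by force+
  moreover have "w - m1 \<le> m2 - m1" "m2 - m1 \<le> w' - m1" using wb wb' m2 by auto
  ultimately have "m2 - m1 \<in> f ` bd"
    using con connected_contains_Icc[of "f ` bd" "w - m1" "w' - m1"] by auto
  then obtain y where y: "y \<in> bd" "f y = m2 - m1" by auto
  let ?z = "(y - x) / cis m1"
  have "?z = of_real (cmod ?z) * exp (\<i> * of_real (Arg2pi ?z))"
    using Arg2pi[of ?z] unfolding is_Arg_def by blast
  also have "\<dots> = of_real (cmod ?z) * cis (m2 - m1)"
    using y(2) unfolding f_def by (simp add: cis_conv_exp)
  finally have "y - x = of_real (cmod ?z) * cis (m2 - m1) * cis m1"
    by (simp add: field_simps)
  moreover have "cis (m2 - m1) * cis m1 = cis m2" by (simp add: cis_mult)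
  ultimately have "y - x = cmod ?z *\<^sub>R cis m2"
    by (simp only: scaleR_conv_of_real mult.assoc)
  then have "y = x + cmod ?z *\<^sub>R cis m2" by (simp add: algebra_simps)
  then show False using notin[of "cmod ?z" m2] y(1) by simp
qed

lemma disjoint_split:
  assumes c: "closed_chain (xs @ T1 # ys @ T2 # zs)"
    and g: "\<forall>T\<in>set (xs @ T1 # ys @ T2 # zs). good T"
  shows "sreg T1 \<inter> sreg T2 = {}"
  using disjoint_first[of T1 ys T2 "zs @ map turn xs"] closed_chain_rotate[OF c] g
  by (simp add: ball_Un)

lemma disjoint_nth:
  assumes c: "closed_chain ts" and g: "\<forall>T\<in>set ts. good T"
    and ij: "i < length ts" "j < length ts" "i \<noteq> j"
  shows "sreg (ts ! i) \<inter> sreg (ts ! j) = {}"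
proof -
  have *: "sreg (ts ! i) \<inter> sreg (ts ! j) = {}" if "i < j" "j < length ts" for i j
  proof -
    have "ts = take i ts @ ts ! i # drop (Suc i) ts" using that by (intro id_take_nth_drop) auto
    moreover have "drop (Suc i) ts = take (j - Suc i) (drop (Suc i) ts) @ ts ! j # drop (Suc j) ts"
      using that id_take_nth_drop[of "j - Suc i" "drop (Suc i) ts"] by simp
    ultimately have e: "ts = take i ts @ ts ! i # take (j - Suc i) (drop (Suc i) ts) @ ts ! j # drop (Suc j) ts"
      by metis
    then show ?thesis using disjoint_split c g by metis
  qed
  then show ?thesis using ij by (metis Int_commute linorder_neqE_nat)
qed

section \<open>Lines shared by consecutive triangles\<close>

definition link :: "tri \<Rightarrow> tri \<Rightarrow> bool" where
  "link T1 T2 \<longleftrightarrow> t2 T1 = t1 T2 \<and> lf (pb T1) (t1 T2) (pa T2) = 0"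

text \<open>The outermost of the two starting points of sector sides on a shared line.\<close>

definition pivot :: "tri \<Rightarrow> tri \<Rightarrow> complex" where
  "pivot T1 T2 = (if inner (cis (t1 T2)) (pb T1 - pa T2) \<ge> 0 then pb T1 else pa T2)"

lemma pivot_cases:
  assumes "link T1 T2"
  obtains r s where "r \<ge> 0" "s \<ge> 0" "r = 0 \<or> s = 0"
    "pivot T1 T2 = pa T2 + r *\<^sub>R cis (t1 T2)" "pivot T1 T2 = pb T1 + s *\<^sub>R cis (t1 T2)"
proof -
  have "lf (pa T2) (t1 T2) (pb T1) = 0" using assms lf_sym by (auto simp: link_def)
  then obtain r where r: "pb T1 = pa T2 + r *\<^sub>R cis (t1 T2)" by (rule lf_zeroE)
  have "inner (cis (t1 T2)) (cis (t1 T2)) = 1"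
    by (simp add: dot_square_norm)
  then have i: "inner (cis (t1 T2)) (pb T1 - pa T2) = r"
    using r by simp
  show ?thesis
  proof (cases "r \<ge> 0")
    case True
    then show ?thesis using that[of r 0] r i by (simp add: pivot_def)
  next
    case False
    then show ?thesis using that[of 0 "- r"] r i by (simp add: pivot_def)
  qed
qed

text \<open>Beyond the pivot a point of the shared line satisfies strictly all inequalities of both
  sectors except those that belong to the shared line.\<close>

lemma link_nbhd:
  assumes g: "good T1" "good T2" and l: "link T1 T2" and r: "r > 0"
  obtains U where "open U" "pivot T1 T2 + r *\<^sub>R cis (t1 T2) \<in> U"
    "\<And>z. z \<in> U \<Longrightarrow> lf (pb T1) (t1 T2) z < 0 \<Longrightarrow> z \<in> sreg T1"
    "\<And>z. z \<in> U \<Longrightarrow> lf (pb T1) (t1 T2) z > 0 \<Longrightarrow> z \<in> sreg T2"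
proof -
  define t where "t = t1 T2"
  define y where "y = pivot T1 T2 + r *\<^sub>R cis t"
  have sh: "shape T1" "shape T2" using g good_shape by auto
  have t: "t2 T1 = t" using l by (simp add: link_def t_def)
  obtain p s where ps: "p \<ge> 0" "s \<ge> 0" "pivot T1 T2 = pa T2 + p *\<^sub>R cis t" "pivot T1 T2 = pb T1 + s *\<^sub>R cis t"
    using pivot_cases[OF l] unfolding t_def by metis
  have y1: "y = pb T1 + (s + r) *\<^sub>R cis t" and y2: "y = pa T2 + (p + r) *\<^sub>R cis t"
    using ps by (simp_all add: y_def scaleR_add_left)
  define U where "U = {z. lf (pa T1) (t1 T1) z > 0 \<and> crs (pb T1 - pa T1) (z - pa T1) < 0 \<and>
     lf (pb T2) (t2 T2) z < 0 \<and> crs (pb T2 - pa T2) (z - pa T2) < 0}"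
  have oU: "open U" unfolding U_def lf_def
    by (intro open_Collect_conj open_Collect_less continuous_intros)
  have d1: "crs (pb T1 - pa T1) (cis t) < 0" using shape_direction[OF sh(1), of t] t sh by (auto simp: shape_def)
  have d2: "crs (pb T2 - pa T2) (cis t) < 0" using shape_direction[OF sh(2), of t] sh by (auto simp: shape_def t_def)
  have s1: "sin (t - t1 T1) > 0" using sh t by (auto simp: shape_def intro!: sin_gt_zero)
  have "sin (t2 T2 - t) > 0" using sh by (auto simp: shape_def t_def intro!: sin_gt_zero)
  then have s2: "sin (t - t2 T2) < 0" by (metis minus_diff_eq neg_less_0_iff_less sin_minus)
  have "lf (pa T1) (t1 T1) y > 0"
    unfolding y1 lf_move using sh s1 ps r by (auto simp: lf_def shape_def add_pos_nonneg)
  moreover have "lf (pb T2) (t2 T2) y < 0"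
  proof -
    have "lf (pb T2) (t2 T2) (pa T2) < 0" using sh by (auto simp: lf_def shape_def crs_simps)
    moreover have "(p + r) * sin (t - t2 T2) \<le> 0" using s2 ps r by (simp add: mult_nonneg_nonpos)
    ultimately show ?thesis unfolding y2 lf_move by linarith
  qed
  moreover have "crs (pb T1 - pa T1) (y - pa T1) = (s + r) * crs (pb T1 - pa T1) (cis t)"
    unfolding y1 by (simp add: crs_simps) (simp add: crs_def)
  then have "crs (pb T1 - pa T1) (y - pa T1) < 0" using d1 ps r by (simp add: mult_pos_neg)
  moreover have "crs (pb T2 - pa T2) (y - pa T2) = (p + r) * crs (pb T2 - pa T2) (cis t)"
    unfolding y2 by (simp add: crs_simps)
  then have "crs (pb T2 - pa T2) (y - pa T2) < 0" using d2 ps r by (simp add: mult_pos_neg)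
  ultimately have yU: "y \<in> U" by (simp add: U_def)
  moreover have "lf (pa T2) t z = lf (pb T1) t z" for z
    using l lf_cong by (auto simp: link_def t_def)
  ultimately show ?thesis using oU t by (intro that[of U]) (auto simp: U_def sreg_def t_def y_def)
qed

text \<open>A boundary point on this ray would have points of the open set \<open>D\<close> nearby,
  also off the line, and there the two sectors leave no room for \<open>D\<close>.\<close>

lemma outer_free:
  assumes g: "good T1" "good T2" and l: "link T1 T2" and r: "r > 0"
  shows "pivot T1 T2 + r *\<^sub>R cis (t1 T2) \<notin> bd"
proof
  define t where "t = t1 T2"
  define y where "y = pivot T1 T2 + r *\<^sub>R cis t"
  obtain U where oU: "open U" and yU: "y \<in> U"
    and U: "\<And>z. z \<in> U \<Longrightarrow> lf (pb T1) t z < 0 \<Longrightarrow> z \<in> sreg T1" "\<And>z. z \<in> U \<Longrightarrow> lf (pb T1) t z > 0 \<Longrightarrow> z \<in> sreg T2"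
    using link_nbhd[OF g l r] unfolding y_def t_def by metis
  assume "pivot T1 T2 + r *\<^sub>R cis (t1 T2) \<in> bd"
  then have "y \<in> closure D" using frontier_D by (auto simp: y_def t_def frontier_def)
  then obtain z where z: "z \<in> U \<inter> D"
    using yU oU closure_iff_nhds_not_empty[of y D] by blast
  have "open (U \<inter> D)" using oU open_D by blast
  then obtain e where e: "e > 0" "ball z e \<subseteq> U \<inter> D" using z open_contains_ball by blast
  \<comment> \<open>If \<open>z\<close> happens to lie on the shared line, a small perpendicular
    shift takes it off the line without leaving \<open>D\<close>.\<close>
  define h where "h = (if lf (pb T1) t z = 0 then e / 2 else 0)"
  define z' where "z' = z + h *\<^sub>R cis (t + pi / 2)"
  have "z' \<in> ball z e" using e by (auto simp: z'_def h_def dist_norm)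
  then have z': "z' \<in> U" "z' \<in> D" using e by auto
  have "lf (pb T1) t z' \<noteq> 0" using e by (auto simp: z'_def lf_move h_def)
  then have "z' \<in> sreg T1 \<or> z' \<in> sreg T2" using U z'(1) by (meson linorder_neqE_linordered_idom)
  then show False using sreg_D g z'(2) by blast
qed

text \<open>One of the two sector sides starts at the pivot. Goodness puts a vertex on that side,
  and no boundary point lies beyond the pivot.\<close>

lemma pivot_vertex:
  assumes g: "good T1" "good T2" and l: "link T1 T2"
  shows "pivot T1 T2 \<in> verts"
proof -
  obtain r where r: "r \<ge> 0" "pa T2 + r *\<^sub>R cis (t1 T2) \<in> verts" using g by (auto simp: good_def)
  obtain s where s: "s \<ge> 0" "pb T1 + s *\<^sub>R cis (t1 T2) \<in> verts" using g l by (auto simp: good_def link_def)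
  obtain p q where pq: "p = 0 \<or> q = 0"
    "pivot T1 T2 = pa T2 + p *\<^sub>R cis (t1 T2)" "pivot T1 T2 = pb T1 + q *\<^sub>R cis (t1 T2)"
    using pivot_cases[OF l] by metis
  from pq(1) show ?thesis
  proof
    assume "p = 0"
    then have "pivot T1 T2 + r *\<^sub>R cis (t1 T2) \<in> verts" using r pq by simp
    then show ?thesis using outer_free[OF g l, of r] verts_bd r(1)
      by (cases "r = 0") auto
  next
    assume "q = 0"
    then have "pivot T1 T2 + s *\<^sub>R cis (t1 T2) \<in> verts" using s pq by simp
    then show ?thesis using outer_free[OF g l, of s] verts_bd s(1)
      by (cases "s = 0") auto
  qed
qed

end

section \<open>Chains cast from a point\<close>

text \<open>Base angle divided by area, for the triangle with apex on the two lines.\<close>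

definition rat :: "tri \<Rightarrow> real" where
  "rat T = 2 * (t2 T - t1 T) * sin (t2 T - t1 T) /
     (crs (cis (t1 T)) (pb T - pa T) * crs (cis (t2 T)) (pb T - pa T))"

lemma rat_turn [simp]: "rat (turn T) = rat T"
  by (simp add: rat_def)

definition centred :: "complex \<Rightarrow> tri \<Rightarrow> bool" where
  "centred q T \<longleftrightarrow> (\<exists>r>0. pa T = q + r *\<^sub>R cis (t1 T)) \<and> (\<exists>r>0. pb T = q + r *\<^sub>R cis (t2 T))"

lemma centred_cross:
  assumes "pa T = q + r *\<^sub>R cis (t1 T)" "pb T = q + s *\<^sub>R cis (t2 T)"
  shows "crs (cis (t1 T)) (pb T - pa T) = s * sin (t2 T - t1 T)"
    "crs (cis (t2 T)) (pb T - pa T) = r * sin (t2 T - t1 T)"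
proof -
  show "crs (cis (t1 T)) (pb T - pa T) = s * sin (t2 T - t1 T)"
    using assms by (simp add: crs_simps crs_cis)
  have "sin (t2 T - t1 T) = - sin (t1 T - t2 T)" by (metis minus_diff_eq sin_minus)
  then show "crs (cis (t2 T)) (pb T - pa T) = r * sin (t2 T - t1 T)"
    using assms by (simp add: crs_simps crs_cis)
qed

lemma crs_closed_segment:
  assumes "a \<in> closed_segment p q" "b \<in> closed_segment p q" "c \<in> closed_segment p q"
  shows "crs (b - a) (c - a) = 0"
proof -
  obtain u v w where e: "a = (1 - u) *\<^sub>R p + u *\<^sub>R q" "b = (1 - v) *\<^sub>R p + v *\<^sub>R q" "c = (1 - w) *\<^sub>R p + w *\<^sub>R q"
    using assms by (auto simp: in_segment)
  show ?thesis unfolding e by (simp add: crs_def algebra_simps)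
qed

context polygon
begin

section \<open>Farthest boundary points on the rays from a centre\<close>

definition far :: "complex \<Rightarrow> real \<Rightarrow> real \<Rightarrow> bool" where
  "far q w r \<longleftrightarrow> r > 0 \<and> q + r *\<^sub>R cis w \<in> bd \<and> (\<forall>s>r. q + s *\<^sub>R cis w \<notin> bd)"

definition hits :: "complex \<Rightarrow> real \<Rightarrow> bool" where
  "hits q w \<longleftrightarrow> (\<exists>r>0. q + r *\<^sub>R cis w \<in> bd)"

definition farvert :: "complex \<Rightarrow> real \<Rightarrow> bool" where
  "farvert q w \<longleftrightarrow> (\<exists>r. far q w r \<and> q + r *\<^sub>R cis w \<in> verts)"

lemma far_unique: "far q w r \<Longrightarrow> far q w s \<Longrightarrow> r = s"
  unfolding far_def by (meson linorder_neqE_linordered_idom)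

lemma ray_bound:
  obtains B where "B > 0" "\<And>r w. q + r *\<^sub>R cis w \<in> bd \<Longrightarrow> \<bar>r\<bar> \<le> B"
proof -
  obtain B where B: "\<And>y. y \<in> bd \<Longrightarrow> norm y \<le> B" "B > 0"
    using compact_imp_bounded[OF compact_bd] bounded_pos by metis
  have "\<bar>r\<bar> \<le> B + norm q" if "q + r *\<^sub>R cis w \<in> bd" for r w
  proof -
    have "norm (r *\<^sub>R cis w) \<le> norm (q + r *\<^sub>R cis w) + norm q"
      by (metis add_diff_cancel_left' norm_triangle_ineq4)
    then show ?thesis using B(1)[OF that] by simp
  qed
  then show ?thesis using that[of "B + norm q"] B(2) by (simp add: add_pos_nonneg)
qed

lemma far_exists:
  assumes "hits q w" obtains r where "far q w r"
proof -
  obtain B where B: "\<And>r w. q + r *\<^sub>R cis w \<in> bd \<Longrightarrow> \<bar>r\<bar> \<le> B" using ray_bound by metis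
  obtain r0 where r0: "r0 > 0" "q + r0 *\<^sub>R cis w \<in> bd" using assms by (auto simp: hits_def)
  let ?R = "{0..B} \<inter> (\<lambda>r. q + r *\<^sub>R cis w) -` bd"
  have "closed ?R"
    by (rule continuous_closed_preimage) (auto intro!: continuous_intros compact_imp_closed compact_bd)
  moreover have "bounded ?R" using bounded_subset[OF compact_imp_bounded[OF compact_Icc]] by blast
  ultimately have "compact ?R" using compact_eq_bounded_closed by blast
  moreover have r0R: "r0 \<in> ?R" using r0 B[of r0 w] by auto
  ultimately obtain r where r: "r \<in> ?R" "\<forall>s\<in>?R. s \<le> r"
    using continuous_attains_sup[of ?R "\<lambda>x. x"] continuous_on_id by blast
  have "r0 \<le> r" using r r0R by blast
  moreover have "q + s *\<^sub>R cis w \<notin> bd" if "s > r" for s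
  proof
    assume "q + s *\<^sub>R cis w \<in> bd"
    then have "s \<in> ?R" using B[of s w] that r(1) by auto
    then show False using r(2) that by force
  qed
  ultimately have "far q w r" using r(1) r0(1) by (auto simp: far_def)
  then show ?thesis using that by blast
qed

text \<open>Lower semicontinuity of the farthest distance: away from vertices the ray crosses an
  edge transversally, so a boundary point persists on all neighbouring rays and moves
  continuously.\<close>

lemma far_lower:
  assumes f: "far q w r" and nv: "q + r *\<^sub>R cis w \<notin> verts"
  obtains g where "isCont g w" "g w = r" "\<forall>\<^sub>F t in nhds w. q + g t *\<^sub>R cis t \<in> bd"
proof -
  define y where "y = q + r *\<^sub>R cis w"
  obtain j where j: "j < n" "y \<in> edge j" using f by (auto simp: far_def bd_def y_def)
  define p p' where "p = P j" and "p' = Q j"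
  have pv: "p \<in> verts" "p' \<in> verts" using j by (auto simp: p_def p'_def verts_def)
  have pb: "p \<in> bd" "p' \<in> bd" using pv verts_bd by auto
  obtain s where s: "0 \<le> s" "s \<le> 1" "y = (1 - s) *\<^sub>R p + s *\<^sub>R p'"
    using j by (auto simp: edge_def in_segment p_def p'_def)
  have "s \<noteq> 0" "s \<noteq> 1" using s nv pv by (auto simp: y_def)
  then have s01: "0 < s" "s < 1" using s by auto
  have z: "(1 - s) * lf q w p + s * lf q w p' = 0"
    using lf_convex[of s q w p p'] s lf_move[of q w q r w] by (simp add: y_def)
  \<comment> \<open>If the edge lay along the ray, one of its endpoints would be farther out than
    \<open>y\<close>, which is strictly between them.\<close>
  have nz: "lf q w p \<noteq> 0"
  proof
    assume 0: "lf q w p = 0"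
    then have "lf q w p' = 0" using z s01 by auto
    then obtain b where b: "p' = q + b *\<^sub>R cis w" using lf_zeroE by blast
    obtain a where a: "p = q + a *\<^sub>R cis w" using 0 lf_zeroE by blast
    have "y = q + ((1 - s) * a + s * b) *\<^sub>R cis w"
      unfolding s(3) a b by (simp add: algebra_simps)
    then have r: "r = (1 - s) * a + s * b" by (simp add: y_def)
    have "a \<noteq> b" using PQ[OF j(1)] a b by (auto simp: p_def p'_def)
    moreover have "r - a = s * (b - a)" "r - b = (1 - s) * (a - b)" using r by (simp_all add: algebra_simps)
    ultimately have "a > r \<or> b > r" using s01
      by (metis diff_gt_0_iff_gt linorder_neqE_linordered_idom mult_pos_neg diff_less_0_iff_less)
    then show False using f a b pb by (auto simp: far_def)
  qed
  define D0 where "D0 t = lf q t p - lf q t p'" for t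
  \<comment> \<open>\<open>k t\<close> is the parameter at which the line through \<open>q\<close>
    with direction \<open>t\<close> cuts the edge; \<open>g t\<close> is the signed distance of that
    point from \<open>q\<close>.\<close>
  define k where "k t = lf q t p / D0 t" for t
  define g where "g t = inner (cis t) ((1 - k t) *\<^sub>R p + k t *\<^sub>R p' - q)" for t
  have D0w: "s * D0 w = lf q w p" using z by (simp add: D0_def algebra_simps)
  then have D0nz: "D0 w \<noteq> 0" using nz by auto
  then have kw: "k w = s" using D0w by (simp add: k_def field_simps)
  have clf: "isCont (\<lambda>t. lf q t x) t" for x t
    unfolding lf_def crs_def by (intro continuous_intros) auto
  have cD: "isCont D0 w" unfolding D0_def by (intro continuous_intros clf)
  have ck: "isCont k w" unfolding k_def by (intro continuous_intros clf cD D0nz)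
  have ccis: "isCont cis w" unfolding cis_conv_exp by (intro continuous_intros)
  have cg: "isCont g w" unfolding g_def by (intro continuous_intros ck ccis)
  have "g w = r"
  proof -
    have "inner (cis w) (cis w) = 1" by (simp add: dot_square_norm)
    then show ?thesis using kw s(3) by (simp add: g_def y_def flip: s(3))
  qed
  moreover have "\<forall>\<^sub>F t in nhds w. q + g t *\<^sub>R cis t \<in> bd"
  proof -
    have e1: "\<forall>\<^sub>F t in nhds w. D0 t \<noteq> 0"
      using tendsto_imp_eventually_ne[of D0 "D0 w" "at w" 0] cD D0nz
      by (simp add: isCont_def eventually_nhds_conv_at)
    have "\<forall>\<^sub>F t in nhds w. k t > 0 \<and> k t < 1"
    proof -
      have "k \<midarrow>w\<rightarrow> s" using ck kw by (simp add: isCont_def)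
      then have "\<forall>\<^sub>F t in at w. k t > 0" "\<forall>\<^sub>F t in at w. k t < 1"
        using s01 by (auto intro: order_tendstoD)
      then show ?thesis using kw s01 by (simp add: eventually_nhds_conv_at eventually_conj_iff)
    qed
    then show ?thesis using e1
    proof eventually_elim
      case (elim t)
      define x where "x = (1 - k t) *\<^sub>R p + k t *\<^sub>R p'"
      have xe: "x \<in> edge j" using elim unfolding edge_def in_segment x_def p_def p'_def by (intro CollectI exI[of _ "k t"]) auto
      have "lf q t x = lf q t p - k t * D0 t"
        using lf_convex[of "k t" q t p p'] elim by (simp add: x_def D0_def algebra_simps)
      then have "lf q t x = 0" using elim by (simp add: k_def)
      then obtain c where c: "x = q + c *\<^sub>R cis t" by (rule lf_zeroE)
      have "inner (cis t) (cis t) = 1" by (simp add: dot_square_norm)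
      then have "g t = c" unfolding g_def x_def[symmetric] using c by simp
      then show ?case using c xe edge_bd j by auto
    qed
  qed
  ultimately show ?thesis using that cg by blast
qed

text \<open>The directions whose farthest point lies on a given edge form a relatively closed set.
  Finitely many such sets cover the interval, they are disjoint because no farthest point is a
  vertex, and the interval is connected.\<close>

lemma radial_edge:
  assumes q: "q \<notin> bd" and xy: "x < y" and h: "\<And>w. x \<le> w \<Longrightarrow> w \<le> y \<Longrightarrow> hits q w"
    and nv: "\<And>w. x < w \<Longrightarrow> w < y \<Longrightarrow> \<not> farvert q w"
  obtains i where "i < n" "\<And>w r. x < w \<Longrightarrow> w < y \<Longrightarrow> far q w r \<Longrightarrow> q + r *\<^sub>R cis w \<in> edge i"
proof -
  let ?I = "{x<..<y}"
  define F where "F w = (SOME r. far q w r)" for w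
  have F: "far q w (F w)" if "w \<in> ?I" for w
    unfolding F_def using far_exists[OF h[of w]] that by (metis greaterThanLessThan_iff less_imp_le someI)
  define pt where "pt w = q + F w *\<^sub>R cis w" for w
  have ptnv: "pt w \<notin> verts" if "w \<in> ?I" for w
    using nv[of w] F[OF that] that by (auto simp: farvert_def pt_def)
  define G where "G i = {w \<in> ?I. pt w \<in> edge i}" for i
  obtain B where B: "\<And>r w. q + r *\<^sub>R cis w \<in> bd \<Longrightarrow> \<bar>r\<bar> \<le> B" using ray_bound by metis
  \<comment> \<open>Along directions tending to \<open>w\<close> the farthest distances accumulate
    at some \<open>r\<close>, which is at most the farthest distance at \<open>w\<close>;
    \<open>far_lower\<close> gives the converse inequality, so the farthest point at
    \<open>w\<close> lies on the same edge.\<close>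
  have cl: "closedin (top_of_set ?I) (G i)" if i: "i < n" for i
  proof (subst closedin_limpt, intro conjI allI impI)
    show "G i \<subseteq> ?I" by (auto simp: G_def)
  next
    fix w assume w: "w islimpt G i \<and> w \<in> ?I"
    then obtain f where f: "\<And>k. f k \<in> G i - {w}" "f \<longlonglongrightarrow> w"
      unfolding islimpt_sequential by blast
    have "F (f k) \<in> {0..B}" for k
      using F[of "f k"] f(1)[of k] B[of "F (f k)" "f k"] by (auto simp: G_def far_def)
    then obtain r s where rs: "r \<in> {0..B}" "strict_mono s" "((F \<circ> f) \<circ> s) \<longlonglongrightarrow> r"
      using compact_Icc[of 0 B] unfolding compact_def by (metis comp_apply)
    have fs: "(f \<circ> s) \<longlonglongrightarrow> w" using f(2) rs(2) LIMSEQ_subseq_LIMSEQ by blast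
    have lim: "(\<lambda>k. pt (f (s k))) \<longlonglongrightarrow> q + r *\<^sub>R cis w"
      unfolding pt_def using rs(3) fs by (auto intro!: tendsto_intros simp: o_def)
    moreover have "pt (f (s k)) \<in> edge i" for k using f(1)[of "s k"] by (auto simp: G_def)
    ultimately have ri: "q + r *\<^sub>R cis w \<in> edge i"
      using closed_sequentially[OF compact_imp_closed[OF compact_edge[of i]], where f = "\<lambda>k. pt (f (s k))"] by blast
    have Fw: "far q w (F w)" using F w by blast
    have "r \<le> F w" using Fw ri edge_bd[OF i] unfolding far_def by (meson not_le subsetD)
    moreover have "F w \<le> r"
    proof -
      obtain g where g: "isCont g w" "g w = F w" "\<forall>\<^sub>F t in nhds w. q + g t *\<^sub>R cis t \<in> bd"
        using far_lower[OF Fw] ptnv w unfolding pt_def by blast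
      have "\<forall>\<^sub>F k in sequentially. q + g (f (s k)) *\<^sub>R cis (f (s k)) \<in> bd"
        using g(3) fs unfolding filterlim_def le_filter_def by (auto simp: eventually_filtermap)
      then have "\<forall>\<^sub>F k in sequentially. g (f (s k)) \<le> F (f (s k))"
      proof eventually_elim
        case (elim k)
        then show ?case using F[of "f (s k)"] f(1)[of "s k"] unfolding far_def G_def
          by (metis DiffD1 mem_Collect_eq not_le)
      qed
      moreover have "(\<lambda>k. g (f (s k))) \<longlonglongrightarrow> F w"
        using isCont_tendsto_compose[OF g(1) fs] g(2) by (simp add: o_def)
      ultimately show ?thesis using rs(3)
        by (intro tendsto_le[OF _ rs(3)]) (auto simp: o_def)
    qed
    ultimately have "r = F w" by simp
    then show "w \<in> G i" using ri w by (auto simp: G_def pt_def)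
  qed
  have cov: "\<exists>i<n. w \<in> G i" if "w \<in> ?I" for w
    using F[OF that] that by (auto simp: far_def bd_def G_def pt_def)
  have disj: "G i \<inter> G j = {}" if "i < n" "j < n" "i \<noteq> j" for i j
    using meet[OF that] ptnv by (auto simp: G_def)
  obtain w0 where w0: "w0 \<in> ?I" using xy dense by (metis greaterThanLessThan_iff)
  obtain i where i: "i < n" "w0 \<in> G i" using cov w0 by blast
  let ?C = "\<Union>j\<in>{..<n} - {i}. G j"
  have cC: "closedin (top_of_set ?I) ?C" by (intro closedin_Union) (auto simp: cl)
  have "connected ?I" by simp
  moreover have "?I \<subseteq> G i \<union> ?C"
  proof
    fix w assume "w \<in> ?I"
    then obtain j where "j < n" "w \<in> G j" using cov by blast
    then show "w \<in> G i \<union> ?C" by (cases "j = i") blast+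
  qed
  moreover have "G i \<inter> ?C = {}" using disj i by blast
  ultimately have "?C = {}" using cl[OF i(1)] cC i(2) unfolding connected_closedin by (metis empty_iff)
  have all: "?I \<subseteq> G i"
  proof
    fix w assume "w \<in> ?I"
    then obtain j where "j < n" "w \<in> G j" using cov by blast
    then show "w \<in> G i" using \<open>?C = {}\<close> by (cases "j = i") blast+
  qed
  show ?thesis
  proof (rule that[OF i(1)])
    fix w r assume "x < w" "w < y" "far q w r"
    then show "q + r *\<^sub>R cis w \<in> edge i"
      using all F[of w] far_unique[of q w r "F w"] by (auto simp: G_def pt_def)
  qed
qed

text \<open>The base joins limits of farthest points as the direction tends to \<open>x\<close> and
  to \<open>y\<close>. Such a limit may be nearer than the farthest point in the limiting direction;
  the latter is a vertex, and the side of the sector passes through it.\<close>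

lemma radial_arc:
  assumes q: "q \<notin> bd" and xy: "x < y" and h: "\<And>w. x \<le> w \<Longrightarrow> w \<le> y \<Longrightarrow> hits q w"
    and nv: "\<And>w. x < w \<Longrightarrow> w < y \<Longrightarrow> \<not> farvert q w" and fx: "farvert q x" and fy: "farvert q y"
  obtains T where "good T" "centred q T" "t1 T = x" "t2 T = y"
proof -
  obtain i where i: "i < n" "\<And>w r. x < w \<Longrightarrow> w < y \<Longrightarrow> far q w r \<Longrightarrow> q + r *\<^sub>R cis w \<in> edge i"
    using radial_edge[OF q xy h nv] by metis
  obtain B where B: "\<And>r w. q + r *\<^sub>R cis w \<in> bd \<Longrightarrow> \<bar>r\<bar> \<le> B" using ray_bound by metis
  have lim: "\<exists>r>0. q + r *\<^sub>R cis w \<in> edge i" if "f \<longlonglongrightarrow> w" "\<And>k. x < f k \<and> f k < y" for f :: "nat \<Rightarrow> real" and w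
  proof -
    have "\<exists>r. far q (f k) r" for k using far_exists[OF h[of "f k"]] that(2)[of k] by (metis less_imp_le)
    then obtain F where F: "\<And>k. far q (f k) (F k)" by metis
    have "F k \<in> {0..B}" for k using F[of k] B[of "F k" "f k"] by (auto simp: far_def)
    then obtain r s where rs: "r \<in> {0..B}" "strict_mono s" "(F \<circ> s) \<longlonglongrightarrow> r"
      using compact_Icc[of 0 B] unfolding compact_def by metis
    have fs: "(f \<circ> s) \<longlonglongrightarrow> w" using that(1) rs(2) LIMSEQ_subseq_LIMSEQ by blast
    have "(\<lambda>k. q + F (s k) *\<^sub>R cis (f (s k))) \<longlonglongrightarrow> q + r *\<^sub>R cis w"
      using rs(3) fs by (auto intro!: tendsto_intros simp: o_def)
    moreover have "q + F (s k) *\<^sub>R cis (f (s k)) \<in> edge i" for k using i(2) that(2) F by blast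
    ultimately have ri: "q + r *\<^sub>R cis w \<in> edge i"
      using closed_sequentially[OF compact_imp_closed[OF compact_edge[of i]], where f = "\<lambda>k. q + F (s k) *\<^sub>R cis (f (s k))"] by blast
    have "r \<noteq> 0" using ri q edge_bd[OF i(1)] by auto
    then show ?thesis using rs(1) ri by (intro exI[of _ r]) auto
  qed
  have l0: "(\<lambda>k. (y - x) / real (k + 2)) \<longlonglongrightarrow> 0"
    using LIMSEQ_ignore_initial_segment[OF lim_const_over_n[of "y - x"], of 2] by simp
  have b0: "0 < (y - x) / real (k + 2)" "(y - x) / real (k + 2) < y - x" for k
    using xy by (simp, simp add: divide_less_eq)
  have "(\<lambda>k. x + (y - x) / real (k + 2)) \<longlonglongrightarrow> x" using tendsto_add[OF tendsto_const l0] by simp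
  moreover have "x < x + (y - x) / real (k + 2) \<and> x + (y - x) / real (k + 2) < y" for k
    using b0(1)[of k] b0(2)[of k] by linarith
  ultimately obtain ra where ra: "ra > 0" "q + ra *\<^sub>R cis x \<in> edge i"
    using lim[of "\<lambda>k. x + (y - x) / real (k + 2)" x] by blast
  have "(\<lambda>k. y - (y - x) / real (k + 2)) \<longlonglongrightarrow> y" using tendsto_diff[OF tendsto_const l0] by simp
  moreover have "x < y - (y - x) / real (k + 2) \<and> y - (y - x) / real (k + 2) < y" for k
    using b0(1)[of k] b0(2)[of k] by linarith
  ultimately obtain rb where rb: "rb > 0" "q + rb *\<^sub>R cis y \<in> edge i"
    using lim[of "\<lambda>k. y - (y - x) / real (k + 2)" y] by blast
  have ptE: "\<exists>r>0. q + r *\<^sub>R cis w \<in> edge i" if "x < w" "w \<le> y" for w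
  proof (cases "w = y")
    case False
    then obtain r where "far q w r" using far_exists[OF h[of w]] \<open>x < w\<close> \<open>w \<le> y\<close> by (metis less_imp_le)
    then show ?thesis using i(2)[of w r] that False by (auto simp: far_def)
  qed (use rb in auto)
  have cv: "convex (edge i)" by (simp add: edge_def)
  \<comment> \<open>A span of \<open>pi\<close> or more would put points of the edge on opposite
    rays from \<open>q\<close>, and by convexity \<open>q\<close> itself on the edge.\<close>
  have ypi: "y < x + pi"
  proof (rule ccontr)
    assume "\<not> y < x + pi"
    then obtain r where r: "r > 0" "q + r *\<^sub>R cis (x + pi) \<in> edge i"
      using ptE[of "x + pi"] by auto
    define s where "s = ra / (ra + r)"
    have c: "cis (x + pi) = - cis x" by (simp add: complex_eq_iff)
    have s: "0 \<le> s" "s \<le> 1" "1 - s = r / (ra + r)" using r ra by (auto simp: s_def field_simps)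
    have "(1 - s) *\<^sub>R (q + ra *\<^sub>R cis x) + s *\<^sub>R (q + r *\<^sub>R cis (x + pi)) = q + ((1 - s) * ra - s * r) *\<^sub>R cis x"
      unfolding c by (simp add: algebra_simps)
    also have "(1 - s) * ra - s * r = 0" unfolding s(3) by (simp add: s_def)
    finally have "q \<in> edge i" using convexD_alt[OF cv ra(2) r(2) s(1,2)] by simp
    then show False using q edge_bd i(1) by auto
  qed
  define T where "T = Tri (q + ra *\<^sub>R cis x) (q + rb *\<^sub>R cis y) x y"
  have cen: "centred q T" using ra rb by (auto simp: centred_def T_def)
  have sp: "sin (y - x) > 0" using xy ypi by (intro sin_gt_zero) auto
  have sh: "shape T"
    using centred_cross[of T q ra rb] sp ra rb xy ypi by (auto simp: shape_def T_def)
  have "sreg T \<inter> bd = {}"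
  proof (rule ccontr)
    assume "sreg T \<inter> bd \<noteq> {}"
    then obtain z where z: "z \<in> sreg T" "z \<in> bd" by auto
    have "crs (cis x) (z - q) > 0" "crs (cis y) (z - q) < 0"
      using z(1) lf_base_move by (auto simp: sreg_def T_def lf_def[symmetric])
    then obtain w where w: "x < w" "w < y" "z - q = cmod (z - q) *\<^sub>R cis w" "cmod (z - q) > 0"
      using between_directions xy ypi by metis
    define r where "r = cmod (z - q)"
    have zr: "z = q + r *\<^sub>R cis w" using w(3) by (simp add: r_def algebra_simps)
    obtain s where s: "far q w s" using far_exists[OF h[of w]] w by (metis less_imp_le)
    then have se: "q + s *\<^sub>R cis w \<in> edge i" using i(2) w by blast
    have rs: "r \<le> s" using s z(2) zr by (auto simp: far_def not_less[symmetric])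
    have "crs (pb T - pa T) (q + s *\<^sub>R cis w - pa T) = 0"
      using crs_closed_segment[OF ra(2)[unfolded edge_def] rb(2)[unfolded edge_def] se[unfolded edge_def]]
      by (simp add: T_def)
    moreover have "z - pa T = (q + s *\<^sub>R cis w - pa T) + (r - s) *\<^sub>R cis w"
      unfolding zr by (simp add: algebra_simps)
    ultimately have "crs (pb T - pa T) (z - pa T) = (r - s) * crs (pb T - pa T) (cis w)"
      by (metis crs_add_right crs_scale_right add_0)
    moreover have "crs (pb T - pa T) (cis w) < 0" using shape_direction[OF sh, of w] w by (auto simp: T_def)
    ultimately have "crs (pb T - pa T) (z - pa T) \<ge> 0" using rs by (simp add: mult_nonpos_nonpos)
    then show False using z(1) by (auto simp: sreg_def)
  qed
  moreover have vx: "\<exists>r\<ge>0. q + c *\<^sub>R cis w + r *\<^sub>R cis w \<in> verts"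
    if "farvert q w" "q + c *\<^sub>R cis w \<in> edge i" for c w
  proof -
    obtain r where r: "far q w r" "q + r *\<^sub>R cis w \<in> verts" using \<open>farvert q w\<close> by (auto simp: farvert_def)
    have "c \<le> r" using r(1) that(2) edge_bd i(1) unfolding far_def by (meson not_le subsetD)
    then show ?thesis using r(2) by (intro exI[of _ "r - c"]) (simp add: algebra_simps)
  qed
  ultimately have "good T"
    unfolding good_def using sh i(1) ra rb vx[OF fx ra(2)] vx[OF fy rb(2)] by (auto simp: T_def)
  then show ?thesis using that[of T] cen by (simp add: T_def)
qed

lemma finite_farvert:
  assumes "y \<le> x + 2 * pi" shows "finite {w. x < w \<and> w < y \<and> farvert q w}" (is "finite ?S")
proof -
  define f where "f w = q + (SOME r. far q w r \<and> q + r *\<^sub>R cis w \<in> verts) *\<^sub>R cis w" for w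
  have f: "f w \<in> verts \<and> (\<exists>r>0. f w = q + r *\<^sub>R cis w)" if "w \<in> ?S" for w
  proof -
    have "\<exists>r. far q w r \<and> q + r *\<^sub>R cis w \<in> verts" using that by (auto simp: farvert_def)
    from someI_ex[OF this] show ?thesis unfolding f_def far_def by blast
  qed
  have "inj_on f ?S"
  proof (rule inj_onI)
    fix v w assume vw: "v \<in> ?S" "w \<in> ?S" "f v = f w"
    obtain r s where rs: "r > 0" "s > 0" "q + r *\<^sub>R cis v = q + s *\<^sub>R cis w" using f vw by metis
    then have e: "r *\<^sub>R cis v = s *\<^sub>R cis w" by simp
    then have "norm (r *\<^sub>R cis v) = norm (s *\<^sub>R cis w)" by simp
    then have "r = s" using rs by simp
    then have "cis v = cis w" using e rs by simp
    then have "sin v = sin w \<and> cos v = cos w" by (simp add: complex_eq_iff)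
    then obtain k :: int where k: "v = w + 2 * pi * of_int k" using sin_cos_eq_iff by blast
    have "\<bar>v - w\<bar> < 2 * pi" using vw assms by auto
    then have "\<bar>of_int k\<bar> < (1::real)" using k by (simp add: abs_mult)
    then have "k = 0" by linarith
    then show "v = w" using k by simp
  qed
  moreover have "f ` ?S \<subseteq> verts" using f by blast
  ultimately show ?thesis using finite_verts inj_on_finite by blast
qed

text \<open>Induction on the number of intermediate directions whose farthest point is a vertex:
  cutting at one of them leaves fewer on either side, and without any the arc is a single
  triangle.\<close>

lemma radial_chain:
  assumes "q \<notin> bd" "x < y" "y \<le> x + 2 * pi" "\<And>w. x \<le> w \<Longrightarrow> w \<le> y \<Longrightarrow> hits q w"
    "farvert q x" "farvert q y"
  shows "\<exists>ts. chain q x ts q y \<and> (\<forall>T\<in>set ts. good T \<and> centred q T)"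
  using assms
proof (induction "card {w. x < w \<and> w < y \<and> farvert q w}" arbitrary: x y rule: less_induct)
  case less
  show ?case
  proof (cases "\<exists>w. x < w \<and> w < y \<and> farvert q w")
    case False
    then obtain T where T: "good T" "centred q T" "t1 T = x" "t2 T = y"
      using radial_arc[of q x y] less.prems by metis
    obtain ra rb where r: "pa T = q + ra *\<^sub>R cis (t1 T)" "pb T = q + rb *\<^sub>R cis (t2 T)"
      using T by (auto simp: centred_def)
    have "lf (pb T) (t2 T) q = 0" unfolding r(2) by (simp add: lf_base_move)
    moreover have "lf q x (pa T) = 0" using r(1) T by (simp add: lf_def crs_simps)
    ultimately have "chain q x [T] q y" using T by simp
    then show ?thesis using T by (metis empty_iff list.set(1) set_ConsD)
  next
    case True
    then obtain w where w: "x < w" "w < y" "farvert q w" by blast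
    have fin: "finite {w. x < w \<and> w < y \<and> farvert q w}" using finite_farvert less.prems by blast
    have "card {v. x < v \<and> v < w \<and> farvert q v} < card {w. x < w \<and> w < y \<and> farvert q w}"
      "card {v. w < v \<and> v < y \<and> farvert q v} < card {w. x < w \<and> w < y \<and> farvert q w}"
      using w by (intro psubset_card_mono fin; force)+
    then obtain us vs where "chain q x us q w" "\<forall>T\<in>set us. good T \<and> centred q T"
      "chain q w vs q y" "\<forall>T\<in>set vs. good T \<and> centred q T"
      using less.hyps[of x w] less.hyps[of w y] less.prems w by fastforce
    then have "chain q x (us @ vs) q y" "\<forall>T\<in>set (us @ vs). good T \<and> centred q T"
      using chain_append by auto
    then show ?thesis by blast
  qed
qed

end

section \<open>Rotating a shared line\<close>

text \<open>The point where the base line of \<open>T\<close> meets the line through \<open>w\<close> with direction \<open>s\<close>.\<close>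

definition mp :: "tri \<Rightarrow> complex \<Rightarrow> real \<Rightarrow> complex" where
  "mp T w s = pa T + (crs (cis s) (w - pa T) / crs (cis s) (pb T - pa T)) *\<^sub>R (pb T - pa T)"

definition rend :: "tri \<Rightarrow> complex \<Rightarrow> real \<Rightarrow> tri" where
  "rend T w s = Tri (pa T) (mp T w s) (t1 T) s"

definition rstart :: "tri \<Rightarrow> complex \<Rightarrow> real \<Rightarrow> tri" where
  "rstart T w s = Tri (mp T w s) (pb T) s (t2 T)"

lemma rend_sel [simp]: "pa (rend T w s) = pa T" "pb (rend T w s) = mp T w s"
  "t1 (rend T w s) = t1 T" "t2 (rend T w s) = s"
  by (simp_all add: rend_def)

lemma rstart_sel [simp]: "pa (rstart T w s) = mp T w s" "pb (rstart T w s) = pb T"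
  "t1 (rstart T w s) = s" "t2 (rstart T w s) = t2 T"
  by (simp_all add: rstart_def)

lemma mp_line: "crs (cis s) (pb T - pa T) \<noteq> 0 \<Longrightarrow> lf w s (mp T w s) = 0"
  by (simp add: lf_def mp_def crs_simps diff_divide_distrib[symmetric] field_simps)

lemma cis_between:
  "sin (t - s) *\<^sub>R cis w = sin (t - w) *\<^sub>R cis s + sin (w - s) *\<^sub>R cis t"
  using crs_expand[of "cis s" "cis t" "cis w"] by (simp add: crs_cis)

lemma eventually_pos_near:
  fixes f :: "real \<Rightarrow> real"
  assumes "isCont f t" "f t > 0" shows "\<forall>\<^sub>F s in nhds t. f s > 0"
  using order_tendstoD(1)[of f "f t" "at t" 0] assms
  by (simp add: isCont_def eventually_nhds_conv_at)

lemma isCont_crs_cis: "isCont (\<lambda>s. crs (cis s) z) t"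
  unfolding crs_def by (intro continuous_intros) auto

text \<open>Source of the angles \<open>arctan (h / r)\<close>: a target lies \<open>r\<close> ahead
  and \<open>h\<close> to the left of the observer.\<close>

lemma polar_arctan:
  assumes "r > 0"
  shows "r *\<^sub>R cis t + h *\<^sub>R cis (t + pi / 2) = sqrt (r\<^sup>2 + h\<^sup>2) *\<^sub>R cis (t + arctan (h / r))"
proof -
  have s: "sqrt (r\<^sup>2 + h\<^sup>2) = r * sqrt (1 + (h / r)\<^sup>2)"
  proof -
    have "r\<^sup>2 + h\<^sup>2 = r\<^sup>2 * (1 + (h / r)\<^sup>2)" using assms by (simp add: field_simps)
    then show ?thesis using assms by (simp add: real_sqrt_mult)
  qed
  have p: "sqrt (1 + (h / r)\<^sup>2) > 0" by (simp add: add_pos_nonneg)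
  have "sqrt (1 + (h / r)\<^sup>2) *\<^sub>R cis (arctan (h / r)) = Complex 1 (h / r)"
    using p by (simp add: complex_eq_iff cos_arctan sin_arctan)
  then have "sqrt (r\<^sup>2 + h\<^sup>2) *\<^sub>R cis (arctan (h / r)) = Complex r h"
    unfolding s using assms by (metis (no_types, lifting) scaleR_scaleR complex_scaleR mult.right_neutral times_divide_eq_right nonzero_mult_div_cancel_left less_irrefl)
  then have "cis t * (sqrt (r\<^sup>2 + h\<^sup>2) *\<^sub>R cis (arctan (h / r))) = cis t * Complex r h" by simp
  also have "\<dots> = r *\<^sub>R cis t + h *\<^sub>R cis (t + pi / 2)"
    by (simp add: complex_eq_iff cos_add sin_add algebra_simps)
  finally show ?thesis by (simp add: cis_mult)
qed

text \<open>The cosine is at least 1/2 up to \<open>pi / 3\<close>, which is why this bound on small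
  angles recurs below. The lemma supplies the factor 2 between the two bounds for the ratios of thin
  triangles.\<close>

lemma sin_ge_half:
  fixes x :: real assumes "0 < x" "x \<le> pi / 3" shows "x / 2 \<le> sin x"
proof -
  obtain z where z: "0 < z" "z < x" "sin x - sin 0 = (x - 0) * cos z"
    using MVT2[of 0 x sin cos] assms by (auto intro: DERIV_sin)
  have "cos z \<ge> cos (pi / 3)" using z assms by (intro cos_monotone_0_pi_le) auto
  then have "cos z \<ge> 1 / 2" by (simp add: cos_60)
  then have "x * (1 / 2) \<le> x * cos z" using assms by (intro mult_left_mono) auto
  then show ?thesis using z by simp
qed

section \<open>Turning one line of a good triangle\<close>

context polygon
begin

text \<open>Shows that what a turned line sweeps beyond its centre of rotation belongs to a sector
  already known to be free of boundary points.\<close>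

lemma wedge_in_sreg:
  assumes sh: "shape T" and w: "w = pa T + k *\<^sub>R cis (t1 T)" "k \<ge> 0"
    and v: "t1 T < v" "v < t2 T" and r: "r > 0"
  shows "w + r *\<^sub>R cis v \<in> sreg T"
proof -
  have "sin (v - t1 T) > 0" using v sh by (auto intro!: sin_gt_zero simp: shape_def)
  then have 1: "lf (pa T) (t1 T) (w + r *\<^sub>R cis v) > 0"
    using r by (simp add: w lf_move)
  have "sin (t2 T - v) > 0" "sin (t2 T - t1 T) > 0" using v sh by (auto intro!: sin_gt_zero simp: shape_def)
  then have "sin (v - t2 T) < 0" "sin (t1 T - t2 T) < 0"
    by (metis minus_diff_eq neg_less_0_iff_less sin_minus)+
  then have "r * sin (v - t2 T) < 0" "k * sin (t1 T - t2 T) \<le> 0"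
    using r w(2) by (auto simp: mult_pos_neg mult_nonneg_nonpos)
  moreover have "lf (pb T) (t2 T) (pa T) < 0" using sh by (auto simp: shape_def lf_def crs_simps)
  ultimately have 2: "lf (pb T) (t2 T) (w + r *\<^sub>R cis v) < 0"
    by (simp add: w(1) lf_move)
  have "crs (pb T - pa T) (w + r *\<^sub>R cis v - pa T) =
      k * crs (pb T - pa T) (cis (t1 T)) + r * crs (pb T - pa T) (cis v)"
    by (simp add: w(1)) (simp add: crs_def algebra_simps)
  moreover have "crs (pb T - pa T) (cis (t1 T)) < 0" "crs (pb T - pa T) (cis v) < 0"
    using shape_direction[OF sh] v sh by (auto simp: shape_def)
  ultimately have "crs (pb T - pa T) (w + r *\<^sub>R cis v - pa T) < 0"
    using r w(2) by (smt (verit) mult_nonneg_nonpos mult_pos_neg)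
  then show ?thesis using 1 2 by (simp add: sreg_def)
qed

text \<open>Turning the last line of \<open>T1\<close> about the pivot pulls the end of the base
  back along the base. The sector gains only a wedge at the pivot, which consists of a piece of the
  sector of \<open>T2\<close> and of points on the outer ray of the shared line, and that ray is
  free of boundary points.\<close>

lemma rend_good:
  assumes g: "good T1" "good T2" and l: "link T1 T2" and w: "w = pivot T1 T2"
  shows "\<forall>\<^sub>F s in nhds (t1 T2). t1 T2 \<le> s \<longrightarrow> good (rend T1 w s)"
proof -
  define t where "t = t1 T2"
  define a b d where "a = pa T1" and "b = pb T1" and "d = pb T1 - pa T1"
  have sh: "shape T1" "shape T2" using g good_shape by auto
  have t: "t2 T1 = t" using l by (simp add: link_def t_def)
  obtain k p where k: "k \<ge> 0" "w = b + k *\<^sub>R cis t" and p: "p \<ge> 0" "w = pa T2 + p *\<^sub>R cis t"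
    using pivot_cases[OF l] w unfolding t_def b_def by metis
  define c where "c s = crs (cis s) d" for s
  define m where "m s = crs (cis s) (w - a) / c s" for s
  have ct: "c t > 0" using sh t by (auto simp: shape_def c_def d_def)
  have mt: "m t = 1" using ct by (simp add: m_def c_def k a_def b_def d_def crs_simps)
  have cc: "isCont c t" unfolding c_def by (rule isCont_crs_cis)
  have cm: "isCont m t" unfolding m_def using ct cc
    by (intro continuous_divide isCont_crs_cis) auto
  have ev: "\<forall>\<^sub>F s in nhds t. c s > 0 \<and> m s > 0 \<and> s < t2 T2 \<and> s < t1 T1 + pi \<and> t1 T1 < s \<and> s < t + pi"
  proof -
    have "\<forall>\<^sub>F s in nhds t. c s > 0" "\<forall>\<^sub>F s in nhds t. m s > 0"
      using eventually_pos_near[OF cc] eventually_pos_near[OF cm] ct mt by auto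
    moreover have "\<forall>\<^sub>F s in nhds t. s < t2 T2" "\<forall>\<^sub>F s in nhds t. s < t1 T1 + pi"
       "\<forall>\<^sub>F s in nhds t. t1 T1 < s" "\<forall>\<^sub>F s in nhds t. s < t + pi"
      using sh t by (auto simp: shape_def t_def intro!: eventually_nhds_in_open[of "{..<_}", simplified] eventually_nhds_in_open[of "{_<..}", simplified])
    ultimately show ?thesis by (simp add: eventually_conj_iff)
  qed
  then have "\<forall>\<^sub>F s in nhds t. t \<le> s \<longrightarrow> good (rend T1 w s)"
  proof eventually_elim
    case (elim s)
    show ?case
    proof
      assume ts: "t \<le> s"
      let ?T = "rend T1 w s"
      have b': "mp T1 w s = a + m s *\<^sub>R d" by (simp add: mp_def m_def c_def a_def d_def)
      have m1: "m s \<le> 1"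
      proof -
        have "crs (cis s) (w - a) = c s - k * sin (s - t)"
          using crs_cis[of s t] sin_minus[of "s - t"] by (simp add: k c_def a_def b_def d_def crs_simps)
        moreover have "sin (s - t) \<ge> 0" using elim ts by (intro sin_ge_zero) auto
        ultimately show ?thesis using elim k by (simp add: m_def divide_le_eq)
      qed
      have shT: "shape ?T"
      proof -
        have "crs (cis (t1 T1)) d > 0" using sh(1) by (simp add: shape_def d_def)
        then show ?thesis using elim by (auto simp: shape_def b' a_def[symmetric] crs_simps c_def)
      qed
      obtain i where i: "i < n" "a \<in> edge i" "b \<in> edge i" using g(1) by (auto simp: good_def a_def b_def)
      have "a + m s *\<^sub>R d = (1 - m s) *\<^sub>R a + m s *\<^sub>R b" by (simp add: a_def b_def d_def algebra_simps)
      then have "a + m s *\<^sub>R d \<in> edge i"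
        using convexD_alt[of "edge i" a b "m s"] i m1 elim by (simp add: edge_def)
      then have ed: "\<exists>i<n. pa ?T \<in> edge i \<and> pb ?T \<in> edge i" using i by (auto simp: b' a_def)
      have lw: "lf w s (mp T1 w s) = 0" using elim by (intro mp_line) (auto simp: c_def d_def)
      then obtain r where r: "w = mp T1 w s + r *\<^sub>R cis s" using lf_sym lf_zeroE by blast
      have "crs d (w - mp T1 w s) = k * crs d (cis t)"
        unfolding b' by (simp add: k a_def b_def d_def) (simp add: crs_def algebra_simps)
      moreover have "crs d (w - mp T1 w s) = r * crs d (cis s)"
        by (subst r) (simp add: crs_simps)
      moreover have "crs d (cis t) < 0" "crs d (cis s) < 0"
        using ct elim crs_commute[of d] by (auto simp: c_def)
      ultimately have r0: "r \<ge> 0" using k(1)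
        by (smt (verit) mult_neg_neg mult_nonneg_nonpos)
      have v2: "\<exists>r\<ge>0. pb ?T + r *\<^sub>R cis (t2 ?T) \<in> verts"
        using r r0 pivot_vertex[OF g l] w by (intro exI[of _ r]) auto
      have v1: "\<exists>r\<ge>0. pa ?T + r *\<^sub>R cis (t1 ?T) \<in> verts" using g by (auto simp: good_def)
      have "x \<notin> bd" if x: "x \<in> sreg ?T" for x
      proof -
        have x1: "lf a (t1 T1) x > 0" "lf (mp T1 w s) s x < 0" "crs d (x - a) < 0"
          using x elim by (auto simp: sreg_def b' crs_simps a_def mult_less_0_iff)
        have x2: "lf w s x < 0" using x1(2) lf_cong[OF lw] by simp
        show ?thesis
        proof (cases "lf b t x < 0")
          case True
          then have "x \<in> sreg T1" using x1 by (auto simp: sreg_def t a_def b_def d_def)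
          then show ?thesis using g by (auto simp: good_def)
        next
          case False
          have "lf w t x = lf b t x" by (simp add: k lf_base_move)
          then have "lf w t x \<ge> 0" using False by simp
          show ?thesis
          proof (cases "lf w t x = 0")
            case True
            then obtain r where r: "x = w + r *\<^sub>R cis t" using lf_zeroE by blast
            then have "lf w s x = r * sin (t - s)" by (simp add: lf_move)
            then have "r * sin (s - t) > 0" using x2 sin_minus[of "s - t"] by simp
            moreover have "sin (s - t) \<ge> 0" using elim ts by (intro sin_ge_zero) auto
            ultimately have "r > 0" by (simp add: zero_less_mult_iff)
            then show ?thesis using outer_free[OF g l] r w by (simp add: t_def)
          next
            case False
            then have "crs (cis t) (x - w) > 0" "crs (cis s) (x - w) < 0"
              using \<open>lf w t x \<ge> 0\<close> x2 by (auto simp: lf_def)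
            moreover from this have "t < s" using ts by (cases "s = t") auto
            ultimately obtain v where v: "t < v" "v < s" "x - w = cmod (x - w) *\<^sub>R cis v" "cmod (x - w) > 0"
              using between_directions elim by metis
            then have "x = w + cmod (x - w) *\<^sub>R cis v" by (simp add: algebra_simps)
            moreover have "w + cmod (x - w) *\<^sub>R cis v \<in> sreg T2"
              using wedge_in_sreg[OF sh(2), of w p v "cmod (x - w)"] p v elim by (auto simp: t_def)
            ultimately show ?thesis using g by (auto simp: good_def)
          qed
        qed
      qed
      then show "good ?T" unfolding good_def using shT ed v1 v2 by blast
    qed
  qed
  then show ?thesis by (simp add: t_def)
qed

text \<open>\<open>T2\<close> is turned about the vertex of the shared ray nearest to its base and
  not about the pivot: behind the centre of rotation the sector grows, and a nearer vertex would be
  swept into it.\<close>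

definition inner_vertex :: "tri \<Rightarrow> tri \<Rightarrow> complex \<Rightarrow> bool" where
  "inner_vertex T1 T2 q \<longleftrightarrow> q \<in> verts \<and>
     (\<exists>k j. 0 \<le> k \<and> 0 \<le> j \<and> q = pa T2 + k *\<^sub>R cis (t1 T2) \<and> pivot T1 T2 = q + j *\<^sub>R cis (t1 T2) \<and>
        (\<forall>i. 0 \<le> i \<longrightarrow> pa T2 + i *\<^sub>R cis (t1 T2) \<in> verts \<longrightarrow> k \<le> i))"

lemma inner_vertex_exists:
  assumes g: "good T1" "good T2" and l: "link T1 T2"
  obtains q where "inner_vertex T1 T2 q"
proof -
  obtain p where p: "p \<ge> 0" "pivot T1 T2 = pa T2 + p *\<^sub>R cis (t1 T2)"
    using pivot_cases[OF l] by metis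
  define I where "I = {i. 0 \<le> i \<and> pa T2 + i *\<^sub>R cis (t1 T2) \<in> verts}"
  have "inj_on (\<lambda>i. pa T2 + i *\<^sub>R cis (t1 T2)) I" by (auto intro!: inj_onI)
  then have fin: "finite I"
    using inj_on_finite[of _ I verts] finite_verts by (auto simp: I_def)
  have pI: "p \<in> I" using p pivot_vertex[OF g l] by (simp add: I_def)
  define k where "k = Min I"
  have k: "k \<in> I" "\<And>i. i \<in> I \<Longrightarrow> k \<le> i" using fin pI Min_in[OF fin] Min_le[OF fin] unfolding k_def by blast+
  have "inner_vertex T1 T2 (pa T2 + k *\<^sub>R cis (t1 T2))"
    unfolding inner_vertex_def using k pI p
    by (intro conjI exI[of _ k] exI[of _ "p - k"]) (auto simp: I_def algebra_simps)
  then show ?thesis using that by blast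
qed

text \<open>A boundary point there is interior to some edge. If that edge crossed the shared line,
  it would enter the sector of \<open>T2\<close>. If it ran along the line, it would meet no vertex
  before \<open>q\<close> and hence extend back to \<open>pa T2\<close>; as this point is not a
  vertex, the edge would be that of the base, which is transversal to the line.\<close>

lemma inner_segment_free:
  assumes g: "good T1" "good T2" and l: "link T1 T2"
    and q: "q = pa T2 + k *\<^sub>R cis (t1 T2)"
    and kmin: "\<And>i. 0 \<le> i \<Longrightarrow> pa T2 + i *\<^sub>R cis (t1 T2) \<in> verts \<Longrightarrow> k \<le> i"
    and j: "0 < j" "j < k"
  shows "pa T2 + j *\<^sub>R cis (t1 T2) \<notin> bd"
proof
  define a b d u where "a = pa T2" and "b = pb T2" and "d = pb T2 - pa T2" and "u = cis (t1 T2)"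
  define y where "y = a + j *\<^sub>R u"
  have sh: "shape T2" using g good_shape by auto
  assume "pa T2 + j *\<^sub>R cis (t1 T2) \<in> bd"
  then obtain e where e: "e < n" "y \<in> edge e" by (auto simp: bd_def y_def a_def u_def)
  have yv: "y \<notin> verts" using kmin[of j] j by (auto simp: y_def a_def u_def)
  have av: "a \<notin> verts" using kmin[of 0] j by (auto simp: a_def)
  define f where "f = Q e - P e"
  obtain \<alpha> where al: "0 \<le> \<alpha>" "\<alpha> \<le> 1" "y = (1 - \<alpha>) *\<^sub>R P e + \<alpha> *\<^sub>R Q e"
    using e by (auto simp: edge_def in_segment)
  have PQv: "P e \<in> verts" "Q e \<in> verts" using e by (auto simp: verts_def)
  have "\<alpha> \<noteq> 0" "\<alpha> \<noteq> 1" using al yv PQv by auto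
  then have a01: "0 < \<alpha>" "\<alpha> < 1" using al by auto
  have mv: "y + h *\<^sub>R f \<in> edge e" if "\<bar>h\<bar> \<le> \<alpha>" "\<bar>h\<bar> \<le> 1 - \<alpha>" for h
  proof -
    have "y + h *\<^sub>R f = (1 - (\<alpha> + h)) *\<^sub>R P e + (\<alpha> + h) *\<^sub>R Q e"
      by (simp add: al f_def algebra_simps)
    then show ?thesis using that by (auto simp: edge_def in_segment intro!: exI[of _ "\<alpha> + h"])
  qed
  define U where "U = {z. lf b (t2 T2) z < 0 \<and> crs d (z - a) < 0}"
  have oU: "open U" unfolding U_def lf_def
    by (intro open_Collect_conj open_Collect_less continuous_intros)
  have du: "crs d u < 0" using shape_direction[OF sh, of "t1 T2"] sh by (auto simp: shape_def d_def u_def)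
  have "sin (t2 T2 - t1 T2) > 0" using sh by (auto simp: shape_def intro!: sin_gt_zero)
  then have "sin (t1 T2 - t2 T2) < 0" by (metis minus_diff_eq neg_less_0_iff_less sin_minus)
  then have "j * sin (t1 T2 - t2 T2) < 0" using j by (simp add: mult_pos_neg)
  moreover have "lf b (t2 T2) a < 0" using sh by (auto simp: shape_def lf_def crs_simps a_def b_def)
  ultimately have "lf b (t2 T2) y < 0" by (simp add: y_def u_def lf_move)
  then have "y \<in> U" using du j by (simp add: U_def y_def crs_simps mult_pos_neg)
  then obtain \<epsilon> where ep: "\<epsilon> > 0" "ball y \<epsilon> \<subseteq> U" using oU open_contains_ball by blast
  have f0: "f \<noteq> 0" using PQ[OF e(1)] by (simp add: f_def)
  have par: "crs u f = 0"
  proof (rule ccontr)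
    assume nz: "crs u f \<noteq> 0"
    \<comment> \<open>A step along the edge, short enough to stay in the edge and in
      \<open>U\<close>; the sign of \<open>h\<close> makes it leave the shared line towards the
      sector of \<open>T2\<close>.\<close>
    define h0 where "h0 = min (min \<alpha> (1 - \<alpha>)) (\<epsilon> / (2 * norm f))"
    define h where "h = sgn (crs u f) * h0"
    have h0: "h0 > 0" "h0 \<le> \<alpha>" "h0 \<le> 1 - \<alpha>" "h0 \<le> \<epsilon> / (2 * norm f)"
      using a01 ep f0 by (auto simp: h0_def)
    have "h0 * norm f \<le> \<epsilon> / 2" using h0(4) f0 by (simp add: field_simps)
    then have h0n: "h0 * norm f < \<epsilon>" using ep by linarith
    have ah: "\<bar>h\<bar> = h0" using nz h0 by (simp add: h_def abs_mult)
    have "y + h *\<^sub>R f \<in> ball y \<epsilon>" using h0n ah by (simp add: dist_norm)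
    then have "y + h *\<^sub>R f \<in> U" using ep by blast
    moreover have "h * crs u f > 0" using h0 nz by (simp add: h_def sgn_if zero_less_mult_iff)
    then have "lf a (t1 T2) (y + h *\<^sub>R f) > 0" by (simp add: lf_def y_def crs_simps u_def)
    ultimately have "y + h *\<^sub>R f \<in> sreg T2" by (auto simp: sreg_def U_def a_def b_def d_def)
    moreover have "y + h *\<^sub>R f \<in> bd" using mv[of h] ah h0 edge_bd e by auto
    ultimately show False using g by (auto simp: good_def)
  qed
  then obtain \<phi> where phi: "f = \<phi> *\<^sub>R u" using crs_eq_0_scale[of u f] by (auto simp: u_def)
  have Pe: "P e = a + (j - \<alpha> * \<phi>) *\<^sub>R u" and Qe: "Q e = a + (j + (1 - \<alpha>) * \<phi>) *\<^sub>R u"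
  proof -
    have "P e = y - \<alpha> *\<^sub>R f" "Q e = y + (1 - \<alpha>) *\<^sub>R f" by (simp_all add: al(3) f_def algebra_simps)
    then show "P e = a + (j - \<alpha> * \<phi>) *\<^sub>R u" "Q e = a + (j + (1 - \<alpha>) * \<phi>) *\<^sub>R u"
      by (simp_all add: phi y_def algebra_simps)
  qed
  have phi0: "\<phi> \<noteq> 0" using f0 phi by auto
  \<comment> \<open>Both endpoints of the edge are vertices, so neither lies on the ray before
    \<open>q\<close>.\<close>
  have P1: "j - \<alpha> * \<phi> < 0 \<or> k \<le> j - \<alpha> * \<phi>" and Q1: "j + (1 - \<alpha>) * \<phi> < 0 \<or> k \<le> j + (1 - \<alpha>) * \<phi>"
    using kmin[of "j - \<alpha> * \<phi>"] kmin[of "j + (1 - \<alpha>) * \<phi>"] PQv Pe Qe by (auto simp: a_def u_def not_less[symmetric])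
  have "a \<in> edge e"
  proof -
    have "0 \<le> \<alpha> - j / \<phi>" "\<alpha> - j / \<phi> \<le> 1"
    proof -
      show "0 \<le> \<alpha> - j / \<phi>"
      proof (cases "\<phi> > 0")
        case True
        then have "j - \<alpha> * \<phi> < j" using a01 by simp
        then have "j - \<alpha> * \<phi> < 0" using P1 j by linarith
        then show ?thesis using True by (simp add: field_simps)
      next
        case False
        then have "j / \<phi> < 0" using phi0 j by (simp add: divide_pos_neg)
        then show ?thesis using a01 by linarith
      qed
      show "\<alpha> - j / \<phi> \<le> 1"
      proof (cases "\<phi> > 0")
        case True
        then have "j / \<phi> > 0" using j by simp
        then show ?thesis using a01 by linarith
      next
        case False
        then have "\<phi> < 0" using phi0 by simp
        then have "(1 - \<alpha>) * \<phi> < 0" using a01 by (simp add: mult_pos_neg)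
        then have "j + (1 - \<alpha>) * \<phi> < 0" using Q1 j by linarith
        then show ?thesis using \<open>\<phi> < 0\<close> by (simp add: field_simps)
      qed
    qed
    moreover have "a = (1 - (\<alpha> - j / \<phi>)) *\<^sub>R P e + (\<alpha> - j / \<phi>) *\<^sub>R Q e"
    proof -
      have "(1 - (\<alpha> - j / \<phi>)) *\<^sub>R P e + (\<alpha> - j / \<phi>) *\<^sub>R Q e = y - (j / \<phi>) *\<^sub>R f"
        by (simp add: al(3) f_def algebra_simps)
      also have "\<dots> = a" using phi0 by (simp add: phi y_def)
      finally show ?thesis by simp
    qed
    ultimately show ?thesis unfolding edge_def in_segment by blast
  qed
  moreover obtain i where i: "i < n" "a \<in> edge i" "b \<in> edge i" using g(2) by (auto simp: good_def a_def b_def)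
  ultimately have "i = e" using meet[OF i(1) e(1)] av by blast
  then have "crs (Q e - P e) (b - a) = 0"
    using crs_closed_segment[of "P e" "P e" "Q e" "Q e" a] crs_closed_segment[of "P e" "P e" "Q e" "Q e" b] i
    by (simp add: edge_def crs_diff_right)
  then have "crs u d = 0" using phi phi0 by (simp add: f_def[symmetric] crs_simps d_def a_def b_def)
  then show False using sh by (auto simp: shape_def u_def d_def)
qed

text \<open>The turned sector gains only the sliver between the old and the new line behind
  \<open>q\<close>, the points \<open>bad s x\<close>. If slivers of vanishing angle all contained
  boundary points, these would accumulate on the segment from \<open>pa T2\<close> to
  \<open>q\<close>; its interior is free, and neither end can be such a limit.\<close>

lemma rstart_good:
  assumes g: "good T1" "good T2" and l: "link T1 T2" and iv: "inner_vertex T1 T2 q"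
  shows "\<forall>\<^sub>F s in nhds (t1 T2). t1 T2 \<le> s \<longrightarrow> good (rstart T2 q s)"
proof -
  define t where "t = t1 T2"
  define a b d where "a = pa T2" and "b = pb T2" and "d = pb T2 - pa T2"
  have sh: "shape T2" using g good_shape by auto
  obtain k where k: "k \<ge> 0" "q = a + k *\<^sub>R cis t"
    and kmin: "\<And>i. 0 \<le> i \<Longrightarrow> a + i *\<^sub>R cis t \<in> verts \<Longrightarrow> k \<le> i" and qv: "q \<in> verts"
    using iv by (auto simp: inner_vertex_def a_def t_def)
  have free: "a + j *\<^sub>R cis t \<notin> bd" if "0 < j" "j < k" for j
    using inner_segment_free[OF g l, of q k j] k kmin that by (auto simp: a_def t_def)
  obtain i where i: "i < n" "a \<in> edge i" "b \<in> edge i" using g(2) by (auto simp: good_def a_def b_def)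
  define c where "c s = crs (cis s) d" for s
  define m where "m s = crs (cis s) (q - a) / c s" for s
  have ct: "c t > 0" using sh by (auto simp: shape_def c_def d_def t_def)
  have mt: "m t = 0" by (simp add: m_def k crs_simps)
  have cc: "isCont c t" unfolding c_def by (rule isCont_crs_cis)
  have cm: "isCont m t" unfolding m_def using ct cc
    by (intro continuous_divide isCont_crs_cis) auto
  \<comment> \<open>If \<open>k > 0\<close>, the base grows backwards across \<open>pa T2\<close>,
    which is then not a vertex, so that its edge continues beyond it.\<close>
  have ed0: "\<forall>\<^sub>F s in nhds t. a + m s *\<^sub>R d \<in> edge i"
  proof (cases "k = 0")
    case True
    then have "m s = 0" for s by (simp add: m_def k)
    then show ?thesis using i by simp
  next
    case False
    then have av: "a \<notin> verts" using kmin[of 0] k by auto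
    obtain \<alpha> where al: "0 \<le> \<alpha>" "\<alpha> \<le> 1" "a = (1 - \<alpha>) *\<^sub>R P i + \<alpha> *\<^sub>R Q i"
      using i by (auto simp: edge_def in_segment)
    obtain \<beta> where be: "0 \<le> \<beta>" "\<beta> \<le> 1" "b = (1 - \<beta>) *\<^sub>R P i + \<beta> *\<^sub>R Q i"
      using i by (auto simp: edge_def in_segment)
    have "P i \<in> verts" "Q i \<in> verts" using i by (auto simp: verts_def)
    then have "\<alpha> \<noteq> 0" "\<alpha> \<noteq> 1" using al av by auto
    then have a01: "0 < \<alpha>" "\<alpha> < 1" using al by auto
    define h where "h s = \<alpha> + m s * (\<beta> - \<alpha>)" for s
    have ch: "isCont h t" unfolding h_def by (intro continuous_intros cm)
    have "\<forall>\<^sub>F s in nhds t. h s > 0" using eventually_pos_near[OF ch] a01 mt by (simp add: h_def)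
    moreover have "\<forall>\<^sub>F s in nhds t. 1 - h s > 0"
    proof (rule eventually_pos_near)
      show "isCont (\<lambda>s. 1 - h s) t" by (intro continuous_intros ch)
      show "1 - h t > 0" using a01 mt by (simp add: h_def)
    qed
    ultimately show ?thesis
    proof eventually_elim
      case (elim s)
      have "a + m s *\<^sub>R d = (1 - h s) *\<^sub>R P i + h s *\<^sub>R Q i"
        unfolding d_def a_def[symmetric] b_def[symmetric] by (simp add: al be h_def algebra_simps)
      then show ?case using elim by (auto simp: edge_def in_segment intro!: exI[of _ "h s"])
    qed
  qed
  define bad where "bad s x \<longleftrightarrow> t \<le> s \<and> lf q t x \<le> 0 \<and> lf q s x > 0 \<and> crs d (x - a) < 0" for s x
  have dt: "crs d (cis t) < 0" using ct crs_commute[of d] by (simp add: c_def)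
  have evdt: "\<forall>\<^sub>F s in nhds t. c s > 0 \<and> s < t2 T2 \<and> s < t + pi"
  proof -
    have "\<forall>\<^sub>F s in nhds t. c s > 0" using eventually_pos_near[OF cc] ct by auto
    moreover have "\<forall>\<^sub>F s in nhds t. s < t2 T2" "\<forall>\<^sub>F s in nhds t. s < t + pi"
      using sh by (auto simp: shape_def t_def intro!: eventually_nhds_in_open[of "{..<_}", simplified])
    ultimately show ?thesis by (simp add: eventually_conj_iff)
  qed
  have badpos: "\<exists>r v. r > 0 \<and> t \<le> v \<and> v < s \<and> x = q - r *\<^sub>R cis v"
    if bsx: "bad s x" and st: "s < t + pi" for s x
  proof -
    have b: "t \<le> s" "crs (cis t) (q - x) \<ge> 0" "crs (cis s) (q - x) < 0"
      using that by (auto simp: bad_def lf_def crs_simps)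
    then have ts: "t < s" by (cases "s = t") auto
    show ?thesis
    proof (cases "crs (cis t) (q - x) = 0")
      case True
      then obtain r where r: "q - x = r *\<^sub>R cis t" using crs_eq_0_scale[of "cis t" "q - x"] by auto
      then have "r * sin (t - s) < 0" using b(3) by (simp add: crs_simps crs_cis)
      moreover have "sin (s - t) > 0" using ts that by (intro sin_gt_zero) auto
      ultimately have "r > 0" using sin_minus[of "s - t"] by (simp add: zero_less_mult_iff)
      then show ?thesis using r ts by (intro exI[of _ r] exI[of _ t]) (auto simp: algebra_simps)
    next
      case False
      then have "crs (cis t) (q - x) > 0" using b by simp
      then obtain v where "t < v" "v < s" "q - x = cmod (q - x) *\<^sub>R cis v" "cmod (q - x) > 0"
        using between_directions[of t "q - x" s] b(3) ts st by metis
      then show ?thesis by (intro exI[of _ "cmod (q - x)"] exI[of _ v]) (auto simp: algebra_simps)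
    qed
  qed
  have edge_ok: "\<forall>\<^sub>F s in nhds t. \<forall>x\<in>edge e. \<not> bad s x" if e: "e < n" and k0: "k > 0" for e
  proof (rule ccontr)
    assume neg: "\<not> ?thesis"
    have "\<exists>s x. \<bar>s - t\<bar> < min (1 / real (Suc N)) (pi / 2) \<and> x \<in> edge e \<and> bad s x" for N
    proof (rule ccontr)
      assume no: "\<not> ?thesis"
      have "\<forall>\<^sub>F s in nhds t. dist s t < min (1 / real (Suc N)) (pi / 2)"
        using eventually_nhds_metric by (metis min_less_iff_conj pi_half_gt_zero zero_less_divide_1_iff of_nat_0_less_iff zero_less_Suc)
      then have "\<forall>\<^sub>F s in nhds t. \<forall>x\<in>edge e. \<not> bad s x"
        by eventually_elim (use no in \<open>auto simp: dist_real_def\<close>)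
      then show False using neg by blast
    qed
    then obtain S X where SX: "\<And>N. \<bar>S N - t\<bar> < 1 / real (Suc N)" "\<And>N. \<bar>S N - t\<bar> < pi / 2" "\<And>N. X N \<in> edge e" "\<And>N. bad (S N) (X N)"
      by (metis min_less_iff_conj)
    have "\<exists>r v. r > 0 \<and> t \<le> v \<and> v < S N \<and> X N = q - r *\<^sub>R cis v" for N
    proof -
      have "S N < t + pi" using SX(2)[of N] pi_gt_zero by linarith
      then show ?thesis using badpos[OF SX(4)[of N]] by blast
    qed
    then obtain r v where rv: "\<And>N. r N > 0" "\<And>N. t \<le> v N" "\<And>N. v N < S N" "\<And>N. X N = q - r N *\<^sub>R cis (v N)"
      by metis
    have vt: "v \<longlonglongrightarrow> t"
    proof (rule LIMSEQ_I)
      fix \<epsilon> :: real assume "\<epsilon> > 0"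
      then obtain N where "1 / real (Suc N) < \<epsilon>" using nat_approx_posE by blast
      then have "norm (v M - t) < \<epsilon>" if "M \<ge> N" for M
      proof -
        have "1 / real (Suc M) \<le> 1 / real (Suc N)" using that by (simp add: frac_le)
        then show ?thesis using rv(2,3)[of M] SX(1)[of M] \<open>1 / real (Suc N) < \<epsilon>\<close> by simp
      qed
      then show "\<exists>no. \<forall>n\<ge>no. norm (v n - t) < \<epsilon>" by blast
    qed
    obtain x \<sigma> where xs: "x \<in> edge e" "strict_mono \<sigma>" "(X \<circ> \<sigma>) \<longlonglongrightarrow> x"
      using compact_edge[of e] SX(3) unfolding compact_def by blast
    have rn: "r N = norm (q - X N)" for N using rv(1)[of N] rv(4)[of N] by simp
    define r0 where "r0 = norm (q - x)"
    have "(\<lambda>N. r (\<sigma> N)) \<longlonglongrightarrow> r0"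
      unfolding rn r0_def using xs(3) by (intro tendsto_intros) (simp add: o_def)
    moreover have "(\<lambda>N. v (\<sigma> N)) \<longlonglongrightarrow> t" using LIMSEQ_subseq_LIMSEQ[OF vt xs(2)] by (simp add: o_def)
    ultimately have "(\<lambda>N. q - r (\<sigma> N) *\<^sub>R cis (v (\<sigma> N))) \<longlonglongrightarrow> q - r0 *\<^sub>R cis t"
      by (intro tendsto_intros)
    moreover have "(\<lambda>N. q - r (\<sigma> N) *\<^sub>R cis (v (\<sigma> N))) = X \<circ> \<sigma>" using rv(4) by (simp add: o_def fun_eq_iff)
    ultimately have xq: "x = q - r0 *\<^sub>R cis t" using xs(3) LIMSEQ_unique by metis
    then have xa: "x = a + (k - r0) *\<^sub>R cis t" by (simp add: k algebra_simps)
    have "crs d (x - a) \<le> 0"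
    proof (rule tendsto_upperbound)
      show "(\<lambda>N. crs d ((X \<circ> \<sigma>) N - a)) \<longlonglongrightarrow> crs d (x - a)"
        using xs(3) by (intro tendsto_intros)
      show "\<forall>\<^sub>F N in sequentially. crs d ((X \<circ> \<sigma>) N - a) \<le> 0"
        using SX(4) by (auto simp: bad_def less_imp_le)
    qed auto
    then have "(k - r0) * crs d (cis t) \<le> 0" by (simp add: xa crs_simps)
    then have kr: "k - r0 \<ge> 0" using dt by (simp add: mult_le_0_iff)
    have xbd: "x \<in> bd" using xs(1) edge_bd e by blast
    have "r0 = 0 \<or> r0 = k"
    proof (rule ccontr)
      assume "\<not> ?thesis"
      moreover have "r0 \<ge> 0" by (simp add: r0_def)
      ultimately have "0 < k - r0" "k - r0 < k" using kr by auto
      then show False using free xbd xa by blast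
    qed
    then show False
    proof
      \<comment> \<open>The edge ends at \<open>q\<close>, so all points \<open>X N\<close> lie on
        one line through \<open>q\<close>. Their directions tend to \<open>t\<close>, hence are all
        equal to \<open>t\<close>, and \<open>X 0\<close> falls into the free segment.\<close>
      assume r0: "r0 = 0"
      then have qe: "q \<in> edge e" using xs(1) xq by simp
      then have qPQ: "q = P e \<or> q = Q e" using vert[OF e qv] by blast
      define z where "z = (if q = P e then Q e else P e)"
      have zq: "z \<noteq> q" using PQ[OF e] qPQ by (auto simp: z_def)
      have el: "\<exists>\<tau>. X N = q + \<tau> *\<^sub>R (z - q)" for N
      proof -
        obtain \<tau> where tau: "X N = (1 - \<tau>) *\<^sub>R P e + \<tau> *\<^sub>R Q e" using SX(3)[of N] by (auto simp: edge_def in_segment)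
        show ?thesis
        proof (cases "q = P e")
          case True
          then show ?thesis using tau by (intro exI[of _ \<tau>]) (simp add: z_def algebra_simps)
        next
          case False
          then show ?thesis using tau qPQ by (intro exI[of _ "1 - \<tau>"]) (simp add: z_def algebra_simps)
        qed
      qed
      have par: "crs (cis (v N)) (z - q) = 0" for N
      proof -
        obtain \<tau> where tau: "X N = q + \<tau> *\<^sub>R (z - q)" using el by blast
        then have "\<tau> *\<^sub>R (z - q) = - r N *\<^sub>R cis (v N)" using rv(4)[of N] by (simp add: algebra_simps)
        then have "crs (cis (v N)) (\<tau> *\<^sub>R (z - q)) = 0" by (simp add: crs_simps)
        moreover have "\<tau> \<noteq> 0" using tau rv(1,4)[of N] by auto
        ultimately show ?thesis by (simp add: crs_scale_right)
      qed
      have "(\<lambda>N. crs (cis (v N)) (z - q)) \<longlonglongrightarrow> crs (cis t) (z - q)"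
        using vt by (intro tendsto_intros)
      then have t0: "crs (cis t) (z - q) = 0" using par by (simp add: LIMSEQ_const_iff)
      obtain zz where zz: "z - q = zz *\<^sub>R cis t" using crs_eq_0_scale[OF t0] by auto
      have v0: "v N = t" for N
      proof -
        have "zz \<noteq> 0" using zz zq by auto
        then have "sin (t - v N) = 0" using par[of N] by (simp add: zz crs_simps crs_cis)
        moreover have "v N < t + pi" using rv(2,3)[of N] SX(2)[of N] pi_gt_zero by linarith
        ultimately show ?thesis using rv(2)[of N] sin_gt_zero[of "v N - t"] sin_minus[of "v N - t"] by fastforce
      qed
      have X0: "X 0 = a + (k - r 0) *\<^sub>R cis t" using rv(4)[of 0] v0[of 0] by (simp add: k algebra_simps)
      have "crs d (X 0 - a) < 0" using SX(4)[of 0] by (simp add: bad_def)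
      with X0 have "(k - r 0) * crs d (cis t) < 0" by (simp add: crs_simps)
      then have "k - r 0 > 0" using dt by (simp add: mult_less_0_iff)
      then show False using free[of "k - r 0"] rv(1)[of 0] X0 SX(3)[of 0] edge_bd[OF e] by auto
    next
      \<comment> \<open>As \<open>pa T2\<close> is not a vertex, the only edge through it is that of
        the base, and no point of that edge is in front of the base line.\<close>
      assume "r0 = k"
      then have xa: "x = a" using xa by simp
      have "a \<notin> verts" using kmin[of 0] k0 by auto
      moreover have "a \<in> edge e" using xs(1) xa by simp
      ultimately have "e = i" using meet[OF e i(1)] i(2) by blast
      then have "crs d (X 0 - a) = 0"
        using crs_closed_segment[of a "P i" "Q i" b "X 0"] i SX(3)[of 0] by (simp add: edge_def d_def a_def b_def)
      then show False using SX(4)[of 0] by (simp add: bad_def)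
    qed
  qed
  have "\<forall>\<^sub>F s in nhds t. \<forall>x\<in>bd. \<not> bad s x"
  proof (cases "k = 0")
    case True
    show ?thesis using evdt
    proof eventually_elim
      case (elim s)
      have False if b: "bad s x" for x
      proof -
        obtain r v where rv: "r > 0" "t \<le> v" "v < s" "x = q - r *\<^sub>R cis v" using badpos[OF b] elim by blast
        then have "crs d (x - a) = - r * crs d (cis v)" using True by (simp add: k crs_simps)
        moreover have "crs d (cis v) < 0" using shape_direction[OF sh, of v] rv elim by (simp add: t_def d_def)
        ultimately have "crs d (x - a) > 0" using rv(1) by (simp add: mult_pos_neg)
        then show False using b by (simp add: bad_def)
      qed
      then show ?case by blast
    qed
  next
    case False
    then have "\<forall>\<^sub>F s in nhds t. \<forall>e\<in>{..<n}. \<forall>x\<in>edge e. \<not> bad s x"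
      using edge_ok k by (intro eventually_ball_finite) auto
    then show ?thesis by eventually_elim (auto simp: bd_def)
  qed
  moreover have "\<forall>\<^sub>F s in nhds t. 1 - m s > 0"
    using eventually_pos_near[where f = "\<lambda>s. 1 - m s" and t = t] cm mt by simp
  ultimately have "\<forall>\<^sub>F s in nhds t. t \<le> s \<longrightarrow> good (rstart T2 q s)"
    using ed0 evdt
  proof eventually_elim
    case (elim s)
    show ?case
    proof
      assume ts: "t \<le> s"
      let ?T = "rstart T2 q s"
      have a': "mp T2 q s = a + m s *\<^sub>R d" by (simp add: mp_def m_def c_def a_def d_def)
      have d': "pb T2 - mp T2 q s = (1 - m s) *\<^sub>R d" unfolding a' by (simp add: a_def d_def algebra_simps)
      have shT: "shape ?T"
      proof -
        have "crs (cis (t2 T2)) d > 0" using sh by (simp add: shape_def d_def)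
        then show ?thesis using elim sh ts by (auto simp: shape_def d' crs_simps c_def t_def)
      qed
      have ed: "\<exists>i<n. pa ?T \<in> edge i \<and> pb ?T \<in> edge i" using i elim by (auto simp: a' b_def)
      have lw: "lf q s (mp T2 q s) = 0" using elim by (intro mp_line) (auto simp: c_def d_def)
      then obtain r where r: "q = mp T2 q s + r *\<^sub>R cis s" using lf_sym lf_zeroE by blast
      have "crs d (q - mp T2 q s) = k * crs d (cis t)"
        unfolding a' by (simp add: k) (simp add: crs_def algebra_simps)
      moreover have "crs d (q - mp T2 q s) = r * crs d (cis s)"
        by (subst r) (simp add: crs_simps)
      moreover have "crs d (cis s) < 0" using elim crs_commute[of d] by (auto simp: c_def)
      ultimately have r0: "r \<ge> 0" using k(1) dt
        by (smt (verit) mult_neg_neg mult_nonneg_nonpos)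
      have v1: "\<exists>r\<ge>0. pa ?T + r *\<^sub>R cis (t1 ?T) \<in> verts"
        using r r0 qv by (intro exI[of _ r]) auto
      have v2: "\<exists>r\<ge>0. pb ?T + r *\<^sub>R cis (t2 ?T) \<in> verts" using g by (auto simp: good_def)
      have "x \<notin> bd" if x: "x \<in> sreg ?T" for x
      proof -
        have "crs (pb T2 - mp T2 q s) (x - mp T2 q s) < 0" using x by (simp add: sreg_def)
        then have "(1 - m s) * crs d (x - mp T2 q s) < 0" by (simp add: d' crs_scale_left)
        then have "crs d (x - mp T2 q s) < 0" using elim by (simp add: mult_less_0_iff)
        then have x3: "crs d (x - a) < 0" by (simp add: a' crs_simps)
        have x1: "lf (mp T2 q s) s x > 0" "lf b (t2 T2) x < 0"
          using x by (auto simp: sreg_def b_def)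
        have x2: "lf q s x > 0" using x1(1) lf_cong[OF lw] by simp
        show ?thesis
        proof (cases "lf a t x > 0")
          case True
          then have "x \<in> sreg T2" using x1 x3 by (auto simp: sreg_def t_def a_def b_def d_def)
          then show ?thesis using g by (auto simp: good_def)
        next
          case False
          have "lf q t x = lf a t x" by (simp add: k lf_base_move)
          then have "bad s x" using False x2 x3 ts by (simp add: bad_def)
          then show ?thesis using elim by blast
        qed
      qed
      then show "good ?T" unfolding good_def using shT ed v1 v2 by blast
    qed
  qed
  then show ?thesis by (simp add: t_def)
qed

text \<open>The two rotated lines are the lines through \<open>w\<close> and \<open>q\<close> and a common centre far behind; the chain
  between them is cast from that centre.\<close>

lemma thin_chain:
  assumes g: "good T1" "good T2" and l: "link T1 T2" and iv: "inner_vertex T1 T2 q"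
    and w: "w = pivot T1 T2" and tau: "w = q + \<tau> *\<^sub>R cis (t1 T2)" "\<tau> \<ge> 0"
    and dm: "\<And>x y. x \<in> bd \<Longrightarrow> y \<in> bd \<Longrightarrow> dist x y \<le> R" and rho: "\<rho> > 2 * R"
    and h: "0 \<le> h" "h \<le> 1"
    and A1: "A1 = t1 T2 + arctan (h / \<rho>)" and A2: "A2 = t1 T2 + arctan (h / (\<rho> - \<tau>))"
    and small: "A2 < t2 T2" "A2 \<le> t1 T2 + pi / 3"
  shows "\<exists>ts. chain w A1 ts q A2 \<and>
     (\<forall>T\<in>set ts. good T \<and> 2 / (\<rho> + 1 + R)\<^sup>2 \<le> rat T \<and> rat T \<le> 4 / (\<rho> - R)\<^sup>2)"
proof -
  define t u where "t = t1 T2" and "u = cis (t1 T2)"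
  have sh: "shape T2" using g good_shape by auto
  have wv: "w \<in> verts" using pivot_vertex[OF g l] w by simp
  have qv: "q \<in> verts" using iv by (simp add: inner_vertex_def)
  have wb: "w \<in> bd" and qb: "q \<in> bd" using wv qv verts_bd by auto
  have R0: "R \<ge> 0" using dm[OF wb wb] by simp
  have tauR: "\<tau> \<le> R" using dm[OF wb qb] tau by (simp add: dist_norm)
  have rho0: "\<rho> > 0" "\<rho> - \<tau> > 0" using rho R0 tauR by auto
  show ?thesis
  proof (cases "\<tau> = 0 \<or> h = 0")
    \<comment> \<open>The two lines coincide, and the empty chain joins them.\<close>
    case True
    then have "A1 = A2" "lf w A1 q = 0"
      using A1 A2 tau by (auto simp: lf_def crs_simps)
    then have "chain w A1 [] q A2" by simp
    then show ?thesis by (metis empty_iff list.set(1))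
  next
    case False
    then have th: "\<tau> > 0" "h > 0" using tau h by auto
    \<comment> \<open>Both turned lines pass through \<open>C\<close>: it lies \<open>\<rho>\<close>
      behind \<open>w\<close>, hence \<open>\<rho> - \<tau>\<close> behind \<open>q\<close>, and
      \<open>h\<close> to the right of the shared line.\<close>
    define C where "C = w - \<rho> *\<^sub>R cis t - h *\<^sub>R cis (t + pi / 2)"
    define s1 s2 where "s1 = sqrt (\<rho>\<^sup>2 + h\<^sup>2)" and "s2 = sqrt ((\<rho> - \<tau>)\<^sup>2 + h\<^sup>2)"
    have wC: "w = C + s1 *\<^sub>R cis A1"
      unfolding s1_def A1 polar_arctan[OF rho0(1), symmetric] C_def by (simp add: t_def)
    have qC: "q = C + s2 *\<^sub>R cis A2"
      unfolding s2_def A2 polar_arctan[OF rho0(2), symmetric] C_def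
      by (simp add: t_def tau algebra_simps)
    have s12: "s1 > 0" "s2 > 0" using rho0 by (auto simp: s1_def s2_def intro!: add_pos_nonneg)
    \<comment> \<open>The sideways shift \<open>h \<le> 1\<close> costs at most 1, which is the
      summand 1 in \<open>\<rho> + 1 + R\<close>.\<close>
    have s1r: "s1 \<ge> \<rho>" "s1 \<le> \<rho> + 1"
    proof -
      show "s1 \<ge> \<rho>" unfolding s1_def using rho0 by (intro real_le_rsqrt) auto
      have "h\<^sup>2 \<le> 1" using h by (simp add: power_le_one)
      then show "s1 \<le> \<rho> + 1" unfolding s1_def using rho0
        by (intro real_le_lsqrt) (auto simp: power2_eq_square algebra_simps)
    qed
    have "h / \<rho> < h / (\<rho> - \<tau>)" using th rho0 by (intro divide_strict_left_mono) auto
    then have A12: "A1 < A2" by (simp add: A1 A2 arctan_less_iff)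
    have tA1: "t < A1" using th rho0 by (simp add: A1 t_def)
    have dist1: "\<rho> - R \<le> norm (y - C)" "norm (y - C) \<le> \<rho> + 1 + R" if "y \<in> bd" for y
    proof -
      have n: "norm (w - C) = s1" using wC s12 by simp
      have "norm (y - w) \<le> R" using dm[OF that wb] by (simp add: dist_norm)
      moreover have "norm (w - C) \<le> norm (y - C) + norm (y - w)"
        using norm_triangle_ineq4[of "y - C" "y - w"] by simp
      moreover have "norm (y - C) \<le> norm (y - w) + norm (w - C)"
        using norm_triangle_ineq[of "y - w" "w - C"] by simp
      ultimately show "\<rho> - R \<le> norm (y - C)" "norm (y - C) \<le> \<rho> + 1 + R"
        using s1r n by linarith+
    qed
    have Cbd: "C \<notin> bd" using dist1(1)[of C] rho R0 by fastforce
    \<comment> \<open>All boundary points on these lines are in front of \<open>C\<close>: the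
      projection of \<open>w\<close> to the line is at least \<open>\<rho> / 2\<close>, which
      exceeds \<open>R\<close>. This is the purpose of \<open>\<rho> > 2 * R\<close>.\<close>
    have front: "r > 0" if y: "C + r *\<^sub>R cis v \<in> bd" and v: "A1 \<le> v" "v \<le> A2" for r v
    proof -
      have i: "inner (cis v) (cis x) = cos (v - x)" for x
        by (simp add: inner_complex_def cos_diff)
      have "\<bar>inner (cis v) (C + r *\<^sub>R cis v - w)\<bar> \<le> norm (cis v) * norm (C + r *\<^sub>R cis v - w)"
        by (rule Cauchy_Schwarz_ineq2)
      then have "\<bar>inner (cis v) (C + r *\<^sub>R cis v - w)\<bar> \<le> R"
        using dm[OF y wb] by (simp add: dist_norm)
      moreover have "C + r *\<^sub>R cis v - w = r *\<^sub>R cis v - s1 *\<^sub>R cis A1" using wC by simp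
      then have "inner (cis v) (C + r *\<^sub>R cis v - w) = r - s1 * cos (v - A1)"
        by (simp only: inner_diff_right inner_scaleR_right i diff_self cos_zero)
      moreover have "cos (v - A1) \<ge> cos (pi / 3)"
        using v small tA1 by (intro cos_monotone_0_pi_le) (auto simp: t_def)
      then have "cos (v - A1) \<ge> 1 / 2" by (simp add: cos_60)
      then have "s1 * cos (v - A1) \<ge> s1 * (1 / 2)" using s12 by (intro mult_left_mono) auto
      ultimately show ?thesis using s1r rho by linarith
    qed
    \<comment> \<open>\<open>w\<close> is weakly right and \<open>q\<close> weakly left of every
      line in between, and \<open>bd\<close> is connected.\<close>
    have hit: "hits C v" if v: "A1 \<le> v" "v \<le> A2" for v
    proof -
      have lw: "lf C v w \<le> 0"
      proof -
        have "lf C v w = - (s1 * sin (v - A1))"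
          using lf_move[of C v C s1 A1] wC sin_minus[of "v - A1"] by simp
        moreover have "sin (v - A1) \<ge> 0" using v small tA1 by (intro sin_ge_zero) (auto simp: t_def)
        ultimately show ?thesis using s12 by simp
      qed
      have lq: "lf C v q \<ge> 0"
      proof -
        have "lf C v q = s2 * sin (A2 - v)" using lf_move[of C v C s2 A2] qC by simp
        moreover have "sin (A2 - v) \<ge> 0" using v small tA1 by (intro sin_ge_zero) (auto simp: t_def)
        ultimately show ?thesis using s12 by simp
      qed
      have "connected (lf C v ` bd)" unfolding lf_def
        by (intro connected_continuous_image connected_bd continuous_intros)
      then have "0 \<in> lf C v ` bd"
        using lw lq wb qb connected_contains_Icc[of "lf C v ` bd" "lf C v w" "lf C v q"] by auto
      then obtain y where y: "y \<in> bd" "lf C v y = 0" by auto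
      then obtain r where "y = C + r *\<^sub>R cis v" using lf_zeroE by blast
      then show ?thesis using front[of r v] y(1) v by (auto simp: hits_def)
    qed
    have "A1 < t2 T2" using A12 small by simp
    obtain p where p: "p \<ge> 0" "w = pa T2 + p *\<^sub>R cis (t1 T2)" using pivot_cases[OF l] w by metis
    obtain k where k: "k \<ge> 0" "q = pa T2 + k *\<^sub>R cis (t1 T2)" using iv by (auto simp: inner_vertex_def)
    \<comment> \<open>Beyond \<open>w\<close> and beyond \<open>q\<close> the two extreme rays run
      inside the sector of \<open>T2\<close>, so these vertices are the farthest points in their
      directions.\<close>
    have "w + (s - s1) *\<^sub>R cis A1 \<notin> bd" if "s > s1" for s
      using wedge_in_sreg[OF sh p(2,1), of A1 "s - s1"] tA1 \<open>A1 < t2 T2\<close> that g(2)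
      by (auto simp: t_def good_def)
    then have "far C A1 s1" using s12 wb wC by (auto simp: far_def algebra_simps)
    then have fv1: "farvert C A1" using wv wC by (auto simp: farvert_def)
    have "q + (s - s2) *\<^sub>R cis A2 \<notin> bd" if "s > s2" for s
      using wedge_in_sreg[OF sh k(2,1), of A2 "s - s2"] tA1 A12 small that g(2)
      by (auto simp: t_def good_def)
    then have "far C A2 s2" using s12 qb qC by (auto simp: far_def algebra_simps)
    then have fv2: "farvert C A2" using qv qC by (auto simp: farvert_def)
    have "A2 \<le> A1 + 2 * pi" using small tA1 pi_gt_zero unfolding t_def by linarith
    then obtain ts where ts: "chain C A1 ts C A2" "\<forall>T\<in>set ts. good T \<and> centred C T"
      using radial_chain[OF Cbd A12 _ hit fv1 fv2] by blast
    have "lf C A1 w = 0" "lf C A2 q = 0" using wC qC lf_move[of C A1 C s1 A1] lf_move[of C A2 C s2 A2] by auto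
    then have ch: "chain w A1 ts q A2" using ts(1) chain_cong_start chain_cong_end by metis
    have "2 / (\<rho> + 1 + R)\<^sup>2 \<le> rat T \<and> rat T \<le> 4 / (\<rho> - R)\<^sup>2" if T: "T \<in> set ts" for T
    proof -
      have gT: "good T" "shape T" using ts T good_shape by auto
      obtain ra rb where r: "ra > 0" "pa T = C + ra *\<^sub>R cis (t1 T)" "rb > 0" "pb T = C + rb *\<^sub>R cis (t2 T)"
        using ts T by (auto simp: centred_def)
      have rr: "\<rho> - R \<le> ra" "ra \<le> \<rho> + 1 + R" "\<rho> - R \<le> rb" "rb \<le> \<rho> + 1 + R"
        using dist1[of "pa T"] dist1[of "pb T"] good_bd[OF gT(1)] r by auto
      define al where "al = t2 T - t1 T"
      have "t1 T \<le> t2 T" if "T \<in> set ts" for T using ts that by (force simp: good_def shape_def)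
      then have "A1 \<le> t1 T" "t2 T \<le> A2" using chain_angles(2)[OF ts(1)] T by auto
      then have al: "0 < al" "al \<le> pi / 3" using gT small tA1 by (auto simp: al_def shape_def t_def)
      have sp: "sin al > 0" using al by (intro sin_gt_zero) auto
      \<comment> \<open>For a triangle with apex \<open>C\<close> the ratio is
        \<open>al / sin al\<close>, which lies between 1 and 2, times \<open>2 / (rb * ra)\<close>,
        which is controlled by the distance of \<open>C\<close>.\<close>
      have "rat T = 2 * al * sin al / ((rb * sin al) * (ra * sin al))"
        using centred_cross[OF r(2,4)] by (simp add: rat_def al_def)
      also have "\<dots> = (al / sin al) * (2 / (rb * ra))" using sp by (simp add: field_simps)
      finally have e: "rat T = (al / sin al) * (2 / (rb * ra))" .
      have "sin al \<le> al" using al by (intro sin_x_le_x) auto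
      then have q1: "1 \<le> al / sin al" using sp by simp
      have q2: "al / sin al \<le> 2" using sin_ge_half[OF al] sp by (simp add: field_simps)
      have pos: "0 < rb * ra" "0 < (\<rho> + 1 + R)\<^sup>2" "0 < (\<rho> - R)\<^sup>2" using r rho R0 by auto
      have "rb * ra \<le> (\<rho> + 1 + R)\<^sup>2" unfolding power2_eq_square using rr r by (intro mult_mono) auto
      then have "2 / (\<rho> + 1 + R)\<^sup>2 \<le> 2 / (rb * ra)" using pos r by (intro divide_left_mono mult_pos_pos) auto
      moreover have "1 * (2 / (rb * ra)) \<le> rat T" unfolding e using q1 r by (intro mult_right_mono) auto
      moreover have "rat T \<le> 2 * (2 / (rb * ra))" unfolding e using q2 r by (intro mult_right_mono) auto
      moreover have "(\<rho> - R)\<^sup>2 \<le> rb * ra" unfolding power2_eq_square using rr r rho R0 by (intro mult_mono) auto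
      then have "4 / (rb * ra) \<le> 4 / (\<rho> - R)\<^sup>2" using pos r by (intro divide_left_mono mult_pos_pos) auto
      ultimately show ?thesis by auto
    qed
    then show ?thesis using ch ts by blast
  qed
qed

end

section \<open>Compactness\<close>

text \<open>Among the triangles with given base and apex angle the isosceles one has the largest
  area.\<close>

lemma crs_product_bound:
  "crs (cis s) d * crs (cis t) d \<le> (norm d)\<^sup>2 * (cos ((t - s) / 2))\<^sup>2"
proof -
  define w where "w = Arg d"
  obtain w where w: "d = cmod d *\<^sub>R cis w" using polar_from[of 0 d] by blast
  have "crs (cis s) d = cmod d * sin (w - s)" "crs (cis t) d = cmod d * sin (w - t)"
    using w by (metis crs_scale_right crs_cis)+
  then have "crs (cis s) d * crs (cis t) d = (cmod d)\<^sup>2 * (sin (w - s) * sin (w - t))"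
    by (simp add: power2_eq_square)
  moreover have "sin (w - s) * sin (w - t) \<le> (cos ((t - s) / 2))\<^sup>2"
  proof -
    have "sin (w - s) * sin (w - t) = (cos (t - s) - cos (2 * w - s - t)) / 2"
      using sin_times_sin[of "w - s" "w - t"] by (simp add: algebra_simps)
    also have "\<dots> \<le> (cos (t - s) + 1) / 2" using cos_ge_minus_one[of "2 * w - s - t"] by (intro divide_right_mono) linarith+
    also have "\<dots> = (cos ((t - s) / 2))\<^sup>2" using cos_double_cos[of "(t - s) / 2"]
      by (simp only: mult_2 field_sum_of_halves) simp
    finally show ?thesis .
  qed
  ultimately show ?thesis by (simp add: mult_left_mono)
qed

text \<open>Cleared of denominators, bounds on the ratio pass to limits in which the triangle
  degenerates.\<close>

lemma rat_le_iff:
  assumes "shape T"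
  shows "rat T \<le> M \<longleftrightarrow> 2 * (t2 T - t1 T) * sin (t2 T - t1 T) \<le> M * (crs (cis (t1 T)) (pb T - pa T) * crs (cis (t2 T)) (pb T - pa T))"
    "M \<le> rat T \<longleftrightarrow> M * (crs (cis (t1 T)) (pb T - pa T) * crs (cis (t2 T)) (pb T - pa T)) \<le> 2 * (t2 T - t1 T) * sin (t2 T - t1 T)"
  using assms by (auto simp: rat_def shape_def divide_le_eq le_divide_eq zero_less_mult_iff)

text \<open>A factor \<open>cos ((t2 T - t1 T) / 2)\<close> has been cancelled: when the angle tends
  to \<open>pi\<close> the right side vanishes and the left side does not. The same inequality
  bounds from below the ratio of a triangle with large angle.\<close>

lemma rat_angle_bound:
  assumes "shape T" "rat T \<le> M" "0 \<le> M"
  shows "4 * (t2 T - t1 T) * sin ((t2 T - t1 T) / 2) \<le> M * (norm (pb T - pa T))\<^sup>2 * cos ((t2 T - t1 T) / 2)"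
proof -
  define al where "al = t2 T - t1 T"
  have al: "0 < al" "al < pi" using assms by (auto simp: shape_def al_def)
  have c: "cos (al / 2) > 0" using al by (intro cos_gt_zero_pi) auto
  have "2 * al * sin al \<le> M * (crs (cis (t1 T)) (pb T - pa T) * crs (cis (t2 T)) (pb T - pa T))"
    using assms(2) rat_le_iff(1)[OF assms(1)] by (simp add: al_def)
  also have "\<dots> \<le> M * ((norm (pb T - pa T))\<^sup>2 * (cos (al / 2))\<^sup>2)"
    unfolding al_def using assms(3) by (intro mult_left_mono crs_product_bound)
  finally have "2 * al * sin al \<le> M * ((norm (pb T - pa T))\<^sup>2 * (cos (al / 2))\<^sup>2)" .
  moreover have "sin al = 2 * sin (al / 2) * cos (al / 2)" using sin_double[of "al / 2"] by simp
  ultimately have "cos (al / 2) * (4 * al * sin (al / 2)) \<le> cos (al / 2) * (M * (norm (pb T - pa T))\<^sup>2 * cos (al / 2))"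
    by (simp add: power2_eq_square algebra_simps)
  then show ?thesis using c by (simp add: al_def)
qed

section \<open>Deleting degenerate triangles from a chain\<close>

lemma chain_nth:
  assumes "ts \<noteq> []"
  shows "chain p t ts p' t' \<longleftrightarrow> t1 (ts ! 0) = t \<and> lf p t (pa (ts ! 0)) = 0 \<and>
    (\<forall>i. Suc i < length ts \<longrightarrow> t2 (ts ! i) = t1 (ts ! Suc i) \<and> lf (pb (ts ! i)) (t2 (ts ! i)) (pa (ts ! Suc i)) = 0) \<and>
    t2 (ts ! (length ts - 1)) = t' \<and> lf (pb (ts ! (length ts - 1))) t' p' = 0"
  using assms
proof (induction ts arbitrary: p t)
  case (Cons T ts)
  show ?case
  proof (cases "ts = []")
    case False
    have s: "(\<forall>i. Suc i < length (T # ts) \<longrightarrow> Q i) \<longleftrightarrow> Q 0 \<and> (\<forall>i. Suc i < length ts \<longrightarrow> Q (Suc i))" for Q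
      using False by (auto simp: less_Suc_eq_0_disj all_conj_distrib) (metis Suc_lessD Suc_less_eq not0_implies_Suc)+
    have l: "(T # ts) ! (length (T # ts) - 1) = ts ! (length ts - 1)" using False by (cases ts) auto
    show ?thesis unfolding s l using Cons.IH[OF False, of "pb T" "t2 T"] by auto
  qed auto
qed simp

definition degen :: "tri \<Rightarrow> bool" where
  "degen T \<longleftrightarrow> t1 T = t2 T \<and> lf (pa T) (t1 T) (pb T) = 0"

lemma chain_filter:
  assumes "chain p t ts p' t'"
    and "\<And>T. T \<in> set ts \<Longrightarrow> \<not> keep T \<Longrightarrow> degen T"
  shows "chain p t (filter keep ts) p' t'"
  using assms
proof (induction ts arbitrary: p t)
  case (Cons T ts)
  have IH: "chain (pb T) (t2 T) (filter keep ts) p' t'" using Cons by auto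
  show ?case
  proof (cases "keep T")
    case True
    then show ?thesis using Cons.prems IH by auto
  next
    case False
    then have "t1 T = t2 T" "lf (pa T) (t1 T) (pb T) = 0" "t1 T = t" "lf p t (pa T) = 0"
      using Cons.prems(1) Cons.prems(2)[of T] by (auto simp: degen_def)
    then have "lf p t (pb T) = 0" using lf_cong[of p t "pa T" "pb T"] by simp
    then show ?thesis using IH False \<open>t1 T = t2 T\<close> \<open>t1 T = t\<close> chain_cong_start by auto
  qed
qed auto

text \<open>The two lines of a degenerate triangle coincide, so its line is also that of the next
  triangle or of the end of the chain. Working from the end, the deleted lines inherit the side of
  the kept ones.\<close>

lemma chain_filter_sign:
  assumes "chain p t ts p' t'"
    and "\<And>T. T \<in> set ts \<Longrightarrow> \<not> keep T \<Longrightarrow> degen T"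
    and "\<And>T. T \<in> set (filter keep ts) \<Longrightarrow> \<sigma> * lf (pa T) (t1 T) x > 0" and "\<sigma> * lf p' t' x > 0"
  shows "\<sigma> * lf p t x > 0 \<and> (\<forall>T\<in>set ts. \<sigma> * lf (pa T) (t1 T) x > 0)"
  using assms
proof (induction ts arbitrary: p t)
  case Nil
  then show ?case using lf_cong[of p t p' x] by auto
next
  case (Cons T ts)
  have IH: "\<sigma> * lf (pb T) (t2 T) x > 0 \<and> (\<forall>T\<in>set ts. \<sigma> * lf (pa T) (t1 T) x > 0)"
  proof (rule Cons.IH)
    show "chain (pb T) (t2 T) ts p' t'" using Cons.prems(1) by simp
    show "\<And>S. S \<in> set ts \<Longrightarrow> \<not> keep S \<Longrightarrow> degen S"
      using Cons.prems(2) by auto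
    show "\<And>S. S \<in> set (filter keep ts) \<Longrightarrow> 0 < \<sigma> * lf (pa S) (t1 S) x"
      using Cons.prems(3) by auto
  qed fact
  have e: "lf p t x = lf (pa T) (t1 T) x" using Cons.prems(1) lf_cong[of p t "pa T" x] by auto
  have "\<sigma> * lf (pa T) (t1 T) x > 0"
  proof (cases "keep T")
    case True
    then show ?thesis using Cons.prems(3) by simp
  next
    case False
    then have d: "t1 T = t2 T" "lf (pa T) (t1 T) (pb T) = 0" using Cons.prems(2)[of T] by (auto simp: degen_def)
    have "lf (pb T) (t1 T) x = lf (pa T) (t1 T) x" using lf_cong[OF d(2)] .
    then show ?thesis using IH d(1) by simp
  qed
  then show ?case using IH e by auto
qed

lemma diagonal_convergence:
  fixes g :: "nat \<Rightarrow> nat \<Rightarrow> 'a::metric_space"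
  assumes "compact S" "\<And>i k. i < m \<Longrightarrow> g i k \<in> S"
  shows "\<exists>r l. strict_mono r \<and> (\<forall>i<m. l i \<in> S \<and> (\<lambda>k. g i (r k)) \<longlonglongrightarrow> l i)"
  using assms(2)
proof (induction m)
  case 0
  then show ?case by (auto intro: exI[of _ id] strict_mono_id)
next
  case (Suc m)
  obtain r l where r: "strict_mono r" "\<forall>i<m. l i \<in> S \<and> (\<lambda>k. g i (r k)) \<longlonglongrightarrow> l i"
    using Suc.IH Suc.prems less_SucI by metis
  have "\<forall>k. (g m \<circ> r) k \<in> S" using Suc.prems by simp
  then obtain y r' where r': "y \<in> S" "strict_mono r'" "((g m \<circ> r) \<circ> r') \<longlonglongrightarrow> y"
    using assms(1) unfolding compact_def by blast
  have "strict_mono (r \<circ> r')" using r r' strict_mono_o by blast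
  moreover have "(l(m := y)) i \<in> S \<and> (\<lambda>k. g i ((r \<circ> r') k)) \<longlonglongrightarrow> (l(m := y)) i" if "i < Suc m" for i
  proof (cases "i = m")
    case True
    then show ?thesis using r' by (simp add: o_def)
  next
    case False
    then have "i < m" using that by simp
    then have "(\<lambda>k. g i (r k)) \<longlonglongrightarrow> l i" "l i \<in> S" using r by auto
    then show ?thesis using LIMSEQ_subseq_LIMSEQ[OF _ r'(2)] False by (fastforce simp: o_def)
  qed
  ultimately show ?case by blast
qed

section \<open>Shifting all directions by full turns\<close>

definition tshift :: "int \<Rightarrow> tri \<Rightarrow> tri" where
  "tshift z T = Tri (pa T) (pb T) (t1 T + 2 * pi * of_int z) (t2 T + 2 * pi * of_int z)"

lemma tshift_sel [simp]: "pa (tshift z T) = pa T" "pb (tshift z T) = pb T"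
  "t1 (tshift z T) = t1 T + 2 * pi * of_int z" "t2 (tshift z T) = t2 T + 2 * pi * of_int z"
  by (simp_all add: tshift_def)

lemma cis_int_shift [simp]: "cis (t + 2 * pi * of_int z) = cis t"
  by (simp add: complex_eq_iff cos_add sin_add)

lemma lf_int_shift [simp]: "lf p (t + 2 * pi * of_int z) x = lf p t x"
  by (simp add: lf_def)

lemma sreg_tshift [simp]: "sreg (tshift z T) = sreg T"
  by (simp add: sreg_def)

lemma shape_tshift [simp]: "shape (tshift z T) = shape T"
  by (auto simp: shape_def)

lemma rat_tshift [simp]: "rat (tshift z T) = rat T"
  by (simp add: rat_def)

lemma chain_tshift: "chain p t ts p' t' \<Longrightarrow>
  chain p (t + 2 * pi * of_int z) (map (tshift z) ts) p' (t' + 2 * pi * of_int z)"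
  by (induction ts arbitrary: p t) auto

definition neutral :: "tri list \<Rightarrow> bool" where
  "neutral ts \<longleftrightarrow> (\<forall>x. (\<exists>T\<in>set ts. lf (pa T) (t1 T) x \<le> 0) \<and> (\<exists>T\<in>set ts. lf (pa T) (t1 T) x \<ge> 0))"

context polygon
begin

definition sys :: "tri list \<Rightarrow> bool" where
  "sys ts \<longleftrightarrow> closed_chain ts \<and> (\<forall>T\<in>set ts. good T)"

lemma good_tshift [simp]: "good (tshift z T) = good T"
  by (simp add: good_def)

lemma sys_normalise:
  assumes "sys ts"
  obtains z where "sys (map (tshift z) ts)" "0 \<le> t1 (hd (map (tshift z) ts))" "t1 (hd (map (tshift z) ts)) \<le> 2 * pi"
proof -
  define t where "t = t1 (hd ts)"
  define z where "z = - \<lfloor>t / (2 * pi)\<rfloor>"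
  have ne: "ts \<noteq> []" and c: "chain (pa (hd ts)) t ts (pa (hd ts)) (t + 2 * pi)"
    using assms by (auto simp: sys_def closed_chain_def t_def)
  have "chain (pa (hd ts)) (t + 2 * pi * of_int z) (map (tshift z) ts) (pa (hd ts)) (t + 2 * pi * of_int z + 2 * pi)"
    using chain_tshift[OF c, of z] by (simp add: algebra_simps)
  then have "closed_chain (map (tshift z) ts)" by (rule closed_chainI)
  then have s: "sys (map (tshift z) ts)" using assms by (auto simp: sys_def)
  have h: "t1 (hd (map (tshift z) ts)) = t + 2 * pi * of_int z" using ne by (simp add: hd_map t_def)
  have "of_int \<lfloor>t / (2 * pi)\<rfloor> \<le> t / (2 * pi)" "t / (2 * pi) < of_int \<lfloor>t / (2 * pi)\<rfloor> + 1" by linarith+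
  then have "of_int \<lfloor>t / (2 * pi)\<rfloor> * (2 * pi) \<le> t" "t < (of_int \<lfloor>t / (2 * pi)\<rfloor> + 1) * (2 * pi)"
    by (simp_all only: pos_le_divide_eq pos_divide_less_eq pi_gt_zero mult_pos_pos zero_less_numeral)
  then show ?thesis using that[OF s] h by (simp add: z_def algebra_simps)
qed

lemma closed_edge_pairs: "closed {(a, b). \<exists>i<n. a \<in> edge i \<and> b \<in> edge i}"
proof -
  have "{(a, b). \<exists>i<n. a \<in> edge i \<and> b \<in> edge i} = (\<Union>i<n. edge i \<times> edge i)" by auto
  then show ?thesis by (simp add: closed_UN closed_Times compact_imp_closed compact_edge)
qed

text \<open>The distance to the vertex determines \<open>r\<close>, which turns the condition into
  one closed equation for each of finitely many vertices.\<close>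

lemma closed_vertex_rays: "closed {(a, t). \<exists>r\<ge>0. a + r *\<^sub>R cis t \<in> verts}"
proof -
  have "{(a, t). \<exists>r\<ge>0. a + r *\<^sub>R cis t \<in> verts} = (\<Union>v\<in>verts. {z. v - fst z = norm (v - fst z) *\<^sub>R cis (snd z)})"
  proof (intro equalityI subsetI)
    fix z assume "z \<in> {(a, t). \<exists>r\<ge>0. a + r *\<^sub>R cis t \<in> verts}"
    then obtain r where r: "r \<ge> 0" "fst z + r *\<^sub>R cis (snd z) \<in> verts" by auto
    then show "z \<in> (\<Union>v\<in>verts. {z. v - fst z = norm (v - fst z) *\<^sub>R cis (snd z)})"
      by (intro UN_I[OF r(2)]) simp
  next
    fix z assume "z \<in> (\<Union>v\<in>verts. {z. v - fst z = norm (v - fst z) *\<^sub>R cis (snd z)})"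
    then obtain v where v: "v \<in> verts" "v - fst z = norm (v - fst z) *\<^sub>R cis (snd z)" by auto
    then have "fst z + norm (v - fst z) *\<^sub>R cis (snd z) = v" by (simp add: algebra_simps)
    then show "z \<in> {(a, t). \<exists>r\<ge>0. a + r *\<^sub>R cis t \<in> verts}" using v(1)
      by (cases z) (auto intro!: exI[of _ "norm (v - fst z)"])
  qed
  moreover have "closed {z. v - fst z = norm (v - fst z) *\<^sub>R cis (snd z)}" for v
    unfolding cis_conv_exp by (intro closed_Collect_eq continuous_intros)
  ultimately show ?thesis using finite_verts by (simp add: closed_UN)
qed

text \<open>Bounded lengths and normalised directions confine the triangles to a compact set. In the
  limit a triangle of positive angle is again good, and one of angle 0 lies along its line and is
  deleted. The upper bound varies with \<open>k\<close> so that a minimising sequence can be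
  inserted.\<close>

lemma sys_limit:
  assumes X: "\<And>k. sys (X k)" "\<And>k. neutral (X k)" "\<And>k. length (X k) \<le> N"
    and lo: "lo > 0" "\<And>k T. T \<in> set (X k) \<Longrightarrow> lo \<le> rat T"
    and hi: "\<And>k T. T \<in> set (X k) \<Longrightarrow> rat T \<le> M k" "M \<longlonglongrightarrow> M0"
  shows "\<exists>ts. sys ts \<and> neutral ts \<and> (\<forall>T\<in>set ts. lo \<le> rat T \<and> rat T \<le> M0)"
proof -
  define Pz where "Pz k z \<longleftrightarrow> sys (map (tshift z) (X k)) \<and> 0 \<le> t1 (hd (map (tshift z) (X k))) \<and>
    t1 (hd (map (tshift z) (X k))) \<le> 2 * pi" for k z
  have "\<exists>z. Pz k z" for k
    using sys_normalise[OF X(1)[of k]] unfolding Pz_def by metis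
  then obtain z where "\<And>k. Pz k (z k)" by metis
  then have z: "\<And>k. sys (map (tshift (z k)) (X k))" "\<And>k. 0 \<le> t1 (hd (map (tshift (z k)) (X k)))"
      "\<And>k. t1 (hd (map (tshift (z k)) (X k))) \<le> 2 * pi" unfolding Pz_def by auto
  \<comment> \<open>Infinitely many of the systems have the same length, so convergence can be
    arranged position by position.\<close>
  have "finite (range (\<lambda>k. length (X k)))" by (rule finite_subset[of _ "{..N}"]) (use X(3) in auto)
  then obtain k0 where "infinite {k. length (X k) = length (X k0)}"
    using pigeonhole_infinite[of UNIV "\<lambda>k. length (X k)"] by auto
  then obtain e :: "nat \<Rightarrow> nat" where e: "strict_mono e" "\<And>k. length (X (e k)) = length (X k0)"
    using infinite_enumerate[of "{k. length (X k) = length (X k0)}"] by auto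
  define m where "m = length (X k0)"
  define Y where "Y k = map (tshift (z (e k))) (X (e k))" for k
  have Ylen: "length (Y k) = m" for k by (simp add: Y_def e m_def)
  have Ysys: "sys (Y k)" for k using z by (simp add: Y_def)
  have m0: "m > 0" using Ysys[of 0] Ylen[of 0] by (auto simp: sys_def closed_chain_def)
  have Yin: "Y k ! i = tshift (z (e k)) (X (e k) ! i)" "X (e k) ! i \<in> set (X (e k))" if "i < m" for k i
    using that e by (auto simp: Y_def m_def)
  have Yg: "good (Y k ! i)" if "i < m" for k i using Ysys[of k] that Ylen[of k] by (auto simp: sys_def)
  have Yrat: "lo \<le> rat (Y k ! i)" "rat (Y k ! i) \<le> M (e k)" if "i < m" for k i
    using Yin[OF that] lo hi by auto
  have Yb: "0 \<le> t1 (Y k ! i)" "t2 (Y k ! i) \<le> 4 * pi" if "i < m" for k i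
  proof -
    have c: "chain (pa (hd (Y k))) (t1 (hd (Y k))) (Y k) (pa (hd (Y k))) (t1 (hd (Y k)) + 2 * pi)"
      using Ysys[of k] by (simp add: sys_def closed_chain_def)
    have "\<forall>T\<in>set (Y k). t1 T \<le> t2 T" using Ysys[of k] by (auto simp: sys_def good_def shape_def)
    from chain_angles(2)[OF c this, of "Y k ! i"] z[of "e k"]
    show "0 \<le> t1 (Y k ! i)" "t2 (Y k ! i) \<le> 4 * pi" using that Ylen[of k] by (auto simp: Y_def)
  qed
  define g where "g i k = (pa (Y k ! i), pb (Y k ! i), t1 (Y k ! i), t2 (Y k ! i))" for i k
  have "compact (bd \<times> bd \<times> {0..4 * pi} \<times> {0..4 * pi})"
    by (intro compact_Times compact_bd compact_Icc)
  moreover have "g i k \<in> bd \<times> bd \<times> {0..4 * pi} \<times> {0..4 * pi}" if "i < m" for i k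
    using good_bd[OF Yg[OF that]] Yb[OF that, of k] Yg[OF that, of k] by (auto simp: g_def good_def shape_def)
  ultimately obtain r l where r: "strict_mono r"
      "\<And>i. i < m \<Longrightarrow> l i \<in> bd \<times> bd \<times> {0..4 * pi} \<times> {0..4 * pi} \<and> (\<lambda>k. g i (r k)) \<longlonglongrightarrow> l i"
    using diagonal_convergence[of "bd \<times> bd \<times> {0..4 * pi} \<times> {0..4 * pi}" m g] by metis
  define L where "L i = Tri (fst (l i)) (fst (snd (l i))) (fst (snd (snd (l i)))) (snd (snd (snd (l i))))" for i
  define W where "W k = Y (r k)" for k
  have lim: "(\<lambda>k. pa (W k ! i)) \<longlonglongrightarrow> pa (L i)" "(\<lambda>k. pb (W k ! i)) \<longlonglongrightarrow> pb (L i)"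
     "(\<lambda>k. t1 (W k ! i)) \<longlonglongrightarrow> t1 (L i)" "(\<lambda>k. t2 (W k ! i)) \<longlonglongrightarrow> t2 (L i)" if "i < m" for i
  proof -
    have "(\<lambda>k. g i (r k)) \<longlonglongrightarrow> l i" using r that by blast
    then have *: "(\<lambda>k. fst (g i (r k))) \<longlonglongrightarrow> fst (l i)" "(\<lambda>k. snd (g i (r k))) \<longlonglongrightarrow> snd (l i)"
      by (auto intro: tendsto_fst tendsto_snd)
    from *(2) have **: "(\<lambda>k. fst (snd (g i (r k)))) \<longlonglongrightarrow> fst (snd (l i))" "(\<lambda>k. snd (snd (g i (r k)))) \<longlonglongrightarrow> snd (snd (l i))"
      by (auto intro: tendsto_fst tendsto_snd)
    from **(2) have ***: "(\<lambda>k. fst (snd (snd (g i (r k))))) \<longlonglongrightarrow> fst (snd (snd (l i)))" "(\<lambda>k. snd (snd (snd (g i (r k))))) \<longlonglongrightarrow> snd (snd (snd (l i)))"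
      by (auto intro: tendsto_fst tendsto_snd)
    show "(\<lambda>k. pa (W k ! i)) \<longlonglongrightarrow> pa (L i)" "(\<lambda>k. pb (W k ! i)) \<longlonglongrightarrow> pb (L i)"
     "(\<lambda>k. t1 (W k ! i)) \<longlonglongrightarrow> t1 (L i)" "(\<lambda>k. t2 (W k ! i)) \<longlonglongrightarrow> t2 (L i)"
      using *(1) **(1) *** by (auto simp: g_def L_def W_def)
  qed
  have Wsys: "sys (W k)" and Wlen: "length (W k) = m" and Wne: "W k \<noteq> []" for k
    using Ysys Ylen m0 by (auto simp: W_def) (metis Ylen length_0_conv less_irrefl)
  have Wg: "good (W k ! i)" "lo \<le> rat (W k ! i)" "rat (W k ! i) \<le> M (e (r k))" if "i < m" for k i
    using Yg[OF that] Yrat[OF that] by (auto simp: W_def)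
  have Wsh: "shape (W k ! i)" if "i < m" for k i using Wg[OF that] good_shape by blast
  have Mlim: "(\<lambda>k. M (e (r k))) \<longlonglongrightarrow> M0"
    using LIMSEQ_subseq_LIMSEQ[OF hi(2)] strict_mono_o[OF e(1) r(1)] by (fastforce simp: o_def)
  define ls where "ls = map L [0..<m]"
  have lsl: "length ls = m" and lsn: "\<And>i. i < m \<Longrightarrow> ls ! i = L i" and lsne: "ls \<noteq> []"
    using m0 by (auto simp: ls_def)
  have ch: "chain (pa (L 0)) (t1 (L 0)) ls (pa (L 0)) (t1 (L 0) + 2 * pi)"
  proof -
    have c: "chain (pa (W k ! 0)) (t1 (W k ! 0)) (W k) (pa (W k ! 0)) (t1 (W k ! 0) + 2 * pi)" for k
      using Wsys[of k] Wne[of k] by (simp add: sys_def closed_chain_def hd_conv_nth)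
    note cn = c[unfolded chain_nth[OF Wne] Wlen]
    have "t2 (L i) = t1 (L (Suc i)) \<and> lf (pb (L i)) (t2 (L i)) (pa (L (Suc i))) = 0" if i: "Suc i < m" for i
    proof -
      have "i < m" using i by simp
      note li = lim[OF \<open>i < m\<close>] lim[OF i]
      have "(\<lambda>k. t2 (W k ! i)) \<longlonglongrightarrow> t1 (L (Suc i))" using li(7) cn i by simp
      then have 1: "t2 (L i) = t1 (L (Suc i))" using li(4) LIMSEQ_unique by blast
      have "(\<lambda>k. lf (pb (W k ! i)) (t2 (W k ! i)) (pa (W k ! Suc i))) \<longlonglongrightarrow> lf (pb (L i)) (t2 (L i)) (pa (L (Suc i)))"
        unfolding lf_def using li by (intro tendsto_intros)
      moreover have "lf (pb (W k ! i)) (t2 (W k ! i)) (pa (W k ! Suc i)) = 0" for k using cn[of k] i by blast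
      ultimately have "lf (pb (L i)) (t2 (L i)) (pa (L (Suc i))) = 0" by (simp only: LIMSEQ_const_iff)
      then show ?thesis using 1 by simp
    qed
    moreover have "t2 (L (m - 1)) = t1 (L 0) + 2 * pi \<and> lf (pb (L (m - 1))) (t1 (L 0) + 2 * pi) (pa (L 0)) = 0"
    proof -
      have i: "m - 1 < m" using m0 by simp
      note li = lim[OF i] lim[OF m0]
      have "(\<lambda>k. t2 (W k ! (m - 1))) \<longlonglongrightarrow> t1 (L 0) + 2 * pi"
        using tendsto_add[OF li(7) tendsto_const[of "2 * pi"]] cn by simp
      then have 1: "t2 (L (m - 1)) = t1 (L 0) + 2 * pi" using li(4) LIMSEQ_unique by blast
      have "(\<lambda>k. lf (pb (W k ! (m - 1))) (t1 (W k ! 0) + 2 * pi) (pa (W k ! 0))) \<longlonglongrightarrow> lf (pb (L (m - 1))) (t1 (L 0) + 2 * pi) (pa (L 0))"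
        unfolding lf_def using li by (intro tendsto_intros)
      moreover have "lf (pb (W k ! (m - 1))) (t1 (W k ! 0) + 2 * pi) (pa (W k ! 0)) = 0" for k using cn[of k] by blast
      ultimately have "lf (pb (L (m - 1))) (t1 (L 0) + 2 * pi) (pa (L 0)) = 0"
        by (simp only: LIMSEQ_const_iff)
      then show ?thesis using 1 by simp
    qed
    moreover have "i < m" if "Suc i < m" for i using that by simp
    ultimately show ?thesis unfolding chain_nth[OF lsne] lsl using lsn m0 by (metis diff_less zero_less_one lf_self)
  qed
  define A B where "A T = crs (cis (t1 T)) (pb T - pa T)" and "B T = crs (cis (t2 T)) (pb T - pa T)" for T
  define al where "al T = t2 T - t1 T" for T
  have ABlim: "(\<lambda>k. A (W k ! i)) \<longlonglongrightarrow> A (L i)" "(\<lambda>k. B (W k ! i)) \<longlonglongrightarrow> B (L i)" "(\<lambda>k. al (W k ! i)) \<longlonglongrightarrow> al (L i)" if "i < m" for i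
    unfolding A_def B_def al_def using lim[OF that] by (auto intro!: tendsto_intros)
  have Wp: "A (W k ! i) > 0" "B (W k ! i) > 0" "al (W k ! i) > 0" "al (W k ! i) < pi" if "i < m" for i k
    using Wsh[OF that, of k] by (auto simp: shape_def A_def B_def al_def)
  have L0: "A (L i) \<ge> 0" "B (L i) \<ge> 0" "al (L i) \<ge> 0" "al (L i) \<le> pi" if "i < m" for i
  proof -
    show "A (L i) \<ge> 0" using Wp(1)[OF that] by (intro LIMSEQ_le_const[OF ABlim(1)[OF that]]) (auto intro: less_imp_le)
    show "B (L i) \<ge> 0" using Wp(2)[OF that] by (intro LIMSEQ_le_const[OF ABlim(2)[OF that]]) (auto intro: less_imp_le)
    show "al (L i) \<ge> 0" using Wp(3)[OF that] by (intro LIMSEQ_le_const[OF ABlim(3)[OF that]]) (auto intro: less_imp_le)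
    show "al (L i) \<le> pi" using Wp(4)[OF that] by (intro LIMSEQ_le_const2[OF ABlim(3)[OF that]]) (auto intro: less_imp_le)
  qed
  have r1: "lo * (A (L i) * B (L i)) \<le> 2 * al (L i) * sin (al (L i))" if "i < m" for i
  proof (rule LIMSEQ_le)
    show "(\<lambda>k. lo * (A (W k ! i) * B (W k ! i))) \<longlonglongrightarrow> lo * (A (L i) * B (L i))"
      "(\<lambda>k. 2 * al (W k ! i) * sin (al (W k ! i))) \<longlonglongrightarrow> 2 * al (L i) * sin (al (L i))"
      using ABlim[OF that] by (auto intro!: tendsto_intros)
    show "\<exists>N. \<forall>k\<ge>N. lo * (A (W k ! i) * B (W k ! i)) \<le> 2 * al (W k ! i) * sin (al (W k ! i))"
      using rat_le_iff(2)[OF Wsh[OF that]] Wg(2)[OF that] by (auto simp: A_def B_def al_def)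
  qed
  have r2: "2 * al (L i) * sin (al (L i)) \<le> M0 * (A (L i) * B (L i))" if "i < m" for i
  proof (rule LIMSEQ_le)
    show "(\<lambda>k. M (e (r k)) * (A (W k ! i) * B (W k ! i))) \<longlonglongrightarrow> M0 * (A (L i) * B (L i))"
      "(\<lambda>k. 2 * al (W k ! i) * sin (al (W k ! i))) \<longlonglongrightarrow> 2 * al (L i) * sin (al (L i))"
      using ABlim[OF that] Mlim by (auto intro!: tendsto_intros)
    show "\<exists>N. \<forall>k\<ge>N. 2 * al (W k ! i) * sin (al (W k ! i)) \<le> M (e (r k)) * (A (W k ! i) * B (W k ! i))"
      using rat_le_iff(1)[OF Wsh[OF that]] Wg(3)[OF that] by (auto simp: A_def B_def al_def)
  qed
  have Mpos: "M (e (r k)) \<ge> 0" for k using Wg(2,3)[OF m0, of k] lo(1) by linarith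
  \<comment> \<open>At angle \<open>pi\<close> the limit of \<open>rat_angle_bound\<close> would
    read \<open>4 * pi \<le> 0\<close>.\<close>
  have npi: "al (L i) \<noteq> pi" if "i < m" for i
  proof
    assume pi: "al (L i) = pi"
    have "4 * al (L i) * sin (al (L i) / 2) \<le> M0 * (norm (pb (L i) - pa (L i)))\<^sup>2 * cos (al (L i) / 2)"
    proof (rule LIMSEQ_le)
      show "(\<lambda>k. 4 * al (W k ! i) * sin (al (W k ! i) / 2)) \<longlonglongrightarrow> 4 * al (L i) * sin (al (L i) / 2)"
        "(\<lambda>k. M (e (r k)) * (norm (pb (W k ! i) - pa (W k ! i)))\<^sup>2 * cos (al (W k ! i) / 2)) \<longlonglongrightarrow>
         M0 * (norm (pb (L i) - pa (L i)))\<^sup>2 * cos (al (L i) / 2)"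
        using ABlim[OF that] lim[OF that] Mlim by (intro tendsto_intros; simp)+
      show "\<exists>N. \<forall>k\<ge>N. 4 * al (W k ! i) * sin (al (W k ! i) / 2) \<le> M (e (r k)) * (norm (pb (W k ! i) - pa (W k ! i)))\<^sup>2 * cos (al (W k ! i) / 2)"
        using rat_angle_bound[OF Wsh[OF that] Wg(3)[OF that] Mpos] by (auto simp: al_def)
    qed
    then show False using pi pi_gt_zero by simp
  qed
  define keep where "keep T \<longleftrightarrow> t1 T \<noteq> t2 T" for T
  \<comment> \<open>At angle 0 the two cross products agree, and the lower bound on the ratio makes
    their product vanish, so the base lies on the line.\<close>
  have deg: "degen T" if T: "T \<in> set ls" "\<not> keep T" for T
  proof -
    obtain i where i: "i < m" "T = L i" using T by (auto simp: ls_def)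
    have t: "t1 T = t2 T" using T by (simp add: keep_def)
    then have "A (L i) = B (L i)" "al (L i) = 0" using i by (auto simp: A_def B_def al_def)
    then have "lo * (A (L i) * A (L i)) \<le> 0" using r1[OF i(1)] by simp
    then have "A (L i) = 0" using lo(1) by (auto simp: mult_le_0_iff)
    then show ?thesis using t i by (simp add: A_def lf_def degen_def)
  qed
  \<comment> \<open>Here the upper bound acts: a positive angle forces both cross products to stay
    positive in the limit.\<close>
  have kept: "good (L i) \<and> lo \<le> rat (L i) \<and> rat (L i) \<le> M0" if i: "i < m" and k: "keep (L i)" for i
  proof -
    have a: "0 < al (L i)" "al (L i) < pi" using L0[OF i] npi[OF i] k by (auto simp: keep_def al_def)
    then have sp: "sin (al (L i)) > 0" by (intro sin_gt_zero) auto
    have "2 * al (L i) * sin (al (L i)) > 0" using a sp by simp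
    then have "M0 * (A (L i) * B (L i)) > 0" using r2[OF i] by linarith
    then have "A (L i) \<noteq> 0" "B (L i) \<noteq> 0" by auto
    then have AB: "A (L i) > 0" "B (L i) > 0" using L0[OF i] by auto
    have sh: "shape (L i)" using a AB by (auto simp: shape_def A_def B_def al_def)
    have rt: "lo \<le> rat (L i) \<and> rat (L i) \<le> M0"
      using r1[OF i] r2[OF i] rat_le_iff[OF sh] by (auto simp: A_def B_def al_def)
    have "(\<lambda>k. (pa (W k ! i), pb (W k ! i))) \<longlonglongrightarrow> (pa (L i), pb (L i))"
      using lim[OF i] by (intro tendsto_intros)
    moreover have "(pa (W k ! i), pb (W k ! i)) \<in> {(a, b). \<exists>i<n. a \<in> edge i \<and> b \<in> edge i}" for k
      using Wg(1)[OF i, of k] by (auto simp: good_def)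
    ultimately have "(pa (L i), pb (L i)) \<in> {(a, b). \<exists>i<n. a \<in> edge i \<and> b \<in> edge i}"
      using closed_sequentially[OF closed_edge_pairs, where f = "\<lambda>k. (pa (W k ! i), pb (W k ! i))"] by blast
    then have ed: "\<exists>j<n. pa (L i) \<in> edge j \<and> pb (L i) \<in> edge j" by auto
    have "(\<lambda>k. (pa (W k ! i), t1 (W k ! i))) \<longlonglongrightarrow> (pa (L i), t1 (L i))"
      using lim[OF i] by (intro tendsto_intros)
    moreover have "(pa (W k ! i), t1 (W k ! i)) \<in> {(a, t). \<exists>r\<ge>0. a + r *\<^sub>R cis t \<in> verts}" for k
      using Wg(1)[OF i, of k] by (auto simp: good_def)
    ultimately have "(pa (L i), t1 (L i)) \<in> {(a, t). \<exists>r\<ge>0. a + r *\<^sub>R cis t \<in> verts}"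
      using closed_sequentially[OF closed_vertex_rays, where f = "\<lambda>k. (pa (W k ! i), t1 (W k ! i))"] by blast
    then have v1: "\<exists>r\<ge>0. pa (L i) + r *\<^sub>R cis (t1 (L i)) \<in> verts" by auto
    have "(\<lambda>k. (pb (W k ! i), t2 (W k ! i))) \<longlonglongrightarrow> (pb (L i), t2 (L i))"
      using lim[OF i] by (intro tendsto_intros)
    moreover have "(pb (W k ! i), t2 (W k ! i)) \<in> {(a, t). \<exists>r\<ge>0. a + r *\<^sub>R cis t \<in> verts}" for k
      using Wg(1)[OF i, of k] by (auto simp: good_def)
    ultimately have "(pb (L i), t2 (L i)) \<in> {(a, t). \<exists>r\<ge>0. a + r *\<^sub>R cis t \<in> verts}"
      using closed_sequentially[OF closed_vertex_rays, where f = "\<lambda>k. (pb (W k ! i), t2 (W k ! i))"] by blast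
    then have v2: "\<exists>r\<ge>0. pb (L i) + r *\<^sub>R cis (t2 (L i)) \<in> verts" by auto
    \<comment> \<open>Membership in the sector is an open condition, so \<open>x\<close> already
      lies in the corresponding sector of some system of the sequence.\<close>
    have "x \<notin> bd" if x: "x \<in> sreg (L i)" for x
    proof -
      have l: "(\<lambda>k. lf (pa (W k ! i)) (t1 (W k ! i)) x) \<longlonglongrightarrow> lf (pa (L i)) (t1 (L i)) x"
        "(\<lambda>k. lf (pb (W k ! i)) (t2 (W k ! i)) x) \<longlonglongrightarrow> lf (pb (L i)) (t2 (L i)) x"
        "(\<lambda>k. crs (pb (W k ! i) - pa (W k ! i)) (x - pa (W k ! i))) \<longlonglongrightarrow> crs (pb (L i) - pa (L i)) (x - pa (L i))"
        unfolding lf_def using lim[OF i] by (auto intro!: tendsto_intros)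
      have "\<forall>\<^sub>F k in sequentially. lf (pa (W k ! i)) (t1 (W k ! i)) x > 0"
        "\<forall>\<^sub>F k in sequentially. lf (pb (W k ! i)) (t2 (W k ! i)) x < 0"
        "\<forall>\<^sub>F k in sequentially. crs (pb (W k ! i) - pa (W k ! i)) (x - pa (W k ! i)) < 0"
        using x order_tendstoD(1)[OF l(1)] order_tendstoD(2)[OF l(2)] order_tendstoD(2)[OF l(3)]
        by (auto simp: sreg_def)
      then have "\<forall>\<^sub>F k in sequentially. x \<in> sreg (W k ! i)"
        by eventually_elim (simp add: sreg_def)
      then obtain k where "x \<in> sreg (W k ! i)" using eventually_happens'[OF sequentially_bot] by blast
      then show ?thesis using Wg(1)[OF i, of k] by (auto simp: good_def)
    qed
    then show ?thesis using sh ed v1 v2 rt by (auto simp: good_def)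
  qed
  define fs where "fs = filter keep ls"
  have cf: "chain (pa (L 0)) (t1 (L 0)) fs (pa (L 0)) (t1 (L 0) + 2 * pi)"
    unfolding fs_def using chain_filter[OF ch] deg by blast
  have fsk: "good T \<and> lo \<le> rat T \<and> rat T \<le> M0" if "T \<in> set fs" for T
    using that kept by (auto simp: fs_def ls_def)
  have "sys fs" using closed_chainI[OF cf] fsk by (auto simp: sys_def)
  moreover have "neutral fs"
  proof -
    have fne: "fs \<noteq> []" using \<open>sys fs\<close> by (auto simp: sys_def closed_chain_def)
    \<comment> \<open>A point strictly on one side of all kept lines is so for the deleted ones too,
      and then, by continuity, for all lines of some system of the sequence, which is neutral. The
      side is encoded by the sign \<sigma>.\<close>
    have False if s: "\<sigma> = 1 \<or> \<sigma> = - 1" and all: "\<And>T. T \<in> set fs \<Longrightarrow> \<sigma> * lf (pa T) (t1 T) x > 0" for \<sigma> x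
    proof -
      have "lf (pa (L 0)) (t1 (L 0)) x = lf (pa (hd fs)) (t1 (hd fs)) x"
        using cf fne lf_cong[of "pa (L 0)" "t1 (L 0)" "pa (hd fs)" x] by (cases fs) auto
      then have "\<sigma> * lf (pa (L 0)) (t1 (L 0) + 2 * pi) x > 0" using all[of "hd fs"] fne by simp
      then have "\<forall>T\<in>set ls. \<sigma> * lf (pa T) (t1 T) x > 0"
        using chain_filter_sign[OF ch, of keep \<sigma> x] deg all by (auto simp: fs_def)
      then have pos: "\<sigma> * lf (pa (L i)) (t1 (L i)) x > 0" if "i < m" for i using that by (auto simp: ls_def)
      have "\<forall>\<^sub>F k in sequentially. \<sigma> * lf (pa (W k ! i)) (t1 (W k ! i)) x > 0" if i: "i < m" for i
      proof -
        have "(\<lambda>k. \<sigma> * lf (pa (W k ! i)) (t1 (W k ! i)) x) \<longlonglongrightarrow> \<sigma> * lf (pa (L i)) (t1 (L i)) x"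
          unfolding lf_def using lim[OF i] by (intro tendsto_intros)
        then show ?thesis using pos[OF i] order_tendstoD(1) by blast
      qed
      then have "\<forall>\<^sub>F k in sequentially. \<forall>i\<in>{..<m}. \<sigma> * lf (pa (W k ! i)) (t1 (W k ! i)) x > 0"
        by (intro eventually_ball_finite) auto
      then obtain k where k: "\<And>i. i < m \<Longrightarrow> \<sigma> * lf (pa (W k ! i)) (t1 (W k ! i)) x > 0"
        using eventually_happens'[OF sequentially_bot] by blast
      have pos: "\<sigma> * lf (pa T) (t1 T) x > 0" if T: "T \<in> set (X (e (r k)))" for T
      proof -
        obtain i where i: "i < m" "T = X (e (r k)) ! i" using T e(2) by (metis in_set_conv_nth m_def)
        then show ?thesis using k[OF i(1)] Yin[OF i(1), of "r k"] by (simp add: W_def)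
      qed
      obtain T T' where "T \<in> set (X (e (r k)))" "lf (pa T) (t1 T) x \<le> 0"
          "T' \<in> set (X (e (r k)))" "lf (pa T') (t1 T') x \<ge> 0"
        using X(2)[of "e (r k)"] unfolding neutral_def by blast
      then show False using pos[of T] pos[of T'] s by auto
    qed
    from this[of 1] this[of "- 1"] show ?thesis unfolding neutral_def
      by (metis (no_types, lifting) mult_1 mult_minus1 neg_0_less_iff_less not_less)
  qed
  ultimately show ?thesis using fsk by blast
qed

end

section \<open>Monotonicity of the ratio\<close>

text \<open>\<open>sin al / (a * b)\<close> is the reciprocal of twice the area. Turning one line
  inwards, then the other (the angle \<open>be\<close> belongs to the stage in between), and then
  stretching the base never decreases the area, while the angle shrinks.\<close>

lemma rat_mono:
  assumes "shape T" "shape T'" and d: "pb T' - pa T' = k *\<^sub>R (pb T - pa T)" and k: "1 \<le> k"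
    and s: "t1 T \<le> t1 T'" and e: "t2 T' \<le> t2 T"
  shows "rat T' \<le> rat T" "t1 T < t1 T' \<or> t2 T' < t2 T \<Longrightarrow> rat T' < rat T"
proof -
  define D where "D = pb T - pa T"
  define a b a' b' where "a = crs (cis (t1 T)) D" and "b = crs (cis (t2 T)) D"
    and "a' = crs (cis (t1 T')) D" and "b' = crs (cis (t2 T')) D"
  have pos: "a > 0" "b > 0" using assms(1) by (auto simp: shape_def a_def b_def D_def)
  have "k * a' > 0" "k * b' > 0" using assms(2) d by (auto simp: shape_def a'_def b'_def D_def crs_simps)
  then have pos': "a' > 0" "b' > 0" using k by (auto simp: zero_less_mult_iff)
  define al be ga where "al = t2 T - t1 T" and "be = t2 T - t1 T'" and "ga = t2 T' - t1 T'"
  have ang: "0 < ga" "ga \<le> be" "be \<le> al" "al < pi"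
    using assms(1,2) s e by (auto simp: shape_def al_def be_def ga_def)
  have sin0: "sin ga > 0" "sin be > 0" "sin al > 0" using ang by (auto intro!: sin_gt_zero)
  have i1: "sin al * a' - sin be * a = sin (t1 T' - t1 T) * b"
  proof -
    have "crs (cis (t1 T)) (cis (t2 T)) * a' - crs (cis (t1 T')) (cis (t2 T)) * a
        = crs (cis (t1 T)) (cis (t1 T')) * b"
      unfolding a_def a'_def b_def by (simp add: crs_def algebra_simps)
    then show ?thesis by (simp add: crs_cis al_def be_def)
  qed
  have i2: "sin be * b' - sin ga * b = sin (t2 T - t2 T') * a'"
  proof -
    have "crs (cis (t1 T')) (cis (t2 T)) * b' - crs (cis (t1 T')) (cis (t2 T')) * b
        = crs (cis (t2 T')) (cis (t2 T)) * a'"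
      unfolding a'_def b'_def b_def by (simp add: crs_def algebra_simps)
    then show ?thesis by (simp add: crs_cis be_def ga_def)
  qed
  have sg: "sin (t1 T' - t1 T) \<ge> 0" "sin (t2 T - t2 T') \<ge> 0"
    using ang s e by (auto intro!: sin_ge_zero simp: al_def be_def ga_def)
  have j1: "sin be * a \<le> sin al * a'" using i1 sg(1) pos by (smt (verit) mult_nonneg_nonneg)
  have j2: "sin ga * b \<le> sin be * b'" using i2 sg(2) pos' by (smt (verit) mult_nonneg_nonneg)
  have eq: "rat T' = 2 * ga * sin ga / ((k * a') * (k * b'))"
    using d by (simp add: rat_def ga_def a'_def b'_def D_def crs_simps)
  have eq0: "rat T = 2 * al * sin al / (a * b)" by (simp add: rat_def al_def a_def b_def D_def)
  have f1: "sin be / (a' * b) \<le> sin al / (a * b)" using j1 pos pos' by (simp add: field_simps)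
  have f2: "sin ga / (a' * b') \<le> sin be / (a' * b)" using j2 pos pos' by (simp add: field_simps)
  have "1 * 1 \<le> k * k" using k by (intro mult_mono) auto
  then have kk: "k * k \<ge> 1" by simp
  have "(k * a') * (k * b') = (k * k) * (a' * b')" by (simp add: algebra_simps)
  then have "a' * b' \<le> (k * a') * (k * b')" using kk pos' mult_right_mono[of 1 "k * k" "a' * b'"] by simp
  then have f3: "sin ga / ((k * a') * (k * b')) \<le> sin ga / (a' * b')"
    using sin0 pos' k by (intro divide_left_mono) auto
  have l1: "sin ga / ((k * a') * (k * b')) \<le> sin al / (a * b)" using f1 f2 f3 by linarith
  have p: "sin al / (a * b) > 0" "sin ga / ((k * a') * (k * b')) > 0" using sin0 pos pos' k by auto
  have "2 * ga * (sin ga / ((k * a') * (k * b'))) \<le> 2 * al * (sin al / (a * b))"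
    using l1 ang p by (intro mult_mono) auto
  then show "rat T' \<le> rat T" unfolding eq eq0 by simp
  assume "t1 T < t1 T' \<or> t2 T' < t2 T"
  then have "ga < al" using s e by (auto simp: al_def ga_def)
  then have "2 * ga * (sin ga / ((k * a') * (k * b'))) < 2 * al * (sin al / (a * b))"
    using l1 ang p(2) by (intro mult_less_le_imp_less[of "2 * ga"]) (simp; fail)+
  then show "rat T' < rat T" unfolding eq eq0 by simp
qed

text \<open>The endpoints are recorded by parameters along the old base, which makes changes at the
  two ends independent. This matters because a run may consist of one triangle, both of whose lines
  move.\<close>

definition modify :: "tri \<Rightarrow> real \<Rightarrow> real \<Rightarrow> real \<Rightarrow> real \<Rightarrow> tri" where
  "modify T m s m' e = Tri (pa T + m *\<^sub>R (pb T - pa T)) (pa T + m' *\<^sub>R (pb T - pa T)) s e"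

lemma modify_sel [simp]: "pa (modify T m s m' e) = pa T + m *\<^sub>R (pb T - pa T)"
  "pb (modify T m s m' e) = pa T + m' *\<^sub>R (pb T - pa T)"
  "t1 (modify T m s m' e) = s" "t2 (modify T m s m' e) = e"
  by (simp_all add: modify_def)

lemma modify_base: "pb (modify T m s m' e) - pa (modify T m s m' e) = (m' - m) *\<^sub>R (pb T - pa T)"
  by (simp add: algebra_simps)

lemma modify_id [simp]: "modify T 0 (t1 T) 1 (t2 T) = T"
  by (cases T) (simp add: modify_def)

text \<open>The parameter of \<open>mp T w s\<close> along the base.\<close>

definition cutp :: "tri \<Rightarrow> complex \<Rightarrow> real \<Rightarrow> real" where
  "cutp T w s = crs (cis s) (w - pa T) / crs (cis s) (pb T - pa T)"

lemma rend_modify: "rend T w s = modify T 0 (t1 T) (cutp T w s) s"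
  by (simp add: rend_def mp_def modify_def cutp_def)

lemma rstart_modify: "rstart T w s = modify T (cutp T w s) s 1 (t2 T)"
  by (simp add: rstart_def mp_def modify_def cutp_def)

lemma rat_modify: "rat (modify T m s m' e) = 2 * (e - s) * sin (e - s) /
    (((m' - m) * crs (cis s) (pb T - pa T)) * ((m' - m) * crs (cis e) (pb T - pa T)))"
  unfolding rat_def modify_base crs_scale_right by simp

lemma rat_modify_tendsto:
  assumes sh: "shape T" and m: "isCont m 0" "m 0 = 0" and s: "isCont s 0" "s 0 = t1 T"
    and m': "isCont m' 0" "m' 0 = 1" and e: "isCont e 0" "e 0 = t2 T"
  shows "((\<lambda>z. rat (modify T (m (fst z)) (s (fst z)) (m' (snd z)) (e (snd z)))) \<longlongrightarrow> rat T) (nhds (0::real) \<times>\<^sub>F nhds (0::real))"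
proof -
  have l: "((\<lambda>z. f (fst z)) \<longlongrightarrow> f 0) (nhds (0::real) \<times>\<^sub>F nhds (0::real))"
    "((\<lambda>z. f (snd z)) \<longlongrightarrow> f 0) (nhds (0::real) \<times>\<^sub>F nhds (0::real))" if "isCont f 0" for f :: "real \<Rightarrow> real"
  proof -
    have f: "filterlim f (nhds (f 0)) (nhds 0)" using that
      by (simp add: isCont_def tendsto_at_iff_tendsto_nhds)
    show "((\<lambda>z. f (fst z)) \<longlongrightarrow> f 0) (nhds (0::real) \<times>\<^sub>F nhds (0::real))"
      using filterlim_compose[OF f filterlim_fst] .
    show "((\<lambda>z. f (snd z)) \<longlongrightarrow> f 0) (nhds (0::real) \<times>\<^sub>F nhds (0::real))"
      using filterlim_compose[OF f filterlim_snd] .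
  qed
  note lm = l(1)[OF m(1)] l(1)[OF s(1)] l(2)[OF m'(1)] l(2)[OF e(1)]
  have nz: "((m' 0 - m 0) * crs (cis (s 0)) (pb T - pa T)) * ((m' 0 - m 0) * crs (cis (e 0)) (pb T - pa T)) \<noteq> 0"
    using sh by (simp add: m s m' e shape_def)
  have "((\<lambda>z. rat (modify T (m (fst z)) (s (fst z)) (m' (snd z)) (e (snd z)))) \<longlongrightarrow>
      rat (modify T (m 0) (s 0) (m' 0) (e 0))) (nhds 0 \<times>\<^sub>F nhds 0)"
    unfolding rat_modify by (intro tendsto_divide tendsto_mult tendsto_crs tendsto_sin tendsto_diff tendsto_cis tendsto_const lm nz)
  then show ?thesis by (simp add: m s m' e)
qed

lemma isCont_cut:
  assumes "crs (cis (s h)) (pb T - pa T) \<noteq> 0" "isCont s h"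
  shows "isCont (\<lambda>h. cutp T w (s h)) h"
  unfolding cutp_def
  by (intro isCont_divide isCont_o2[OF assms(2) isCont_crs_cis] assms(1))

context polygon
begin

lemma edge_unique:
  assumes "i < n" "j < n" "x \<noteq> y" "x \<in> edge i" "y \<in> edge i" "x \<in> edge j" "y \<in> edge j"
  shows "i = j"
proof (rule ccontr)
  assume ij: "i \<noteq> j"
  have "closed_segment x y \<subseteq> edge i \<inter> edge j"
    using assms closed_segment_subset[of x _ y] by (auto simp: edge_def)
  also have "\<dots> \<subseteq> verts" using meet[OF assms(1,2) ij] by blast
  finally have "finite (closed_segment x y)" using finite_verts finite_subset by blast
  then show False using assms(3) by simp
qed

text \<open>Two one-sided modifications combine: a point of the new sector is in front of the base
  line, hence on the inner side of one of the two old lines, hence in one of the two sectors that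
  are already known to miss \<open>bd\<close>.\<close>

lemma good_modify:
  assumes g: "good T" "good (modify T m s 1 (t2 T))" "good (modify T 0 (t1 T) m' e)"
    and m: "m < m'" and se: "s < e" "e < s + pi"
  shows "good (modify T m s m' e)"
proof -
  let ?d = "pb T - pa T" and ?U = "modify T m s m' e"
  have sh: "shape T" "shape (modify T m s 1 (t2 T))" "shape (modify T 0 (t1 T) m' e)"
    using g good_shape by auto
  have "(1 - m) * crs (cis s) ?d > 0" "(1 - m) * crs (cis (t2 T)) ?d > 0"
    using sh(2) unfolding shape_def modify_base crs_scale_right by auto
  moreover have "crs (cis (t2 T)) ?d > 0" "crs (cis (t1 T)) ?d > 0" using sh(1) by (auto simp: shape_def)
  ultimately have 1: "m < 1" "crs (cis s) ?d > 0" by (auto simp: zero_less_mult_iff)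
  have "(m' - 0) * crs (cis e) ?d > 0" "(m' - 0) * crs (cis (t1 T)) ?d > 0"
    using sh(3) unfolding shape_def modify_base crs_scale_right by auto
  then have 2: "m' > 0" "crs (cis e) ?d > 0"
    using \<open>crs (cis (t1 T)) ?d > 0\<close> by (auto simp: zero_less_mult_iff)
  have shU: "shape ?U" unfolding shape_def modify_base crs_scale_right using m se 1 2 by auto
  obtain i where i: "i < n" "pa T \<in> edge i" "pb T \<in> edge i" using g(1) by (auto simp: good_def)
  have nab: "pa T \<noteq> pb T" using sh(1) by (auto simp: shape_def)
  have in_i: "pa T + h *\<^sub>R ?d \<in> edge i" if "0 \<le> h" "h \<le> 1" for h
  proof -
    have "pa T + h *\<^sub>R ?d = (1 - h) *\<^sub>R pa T + h *\<^sub>R pb T" by (simp add: algebra_simps)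
    then show ?thesis using convexD_alt[of "edge i" "pa T" "pb T" h] i that by (simp add: edge_def)
  qed
  have ea: "pa ?U \<in> edge i"
  proof (cases "m \<ge> 0")
    case True
    then show ?thesis using in_i[of m] 1 by simp
  next
    case False
    obtain j where j: "j < n" "pa T + m *\<^sub>R ?d \<in> edge j" "pb T \<in> edge j" using g(2) by (auto simp: good_def)
    \<comment> \<open>The base has grown backwards, so \<open>pa T\<close> lies between the new
      start and \<open>pb T\<close>. The edge \<open>j\<close> therefore contains both old endpoints
      and equals \<open>i\<close>.\<close>
    define h where "h = - m / (1 - m)"
    have h: "0 \<le> h" "h \<le> 1" "(1 - h) * m + h = 0" using False 1 by (auto simp: h_def field_simps)
    have "(1 - h) *\<^sub>R (pa T + m *\<^sub>R ?d) + h *\<^sub>R pb T = pa T + ((1 - h) * m + h) *\<^sub>R ?d"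
      by (simp add: algebra_simps)
    then have "pa T \<in> edge j" using convexD_alt[of "edge j" "pa T + m *\<^sub>R ?d" "pb T" h] j h by (simp add: edge_def)
    then have "j = i" using edge_unique[OF j(1) i(1) nab] j i by blast
    then show ?thesis using j by simp
  qed
  have eb: "pb ?U \<in> edge i"
  proof (cases "m' \<le> 1")
    case True
    then show ?thesis using in_i[of m'] 2 by simp
  next
    case False
    obtain j where j: "j < n" "pa T \<in> edge j" "pa T + m' *\<^sub>R ?d \<in> edge j" using g(3) by (auto simp: good_def)
    define h where "h = 1 / m'"
    have h: "0 \<le> h" "h \<le> 1" "h * m' = 1" using False by (auto simp: h_def field_simps)
    have "(1 - h) *\<^sub>R pa T + h *\<^sub>R (pa T + m' *\<^sub>R ?d) = pa T + (h * m') *\<^sub>R ?d"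
      by (simp add: algebra_simps)
    then have "pb T \<in> edge j" using convexD_alt[of "edge j" "pa T" "pa T + m' *\<^sub>R ?d" h] j h by (simp add: edge_def)
    then have "j = i" using edge_unique[OF j(1) i(1) nab] j i by blast
    then show ?thesis using j by simp
  qed
  have "x \<notin> bd" if x: "x \<in> sreg ?U" for x
  proof -
    have base: "crs ?d (x - (pa T + h *\<^sub>R ?d)) = crs ?d (x - pa T)" for h
      by (simp add: crs_simps)
    have x1: "lf (pa T + m *\<^sub>R ?d) s x > 0" "lf (pa T + m' *\<^sub>R ?d) e x < 0"
      using x by (auto simp: sreg_def)
    have "(m' - m) * crs ?d (x - pa T) < 0"
      using x unfolding sreg_def modify_base crs_scale_left by (simp add: base)
    then have x2: "crs ?d (x - pa T) < 0" using m by (simp add: mult_less_0_iff)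
    from shape_beyond_base[OF sh(1) x2] show ?thesis
    proof
      assume "lf (pa T) (t1 T) x > 0"
      then have "x \<in> sreg (modify T 0 (t1 T) m' e)"
        using x1 x2 2 unfolding sreg_def modify_base crs_scale_left by (simp add: mult_pos_neg)
      then show ?thesis using g(3) by (auto simp: good_def)
    next
      assume "lf (pb T) (t2 T) x < 0"
      then have "x \<in> sreg (modify T m s 1 (t2 T))"
        using x1 x2 1 base[of m] unfolding sreg_def modify_base crs_scale_left by (simp add: mult_pos_neg)
      then show ?thesis using g(2) by (auto simp: good_def)
    qed
  qed
  moreover have "\<exists>r\<ge>0. pa ?U + r *\<^sub>R cis (t1 ?U) \<in> verts" "\<exists>r\<ge>0. pb ?U + r *\<^sub>R cis (t2 ?U) \<in> verts"
    using g(2,3) by (auto simp: good_def)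
  ultimately show ?thesis unfolding good_def using shU i(1) ea eb by blast
qed

section \<open>Reflection in the real axis\<close>

lemma mirror_polygon: "polygon n (cnj \<circ> P) (cnj \<circ> Q) (cnj ` D)"
proof -
  have seg: "closed_segment ((cnj \<circ> P) i) ((cnj \<circ> Q) i) = cnj ` edge i" for i
    using closed_segment_linear_image[OF bounded_linear.linear[OF bounded_linear_cnj], of "P i" "Q i"]
    by (simp add: edge_def)
  have vs: "(cnj \<circ> P) ` {..<n} \<union> (cnj \<circ> Q) ` {..<n} = cnj ` verts"
    by (auto simp: verts_def image_image image_Un)
  have bds: "(\<Union>i<n. cnj ` edge i) = cnj ` bd"
    unfolding bd_def by auto
  have inj: "inj cnj" by (auto intro!: injI)
  have sur: "surj cnj" by (metis complex_cnj_cnj surjI)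
  show ?thesis
  proof (unfold polygon_def seg vs bds, intro conjI allI impI)
    fix i assume "i < n" then show "(cnj \<circ> P) i \<noteq> (cnj \<circ> Q) i" using PQ by simp
  next
    fix i j x assume "i < n" "j < n" "i \<noteq> j" "x \<in> cnj ` edge i" "x \<in> cnj ` edge j"
    then have "cnj x \<in> edge i" "cnj x \<in> edge j" by auto
    then have "cnj x \<in> verts" using meet \<open>i < n\<close> \<open>j < n\<close> \<open>i \<noteq> j\<close> by blast
    then show "x \<in> cnj ` verts" by (metis complex_cnj_cnj imageI)
  next
    fix i x assume "i < n" "x \<in> cnj ` verts" "x \<in> cnj ` edge i"
    then have "cnj x \<in> verts" "cnj x \<in> edge i" by auto
    then have "cnj x = P i \<or> cnj x = Q i" using vert \<open>i < n\<close> by blast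
    then show "x = (cnj \<circ> P) i \<or> x = (cnj \<circ> Q) i" by (metis complex_cnj_cnj comp_apply)
  next
    have l: "linear cnj" by (rule bounded_linear.linear[OF bounded_linear_cnj])
    show "open (cnj ` D)" using open_surjective_linear_image[OF open_D l sur] .
    show "connected (cnj ` D)" "connected (cnj ` bd)"
      by (auto intro!: connected_continuous_image continuous_intros connected_D connected_bd)
    show "bounded (cnj ` D)" using bounded_linear_image[OF bounded_D bounded_linear_cnj] .
    show "cnj ` D \<noteq> {}" using D_ne by simp
    have "closure (cnj ` D) = cnj ` closure D" using closure_injective_linear_image[OF l inj] by simp
    moreover have "interior (cnj ` D) = cnj ` interior D" using interior_injective_linear_image[OF l inj] by simp
    ultimately show "frontier (cnj ` D) = cnj ` bd"
      using frontier_D by (simp add: frontier_def image_set_diff[OF inj, symmetric])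
  qed
qed

end

text \<open>Reflection reverses the orientation, so the endpoints are exchanged and the directions
  change both sign and order.\<close>

definition mirror :: "tri \<Rightarrow> tri" where
  "mirror T = Tri (cnj (pb T)) (cnj (pa T)) (- t2 T) (- t1 T)"

lemma mirror_sel [simp]: "pa (mirror T) = cnj (pb T)" "pb (mirror T) = cnj (pa T)"
  "t1 (mirror T) = - t2 T" "t2 (mirror T) = - t1 T"
  by (simp_all add: mirror_def)

lemma mirror_mirror [simp]: "mirror (mirror T) = T"
  by (simp add: mirror_def)

lemma crs_cis_minus: "crs (cis (- t)) z = - crs (cis t) (cnj z)"
  by (simp add: crs_def)

lemma lf_mirror: "lf (cnj p) (- t) x = - lf p t (cnj x)"
  by (simp add: lf_def crs_cis_minus)

lemma shape_mirror [simp]: "shape (mirror T) \<longleftrightarrow> shape T"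
  by (auto simp: shape_def crs_cis_minus crs_simps)

lemma rat_mirror [simp]: "rat (mirror T) = rat T"
proof -
  have "crs (cis (- t2 T)) (cnj (pa T) - cnj (pb T)) = crs (cis (t2 T)) (pb T - pa T)"
    "crs (cis (- t1 T)) (cnj (pa T) - cnj (pb T)) = crs (cis (t1 T)) (pb T - pa T)"
    by (simp_all add: crs_cis_minus crs_simps)
  then show ?thesis by (simp add: rat_def mult.commute)
qed

lemma sreg_mirror: "x \<in> sreg (mirror T) \<longleftrightarrow> cnj x \<in> sreg T"
proof -
  have "crs (cnj (pa T) - cnj (pb T)) (x - cnj (pb T)) = crs (pb T - pa T) (cnj x - pa T)"
    by (simp add: crs_def algebra_simps)
  then show ?thesis by (auto simp: sreg_def lf_mirror)
qed

lemma chain_mirror: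
  "chain p t ts p' t' \<Longrightarrow> chain (cnj p') (- t') (rev (map mirror ts)) (cnj p) (- t)"
proof (induction ts arbitrary: p t)
  case Nil
  then have "t = t'" "lf p t p' = 0" by auto
  then show ?case using lf_sym by (auto simp: lf_mirror)
next
  case (Cons T ts)
  then have "chain (cnj p') (- t') (rev (map mirror ts)) (cnj (pb T)) (- t2 T)" by simp
  moreover have "chain (cnj (pb T)) (- t2 T) [mirror T] (cnj p) (- t)"
    using Cons.prems lf_sym by (auto simp: lf_mirror)
  ultimately show ?case by (simp only: list.map rev.simps chain_append) blast
qed

lemma mirror_modify:
  "mirror (modify T m s m' e) = modify (mirror T) (1 - m') (- e) (1 - m) (- s)"
  by (simp add: mirror_def modify_def algebra_simps)

lemma cut_mirror:
  assumes "crs (cis s) (pb T - pa T) \<noteq> 0"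
  shows "cutp (mirror T) (cnj w) (- s) = 1 - cutp T w s"
proof -
  have "crs (cis (- s)) (cnj w - cnj (pb T)) = - (crs (cis s) (w - pa T) - crs (cis s) (pb T - pa T))"
    "crs (cis (- s)) (cnj (pa T) - cnj (pb T)) = crs (cis s) (pb T - pa T)"
    by (simp_all add: crs_cis_minus crs_simps)
  then show ?thesis using assms by (simp add: cutp_def field_simps)
qed

lemma arctan_small_eventually:
  assumes "(0::real) < e" shows "\<forall>\<^sub>F h in nhds 0. arctan (h / c) < e"
proof -
  have "isCont (\<lambda>h. e - arctan (h / c)) 0"
  proof (cases "c = 0")
    case False
    then show ?thesis by (intro continuous_intros isCont_arctan isCont_o2[of 0 "\<lambda>h. h / c" arctan]) auto
  qed auto
  from eventually_pos_near[OF this] assms show ?thesis by simp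
qed

lemma eventually_nhds_uminus:
  fixes t :: real
  shows "(\<forall>\<^sub>F s in nhds (- t). Q s) \<longleftrightarrow> (\<forall>\<^sub>F s in nhds t. Q (- s))"
  using filtermap_nhds_minus[of t] by (metis eventually_filtermap)

context polygon
begin

text \<open>What one opening provides: \<open>T1\<close> turns about the pivot \<open>w\<close> and
  \<open>T2\<close> about the inner vertex \<open>q\<close>, by different angles, matched so that
  both new lines come from one far centre. \<open>T2\<close> loses angle and \<open>T1\<close> gains
  it.\<close>

lemma opening_ccw:
  assumes g: "good T1" "good T2" and l: "link T1 T2"
    and dm: "\<And>x y. x \<in> bd \<Longrightarrow> y \<in> bd \<Longrightarrow> dist x y \<le> R" and rho: "\<rho> > 2 * R"
  obtains w q \<tau> where "0 \<le> \<tau>" "\<tau> < \<rho>" "w = q + \<tau> *\<^sub>R cis (t1 T2)"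
    "\<exists>k\<ge>0. w = pb T1 + k *\<^sub>R cis (t1 T2)" "\<exists>k\<ge>0. q = pa T2 + k *\<^sub>R cis (t1 T2)"
    "\<forall>\<^sub>F s in nhds (t1 T2). t1 T2 \<le> s \<longrightarrow> good (modify T1 0 (t1 T1) (cutp T1 w s) s)"
    "\<forall>\<^sub>F s in nhds (t1 T2). t1 T2 \<le> s \<longrightarrow> good (modify T2 (cutp T2 q s) s 1 (t2 T2))"
    "\<forall>h. 0 \<le> h \<longrightarrow> h \<le> 1 \<longrightarrow> t1 T2 + arctan (h / (\<rho> - \<tau>)) < t2 T2 \<longrightarrow> arctan (h / (\<rho> - \<tau>)) \<le> pi / 3 \<longrightarrow>
       (\<exists>ts. chain w (t1 T2 + arctan (h / \<rho>)) ts q (t1 T2 + arctan (h / (\<rho> - \<tau>))) \<and>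
         (\<forall>T\<in>set ts. good T \<and> 2 / (\<rho> + 1 + R)\<^sup>2 \<le> rat T \<and> rat T \<le> 4 / (\<rho> - R)\<^sup>2))"
proof -
  obtain q where q: "inner_vertex T1 T2 q" using inner_vertex_exists[OF g l] by blast
  define w where "w = pivot T1 T2"
  obtain k \<tau> where k: "0 \<le> k" "q = pa T2 + k *\<^sub>R cis (t1 T2)" and tau: "0 \<le> \<tau>" "w = q + \<tau> *\<^sub>R cis (t1 T2)"
    using q by (auto simp: inner_vertex_def w_def)
  obtain s where s: "s \<ge> 0" "w = pb T1 + s *\<^sub>R cis (t1 T2)" using pivot_cases[OF l] w_def by metis
  have "w \<in> bd" "q \<in> bd" using pivot_vertex[OF g l] q verts_bd by (auto simp: w_def inner_vertex_def)
  from dm[OF this] have "\<tau> \<le> R" using tau by (simp add: dist_norm)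
  moreover have "R \<ge> 0" using dm[OF \<open>w \<in> bd\<close> \<open>w \<in> bd\<close>] by simp
  ultimately have tr: "\<tau> < \<rho>" using rho by linarith
  show ?thesis
  proof (rule that[OF tau(1) tr tau(2)])
    show "\<exists>k\<ge>0. w = pb T1 + k *\<^sub>R cis (t1 T2)" "\<exists>k\<ge>0. q = pa T2 + k *\<^sub>R cis (t1 T2)"
      using s k by auto
    show "\<forall>\<^sub>F s in nhds (t1 T2). t1 T2 \<le> s \<longrightarrow> good (modify T1 0 (t1 T1) (cutp T1 w s) s)"
      using rend_good[OF g l w_def] by (simp add: rend_modify)
    show "\<forall>\<^sub>F s in nhds (t1 T2). t1 T2 \<le> s \<longrightarrow> good (modify T2 (cutp T2 q s) s 1 (t2 T2))"
      using rstart_good[OF g l q] by (simp add: rstart_modify)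
  next
    show "\<forall>h. 0 \<le> h \<longrightarrow> h \<le> 1 \<longrightarrow> t1 T2 + arctan (h / (\<rho> - \<tau>)) < t2 T2 \<longrightarrow> arctan (h / (\<rho> - \<tau>)) \<le> pi / 3 \<longrightarrow>
       (\<exists>ts. chain w (t1 T2 + arctan (h / \<rho>)) ts q (t1 T2 + arctan (h / (\<rho> - \<tau>))) \<and>
         (\<forall>T\<in>set ts. good T \<and> 2 / (\<rho> + 1 + R)\<^sup>2 \<le> rat T \<and> rat T \<le> 4 / (\<rho> - R)\<^sup>2))"
    proof (intro allI impI)
    fix h :: real
    assume h: "0 \<le> h" "h \<le> 1" "t1 T2 + arctan (h / (\<rho> - \<tau>)) < t2 T2" "arctan (h / (\<rho> - \<tau>)) \<le> pi / 3"
    show "\<exists>ts. chain w (t1 T2 + arctan (h / \<rho>)) ts q (t1 T2 + arctan (h / (\<rho> - \<tau>))) \<and>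
         (\<forall>T\<in>set ts. good T \<and> 2 / (\<rho> + 1 + R)\<^sup>2 \<le> rat T \<and> rat T \<le> 4 / (\<rho> - R)\<^sup>2)"
      by (rule thin_chain[OF g l q w_def tau(2,1) dm rho h(1,2) refl refl]) (use h in auto)
    qed
  qed
qed

text \<open>The mirror image of \<open>opening_ccw\<close>, in which the two triangles exchange
  their roles: now \<open>T1\<close> loses angle.\<close>

lemma opening_cw:
  assumes g: "good T1" "good T2" and l: "link T1 T2"
    and dm: "\<And>x y. x \<in> bd \<Longrightarrow> y \<in> bd \<Longrightarrow> dist x y \<le> R" and rho: "\<rho> > 2 * R"
  obtains w q \<tau> where "0 \<le> \<tau>" "\<tau> < \<rho>" "w = q + \<tau> *\<^sub>R cis (t1 T2)"
    "\<exists>k\<ge>0. w = pa T2 + k *\<^sub>R cis (t1 T2)" "\<exists>k\<ge>0. q = pb T1 + k *\<^sub>R cis (t1 T2)"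
    "\<forall>\<^sub>F s in nhds (t1 T2). s \<le> t1 T2 \<longrightarrow> good (modify T2 (cutp T2 w s) s 1 (t2 T2))"
    "\<forall>\<^sub>F s in nhds (t1 T2). s \<le> t1 T2 \<longrightarrow> good (modify T1 0 (t1 T1) (cutp T1 q s) s)"
    "\<forall>h. 0 \<le> h \<longrightarrow> h \<le> 1 \<longrightarrow> t1 T1 < t1 T2 - arctan (h / (\<rho> - \<tau>)) \<longrightarrow> arctan (h / (\<rho> - \<tau>)) \<le> pi / 3 \<longrightarrow>
       (\<exists>ts. chain q (t1 T2 - arctan (h / (\<rho> - \<tau>))) ts w (t1 T2 - arctan (h / \<rho>)) \<and>
         (\<forall>T\<in>set ts. good T \<and> 2 / (\<rho> + 1 + R)\<^sup>2 \<le> rat T \<and> rat T \<le> 4 / (\<rho> - R)\<^sup>2))"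
proof -
  define edge' where "edge' = (\<lambda>i. closed_segment ((cnj \<circ> P) i) ((cnj \<circ> Q) i))"
  define verts' where "verts' = (cnj \<circ> P) ` {..<n} \<union> (cnj \<circ> Q) ` {..<n}"
  define bd' where "bd' = (\<Union>i<n. edge' i)"
  interpret m: polygon n "cnj \<circ> P" "cnj \<circ> Q" "cnj ` D" edge' verts' bd'
    using mirror_polygon by (simp_all add: edge'_def verts'_def bd'_def)
  have e': "edge' i = cnj ` edge i" for i
    using closed_segment_linear_image[OF bounded_linear.linear[OF bounded_linear_cnj], of "P i" "Q i"]
    by (simp add: edge'_def edge_def)
  have v': "verts' = cnj ` verts" by (auto simp: verts'_def verts_def image_image image_Un)
  have b': "bd' = cnj ` bd" by (auto simp: bd'_def bd_def e')
  have mem: "cnj x \<in> cnj ` S \<longleftrightarrow> x \<in> S" for x S by (auto simp: image_iff)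
  have mgood: "m.good (mirror T) \<longleftrightarrow> good T" for T
  proof -
    have 1: "(\<exists>i<n. pa (mirror T) \<in> edge' i \<and> pb (mirror T) \<in> edge' i) \<longleftrightarrow> (\<exists>i<n. pa T \<in> edge i \<and> pb T \<in> edge i)"
      by (auto simp: e' mem)
    have 2: "sreg (mirror T) \<inter> bd' = {} \<longleftrightarrow> sreg T \<inter> bd = {}"
    proof -
      have "sreg (mirror T) = cnj ` sreg T"
      proof (intro equalityI subsetI)
        fix x assume "x \<in> sreg (mirror T)"
        then have "cnj x \<in> sreg T" by (simp add: sreg_mirror)
        then show "x \<in> cnj ` sreg T" by (metis complex_cnj_cnj imageI)
      qed (auto simp: sreg_mirror)
      moreover have "inj cnj" by (auto intro!: injI)
      ultimately show ?thesis by (simp add: b' image_Int[symmetric])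
    qed
    have r: "(cnj p + r *\<^sub>R cis (- t) \<in> verts') = (p + r *\<^sub>R cis t \<in> verts)" for p r t
      unfolding v' by (metis cis_cnj complex_cnj_add complex_cnj_scaleR mem)
    show ?thesis unfolding m.good_def good_def 1 2 by (auto simp: r)
  qed
  have ml: "m.link (mirror T2) (mirror T1)"
    using l lf_sym by (auto simp: m.link_def link_def lf_mirror)
  have g': "m.good (mirror T2)" "m.good (mirror T1)" using g mgood by auto
  have dm': "dist x y \<le> R" if xy: "x \<in> bd'" "y \<in> bd'" for x y
  proof -
    obtain x0 y0 where "x = cnj x0" "y = cnj y0" "x0 \<in> bd" "y0 \<in> bd" using xy by (auto simp: b')
    then show ?thesis using dm[of x0 y0] by (metis complex_cnj_diff complex_mod_cnj dist_norm)
  qed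
  define t where "t = t1 T2"
  have tt: "t2 T1 = t" "t1 (mirror T1) = - t" using l by (auto simp: link_def t_def)
  obtain w q \<tau> where *: "0 \<le> \<tau>" "\<tau> < \<rho>" "w = q + \<tau> *\<^sub>R cis (- t)"
    "\<exists>k\<ge>0. w = pb (mirror T2) + k *\<^sub>R cis (- t)" "\<exists>k\<ge>0. q = pa (mirror T1) + k *\<^sub>R cis (- t)"
    "\<forall>\<^sub>F s in nhds (- t). - t \<le> s \<longrightarrow> m.good (modify (mirror T2) 0 (t1 (mirror T2)) (cutp (mirror T2) w s) s)"
    "\<forall>\<^sub>F s in nhds (- t). - t \<le> s \<longrightarrow> m.good (modify (mirror T1) (cutp (mirror T1) q s) s 1 (t2 (mirror T1)))"
    "\<forall>h. 0 \<le> h \<longrightarrow> h \<le> 1 \<longrightarrow> - t + arctan (h / (\<rho> - \<tau>)) < t2 (mirror T1) \<longrightarrow> arctan (h / (\<rho> - \<tau>)) \<le> pi / 3 \<longrightarrow>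
       (\<exists>ts. chain w (- t + arctan (h / \<rho>)) ts q (- t + arctan (h / (\<rho> - \<tau>))) \<and>
         (\<forall>T\<in>set ts. m.good T \<and> 2 / (\<rho> + 1 + R)\<^sup>2 \<le> rat T \<and> rat T \<le> 4 / (\<rho> - R)\<^sup>2))"
    by (rule m.opening_ccw[OF g' ml dm' rho, unfolded tt])
  have near: "\<forall>\<^sub>F s in nhds t. crs (cis s) (pb T - pa T) > 0" if "crs (cis t) (pb T - pa T) > 0" for T
    using eventually_pos_near[OF isCont_crs_cis that] .
  have c12: "crs (cis t) (pb T1 - pa T1) > 0" "crs (cis t) (pb T2 - pa T2) > 0"
    using good_shape[OF g(1)] good_shape[OF g(2)] tt by (auto simp: shape_def t_def)
  show ?thesis
  proof (rule that[OF *(1,2)])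
    show "cnj w = cnj q + \<tau> *\<^sub>R cis (t1 T2)" using *(3) by (simp add: t_def cis_cnj)
    show "\<exists>k\<ge>0. cnj w = pa T2 + k *\<^sub>R cis (t1 T2)" "\<exists>k\<ge>0. cnj q = pb T1 + k *\<^sub>R cis (t1 T2)"
      using *(4,5) by (auto simp: t_def cis_cnj)
    have "\<forall>\<^sub>F s in nhds t. - t \<le> - s \<longrightarrow> m.good (modify (mirror T2) 0 (t1 (mirror T2)) (cutp (mirror T2) w (- s)) (- s))"
      using *(6) unfolding eventually_nhds_uminus .
    with near[OF c12(2)] show "\<forall>\<^sub>F s in nhds (t1 T2). s \<le> t1 T2 \<longrightarrow> good (modify T2 (cutp T2 (cnj w) s) s 1 (t2 T2))"
      unfolding t_def[symmetric]
    proof eventually_elim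
      case (elim s)
      have "mirror (modify T2 (cutp T2 (cnj w) s) s 1 (t2 T2)) = modify (mirror T2) 0 (t1 (mirror T2)) (cutp (mirror T2) w (- s)) (- s)"
        using cut_mirror[of s T2 "cnj w"] elim(1) by (simp add: mirror_modify)
      then show ?case using elim(2) mgood by (metis neg_le_iff_le)
    qed
    have "\<forall>\<^sub>F s in nhds t. - t \<le> - s \<longrightarrow> m.good (modify (mirror T1) (cutp (mirror T1) q (- s)) (- s) 1 (t2 (mirror T1)))"
      using *(7) unfolding eventually_nhds_uminus .
    with near[OF c12(1)] show "\<forall>\<^sub>F s in nhds (t1 T2). s \<le> t1 T2 \<longrightarrow> good (modify T1 0 (t1 T1) (cutp T1 (cnj q) s) s)"
      unfolding t_def[symmetric]
    proof eventually_elim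
      case (elim s)
      have "mirror (modify T1 0 (t1 T1) (cutp T1 (cnj q) s) s) = modify (mirror T1) (cutp (mirror T1) q (- s)) (- s) 1 (t2 (mirror T1))"
        using cut_mirror[of s T1 "cnj q"] elim(1) by (simp add: mirror_modify)
      then show ?case using elim(2) mgood by (metis neg_le_iff_le)
    qed
  next
    show "\<forall>h. 0 \<le> h \<longrightarrow> h \<le> 1 \<longrightarrow> t1 T1 < t1 T2 - arctan (h / (\<rho> - \<tau>)) \<longrightarrow> arctan (h / (\<rho> - \<tau>)) \<le> pi / 3 \<longrightarrow>
       (\<exists>ts. chain (cnj q) (t1 T2 - arctan (h / (\<rho> - \<tau>))) ts (cnj w) (t1 T2 - arctan (h / \<rho>)) \<and>
         (\<forall>T\<in>set ts. good T \<and> 2 / (\<rho> + 1 + R)\<^sup>2 \<le> rat T \<and> rat T \<le> 4 / (\<rho> - R)\<^sup>2))"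
    proof (intro allI impI)
    fix h :: real
    assume h: "0 \<le> h" "h \<le> 1" "t1 T1 < t1 T2 - arctan (h / (\<rho> - \<tau>))" "arctan (h / (\<rho> - \<tau>)) \<le> pi / 3"
    then obtain ts where ts: "chain w (- t + arctan (h / \<rho>)) ts q (- t + arctan (h / (\<rho> - \<tau>)))"
       "\<forall>T\<in>set ts. m.good T \<and> 2 / (\<rho> + 1 + R)\<^sup>2 \<le> rat T \<and> rat T \<le> 4 / (\<rho> - R)\<^sup>2"
      using *(8) by (auto simp: t_def)
    have "chain (cnj q) (t - arctan (h / (\<rho> - \<tau>))) (rev (map mirror ts)) (cnj w) (t - arctan (h / \<rho>))"
      using chain_mirror[OF ts(1)] by simp
    moreover have "good (mirror T) \<and> 2 / (\<rho> + 1 + R)\<^sup>2 \<le> rat (mirror T) \<and> rat (mirror T) \<le> 4 / (\<rho> - R)\<^sup>2"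
      if "T \<in> set ts" for T
      using ts(2) that mgood[of "mirror T"] by simp
    ultimately show "\<exists>ts. chain (cnj q) (t1 T2 - arctan (h / (\<rho> - \<tau>))) ts (cnj w) (t1 T2 - arctan (h / \<rho>)) \<and>
         (\<forall>T\<in>set ts. good T \<and> 2 / (\<rho> + 1 + R)\<^sup>2 \<le> rat T \<and> rat T \<le> 4 / (\<rho> - R)\<^sup>2)"
      unfolding t_def[symmetric] by (intro exI[of _ "rev (map mirror ts)"]) auto
    qed
  qed
qed

end

section \<open>Reducing the number of maximal ratios\<close>

lemma eventually_square:
  assumes "\<forall>\<^sub>F z in nhds (0::real) \<times>\<^sub>F nhds (0::real). R z"
  obtains d where "d > 0" "\<And>x y. \<bar>x\<bar> < d \<Longrightarrow> \<bar>y\<bar> < d \<Longrightarrow> R (x, y)"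
proof -
  obtain F G where FG: "\<forall>\<^sub>F x in nhds 0. F x" "\<forall>\<^sub>F y in nhds 0. G y" "\<And>x y. F x \<Longrightarrow> G y \<Longrightarrow> R (x, y)"
    using assms unfolding eventually_prod_filter by blast
  obtain d1 d2 where "d1 > 0" "\<And>x. dist x 0 < d1 \<Longrightarrow> F x" "d2 > 0" "\<And>y. dist y 0 < d2 \<Longrightarrow> G y"
    using FG(1,2) unfolding eventually_nhds_metric by blast
  then show ?thesis using FG(3) by (intro that[of "min d1 d2"]) auto
qed

lemma eventually_fst: "(\<forall>\<^sub>F x in F. R x) \<Longrightarrow> \<forall>\<^sub>F z in F \<times>\<^sub>F G. R (fst z)"
  using filterlim_fst eventually_compose_filterlim by blast

lemma eventually_snd: "(\<forall>\<^sub>F x in G. R x) \<Longrightarrow> \<forall>\<^sub>F z in F \<times>\<^sub>F G. R (snd z)"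
  using filterlim_snd eventually_compose_filterlim by blast

lemma eventually_swap:
  "(\<forall>\<^sub>F z in F \<times>\<^sub>F G. R z) \<Longrightarrow> \<forall>\<^sub>F z in G \<times>\<^sub>F F. R (snd z, fst z)"
  unfolding eventually_prod_filter by force

lemma eventually_isCont:
  assumes "isCont f (x::real)" "\<forall>\<^sub>F s in nhds (f x). R s"
  shows "\<forall>\<^sub>F h in nhds x. R (f h)"
proof -
  have "filterlim f (nhds (f x)) (nhds x)" using assms(1)
    by (simp add: isCont_def tendsto_at_iff_tendsto_nhds)
  then show ?thesis using assms(2) eventually_compose_filterlim by blast
qed

lemma isCont_arctan_div: "isCont (\<lambda>h. arctan (h / c)) (x::real)"
proof (cases "c = 0")
  case False
  then show ?thesis by (intro isCont_o2[of x "\<lambda>h. h / c" arctan] isCont_arctan continuous_intros) auto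
qed auto

text \<open>The sign of the cut parameter tells whether the base becomes longer or shorter at its
  start, as needed for \<open>rat_mono\<close>.\<close>

lemma cut_start:
  assumes q: "q = pa T + k *\<^sub>R cis t" "k \<ge> 0" and c: "crs (cis s) (pb T - pa T) > 0"
  shows "cutp T q t = 0" "t \<le> s \<Longrightarrow> s \<le> t + pi \<Longrightarrow> cutp T q s \<le> 0" "s \<le> t \<Longrightarrow> t \<le> s + pi \<Longrightarrow> 0 \<le> cutp T q s"
proof -
  have e: "cutp T q s = k * sin (t - s) / crs (cis s) (pb T - pa T)" for s
    by (simp add: cutp_def q crs_scale_right crs_cis)
  show "cutp T q t = 0" by (simp add: e)
  show "cutp T q s \<le> 0" if "t \<le> s" "s \<le> t + pi"
  proof -
    have "sin (s - t) \<ge> 0" using that by (intro sin_ge_zero) auto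
    then have "k * sin (t - s) \<le> 0" using q(2) sin_minus[of "s - t"] by (simp add: mult_nonneg_nonpos)
    then show ?thesis using c by (simp add: e divide_le_0_iff)
  qed
  show "0 \<le> cutp T q s" if "s \<le> t" "t \<le> s + pi"
  proof -
    have "sin (t - s) \<ge> 0" using that by (intro sin_ge_zero) auto
    then show ?thesis using c q(2) by (simp add: e)
  qed
qed

lemma cut_end:
  assumes w: "w = pb T + k *\<^sub>R cis t" "k \<ge> 0" and c: "crs (cis s) (pb T - pa T) > 0"
  shows "t = s \<Longrightarrow> cutp T w s = 1" "t \<le> s \<Longrightarrow> s \<le> t + pi \<Longrightarrow> cutp T w s \<le> 1" "s \<le> t \<Longrightarrow> t \<le> s + pi \<Longrightarrow> 1 \<le> cutp T w s"
proof -
  have "crs (cis s) (w - pa T) = crs (cis s) (pb T - pa T) + k * sin (t - s)"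
    by (simp add: w crs_add_right crs_diff_right crs_scale_right crs_cis)
  then have e: "cutp T w s = 1 + k * sin (t - s) / crs (cis s) (pb T - pa T)"
    using c by (simp add: cutp_def field_simps)
  show "t = s \<Longrightarrow> cutp T w s = 1" by (simp add: e)
  show "cutp T w s \<le> 1" if "t \<le> s" "s \<le> t + pi"
  proof -
    have "sin (s - t) \<ge> 0" using that by (intro sin_ge_zero) auto
    then have "k * sin (t - s) \<le> 0" using w(2) sin_minus[of "s - t"] by (simp add: mult_nonneg_nonpos)
    then show ?thesis using c by (simp add: e divide_le_0_iff)
  qed
  show "1 \<le> cutp T w s" if "s \<le> t" "t \<le> s + pi"
  proof -
    have "sin (t - s) \<ge> 0" using that by (intro sin_ge_zero) auto
    then show ?thesis using c w(2) by (simp add: e)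
  qed
qed

lemma cut_line: "crs (cis s) (pb T - pa T) \<noteq> 0 \<Longrightarrow> lf w s (pa T + cutp T w s *\<^sub>R (pb T - pa T)) = 0"
  using mp_line[of s T w] by (simp add: mp_def cutp_def)

lemma cut_tshift [simp]: "cutp (tshift z T) w s = cutp T w s"
  by (simp add: cutp_def)

lemma cut_int_shift [simp]: "cutp T w (s + 2 * pi * of_int z) = cutp T w s"
  by (simp add: cutp_def)

lemma cut_2pi [simp]: "cutp T w (s + 2 * pi) = cutp T w s"
  by (simp add: cutp_def)

lemma modify_tshift: "modify (tshift z T) m s m' e = tshift z (modify T m (s - 2 * pi * of_int z) m' (e - 2 * pi * of_int z))"
  by (simp add: modify_def tshift_def)

text \<open>Only the outermost two lines change. Distinctness ensures that the tests
  \<open>T = hd A\<close> and \<open>T = last A\<close> single out one position each.\<close>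

lemma chain_modify:
  assumes d: "distinct A" "A \<noteq> []" and c: "chain p t A p' t'"
    and f: "\<And>T. f T = modify T (if T = hd A then m else 0) (if T = hd A then s else t1 T)
         (if T = last A then m' else 1) (if T = last A then e else t2 T)"
    and w: "lf w s (pa (f (hd A))) = 0" "lf w' e (pb (f (last A))) = 0"
  shows "chain w s (map f A) w' e"
proof -
  note cn = c[unfolded chain_nth[OF d(2)]]
  have h: "A ! 0 = hd A" "A ! (length A - 1) = last A" using d(2) by (auto simp: hd_conv_nth last_conv_nth)
  have l: "length A > 0" using d(2) by simp
  have ne': "map f A \<noteq> []" using d(2) by simp
  have "t2 (map f A ! i) = t1 (map f A ! Suc i) \<and> lf (pb (map f A ! i)) (t2 (map f A ! i)) (pa (map f A ! Suc i)) = 0"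
    if i: "Suc i < length A" for i
  proof -
    have n1: "A ! i \<noteq> last A" using d(1) i l unfolding h(2)[symmetric] by (subst nth_eq_iff_index_eq) auto
    have n2: "A ! Suc i \<noteq> hd A" using d(1) i l unfolding h(1)[symmetric] by (subst nth_eq_iff_index_eq) auto
    have "pb (f (A ! i)) = pb (A ! i)" "t2 (f (A ! i)) = t2 (A ! i)" "pa (f (A ! Suc i)) = pa (A ! Suc i)" "t1 (f (A ! Suc i)) = t1 (A ! Suc i)"
      using n1 n2 by (simp_all add: f)
    moreover have "t2 (A ! i) = t1 (A ! Suc i)" "lf (pb (A ! i)) (t1 (A ! Suc i)) (pa (A ! Suc i)) = 0"
      using cn i by metis+
    ultimately show ?thesis using i by simp
  qed
  moreover have "t1 (map f A ! 0) = s" "t2 (map f A ! (length (map f A) - 1)) = e"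
    using l h by (auto simp: f)
  moreover have "lf w s (pa (map f A ! 0)) = 0" using w(1) l h by simp
  moreover have "lf (pb (map f A ! (length (map f A) - 1))) e w' = 0" using lf_sym[OF w(2)] l h by simp
  ultimately show ?thesis unfolding chain_nth[OF ne'] length_map by blast
qed

lemma length_filter_map_le:
  "(\<And>x. x \<in> set xs \<Longrightarrow> P' (f x) \<Longrightarrow> P x) \<Longrightarrow> length (filter P' (map f xs)) \<le> length (filter P xs)"
  by (induction xs) auto

lemma length_filter_map_less:
  assumes "\<And>x. x \<in> set xs \<Longrightarrow> P' (f x) \<Longrightarrow> P x" "y \<in> set xs" "P y" "\<not> P' (f y)"
  shows "length (filter P' (map f xs)) < length (filter P xs)"
  using assms
proof (induction xs)
  case (Cons x xs)
  have le: "length (filter P' (map f xs)) \<le> length (filter P xs)"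
    using Cons.prems by (intro length_filter_map_le) auto
  show ?case
  proof (cases "x = y")
    case True
    then show ?thesis using le Cons.prems by auto
  next
    case False
    then have "length (filter P' (map f xs)) < length (filter P xs)" using Cons by auto
    then show ?thesis using Cons.prems(1)[of x] by auto
  qed
qed auto

text \<open>Lets the two extreme directions of a thin chain speak for all directions in it.\<close>

lemma between_negative:
  assumes "s \<le> w" "w \<le> t" "t < s + pi" "crs (cis s) z < 0" "crs (cis t) z < 0"
  shows "crs (cis w) z < 0"
proof (cases "s = t")
  case False
  have p: "sin (t - s) > 0" using False assms by (intro sin_gt_zero) auto
  have "sin (t - s) * crs (cis w) z = sin (t - w) * crs (cis s) z + sin (w - s) * crs (cis t) z"
    using arg_cong[OF cis_between[of t s w], of "\<lambda>u. crs u z"] by (simp add: crs_simps)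
  moreover have "sin (t - w) \<ge> 0" "sin (w - s) \<ge> 0" using assms by (auto intro!: sin_ge_zero)
  moreover have "sin (t - w) > 0 \<or> sin (w - s) > 0"
    using assms False by (cases "w < t") (auto intro!: sin_gt_zero)
  ultimately have "sin (t - s) * crs (cis w) z < 0"
    using assms(4,5) by (smt (verit) mult_nonneg_nonpos mult_pos_neg)
  then show ?thesis using p by (simp add: mult_less_0_iff)
qed (use assms in auto)

context polygon
begin

lemma sreg_nonempty: "good T \<Longrightarrow> sreg T \<noteq> {}"
  using sreg_base_move[of T "1 / 2" "t1 T" 1] good_shape[of T] by (force simp: shape_def)

lemma sys_distinct:
  assumes "sys ts" shows "distinct ts"
  unfolding distinct_conv_nth
proof (intro allI impI)
  fix i j assume ij: "i < length ts" "j < length ts" "i \<noteq> j"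
  then have "sreg (ts ! i) \<inter> sreg (ts ! j) = {}"
    using assms disjoint_nth by (auto simp: sys_def)
  moreover have "sreg (ts ! i) \<noteq> {}" using sreg_nonempty assms ij by (auto simp: sys_def)
  ultimately show "ts ! i \<noteq> ts ! j" by auto
qed

text \<open>For small parameters the moved endpoints and directions stay on their own side of the
  middle of \<open>T\<close>, and the angle stays below \<open>pi\<close>; this is what
  \<open>good_modify\<close> asks for. The parameters of the two ends are independent.\<close>

lemma eventually_good_modify:
  assumes g: "good T" and m: "isCont m 0" "m 0 = 0" and s: "isCont s 0" "s 0 = t1 T"
    and m': "isCont m' 0" "m' 0 = 1" and e: "isCont e 0" "e 0 = t2 T"
    and gs: "\<forall>\<^sub>F h in nhds 0. 0 \<le> h \<longrightarrow> good (modify T (m h) (s h) 1 (t2 T))"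
    and ge: "\<forall>\<^sub>F h in nhds 0. 0 \<le> h \<longrightarrow> good (modify T 0 (t1 T) (m' h) (e h))"
  shows "\<forall>\<^sub>F z in nhds (0::real) \<times>\<^sub>F nhds (0::real). 0 \<le> fst z \<longrightarrow> 0 \<le> snd z \<longrightarrow>
     good (modify T (m (fst z)) (s (fst z)) (m' (snd z)) (e (snd z)))"
proof -
  have sh: "t1 T < t2 T" "t2 T < t1 T + pi" using good_shape[OF g] by (auto simp: shape_def)
  define mid \<epsilon> where "mid = (t1 T + t2 T) / 2" and "\<epsilon> = (pi - (t2 T - t1 T)) / 2"
  have p: "t1 T < mid" "mid < t2 T" "\<epsilon> > 0" "t2 T + \<epsilon> = (t1 T - \<epsilon>) + pi"
    using sh by (auto simp: mid_def \<epsilon>_def field_simps)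
  have up: "\<forall>\<^sub>F h in nhds 0. f h < c" if "isCont f 0" "f 0 < c" for f :: "real \<Rightarrow> real" and c
    using eventually_pos_near[where f = "\<lambda>h. c - f h" and t = 0] that by (auto intro: continuous_intros)
  have dn: "\<forall>\<^sub>F h in nhds 0. f h > c" if "isCont f 0" "f 0 > c" for f :: "real \<Rightarrow> real" and c
    using eventually_pos_near[where f = "\<lambda>h. f h - c" and t = 0] that by (auto intro: continuous_intros)
  have 1: "\<forall>\<^sub>F h in nhds 0. m h < 1 / 2 \<and> s h < mid \<and> s h > t1 T - \<epsilon> \<and> (0 \<le> h \<longrightarrow> good (modify T (m h) (s h) 1 (t2 T)))"
    using up[OF m(1), of "1 / 2"] up[OF s(1), of mid] dn[OF s(1), of "t1 T - \<epsilon>"] gs m s p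
    by (simp add: eventually_conj_iff)
  have 2: "\<forall>\<^sub>F h in nhds 0. m' h > 1 / 2 \<and> e h > mid \<and> e h < t2 T + \<epsilon> \<and> (0 \<le> h \<longrightarrow> good (modify T 0 (t1 T) (m' h) (e h)))"
  proof -
    have "\<forall>\<^sub>F h in nhds 0. e h < t2 T + \<epsilon>" by (rule up[OF e(1)]) (use e p in simp)
    then show ?thesis using dn[OF m'(1), of "1 / 2"] dn[OF e(1), of mid] ge m' e p(2)
      by (simp add: eventually_conj_iff)
  qed
  from eventually_fst[OF 1] eventually_snd[OF 2] show ?thesis
  proof eventually_elim
    case (elim z)
    show ?case
    proof (intro impI)
      assume "0 \<le> fst z" "0 \<le> snd z"
      then show "good (modify T (m (fst z)) (s (fst z)) (m' (snd z)) (e (snd z)))"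
        using elim p(4) by - (rule good_modify[OF g], auto)
    qed
  qed
qed

lemma first_line:
  assumes "chain p t (us @ vs) p' t'" "vs \<noteq> []" "\<forall>T\<in>set (us @ vs). \<sigma> * lf (pa T) (t1 T) x > 0"
  shows "\<sigma> * lf p t x > 0"
proof -
  obtain T ws where T: "us @ vs = T # ws" using assms(2) by (metis append_is_Nil_conv neq_Nil_conv)
  then have "lf p t x = lf (pa T) (t1 T) x" using assms(1) lf_cong[of p t "pa T" x] by auto
  then show ?thesis using assms(3) T by auto
qed

text \<open>\<open>h\<close> and \<open>k\<close> measure the openings before and after the run
  \<open>A\<close>. For all small values the opened cycle respects the bounds, and it has fewer
  maximal ratios as soon as one of the two is positive; their proportion is left free to restore
  neutrality.\<close>

lemma improve:
  assumes dm: "\<And>x y. x \<in> bd \<Longrightarrow> y \<in> bd \<Longrightarrow> dist x y \<le> R" and rho: "\<rho> > 2 * R"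
    and sys: "sys (A @ B)" and neu: "neutral (A @ B)" and ne: "A \<noteq> []" "B \<noteq> []"
    and AM: "\<forall>T\<in>set A. rat T = M" and BM: "rat (hd B) < M" "rat (last B) < M"
    and bnd: "\<forall>T\<in>set (A @ B). lo \<le> rat T \<and> rat T \<le> M"
    and lo: "lo \<le> 2 / (\<rho> + 1 + R)\<^sup>2" "lo < M" and hi: "4 / (\<rho> - R)\<^sup>2 < M"
  shows "\<exists>ts. sys ts \<and> neutral ts \<and> (\<forall>T\<in>set ts. lo \<le> rat T \<and> rat T \<le> M) \<and>
    length (filter (\<lambda>T. rat T = M) ts) < length (filter (\<lambda>T. rat T = M) (A @ B))"
proof -
  define H La Hb Lb where "H = hd A" and "La = last A" and "Hb = hd B" and "Lb = last B"
  have mem: "H \<in> set A" "La \<in> set A" "Hb \<in> set B" "Lb \<in> set B"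
    using ne by (auto simp: H_def La_def Hb_def Lb_def)
  have gd: "good T" if "T \<in> set A \<or> T \<in> set B" for T using sys that by (auto simp: sys_def)
  have shp: "shape T" if "T \<in> set A \<or> T \<in> set B" for T using gd[OF that] good_shape by blast
  have gm: "good H" "good La" "good Hb" "good Lb" using gd mem by auto
  have dist: "distinct A" "distinct B" "set A \<inter> set B = {}" using sys_distinct[OF sys] by auto
  define t0 where "t0 = t1 H"
  obtain q0 t' where cA: "chain (pa H) t0 A q0 t'" and cB: "chain q0 t' B (pa H) (t0 + 2 * pi)"
    using sys ne unfolding sys_def closed_chain_def H_def t0_def by (auto simp: chain_append)
  have lA: "A ! (length A - 1) = La" "A ! 0 = H" "B ! (length B - 1) = Lb" "B ! 0 = Hb"
    using ne by (auto simp: H_def La_def Hb_def Lb_def hd_conv_nth last_conv_nth)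
  have eA: "t2 La = t'" "lf (pb La) t' q0 = 0" and sB: "t1 Hb = t'" "lf q0 t' (pa Hb) = 0"
    and eB: "t2 Lb = t0 + 2 * pi" "lf (pb Lb) (t0 + 2 * pi) (pa H) = 0"
    using cA[unfolded chain_nth[OF ne(1)]] cB[unfolded chain_nth[OF ne(2)]] lA by auto
  have lk: "link La Hb" using eA sB lf_cong[OF eA(2), of "pa Hb"] by (simp add: link_def)
  \<comment> \<open>The last triangle turned back by a full angle, so that it directly precedes
    \<open>H\<close>.\<close>
  define Lb' where "Lb' = tshift (- 1) Lb"
  have lj: "link Lb' H" using eB by (simp add: link_def Lb'_def t0_def)
  have gLb': "good Lb'" using gm by (simp add: Lb'_def)
  obtain wj qj tauj where tj: "0 \<le> tauj" "tauj < \<rho>" and wqj: "wj = qj + tauj *\<^sub>R cis t0"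
    and wj: "\<exists>k\<ge>0. wj = pb Lb' + k *\<^sub>R cis t0" and qj: "\<exists>k\<ge>0. qj = pa H + k *\<^sub>R cis t0"
    and gwj: "\<forall>\<^sub>F s in nhds t0. t0 \<le> s \<longrightarrow> good (modify Lb' 0 (t1 Lb') (cutp Lb' wj s) s)"
    and gqj: "\<forall>\<^sub>F s in nhds t0. t0 \<le> s \<longrightarrow> good (modify H (cutp H qj s) s 1 (t2 H))"
    and thj: "\<forall>h. 0 \<le> h \<longrightarrow> h \<le> 1 \<longrightarrow> t0 + arctan (h / (\<rho> - tauj)) < t2 H \<longrightarrow> arctan (h / (\<rho> - tauj)) \<le> pi / 3 \<longrightarrow>
       (\<exists>ts. chain wj (t0 + arctan (h / \<rho>)) ts qj (t0 + arctan (h / (\<rho> - tauj))) \<and>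
         (\<forall>T\<in>set ts. good T \<and> 2 / (\<rho> + 1 + R)\<^sup>2 \<le> rat T \<and> rat T \<le> 4 / (\<rho> - R)\<^sup>2))"
    unfolding t0_def by (rule opening_ccw[OF gLb' gm(1) lj dm rho])
  obtain wk qk tauk where tk: "0 \<le> tauk" "tauk < \<rho>" and wqk: "wk = qk + tauk *\<^sub>R cis t'"
    and wk: "\<exists>k\<ge>0. wk = pa Hb + k *\<^sub>R cis t'" and qk: "\<exists>k\<ge>0. qk = pb La + k *\<^sub>R cis t'"
    and gwk: "\<forall>\<^sub>F s in nhds t'. s \<le> t' \<longrightarrow> good (modify Hb (cutp Hb wk s) s 1 (t2 Hb))"
    and gqk: "\<forall>\<^sub>F s in nhds t'. s \<le> t' \<longrightarrow> good (modify La 0 (t1 La) (cutp La qk s) s)"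
    and thk: "\<forall>h. 0 \<le> h \<longrightarrow> h \<le> 1 \<longrightarrow> t1 La < t' - arctan (h / (\<rho> - tauk)) \<longrightarrow> arctan (h / (\<rho> - tauk)) \<le> pi / 3 \<longrightarrow>
       (\<exists>ts. chain qk (t' - arctan (h / (\<rho> - tauk))) ts wk (t' - arctan (h / \<rho>)) \<and>
         (\<forall>T\<in>set ts. good T \<and> 2 / (\<rho> + 1 + R)\<^sup>2 \<le> rat T \<and> rat T \<le> 4 / (\<rho> - R)\<^sup>2))"
    unfolding sB(1)[symmetric] by (rule opening_cw[OF gm(2) gm(3) lk dm rho])
  have rho0: "\<rho> > 0" using tj by linarith
  define sj ej ek sk where "sj h = t0 + arctan (h / (\<rho> - tauj))" and "ej h = t0 + 2 * pi + arctan (h / \<rho>)"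
    and "ek h = t' - arctan (h / (\<rho> - tauk))" and "sk h = t' - arctan (h / \<rho>)" for h :: real
  have cont: "isCont sj x" "isCont ej x" "isCont ek x" "isCont sk x" for x
    unfolding sj_def ej_def ek_def sk_def by (intro continuous_intros isCont_arctan_div)+
  have z0: "sj 0 = t0" "ej 0 = t0 + 2 * pi" "ek 0 = t'" "sk 0 = t'"
    by (simp_all add: sj_def ej_def ek_def sk_def)
  have ge: "t0 \<le> sj h" "t0 + 2 * pi \<le> ej h" "ek h \<le> t'" "sk h \<le> t'" if "h \<ge> 0" for h
    using that tj tk rho0 by (auto simp: sj_def ej_def ek_def sk_def)
  have lt: "sj h \<le> t0 + pi" "ej h \<le> t0 + 2 * pi + pi" "t' \<le> ek h + pi" "t' \<le> sk h + pi" for h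
    using arctan_ubound[of "h / (\<rho> - tauj)"] arctan_ubound[of "h / \<rho>"] arctan_ubound[of "h / (\<rho> - tauk)"] pi_gt_zero
    unfolding sj_def ej_def ek_def sk_def by linarith+
  have gt: "t0 < sj h" "ek h < t'" if "h > 0" for h
    using that tj tk by (auto simp: sj_def ek_def)
  have tH: "t1 H = t0" "t2 La = t'" "t1 Hb = t'" "t2 Lb = t0 + 2 * pi" using t0_def eA sB eB by auto
  have cpos: "crs (cis (sj 0)) (pb H - pa H) > 0" "crs (cis (ek 0)) (pb La - pa La) > 0"
    "crs (cis (sk 0)) (pb Hb - pa Hb) > 0" "crs (cis (ej 0)) (pb Lb - pa Lb) > 0"
    using good_shape[OF gm(1)] good_shape[OF gm(2)] good_shape[OF gm(3)] good_shape[OF gm(4)] tH z0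
    by (auto simp: shape_def)
  obtain kqj where kqj: "kqj \<ge> 0" "qj = pa H + kqj *\<^sub>R cis t0" using qj by blast
  obtain kwj where kwj: "kwj \<ge> 0" "wj = pb Lb + kwj *\<^sub>R cis (t0 + 2 * pi)" using wj by (auto simp: Lb'_def)
  obtain kqk where kqk: "kqk \<ge> 0" "qk = pb La + kqk *\<^sub>R cis t'" using qk by blast
  obtain kwk where kwk: "kwk \<ge> 0" "wk = pa Hb + kwk *\<^sub>R cis t'" using wk by blast
  \<comment> \<open>In the run the first triangle changes with \<open>h\<close> and the last with
    \<open>k\<close>, and both changes apply if they coincide. In \<open>B\<close> the first changes
    with \<open>k\<close> and the last with \<open>h\<close>.\<close>
  define mA m'A sA eA' where
    "mA T h = (if T = H then cutp H qj (sj h) else 0)" and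
    "m'A T h = (if T = La then cutp La qk (ek h) else 1)" and
    "sA T h = (if T = H then sj h else t1 T)" and
    "eA' T h = (if T = La then ek h else t2 T)" for T h
  define mB m'B sB' eB' where
    "mB T h = (if T = Hb then cutp Hb wk (sk h) else 0)" and
    "m'B T h = (if T = Lb then cutp Lb wj (ej h) else 1)" and
    "sB' T h = (if T = Hb then sk h else t1 T)" and
    "eB' T h = (if T = Lb then ej h else t2 T)" for T h
  define fA where "fA h k T = modify T (mA T h) (sA T h) (m'A T k) (eA' T k)" for h k T
  define fB where "fB h k T = modify T (mB T k) (sB' T k) (m'B T h) (eB' T h)" for h k T
  have cc: "isCont (\<lambda>h. cutp H qj (sj h)) 0" "isCont (\<lambda>h. cutp La qk (ek h)) 0"
     "isCont (\<lambda>h. cutp Hb wk (sk h)) 0" "isCont (\<lambda>h. cutp Lb wj (ej h)) 0"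
    using cpos by (auto intro!: isCont_cut cont)
  have contA: "isCont (mA T) 0" "isCont (sA T) 0" "isCont (m'A T) 0" "isCont (eA' T) 0"
     "mA T 0 = 0" "sA T 0 = t1 T" "m'A T 0 = 1" "eA' T 0 = t2 T" for T
  proof -
    show "isCont (mA T) 0" "isCont (sA T) 0" "isCont (m'A T) 0" "isCont (eA' T) 0"
      unfolding mA_def sA_def m'A_def eA'_def using cc cont[of 0]
      by (cases "T = H"; cases "T = La"; simp)+
    show "mA T 0 = 0" "m'A T 0 = 1"
      using cut_start(1)[OF kqj(2,1) cpos(1)] cut_end(1)[OF kqk(2,1) cpos(2)] z0 by (auto simp: mA_def m'A_def)
    show "sA T 0 = t1 T" "eA' T 0 = t2 T" using z0 tH by (auto simp: sA_def eA'_def)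
  qed
  have contB: "isCont (mB T) 0" "isCont (sB' T) 0" "isCont (m'B T) 0" "isCont (eB' T) 0"
     "mB T 0 = 0" "sB' T 0 = t1 T" "m'B T 0 = 1" "eB' T 0 = t2 T" for T
  proof -
    show "isCont (mB T) 0" "isCont (sB' T) 0" "isCont (m'B T) 0" "isCont (eB' T) 0"
      unfolding mB_def sB'_def m'B_def eB'_def using cc cont[of 0]
      by (cases "T = Hb"; cases "T = Lb"; simp)+
    show "mB T 0 = 0" "m'B T 0 = 1"
      using cut_start(1)[OF kwk(2,1) cpos(3)] cut_end(1)[OF kwj(2,1) cpos(4)] z0 by (auto simp: mB_def m'B_def)
    show "sB' T 0 = t1 T" "eB' T 0 = t2 T" using z0 tH by (auto simp: sB'_def eB'_def)
  qed
  have evA: "\<forall>\<^sub>F z in nhds 0 \<times>\<^sub>F nhds 0. 0 \<le> fst z \<longrightarrow> 0 \<le> snd z \<longrightarrow> good (fA (fst z) (snd z) T)" if T: "T \<in> set A" for T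
    unfolding fA_def
  proof (rule eventually_good_modify)
    show "\<forall>\<^sub>F h in nhds 0. 0 \<le> h \<longrightarrow> good (modify T (mA T h) (sA T h) 1 (t2 T))"
    proof (cases "T = H")
      case True
      have "\<forall>\<^sub>F h in nhds 0. t0 \<le> sj h \<longrightarrow> good (modify H (cutp H qj (sj h)) (sj h) 1 (t2 H))"
        using eventually_isCont[OF cont(1)[of 0]] gqj z0 by simp
      then show ?thesis by eventually_elim (use ge True in \<open>auto simp: mA_def sA_def\<close>)
    qed (use gd T in \<open>auto simp: mA_def sA_def\<close>)
    show "\<forall>\<^sub>F h in nhds 0. 0 \<le> h \<longrightarrow> good (modify T 0 (t1 T) (m'A T h) (eA' T h))"
    proof (cases "T = La")
      case True
      have "\<forall>\<^sub>F h in nhds 0. ek h \<le> t' \<longrightarrow> good (modify La 0 (t1 La) (cutp La qk (ek h)) (ek h))"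
        using eventually_isCont[OF cont(3)[of 0]] gqk z0 by simp
      then show ?thesis by eventually_elim (use ge True in \<open>auto simp: m'A_def eA'_def\<close>)
    qed (use gd T in \<open>auto simp: m'A_def eA'_def\<close>)
  qed (use contA gd T in auto)
  have evB: "\<forall>\<^sub>F z in nhds 0 \<times>\<^sub>F nhds 0. 0 \<le> fst z \<longrightarrow> 0 \<le> snd z \<longrightarrow> good (fB (snd z) (fst z) T)" if T: "T \<in> set B" for T
    unfolding fB_def
  proof (rule eventually_good_modify)
    show "\<forall>\<^sub>F h in nhds 0. 0 \<le> h \<longrightarrow> good (modify T (mB T h) (sB' T h) 1 (t2 T))"
    proof (cases "T = Hb")
      case True
      have "\<forall>\<^sub>F h in nhds 0. sk h \<le> t' \<longrightarrow> good (modify Hb (cutp Hb wk (sk h)) (sk h) 1 (t2 Hb))"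
        using eventually_isCont[OF cont(4)[of 0]] gwk z0 by simp
      then show ?thesis by eventually_elim (use ge True in \<open>auto simp: mB_def sB'_def\<close>)
    qed (use gd T in \<open>auto simp: mB_def sB'_def\<close>)
    show "\<forall>\<^sub>F h in nhds 0. 0 \<le> h \<longrightarrow> good (modify T 0 (t1 T) (m'B T h) (eB' T h))"
    proof (cases "T = Lb")
      case True
      \<comment> \<open>The opening was made for \<open>Lb'\<close>; its directions are carried over
        to \<open>Lb\<close> by a full turn.\<close>
      define s0 where "s0 h = t0 + arctan (h / \<rho>)" for h
      have "isCont s0 0" unfolding s0_def by (intro continuous_intros isCont_arctan_div)
      then have "\<forall>\<^sub>F h in nhds 0. t0 \<le> s0 h \<longrightarrow> good (modify Lb' 0 (t1 Lb') (cutp Lb' wj (s0 h)) (s0 h))"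
        by (rule eventually_isCont[where f = s0 and x = 0]) (use gwj in \<open>simp add: s0_def\<close>)
      then show ?thesis
      proof eventually_elim
        case (elim h)
        have e: "ej h = s0 h + 2 * pi" by (simp add: ej_def s0_def)
        have "modify Lb' 0 (t1 Lb') (cutp Lb' wj (s0 h)) (s0 h) = tshift (- 1) (modify Lb 0 (t1 Lb) (cutp Lb wj (ej h)) (ej h))"
          unfolding Lb'_def modify_tshift e by simp
        moreover have "t0 \<le> s0 h" if "0 \<le> h" using that rho0 by (simp add: s0_def)
        ultimately show ?case using elim True by (simp add: m'B_def eB'_def)
      qed
    qed (use gd T in \<open>auto simp: m'B_def eB'_def\<close>)
  qed (use contB gd T in auto)
  have rA: "\<forall>\<^sub>F z in nhds 0 \<times>\<^sub>F nhds 0. rat (fA (fst z) (snd z) T) > lo" if T: "T \<in> set A" for T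
    unfolding fA_def using rat_modify_tendsto[of T "mA T" "sA T" "m'A T" "eA' T"] contA shp[of T] T AM lo
    by (intro order_tendstoD(1)[of _ "rat T"]) auto
  have rB: "\<forall>\<^sub>F z in nhds 0 \<times>\<^sub>F nhds 0. rat (fB (snd z) (fst z) T) < M" if T: "T \<in> set B" "rat T < M" for T
    unfolding fB_def using rat_modify_tendsto[of T "mB T" "sB' T" "m'B T" "eB' T"] contB shp[of T] T
    by (intro order_tendstoD(2)[of _ "rat T"]) auto
  have cneg: "\<forall>\<^sub>F h in nhds 0. crs (cis (sj h)) (pb H - pa H) > 0 \<and> crs (cis (ek h)) (pb La - pa La) > 0 \<and>
    crs (cis (sk h)) (pb Hb - pa Hb) > 0 \<and> crs (cis (ej h)) (pb Lb - pa Lb) > 0"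
    using cpos by (simp add: eventually_conj_iff)
      (intro conjI eventually_pos_near isCont_o2[OF cont(1) isCont_crs_cis] isCont_o2[OF cont(2) isCont_crs_cis]
        isCont_o2[OF cont(3) isCont_crs_cis] isCont_o2[OF cont(4) isCont_crs_cis])
  have small: "\<forall>\<^sub>F h in nhds 0. h < 1 \<and> t0 + arctan (h / (\<rho> - tauj)) < t2 H \<and> arctan (h / (\<rho> - tauj)) < pi / 3 \<and>
     t1 La < t' - arctan (h / (\<rho> - tauk)) \<and> arctan (h / (\<rho> - tauk)) < pi / 3"
  proof -
    have "t2 H - t0 > 0" "t' - t1 La > 0" using good_shape[OF gm(1)] good_shape[OF gm(2)] tH by (auto simp: shape_def)
    then have "\<forall>\<^sub>F h in nhds 0. arctan (h / (\<rho> - tauj)) < t2 H - t0" "\<forall>\<^sub>F h in nhds 0. arctan (h / (\<rho> - tauk)) < t' - t1 La"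
      "\<forall>\<^sub>F h in nhds 0. arctan (h / (\<rho> - tauj)) < pi / 3" "\<forall>\<^sub>F h in nhds 0. arctan (h / (\<rho> - tauk)) < pi / 3"
      by - (rule arctan_small_eventually, simp)+
    moreover have "\<forall>\<^sub>F h in nhds 0. h < (1::real)" using eventually_nhds_in_open[of "{..<1::real}" 0] by simp
    ultimately show ?thesis by eventually_elim auto
  qed
  \<comment> \<open>All finitely many conditions that hold for small parameters, collected so that
    one \<open>d\<close> serves them all.\<close>
  define OK where "OK z \<longleftrightarrow>
      (\<forall>T\<in>set A. (0 \<le> fst z \<longrightarrow> 0 \<le> snd z \<longrightarrow> good (fA (fst z) (snd z) T)) \<and> rat (fA (fst z) (snd z) T) > lo) \<and>
      (\<forall>T\<in>set B. (0 \<le> snd z \<longrightarrow> 0 \<le> fst z \<longrightarrow> good (fB (fst z) (snd z) T)) \<and> (rat T < M \<longrightarrow> rat (fB (fst z) (snd z) T) < M)) \<and>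
      (crs (cis (sj (fst z))) (pb H - pa H) > 0 \<and> crs (cis (ek (snd z))) (pb La - pa La) > 0 \<and>
       crs (cis (sk (snd z))) (pb Hb - pa Hb) > 0 \<and> crs (cis (ej (fst z))) (pb Lb - pa Lb) > 0) \<and>
      (fst z < 1 \<and> t0 + arctan (fst z / (\<rho> - tauj)) < t2 H \<and> arctan (fst z / (\<rho> - tauj)) < pi / 3) \<and>
      (snd z < 1 \<and> t1 La < t' - arctan (snd z / (\<rho> - tauk)) \<and> arctan (snd z / (\<rho> - tauk)) < pi / 3)" for z :: "real \<times> real"
  have "\<forall>\<^sub>F z in nhds 0 \<times>\<^sub>F nhds 0. \<forall>T\<in>set A. (0 \<le> fst z \<longrightarrow> 0 \<le> snd z \<longrightarrow> good (fA (fst z) (snd z) T)) \<and> rat (fA (fst z) (snd z) T) > lo"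
    using evA rA by (intro eventually_ball_finite ballI eventually_conj) auto
  moreover have "\<forall>\<^sub>F z in nhds 0 \<times>\<^sub>F nhds 0. \<forall>T\<in>set B. (0 \<le> snd z \<longrightarrow> 0 \<le> fst z \<longrightarrow> good (fB (fst z) (snd z) T)) \<and> (rat T < M \<longrightarrow> rat (fB (fst z) (snd z) T) < M)"
  proof -
    have "\<forall>\<^sub>F z in nhds 0 \<times>\<^sub>F nhds 0. (0 \<le> snd z \<longrightarrow> 0 \<le> fst z \<longrightarrow> good (fB (fst z) (snd z) T))" if "T \<in> set B" for T
      using eventually_swap[OF evB[OF that]] by simp
    moreover have "\<forall>\<^sub>F z in nhds 0 \<times>\<^sub>F nhds 0. rat T < M \<longrightarrow> rat (fB (fst z) (snd z) T) < M" if "T \<in> set B" for T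
    proof (cases "rat T < M")
      case True
      then show ?thesis using eventually_swap[OF rB[OF that True]] by simp
    qed auto
    ultimately show ?thesis by (intro eventually_ball_finite ballI eventually_conj) auto
  qed
  moreover note eventually_fst[OF cneg, of "nhds 0"] eventually_snd[OF cneg, of "nhds 0"]
    eventually_fst[OF small, of "nhds 0"] eventually_snd[OF small, of "nhds 0"]
  ultimately have "\<forall>\<^sub>F z in nhds 0 \<times>\<^sub>F nhds 0. OK z"
    unfolding OK_def by eventually_elim auto
  then obtain d where d: "d > 0" and d0: "\<And>h k. \<bar>h\<bar> < d \<Longrightarrow> \<bar>k\<bar> < d \<Longrightarrow> OK (h, k)"
    using eventually_square by blast
  have dd: "
      (\<forall>T\<in>set A. (0 \<le> h \<longrightarrow> 0 \<le> k \<longrightarrow> good (fA h k T)) \<and> rat (fA h k T) > lo) \<and>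
      (\<forall>T\<in>set B. (0 \<le> k \<longrightarrow> 0 \<le> h \<longrightarrow> good (fB h k T)) \<and> (rat T < M \<longrightarrow> rat (fB h k T) < M)) \<and>
      (crs (cis (sj h)) (pb H - pa H) > 0 \<and> crs (cis (ek k)) (pb La - pa La) > 0 \<and>
       crs (cis (sk k)) (pb Hb - pa Hb) > 0 \<and> crs (cis (ej h)) (pb Lb - pa Lb) > 0) \<and>
      (h < 1 \<and> t0 + arctan (h / (\<rho> - tauj)) < t2 H \<and> arctan (h / (\<rho> - tauj)) < pi / 3) \<and>
      (k < 1 \<and> t1 La < t' - arctan (k / (\<rho> - tauk)) \<and> arctan (k / (\<rho> - tauk)) < pi / 3)"
 if "\<bar>h\<bar> < d" "\<bar>k\<bar> < d" for h k
    using d0[OF that] unfolding OK_def fst_conv snd_conv .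
  \<comment> \<open>The inner lines of the thin chains are left out: these chains need not depend
    continuously on \<open>h\<close> and \<open>k\<close>, whereas the lines listed here do.\<close>
  define allpos where "allpos \<sigma> h k x \<longleftrightarrow> \<sigma> * lf wj (t0 + arctan (h / \<rho>)) x > 0 \<and> \<sigma> * lf qj (sj h) x > 0 \<and>
    \<sigma> * lf qk (ek k) x > 0 \<and> \<sigma> * lf wk (sk k) x > 0 \<and>
    (\<forall>T\<in>set (tl A) \<union> set (tl B). \<sigma> * lf (pa T) (t1 T) x > 0)" for \<sigma> h k x
  have nH: "T \<noteq> H" if "T \<in> set (tl A)" for T using that dist ne unfolding H_def by (cases A) auto
  have nHb: "T \<noteq> Hb" if "T \<in> set (tl B)" for T using that dist ne unfolding Hb_def by (cases B) auto
  \<comment> \<open>The last two clauses compensate for the omitted lines: one-sidedness of the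
    whole cycle implies \<open>allpos\<close>, and a vector on the negative side of all listed
    directions is so for the thin chains as well.\<close>
  have key: "\<exists>ts. chain wj (t0 + arctan (h / \<rho>)) ts wj (t0 + arctan (h / \<rho>) + 2 * pi) \<and>
      (\<forall>T\<in>set ts. good T \<and> lo \<le> rat T \<and> rat T \<le> M) \<and>
      (0 < h \<or> 0 < k \<longrightarrow> length (filter (\<lambda>T. rat T = M) ts) < length (filter (\<lambda>T. rat T = M) (A @ B))) \<and>
      (\<forall>\<sigma> x. (\<forall>T\<in>set ts. \<sigma> * lf (pa T) (t1 T) x > 0) \<longrightarrow> allpos \<sigma> h k x) \<and>
      (\<forall>z. crs (cis (t0 + arctan (h / \<rho>))) z < 0 \<and> crs (cis (sj h)) z < 0 \<and> crs (cis (ek k)) z < 0 \<and>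
         crs (cis (sk k)) z < 0 \<and> (\<forall>T\<in>set (tl A) \<union> set (tl B). crs (cis (t1 T)) z < 0) \<longrightarrow>
         (\<forall>T\<in>set ts. crs (cis (t1 T)) z < 0))"
    if hk: "0 \<le> h" "h < d" "0 \<le> k" "k < d" for h k
  proof -
    have d1: "\<And>T. T \<in> set A \<Longrightarrow> good (fA h k T) \<and> rat (fA h k T) > lo"
      "\<And>T. T \<in> set B \<Longrightarrow> good (fB h k T) \<and> (rat T < M \<longrightarrow> rat (fB h k T) < M)"
      and cp: "crs (cis (sj h)) (pb H - pa H) > 0" "crs (cis (ek k)) (pb La - pa La) > 0"
       "crs (cis (sk k)) (pb Hb - pa Hb) > 0" "crs (cis (ej h)) (pb Lb - pa Lb) > 0"
      and sm: "h \<le> 1" "t0 + arctan (h / (\<rho> - tauj)) < t2 H" "arctan (h / (\<rho> - tauj)) \<le> pi / 3"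
        "k \<le> 1" "t1 La < t' - arctan (k / (\<rho> - tauk))" "arctan (k / (\<rho> - tauk)) \<le> pi / 3"
      using dd[of h k] hk by auto
    obtain th1 where th1: "chain wj (t0 + arctan (h / \<rho>)) th1 qj (sj h)"
      "\<And>T. T \<in> set th1 \<Longrightarrow> good T \<and> 2 / (\<rho> + 1 + R)\<^sup>2 \<le> rat T \<and> rat T \<le> 4 / (\<rho> - R)\<^sup>2"
      using thj hk(1) sm unfolding sj_def by blast
    obtain th2 where th2: "chain qk (ek k) th2 wk (sk k)"
      "\<And>T. T \<in> set th2 \<Longrightarrow> good T \<and> 2 / (\<rho> + 1 + R)\<^sup>2 \<le> rat T \<and> rat T \<le> 4 / (\<rho> - R)\<^sup>2"
      using thk hk(3) sm unfolding ek_def sk_def by blast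
    define ts where "ts = th1 @ map (fA h k) A @ th2 @ map (fB h k) B"
    have cA': "chain qj (sj h) (map (fA h k) A) qk (ek k)"
    proof (rule chain_modify[OF dist(1) ne(1) cA])
      show "fA h k T = modify T (if T = hd A then cutp H qj (sj h) else 0) (if T = hd A then sj h else t1 T)
         (if T = last A then cutp La qk (ek k) else 1) (if T = last A then ek k else t2 T)" for T
        by (simp add: fA_def mA_def m'A_def sA_def eA'_def H_def La_def)
      show "lf qj (sj h) (pa (fA h k (hd A))) = 0"
        using cut_line[of "sj h" H qj] cp(1) by (simp add: fA_def mA_def H_def[symmetric])
      show "lf qk (ek k) (pb (fA h k (last A))) = 0"
        using cut_line[of "ek k" La qk] cp(2) by (simp add: fA_def m'A_def La_def[symmetric])
    qed
    have cB': "chain wk (sk k) (map (fB h k) B) wj (ej h)"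
    proof (rule chain_modify[OF dist(2) ne(2) cB])
      show "fB h k T = modify T (if T = hd B then cutp Hb wk (sk k) else 0) (if T = hd B then sk k else t1 T)
         (if T = last B then cutp Lb wj (ej h) else 1) (if T = last B then ej h else t2 T)" for T
        by (simp add: fB_def mB_def m'B_def sB'_def eB'_def Hb_def Lb_def)
      show "lf wk (sk k) (pa (fB h k (hd B))) = 0"
        using cut_line[of "sk k" Hb wk] cp(3) by (simp add: fB_def mB_def Hb_def[symmetric])
      show "lf wj (ej h) (pb (fB h k (last B))) = 0"
        using cut_line[of "ej h" Lb wj] cp(4) by (simp add: fB_def m'B_def Lb_def[symmetric])
    qed
    have c2: "chain qk (ek k) (th2 @ map (fB h k) B) wj (ej h)" using th2(1) cB' chain_append by blast
    have c3: "chain qj (sj h) (map (fA h k) A @ th2 @ map (fB h k) B) wj (ej h)" using cA' c2 chain_append by blast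
    have c4: "chain wj (t0 + arctan (h / \<rho>)) ts wj (ej h)" unfolding ts_def using th1(1) c3 chain_append by blast
    have eje: "ej h = t0 + arctan (h / \<rho>) + 2 * pi" by (simp add: ej_def)
    have gts: "good T" if "T \<in> set ts" for T using that th1(2) th2(2) d1 by (auto simp: ts_def)
    have rA1: "rat (fA h k T) \<le> M" "0 < h \<and> T = H \<or> 0 < k \<and> T = La \<Longrightarrow> rat (fA h k T) < M" if T: "T \<in> set A" for T
    proof -
      have m1: "mA T h \<le> 0" using cut_start(2)[OF kqj(2,1) cp(1)] ge lt hk by (auto simp: mA_def)
      have m2: "1 \<le> m'A T k" using cut_end(3)[OF kqk(2,1) cp(2)] ge lt hk by (auto simp: m'A_def)
      have s1: "t1 T \<le> sA T h" "eA' T k \<le> t2 T" using ge hk tH by (auto simp: sA_def eA'_def)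
      have sh: "shape T" "shape (fA h k T)" using shp T d1(1)[OF T] good_shape by auto
      have "pb (fA h k T) - pa (fA h k T) = (m'A T k - mA T h) *\<^sub>R (pb T - pa T)"
        unfolding fA_def by (rule modify_base)
      note mono = rat_mono[OF sh this]
      show "rat (fA h k T) \<le> M" using mono(1) m1 m2 s1 AM T by (auto simp: fA_def)
      assume "0 < h \<and> T = H \<or> 0 < k \<and> T = La"
      then have "t1 T < sA T h \<or> eA' T k < t2 T" using gt tH by (auto simp: sA_def eA'_def)
      then show "rat (fA h k T) < M" using mono(2) m1 m2 s1 AM T by (auto simp: fA_def)
    qed
    \<comment> \<open>Outside the run angles can only grow and bases only shrink, so ratios do not
      decrease and \<open>lo\<close> is preserved. Ratios below \<open>M\<close> stay below by the
      choice of \<open>d\<close>; a triangle with ratio \<open>M\<close> is neither first nor last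
      in \<open>B\<close> and is unchanged.\<close>
    have rB1: "lo \<le> rat (fB h k T)" "rat (fB h k T) \<le> M" "rat (fB h k T) = M \<Longrightarrow> rat T = M" if T: "T \<in> set B" for T
    proof -
      have m1: "0 \<le> mB T k" using cut_start(3)[OF kwk(2,1) cp(3)] ge lt hk by (auto simp: mB_def)
      have m2: "m'B T h \<le> 1" using cut_end(2)[OF kwj(2,1) cp(4)] ge lt hk by (auto simp: m'B_def)
      have s1: "sB' T k \<le> t1 T" "t2 T \<le> eB' T h" using ge hk tH by (auto simp: sB'_def eB'_def)
      have sh: "shape T" "shape (fB h k T)" using shp T d1(2)[OF T] good_shape by auto
      define \<kappa> where "\<kappa> = m'B T h - mB T k"
      have e: "pb (fB h k T) - pa (fB h k T) = \<kappa> *\<^sub>R (pb T - pa T)"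
        unfolding fB_def \<kappa>_def by (rule modify_base)
      have "\<kappa> * crs (cis (sB' T k)) (pb T - pa T) > 0"
        using sh(2) unfolding shape_def e crs_scale_right by (simp add: fB_def)
      moreover have "crs (cis (sB' T k)) (pb T - pa T) > 0"
        using cp(3) sh(1) by (auto simp: sB'_def shape_def)
      ultimately have kp: "\<kappa> > 0" by (simp add: zero_less_mult_iff)
      have "pb T - pa T = (1 / \<kappa>) *\<^sub>R (pb (fB h k T) - pa (fB h k T))" unfolding e using kp by simp
      note mono = rat_mono(1)[OF sh(2,1) this]
      have "1 \<le> 1 / \<kappa>" using kp m1 m2 by (simp add: \<kappa>_def)
      then have "rat T \<le> rat (fB h k T)" using mono s1 by (simp add: fB_def)
      then show "lo \<le> rat (fB h k T)" using bnd[rule_format, of T] T by auto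
      have iM: "fB h k T = T" if "\<not> rat T < M"
      proof -
        have "T \<noteq> Hb" "T \<noteq> Lb" using that BM by (auto simp: Hb_def Lb_def)
        then show ?thesis by (simp add: fB_def mB_def m'B_def sB'_def eB'_def)
      qed
      show "rat (fB h k T) \<le> M" using d1(2)[OF T] iM bnd[rule_format, of T] T by (cases "rat T < M") auto
      show "rat T = M" if "rat (fB h k T) = M" using d1(2)[OF T] iM that by (cases "rat T < M") auto
    qed
    have thlt: "rat T < M" "lo \<le> rat T" if "T \<in> set th1 \<or> T \<in> set th2" for T
      using that th1(2)[of T] th2(2)[of T] hi lo by fastforce+
    have bts: "lo \<le> rat T \<and> rat T \<le> M" if Tts: "T \<in> set ts" for T
    proof -
      consider "T \<in> set th1 \<or> T \<in> set th2" | U where "U \<in> set A" "T = fA h k U" | U where "U \<in> set B" "T = fB h k U"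
        using Tts by (auto simp: ts_def)
      then show ?thesis
      proof cases
        case 1
        then show ?thesis using thlt by (meson less_imp_le)
      next
        case 2
        then show ?thesis using d1(1) rA1(1) by (meson less_imp_le)
      next
        case 3
        then show ?thesis using rB1 by blast
      qed
    qed
    have cnt: "length (filter (\<lambda>T. rat T = M) ts) < length (filter (\<lambda>T. rat T = M) (A @ B))" if pos: "0 < h \<or> 0 < k"
    proof -
      have "filter (\<lambda>T. rat T = M) th1 = []" "filter (\<lambda>T. rat T = M) th2 = []"
        using thlt by (force simp: filter_empty_conv)+
      moreover obtain y where y: "y \<in> set A" "rat (fA h k y) < M" using pos rA1(2) mem by blast
      have "length (filter (\<lambda>T. rat T = M) (map (fA h k) A)) < length (filter (\<lambda>T. rat T = M) A)"
        by (rule length_filter_map_less[of _ _ _ _ y]) (use y AM in auto)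
      moreover have "length (filter (\<lambda>T. rat T = M) (map (fB h k) B)) \<le> length (filter (\<lambda>T. rat T = M) B)"
        by (rule length_filter_map_le) (use rB1(3) in auto)
      ultimately show ?thesis by (simp add: ts_def)
    qed
    have ne': "map (fA h k) A \<noteq> []" "map (fB h k) B \<noteq> []" using ne by auto
    have startA: "pa (fA h k T) = pa T" "t1 (fA h k T) = t1 T" if "T \<in> set (tl A)" for T
      using nH[OF that] by (simp_all add: fA_def mA_def sA_def)
    have startB: "pa (fB h k T) = pa T" "t1 (fB h k T) = t1 T" if "T \<in> set (tl B)" for T
      using nHb[OF that] by (simp_all add: fB_def mB_def sB'_def)
    have ap: "allpos \<sigma> h k x" if all: "\<forall>T\<in>set ts. \<sigma> * lf (pa T) (t1 T) x > 0" for \<sigma> x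
      unfolding allpos_def
    proof (intro conjI ballI)
      have nn: "map (fA h k) A @ th2 @ map (fB h k) B \<noteq> []" using ne by simp
      show "\<sigma> * lf wj (t0 + arctan (h / \<rho>)) x > 0"
        by (rule first_line[OF c4[unfolded ts_def] nn]) (use all in \<open>simp add: ts_def\<close>)
      show "\<sigma> * lf qj (sj h) x > 0"
        by (rule first_line[of _ _ "[]", OF _ nn]) (use c3 all in \<open>auto simp: ts_def\<close>)
      show "\<sigma> * lf qk (ek k) x > 0"
        by (rule first_line[OF c2 ne'(2)]) (use all in \<open>auto simp: ts_def\<close>)
      show "\<sigma> * lf wk (sk k) x > 0"
        by (rule first_line[of _ _ "[]", OF _ ne'(2)]) (use cB' all in \<open>auto simp: ts_def\<close>)
      fix T assume T: "T \<in> set (tl A) \<union> set (tl B)"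
      have "set (tl A) \<subseteq> set A" "set (tl B) \<subseteq> set B" by (auto intro: list.set_sel(2) simp: ne)
      then have "fA h k T \<in> set ts \<and> T \<in> set (tl A) \<or> fB h k T \<in> set ts \<and> T \<in> set (tl B)"
        using T by (auto simp: ts_def)
      then show "\<sigma> * lf (pa T) (t1 T) x > 0" using all startA startB by metis
    qed
    have dirs: "crs (cis (t1 T)) z < 0" if z: "crs (cis (t0 + arctan (h / \<rho>))) z < 0" "crs (cis (sj h)) z < 0"
        "crs (cis (ek k)) z < 0" "crs (cis (sk k)) z < 0" "\<forall>T\<in>set (tl A) \<union> set (tl B). crs (cis (t1 T)) z < 0"
      and T: "T \<in> set ts" for z T
    proof -
      consider "T \<in> set th1" | "T \<in> set th2" | U where "U \<in> set A" "T = fA h k U" | U where "U \<in> set B" "T = fB h k U"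
        using T by (auto simp: ts_def)
      then show ?thesis
      proof cases
        case 1
        have le: "\<forall>T\<in>set th1. t1 T \<le> t2 T" using th1(2) good_shape by (force simp: shape_def)
        have "t0 + arctan (h / \<rho>) \<le> t1 T" "t2 T \<le> sj h" using chain_angles(2)[OF th1(1) le 1] by auto
        moreover have "t1 T \<le> t2 T" using le 1 by blast
        moreover have "sj h < t0 + arctan (h / \<rho>) + pi"
        proof -
          have "0 \<le> arctan (h / \<rho>)" using hk(1) rho0 by simp
          then show ?thesis using sm(3) pi_gt_zero unfolding sj_def by linarith
        qed
        ultimately show ?thesis using between_negative[of "t0 + arctan (h / \<rho>)" "t1 T" "sj h" z] z by linarith
      next
        case 2
        have le: "\<forall>T\<in>set th2. t1 T \<le> t2 T" using th2(2) good_shape by (force simp: shape_def)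
        have "ek k \<le> t1 T" "t2 T \<le> sk k" using chain_angles(2)[OF th2(1) le 2] by auto
        moreover have "t1 T \<le> t2 T" using le 2 by blast
        moreover have "sk k < ek k + pi"
        proof -
          have "0 \<le> arctan (k / \<rho>)" using hk(3) rho0 by simp
          then show ?thesis using sm(6) pi_gt_zero unfolding sk_def ek_def by linarith
        qed
        ultimately show ?thesis using between_negative[of "ek k" "t1 T" "sk k" z] z by linarith
      next
        case 3
        show ?thesis
        proof (cases "U = H")
          case True
          then show ?thesis using 3 z by (simp add: fA_def sA_def)
        next
          case False
          then have "U \<in> set (tl A)" using 3 ne by (cases A) (auto simp: H_def)
          then show ?thesis using 3 z startA by auto
        qed
      next
        case 4
        show ?thesis
        proof (cases "U = Hb")
          case True
          then show ?thesis using 4 z by (simp add: fB_def sB'_def)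
        next
          case False
          then have "U \<in> set (tl B)" using 4 ne by (cases B) (auto simp: Hb_def)
          then show ?thesis using 4 z startB by auto
        qed
      qed
    qed
    show ?thesis using c4 eje gts bts cnt ap dirs by (intro exI[of _ ts]) auto
  qed
  define Typ where "Typ \<sigma> h k \<longleftrightarrow> (\<exists>x. allpos \<sigma> h k x)" for \<sigma> h k
  have LbA: "lf (pa Lb) (t1 Lb) wj > 0"
  proof -
    have "crs (cis (t1 Lb)) (pb Lb - pa Lb) > 0" using good_shape[OF gm(4)] by (simp add: shape_def)
    then have "lf (pa Lb) (t1 Lb) (pb Lb) > 0" by (simp add: lf_def)
    moreover have "sin (t0 + 2 * pi - t1 Lb) \<ge> 0"
      using good_shape[OF gm(4)] tH by (intro sin_ge_zero) (auto simp: shape_def)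
    ultimately show ?thesis using kwj(1) unfolding kwj(2) lf_move by (simp add: add_pos_nonneg)
  qed
  have HbB: "lf (pb Hb) (t2 Hb) wk < 0"
  proof -
    have "crs (cis (t2 Hb)) (pb Hb - pa Hb) > 0" using good_shape[OF gm(3)] by (simp add: shape_def)
    then have "lf (pb Hb) (t2 Hb) (pa Hb) < 0" by (simp add: lf_def crs_simps)
    moreover have "sin (t2 Hb - t') \<ge> 0"
      using good_shape[OF gm(3)] tH by (intro sin_ge_zero) (auto simp: shape_def)
    then have "kwk * sin (t' - t2 Hb) \<le> 0" using kwk(1) sin_minus[of "t2 Hb - t'"] by (simp add: mult_nonneg_nonpos)
    ultimately show ?thesis unfolding kwk(2) lf_move by simp
  qed
  have wjH: "lf wj t0 x = lf (pa H) t0 x" and wkHb: "lf wk t' x = lf (pa Hb) t' x" for x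
  proof -
    have "lf wj t0 x = lf qj t0 x" unfolding wqj by (rule lf_base_move)
    then show "lf wj t0 x = lf (pa H) t0 x" unfolding kqj(2) by (simp add: lf_base_move)
    show "lf wk t' x = lf (pa Hb) t' x" unfolding kwk(2) by (rule lf_base_move)
  qed
  have starts: "T = H \<or> T \<in> set (tl A) \<or> T = Hb \<or> T \<in> set (tl B)" if "T \<in> set (A @ B)" for T
    using that ne by (cases A; cases B) (auto simp: H_def Hb_def)
  \<comment> \<open>With \<open>k = 0\<close> only the lines at the start of the run have turned. By
    neutrality of the old cycle \<open>x\<close> is weakly left of the old line of \<open>H\<close>,
    so it lies in the wedge at \<open>wj\<close> between the old and the turned direction. This
    wedge is strictly left of the first line of \<open>Lb\<close>, while \<open>x\<close> is right
    of it.\<close>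
  have noR: "\<not> Typ (- 1) h 0" if h: "0 \<le> h" "h < d" for h
  proof
    assume "Typ (- 1) h 0"
    then obtain x where x: "lf wj (t0 + arctan (h / \<rho>)) x < 0" "lf wk t' x < 0"
       "\<And>T. T \<in> set (tl A) \<union> set (tl B) \<Longrightarrow> lf (pa T) (t1 T) x < 0"
      by (auto simp: Typ_def allpos_def z0)
    have neg: "lf (pa T) (t1 T) x < 0" if "T \<in> set (A @ B)" "T \<noteq> H" for T
      using starts[OF that(1)] that(2) x(2,3) wkHb tH by auto
    obtain U where "U \<in> set (A @ B)" "0 \<le> lf (pa U) (t1 U) x" using neu unfolding neutral_def by blast
    then have "lf (pa H) (t1 H) x \<ge> 0" using neg[of U] by (cases "U = H") auto
    then have p: "lf wj t0 x \<ge> 0" using wjH tH by simp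
    have Lbn: "lf (pa Lb) (t1 Lb) x < 0"
      using neg[of Lb] mem dist by auto
    have a0: "0 \<le> arctan (h / \<rho>)" "arctan (h / \<rho>) < pi / 2" using h rho0 arctan_ubound by auto
    have sh: "t1 Lb < t0 + 2 * pi" "t0 + 2 * pi < t1 Lb + pi" using good_shape[OF gm(4)] tH by (auto simp: shape_def)
    have gB: "good (fB h 0 Lb)" using dd[of h 0] h d mem by auto
    have "ej h < t1 Lb + pi" using good_shape[OF gB] z0 tH by (auto simp: shape_def fB_def sB'_def eB'_def split: if_splits)
    then have up: "t0 + 2 * pi + arctan (h / \<rho>) < t1 Lb + pi" by (simp add: ej_def)
    have "\<exists>r v. r \<ge> 0 \<and> t0 \<le> v \<and> v \<le> t0 + arctan (h / \<rho>) \<and> x = wj + r *\<^sub>R cis v"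
    proof (cases "lf wj t0 x = 0")
      case True
      then obtain r where r: "x = wj + r *\<^sub>R cis t0" by (rule lf_zeroE)
      then have "lf wj (t0 + arctan (h / \<rho>)) x = - (r * sin (arctan (h / \<rho>)))"
        using lf_move[of wj "t0 + arctan (h / \<rho>)" wj r t0] by simp
      then have "r * sin (arctan (h / \<rho>)) > 0" using x(1) by simp
      moreover have "sin (arctan (h / \<rho>)) \<ge> 0" using a0 pi_gt_zero by (intro sin_ge_zero) linarith+
      ultimately have "r \<ge> 0" by (simp add: zero_less_mult_iff)
      then show ?thesis using r a0 by (intro exI[of _ r] exI[of _ t0]) auto
    next
      case False
      then have "crs (cis t0) (x - wj) > 0" "crs (cis (t0 + arctan (h / \<rho>))) (x - wj) < 0"
        using p x(1) by (auto simp: lf_def)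
      moreover from this have "arctan (h / \<rho>) \<noteq> 0" by (metis add.right_neutral less_asym)
      then have "t0 < t0 + arctan (h / \<rho>)" "t0 + arctan (h / \<rho>) < t0 + pi" using a0 pi_gt_zero by linarith+
      ultimately obtain v where "t0 < v" "v < t0 + arctan (h / \<rho>)" "x - wj = cmod (x - wj) *\<^sub>R cis v"
        using between_directions[of t0 "x - wj" "t0 + arctan (h / \<rho>)"] by metis
      then show ?thesis by (intro exI[of _ "cmod (x - wj)"] exI[of _ v]) (auto simp: algebra_simps)
    qed
    then obtain r v where rv: "r \<ge> 0" "t0 \<le> v" "v \<le> t0 + arctan (h / \<rho>)" "x = wj + r *\<^sub>R cis v" by blast
    have "sin (v + 2 * pi - t1 Lb) \<ge> 0" using rv up sh by (intro sin_ge_zero) auto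
    moreover have "sin (v + 2 * pi - t1 Lb) = sin (v - t1 Lb)" using sin_periodic[of "v - t1 Lb"] by (simp add: algebra_simps)
    ultimately have "r * sin (v - t1 Lb) \<ge> 0" using rv(1) by simp
    then have "lf (pa Lb) (t1 Lb) x > 0" using LbA by (simp add: rv(4) lf_move)
    then show False using Lbn by simp
  qed
  \<comment> \<open>Symmetric to \<open>noR\<close>, with the wedge at \<open>wk\<close> and the
    line that leaves \<open>Hb\<close> in place of the line that enters \<open>Lb\<close>.\<close>
  have noL: "\<not> Typ 1 0 k" if k: "0 \<le> k" "k < d" for k
  proof
    assume "Typ 1 0 k"
    then obtain x where x: "lf wj t0 x > 0" "lf wk (t' - arctan (k / \<rho>)) x > 0"
       "\<And>T. T \<in> set (tl A) \<union> set (tl B) \<Longrightarrow> lf (pa T) (t1 T) x > 0"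
      by (auto simp: Typ_def allpos_def z0 sk_def)
    have pos: "lf (pa T) (t1 T) x > 0" if "T \<in> set (A @ B)" "T \<noteq> Hb" for T
      using starts[OF that(1)] that(2) x(1,3) wjH tH by auto
    obtain U where "U \<in> set (A @ B)" "lf (pa U) (t1 U) x \<le> 0" using neu unfolding neutral_def by blast
    then have "lf (pa Hb) (t1 Hb) x \<le> 0" using pos[of U] by (cases "U = Hb") auto
    then have p: "lf wk t' x \<le> 0" using wkHb tH by simp
    have nxt: "lf (pb Hb) (t2 Hb) x > 0"
    proof -
      obtain B' where B': "B = Hb # B'" using ne by (cases B) (auto simp: Hb_def)
      then have c: "chain (pb Hb) (t2 Hb) B' (pa H) (t0 + 2 * pi)" using cB by auto
      show ?thesis
      proof (cases B')
        case Nil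
        then show ?thesis using c lf_cong[of "pb Hb" "t2 Hb" "pa H" x] x(1) wjH by auto
      next
        case (Cons U us)
        then show ?thesis using c lf_cong[of "pb Hb" "t2 Hb" "pa U" x] x(3)[of U] B' by auto
      qed
    qed
    have a0: "0 \<le> arctan (k / \<rho>)" "arctan (k / \<rho>) < pi / 2" using k rho0 arctan_ubound by auto
    have sh: "t' < t2 Hb" "t2 Hb < t' + pi" using good_shape[OF gm(3)] tH by (auto simp: shape_def)
    have gB: "good (fB 0 k Hb)" using dd[of 0 k] k d mem by auto
    have "t2 Hb < sk k + pi" using good_shape[OF gB] z0 tH by (auto simp: shape_def fB_def sB'_def eB'_def split: if_splits)
    then have up: "t2 Hb < t' - arctan (k / \<rho>) + pi" by (simp add: sk_def)
    have "\<exists>r v. r \<ge> 0 \<and> t' - arctan (k / \<rho>) \<le> v \<and> v \<le> t' \<and> x = wk + r *\<^sub>R cis v"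
    proof (cases "lf wk t' x = 0")
      case True
      then obtain r where r: "x = wk + r *\<^sub>R cis t'" by (rule lf_zeroE)
      then have "lf wk (t' - arctan (k / \<rho>)) x = r * sin (arctan (k / \<rho>))"
        using lf_move[of wk "t' - arctan (k / \<rho>)" wk r t'] by simp
      then have "r * sin (arctan (k / \<rho>)) > 0" using x(2) by simp
      moreover have "sin (arctan (k / \<rho>)) \<ge> 0" using a0 pi_gt_zero by (intro sin_ge_zero) linarith+
      ultimately have "r \<ge> 0" by (simp add: zero_less_mult_iff)
      then show ?thesis using r a0 by (intro exI[of _ r] exI[of _ t']) auto
    next
      case False
      then have "crs (cis t') (x - wk) < 0" "crs (cis (t' - arctan (k / \<rho>))) (x - wk) > 0"
        using p x(2) by (auto simp: lf_def)
      moreover from this have "arctan (k / \<rho>) \<noteq> 0" by (metis diff_zero less_asym)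
      then have "t' - arctan (k / \<rho>) < t'" "t' < t' - arctan (k / \<rho>) + pi" using a0 pi_gt_zero by linarith+
      ultimately obtain v where "t' - arctan (k / \<rho>) < v" "v < t'" "x - wk = cmod (x - wk) *\<^sub>R cis v"
        using between_directions[of "t' - arctan (k / \<rho>)" "x - wk" t'] by metis
      then show ?thesis by (intro exI[of _ "cmod (x - wk)"] exI[of _ v]) (auto simp: algebra_simps)
    qed
    then obtain r v where rv: "r \<ge> 0" "t' - arctan (k / \<rho>) \<le> v" "v \<le> t'" "x = wk + r *\<^sub>R cis v" by blast
    have "sin (t2 Hb - v) \<ge> 0" using rv up sh by (intro sin_ge_zero) auto
    then have "r * sin (v - t2 Hb) \<le> 0" using rv(1) sin_minus[of "t2 Hb - v"] by (simp add: mult_nonneg_nonpos)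
    then have "lf (pb Hb) (t2 Hb) x < 0" using HbB by (simp add: rv(4) lf_move)
    then show False using nxt by simp
  qed
  \<comment> \<open>The difference of two such points would be on the negative side of all
    directions of one closed chain.\<close>
  have excl: "\<not> (Typ 1 h k \<and> Typ (- 1) h k)" if hk: "0 \<le> h" "h < d" "0 \<le> k" "k < d" for h k
  proof
    assume "Typ 1 h k \<and> Typ (- 1) h k"
    then obtain x y where xy: "allpos 1 h k x" "allpos (- 1) h k y" by (auto simp: Typ_def)
    obtain ts where ts: "chain wj (t0 + arctan (h / \<rho>)) ts wj (t0 + arctan (h / \<rho>) + 2 * pi)" "\<forall>T\<in>set ts. good T"
      "\<And>z. crs (cis (t0 + arctan (h / \<rho>))) z < 0 \<and> crs (cis (sj h)) z < 0 \<and> crs (cis (ek k)) z < 0 \<and>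
         crs (cis (sk k)) z < 0 \<and> (\<forall>T\<in>set (tl A) \<union> set (tl B). crs (cis (t1 T)) z < 0) \<Longrightarrow>
         (\<forall>T\<in>set ts. crs (cis (t1 T)) z < 0)"
      using key[OF hk] by blast
    have df: "crs (cis s) (y - x) < 0" if "lf p s x > 0" "lf p s y < 0" for p s
      using that by (simp add: lf_def crs_simps)
    have "crs (cis (t0 + arctan (h / \<rho>))) (y - x) < 0 \<and> crs (cis (sj h)) (y - x) < 0 \<and> crs (cis (ek k)) (y - x) < 0 \<and>
         crs (cis (sk k)) (y - x) < 0 \<and> (\<forall>T\<in>set (tl A) \<union> set (tl B). crs (cis (t1 T)) (y - x) < 0)"
      using xy unfolding allpos_def by (auto intro!: df)
    from ts(3)[OF this] have all: "\<forall>T\<in>set ts. crs (cis (t1 T)) (y - x) < 0" .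
    have "closed_chain ts" using closed_chainI[OF ts(1)] .
    moreover have "\<forall>T\<in>set ts. t2 T < t1 T + pi" using ts(2) good_shape by (auto simp: shape_def)
    moreover have "y - x \<noteq> 0"
      using xy by (auto simp: allpos_def)
    ultimately show False using no_common_side[of ts "y - x"] all by force
  qed
  define \<delta> where "\<delta> = d / 2"
  have dl: "0 < \<delta>" "\<delta> < d" using d by (auto simp: \<delta>_def)
  \<comment> \<open>On the segment from \<open>(\<delta>, 0)\<close> to \<open>(0, \<delta>)\<close>
    the two kinds of one-sidedness are open and disjoint conditions. If they covered it,
    \<open>noR\<close> and \<open>noL\<close> would put the two ends into different ones, against
    connectedness. At least one opening is positive at every point of the segment.\<close>
  define V where "V \<sigma> = {s. Typ \<sigma> ((1 - s) * \<delta>) (s * \<delta>)}" for \<sigma> :: real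
  have oV: "open (V \<sigma>)" for \<sigma>
  proof -
    have e: "V \<sigma> = (\<Union>x. {s. \<sigma> * lf wj (t0 + arctan ((1 - s) * \<delta> / \<rho>)) x > 0} \<inter> {s. \<sigma> * lf qj (sj ((1 - s) * \<delta>)) x > 0} \<inter>
        {s. \<sigma> * lf qk (ek (s * \<delta>)) x > 0} \<inter> {s. \<sigma> * lf wk (sk (s * \<delta>)) x > 0} \<inter>
        {s. \<forall>T\<in>set (tl A) \<union> set (tl B). \<sigma> * lf (pa T) (t1 T) x > 0})"
      by (auto simp: V_def Typ_def allpos_def simp del: Collect_const)
    have o: "open {s. \<sigma> * lf p (f s) x > 0}" if "continuous_on UNIV f" for p x f
      unfolding lf_def using that by (intro open_Collect_less continuous_intros)
    have "tauj \<noteq> \<rho>" "tauk \<noteq> \<rho>" using tj tk by auto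
    then show ?thesis unfolding e sj_def ek_def sk_def
      by (intro open_UN ballI open_Int o open_Collect_const continuous_intros) (use rho0 in auto)
  qed
  have "\<exists>s\<in>{0..1}. s \<notin> V 1 \<and> s \<notin> V (- 1)"
  proof (rule ccontr)
    assume "\<not> ?thesis"
    then have cov: "{0..1} \<subseteq> V 1 \<union> V (- 1)" by auto
    have rng: "0 \<le> (1 - s) * \<delta> \<and> (1 - s) * \<delta> < d \<and> 0 \<le> s * \<delta> \<and> s * \<delta> < d" if "s \<in> {0..1}" for s
    proof -
      have "(1 - s) * \<delta> \<le> 1 * \<delta>" "s * \<delta> \<le> 1 * \<delta>" using that dl by (intro mult_right_mono; simp)+
      moreover have "0 \<le> (1 - s) * \<delta>" "0 \<le> s * \<delta>" using that dl by auto
      ultimately show ?thesis using dl by linarith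
    qed
    have "V 1 \<inter> V (- 1) \<inter> {0..1} = {}" using excl rng by (force simp: V_def)
    moreover have "0 \<notin> V (- 1)" "1 \<notin> V 1" using noR[of \<delta>] noL[of \<delta>] dl by (auto simp: V_def)
    moreover have "(0::real) \<in> {0..1}" "(1::real) \<in> {0..1}" by auto
    ultimately have "0 \<in> V 1" "1 \<in> V (- 1)" using cov by blast+
    moreover have "connected {0..1::real}" by simp
    moreover note \<open>V 1 \<inter> V (- 1) \<inter> {0..1} = {}\<close>
    ultimately show False using connectedD[OF _ oV oV, of "{0..1}" 1 "- 1"] cov by (auto simp: disjoint_iff)
  qed
  then obtain s where s: "0 \<le> s" "s \<le> 1" "\<not> Typ 1 ((1 - s) * \<delta>) (s * \<delta>)" "\<not> Typ (- 1) ((1 - s) * \<delta>) (s * \<delta>)"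
    by (auto simp: V_def)
  define h k where "h = (1 - s) * \<delta>" and "k = s * \<delta>"
  have hk: "0 \<le> h" "h < d" "0 \<le> k" "k < d"
  proof -
    have "(1 - s) * \<delta> \<le> 1 * \<delta>" "s * \<delta> \<le> 1 * \<delta>" using s dl by (intro mult_right_mono; simp)+
    moreover have "0 \<le> (1 - s) * \<delta>" "0 \<le> s * \<delta>" using s dl by auto
    ultimately show "0 \<le> h" "h < d" "0 \<le> k" "k < d" using dl unfolding h_def k_def by linarith+
  qed
  have hk0: "0 < h \<or> 0 < k" using s dl by (cases "s = 0") (auto simp: h_def k_def)
  obtain ts where ts: "chain wj (t0 + arctan (h / \<rho>)) ts wj (t0 + arctan (h / \<rho>) + 2 * pi)"
      "\<forall>T\<in>set ts. good T \<and> lo \<le> rat T \<and> rat T \<le> M"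
      "length (filter (\<lambda>T. rat T = M) ts) < length (filter (\<lambda>T. rat T = M) (A @ B))"
      "\<And>\<sigma> x. (\<forall>T\<in>set ts. \<sigma> * lf (pa T) (t1 T) x > 0) \<Longrightarrow> allpos \<sigma> h k x"
    using key[OF hk] hk0 by blast
  have "sys ts" using closed_chainI[OF ts(1)] ts(2) by (simp add: sys_def)
  moreover have "neutral ts"
    unfolding neutral_def
  proof (intro allI conjI; rule ccontr)
    fix x
    assume "\<not> (\<exists>T\<in>set ts. lf (pa T) (t1 T) x \<le> 0)"
    then have "Typ 1 h k" using ts(4)[of 1 x] by (auto simp: Typ_def not_le)
    then show False using s by (simp add: h_def k_def)
  next
    fix x
    assume "\<not> (\<exists>T\<in>set ts. lf (pa T) (t1 T) x \<ge> 0)"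
    then have "Typ (- 1) h k" using ts(4)[of "- 1" x] by (auto simp: Typ_def not_le)
    then show False using s by (simp add: h_def k_def)
  qed
  ultimately show ?thesis using ts(2,3) by blast
qed

end

section \<open>Each side carries at most one base\<close>

context polygon
begin

lemma half_disc:
  assumes sh: "shape T" and m: "0 < m" "m < 1"
  obtains e where "e > 0" "\<And>x. dist x (pa T + m *\<^sub>R (pb T - pa T)) < e \<Longrightarrow> crs (pb T - pa T) (x - pa T) < 0 \<Longrightarrow> x \<in> sreg T"
proof -
  let ?x = "pa T + m *\<^sub>R (pb T - pa T)"
  define U where "U = {x. lf (pa T) (t1 T) x > 0 \<and> lf (pb T) (t2 T) x < 0}"
  have "open U" unfolding U_def lf_def by (intro open_Collect_conj open_Collect_less continuous_intros)
  moreover have "?x \<in> U"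
  proof -
    have "lf (pa T) (t1 T) ?x = m * crs (cis (t1 T)) (pb T - pa T)" by (simp add: lf_def crs_scale_right)
    moreover have "lf (pb T) (t2 T) ?x = - ((1 - m) * crs (cis (t2 T)) (pb T - pa T))"
      by (simp add: lf_def crs_simps algebra_simps)
    ultimately show ?thesis using sh m by (simp add: U_def shape_def)
  qed
  ultimately obtain e where "e > 0" "ball ?x e \<subseteq> U" using open_contains_ball by blast
  then show ?thesis by (intro that[of e]) (auto simp: sreg_def U_def dist_commute subset_iff)
qed

text \<open>If the two rays converged, Cramer's rule would give their crossing point at the positive
  distances \<open>r\<close> and \<open>s\<close>, a common point of the two sectors.\<close>

lemma rays_do_not_cross:
  assumes g: "good T1" "good T2" and dis: "sreg T1 \<inter> sreg T2 = {}"
    and m: "0 < m1" "m1 < 1" "0 < m2" "m2 < 1"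
    and x1: "x1 = pa T1 + m1 *\<^sub>R (pb T1 - pa T1)" and x2: "x2 = pa T2 + m2 *\<^sub>R (pb T2 - pa T2)"
    and d: "x2 - x1 = k1 *\<^sub>R (pb T1 - pa T1)" "x2 - x1 = k2 *\<^sub>R (pb T2 - pa T2)" "k1 > 0" "k2 > 0"
    and w: "t1 T1 \<le> w1" "w1 \<le> t2 T1" "t1 T2 \<le> w2" "w2 \<le> t2 T2"
  shows "crs (cis w1) (cis w2) \<ge> 0"
proof (rule ccontr)
  assume "\<not> ?thesis"
  then have neg: "crs (cis w1) (cis w2) < 0" by simp
  define \<kappa> where "\<kappa> = - crs (cis w1) (cis w2)"
  have sh: "shape T1" "shape T2" using g good_shape by auto
  define D0 where "D0 = x2 - x1"
  have c1: "crs (cis w1) D0 > 0"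
    using shape_direction[OF sh(1) w(1,2)] d(1,3) crs_commute[of "cis w1"] by (simp add: D0_def crs_scale_right crs_scale_left mult_pos_neg)
  have c2: "crs (cis w2) D0 > 0"
    using shape_direction[OF sh(2) w(3,4)] d(2,4) crs_commute[of "cis w2"] by (simp add: D0_def crs_scale_right crs_scale_left mult_pos_neg)
  define r s where "r = crs (cis w2) D0 / \<kappa>" and "s = crs (cis w1) D0 / \<kappa>"
  have "\<kappa> > 0" using neg by (simp add: \<kappa>_def)
  then have rs: "r > 0" "s > 0" using c1 c2 by (auto simp: r_def s_def)
  have "\<kappa> *\<^sub>R D0 = crs (cis w2) D0 *\<^sub>R cis w1 - crs (cis w1) D0 *\<^sub>R cis w2"
    by (simp add: \<kappa>_def complex_eq_iff crs_def algebra_simps)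
  then have "(1 / \<kappa>) *\<^sub>R (\<kappa> *\<^sub>R D0) = (1 / \<kappa>) *\<^sub>R (crs (cis w2) D0 *\<^sub>R cis w1 - crs (cis w1) D0 *\<^sub>R cis w2)" by simp
  then have "D0 = r *\<^sub>R cis w1 - s *\<^sub>R cis w2"
    using neg by (simp add: \<kappa>_def r_def s_def scaleR_diff_right)
  then have "x1 + r *\<^sub>R cis w1 = x2 + s *\<^sub>R cis w2" by (simp add: D0_def algebra_simps)
  moreover have "x1 + r *\<^sub>R cis w1 \<in> sreg T1" unfolding x1 using sreg_base_move[OF sh(1)] m w rs by simp
  moreover have "x2 + s *\<^sub>R cis w2 \<in> sreg T2" unfolding x2 using sreg_base_move[OF sh(2)] m w rs by simp
  ultimately show False using dis by auto
qed

text \<open>The middle rays of the two sectors together with the segment between the midpoints of the bases cut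
  off a region that contains boundary points but, \<open>D\<close> being connected, no point of \<open>D\<close>.\<close>

lemma not_two_bases_ordered:
  assumes g: "good T1" "good T2" and dis: "sreg T1 \<inter> sreg T2 = {}"
    and e: "e < n" "pa T1 \<in> edge e" "pb T1 \<in> edge e" "pa T2 \<in> edge e" "pb T2 \<in> edge e"
    and d: "pb T2 - pa T2 = c *\<^sub>R (pb T1 - pa T1)" "c > 0"
    and o: "pa T2 = pb T1 + k *\<^sub>R (pb T1 - pa T1)" "k \<ge> 0"
  shows False
proof -
  have sh: "shape T1" "shape T2" using g good_shape by auto
  define D0 where "D0 = pb T1 - pa T1"
  define x1 x2 where "x1 = pa T1 + (1 / 2) *\<^sub>R D0" and "x2 = pa T2 + (1 / 2) *\<^sub>R (pb T2 - pa T2)"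
  define w1 w2 where "w1 = (t1 T1 + t2 T1) / 2" and "w2 = (t1 T2 + t2 T2) / 2"
  have w: "t1 T1 < w1" "w1 < t2 T1" "t1 T2 < w2" "w2 < t2 T2" "t2 T1 < w1 + pi"
  proof -
    have "t1 T1 < t2 T1" "t2 T1 < t1 T1 + pi" "t1 T2 < t2 T2" using sh by (auto simp: shape_def)
    then show "t1 T1 < w1" "w1 < t2 T1" "t1 T2 < w2" "w2 < t2 T2" "t2 T1 < w1 + pi"
      using pi_gt_zero by (simp_all add: w1_def w2_def field_simps)
  qed
  define k0 where "k0 = 1 / 2 + k + c / 2"
  have pts: "pb T1 = pa T1 + D0" "pa T2 = pa T1 + (1 + k) *\<^sub>R D0" "pb T2 = pa T1 + (1 + k + c) *\<^sub>R D0"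
  proof -
    show 1: "pb T1 = pa T1 + D0" by (simp add: D0_def)
    show 2: "pa T2 = pa T1 + (1 + k) *\<^sub>R D0" using o(1) 1 by (simp add: D0_def[symmetric] algebra_simps)
    have "pb T2 = pa T2 + c *\<^sub>R D0" using d(1) by (simp add: D0_def algebra_simps)
    then show "pb T2 = pa T1 + (1 + k + c) *\<^sub>R D0" by (simp add: 2 algebra_simps)
  qed
  have k0: "k0 > 0" "x2 - x1 = k0 *\<^sub>R D0"
  proof -
    show "k0 > 0" using d(2) o(2) by (simp add: k0_def)
    show "x2 - x1 = k0 *\<^sub>R D0" unfolding x1_def x2_def pts(2,3)
      by (simp add: k0_def complex_eq_iff algebra_simps)
  qed
  have ncr: "crs (cis w) (cis w2) \<ge> 0" if "t1 T1 \<le> w" "w \<le> t2 T1" for w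
  proof (rule rays_do_not_cross[OF g dis, of "1 / 2" "1 / 2" x1 x2 k0 "k0 / c"])
    show "x2 - x1 = (k0 / c) *\<^sub>R (pb T2 - pa T2)" using d k0(2) by (simp add: D0_def)
  qed (use that w k0 d in \<open>auto simp: x1_def x2_def D0_def\<close>)
  define B where "B = {x. crs (cis w1) (x - x1) > 0 \<and> crs (cis w2) (x - x2) < 0 \<and> crs D0 (x - x1) < 0}"
  have oB: "open B" unfolding B_def by (intro open_Collect_conj open_Collect_less continuous_intros)
  have D1: "crs D0 (cis w) < 0" if "t1 T1 \<le> w" "w \<le> t2 T1" for w
    using shape_direction[OF sh(1)] that by (simp add: D0_def)
  have D2: "crs D0 (cis w2) < 0"
    using shape_direction[OF sh(2), of w2] w d by (simp add: D0_def crs_scale_left mult_less_0_iff)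
  have ray1: "x1 + r *\<^sub>R cis w1 \<in> sreg T1" if "r > 0" for r
    unfolding x1_def D0_def using sreg_base_move[OF sh(1)] that w by simp
  have ray2: "x2 + r *\<^sub>R cis w2 \<in> sreg T2" if "r > 0" for r
    unfolding x2_def using sreg_base_move[OF sh(2)] that w by simp
  obtain r where r: "r \<ge> 0" "pb T1 + r *\<^sub>R cis (t2 T1) \<in> verts" using g by (auto simp: good_def)
  define y where "y = pb T1 + r *\<^sub>R cis (t2 T1)"
  have D00: "D0 \<noteq> 0" using sh by (auto simp: D0_def shape_def)
  \<comment> \<open>\<open>pb T1\<close> lies strictly inside the edge and so is not a vertex; the
    vertex on the second side of the sector is strictly beyond it.\<close>
  have r0: "r > 0"
  proof (rule ccontr)
    assume "\<not> r > 0"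
    then have bv: "pb T1 \<in> verts" using r by simp
    have "pb T1 \<in> open_segment (pa T1) (pb T2)"
    proof -
      have s: "1 + k + c > 1" using d o by simp
      have "(1 - 1 / (1 + k + c)) *\<^sub>R pa T1 + (1 / (1 + k + c)) *\<^sub>R pb T2 = pa T1 + (1 / (1 + k + c) * (1 + k + c)) *\<^sub>R D0"
        unfolding pts(3) scaleR_add_right scaleR_scaleR by (simp only: scaleR_diff_left scaleR_one) simp
      also have "\<dots> = pb T1" using s by (simp add: pts(1))
      finally have "pb T1 = (1 - 1 / (1 + k + c)) *\<^sub>R pa T1 + (1 / (1 + k + c)) *\<^sub>R pb T2" by simp
      moreover have "pa T1 \<noteq> pb T2" using pts(3) D00 s by auto
      ultimately show ?thesis using d o unfolding in_segment
        by (intro conjI exI[of _ "1 / (1 + k + c)"]) auto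
    qed
    moreover have "pb T1 = P e \<or> pb T1 = Q e" using vert[OF e(1) bv e(3)] .
    moreover have "open_segment (pa T1) (pb T2) \<subseteq> open_segment (P e) (Q e)"
      using e(2,5) by (simp add: edge_def subset_open_segment)
    ultimately show False by (auto simp: open_segment_def)
  qed
  have yb: "y \<in> bd" using r verts_bd by (auto simp: y_def)
  have "y \<in> B"
  proof -
    have "y - x1 = (1 / 2) *\<^sub>R D0 + r *\<^sub>R cis (t2 T1)" by (simp add: y_def x1_def pts(1) complex_eq_iff)
    then have e1: "crs z (y - x1) = crs z D0 / 2 + r * crs z (cis (t2 T1))" for z
      by (simp add: crs_add_right crs_scale_right)
    have "y - x2 = y - x1 - k0 *\<^sub>R D0" using k0(2) by (simp add: algebra_simps)
    then have e2: "crs z (y - x2) = - ((k0 - 1 / 2) * crs z D0) + r * crs z (cis (t2 T1))" for z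
      by (simp only: crs_diff_right[of z "y - x1"] crs_scale_right e1) (simp add: algebra_simps)
    have "sin (t2 T1 - w1) > 0" using w by (intro sin_gt_zero) auto
    then have "crs (cis w1) (cis (t2 T1)) > 0" by (simp add: crs_cis)
    moreover have "crs (cis w1) D0 > 0" using D1[of w1] w crs_commute[of "cis w1"] by simp
    ultimately have "crs (cis w1) (y - x1) > 0" using r0 by (simp add: e1 add_pos_pos)
    moreover have "crs D0 (y - x1) < 0" using D1[of "t2 T1"] r0 w by (simp add: e1 mult_pos_neg)
    moreover have "crs (cis w2) (y - x2) < 0"
    proof -
      have "crs (cis w2) (cis (t2 T1)) \<le> 0" using ncr[of "t2 T1"] w crs_commute[of "cis w2"] by simp
      moreover have "crs (cis w2) D0 > 0" using D2 crs_commute[of "cis w2"] by simp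
      moreover have "k0 - 1 / 2 > 0" using o d by (simp add: k0_def add_nonneg_pos)
      ultimately show ?thesis unfolding e2 using r0 by (smt (verit) mult_nonneg_nonpos mult_pos_pos)
    qed
    ultimately show ?thesis by (simp add: B_def)
  qed
  have seg: "closed_segment x1 x2 \<subseteq> bd"
  proof -
    have cv: "convex (edge e)" by (simp add: edge_def)
    have "x1 = (1 - 1 / 2) *\<^sub>R pa T1 + (1 / 2) *\<^sub>R pb T1" "x2 = (1 - 1 / 2) *\<^sub>R pa T2 + (1 / 2) *\<^sub>R pb T2"
      by (auto simp: x1_def x2_def D0_def algebra_simps complex_eq_iff)
    then have "x1 \<in> edge e" "x2 \<in> edge e"
      using convexD_alt[OF cv e(2,3), of "1 / 2"] convexD_alt[OF cv e(4,5), of "1 / 2"] by auto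
    then show ?thesis using closed_segment_subset[OF _ _ cv] edge_bd[OF e(1)] by blast
  qed
  have fr: "D \<inter> frontier B = {}"
  proof (rule ccontr)
    assume "D \<inter> frontier B \<noteq> {}"
    then obtain x where x: "x \<in> D" "x \<in> frontier B" by auto
    have xnb: "x \<notin> bd" using x(1) open_D frontier_D frontier_disjoint_eq by blast
    have xn: "x \<notin> sreg T1" "x \<notin> sreg T2" using sreg_D g x by blast+
    have "closed {x. crs (cis w1) (x - x1) \<ge> 0 \<and> crs (cis w2) (x - x2) \<le> 0 \<and> crs D0 (x - x1) \<le> 0}" (is "closed ?C")
      by (intro closed_Collect_conj closed_Collect_le continuous_intros)
    moreover have "B \<subseteq> ?C" by (auto simp: B_def)
    ultimately have "closure B \<subseteq> ?C" using closure_minimal by blast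
    then have xc: "crs (cis w1) (x - x1) \<ge> 0" "crs (cis w2) (x - x2) \<le> 0" "crs D0 (x - x1) \<le> 0"
      using x(2) by (auto simp: frontier_def)
    have "x \<notin> B" using x(2) oB by (simp add: frontier_def interior_open)
    then consider "crs (cis w1) (x - x1) = 0" | "crs (cis w2) (x - x2) = 0" | "crs D0 (x - x1) = 0"
      using xc unfolding B_def by force
    then show False
    proof cases
      case 1
      then obtain s where s: "x - x1 = s *\<^sub>R cis w1" using crs_eq_0_scale by (metis cis_neq_zero)
      then have "s * crs D0 (cis w1) \<le> 0" using xc(3) by (simp add: crs_scale_right)
      then have "s \<ge> 0" using D1[of w1] w by (simp add: mult_le_0_iff)
      moreover have "x = x1 + s *\<^sub>R cis w1" using s by (simp add: algebra_simps)
      ultimately show False using ray1[of s] xn xnb seg by (cases "s = 0") auto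
    next
      case 2
      then obtain s where s: "x - x2 = s *\<^sub>R cis w2" using crs_eq_0_scale by (metis cis_neq_zero)
      have "x - x1 = s *\<^sub>R cis w2 + k0 *\<^sub>R D0" using s k0(2) by (simp add: algebra_simps)
      then have "s * crs D0 (cis w2) \<le> 0" using xc(3) by (simp add: crs_add_right crs_scale_right)
      then have "s \<ge> 0" using D2 by (simp add: mult_le_0_iff)
      moreover have "x = x2 + s *\<^sub>R cis w2" using s by (simp add: algebra_simps)
      ultimately show False using ray2[of s] xn xnb seg by (cases "s = 0") auto
    next
      case 3
      then obtain s where s: "x - x1 = s *\<^sub>R D0" using crs_eq_0_scale D00 by blast
      have "s * crs (cis w1) D0 \<ge> 0" using xc(1) by (simp add: s crs_scale_right)
      moreover have "crs (cis w1) D0 > 0" using D1[of w1] w crs_commute[of "cis w1"] by simp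
      ultimately have s0: "s \<ge> 0" by (simp add: zero_le_mult_iff)
      have "x - x2 = (s - k0) *\<^sub>R D0" using s k0(2) by (simp add: algebra_simps)
      then have "(s - k0) * crs (cis w2) D0 \<le> 0" using xc(2) by (simp add: crs_scale_right)
      moreover have "crs (cis w2) D0 > 0" using D2 crs_commute[of "cis w2"] by simp
      ultimately have s1: "s \<le> k0" by (simp add: mult_le_0_iff)
      have "x = (1 - s / k0) *\<^sub>R x1 + (s / k0) *\<^sub>R x2"
      proof -
        have "(1 - s / k0) *\<^sub>R x1 + (s / k0) *\<^sub>R x2 = x1 + (s / k0) *\<^sub>R (x2 - x1)" by (simp add: algebra_simps)
        also have "\<dots> = x" using k0 s by (simp add: algebra_simps)
        finally show ?thesis by simp
      qed
      then have "x \<in> closed_segment x1 x2" using s0 s1 k0 unfolding in_segment by (intro exI[of _ "s / k0"]) auto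
      then show False using seg xnb by blast
    qed
  qed
  \<comment> \<open>\<open>D\<close> can approach \<open>x1\<close> only from behind the base line,
    so it has a point outside \<open>B\<close> and, being connected, no point in \<open>B\<close>.
    But \<open>y\<close> is in \<open>B\<close> and is a limit of points of
    \<open>D\<close>.\<close>
  obtain \<epsilon> where ep: "\<epsilon> > 0" "\<And>x. dist x x1 < \<epsilon> \<Longrightarrow> crs D0 (x - pa T1) < 0 \<Longrightarrow> x \<in> sreg T1"
    using half_disc[OF sh(1), of "1 / 2"] unfolding x1_def D0_def by auto
  have "x1 \<in> closure D" using seg frontier_D by (auto simp: frontier_def)
  then obtain z where z: "z \<in> D" "dist z x1 < \<epsilon>" using ep(1) closure_approachable by blast
  then have "\<not> crs D0 (z - pa T1) < 0" using ep(2) sreg_D g(1) by blast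
  moreover have "crs D0 (z - x1) = crs D0 (z - pa T1)" by (simp add: x1_def crs_simps)
  ultimately have "z \<notin> B" by (simp add: B_def)
  then have "D \<inter> B = {}" using connected_Int_frontier[OF connected_D, of B] fr z(1) by blast
  then have "closure D \<inter> B = {}" using oB open_Int_closure_eq_empty by blast
  moreover have "y \<in> closure D" using yb frontier_D by (auto simp: frontier_def)
  ultimately show False using \<open>y \<in> B\<close> by blast
qed

text \<open>Otherwise the two sectors lie on different sides of the edge, and \<open>D\<close> has no points near it.\<close>

lemma same_orientation:
  assumes g: "good T1" "good T2"
    and e: "e < n" "pa T1 \<in> edge e" "pb T1 \<in> edge e" "pa T2 \<in> edge e" "pb T2 \<in> edge e"
  obtains c where "c > 0" "pb T2 - pa T2 = c *\<^sub>R (pb T1 - pa T1)"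
proof -
  have sh: "shape T1" "shape T2" using g good_shape by auto
  define p f where "p = P e" and "f = Q e - P e"
  have f0: "f \<noteq> 0" using PQ[OF e(1)] by (simp add: f_def)
  have par: "\<exists>\<alpha>. 0 \<le> \<alpha> \<and> \<alpha> \<le> 1 \<and> x = p + \<alpha> *\<^sub>R f" if "x \<in> edge e" for x
    using that by (auto simp: edge_def in_segment p_def f_def algebra_simps)
  obtain \<alpha>1 \<beta>1 where ab1: "0 \<le> \<alpha>1" "\<alpha>1 \<le> 1" "pa T1 = p + \<alpha>1 *\<^sub>R f" "0 \<le> \<beta>1" "\<beta>1 \<le> 1" "pb T1 = p + \<beta>1 *\<^sub>R f"
    using par e(2,3) by blast
  obtain \<alpha>2 \<beta>2 where ab2: "0 \<le> \<alpha>2" "\<alpha>2 \<le> 1" "pa T2 = p + \<alpha>2 *\<^sub>R f" "0 \<le> \<beta>2" "\<beta>2 \<le> 1" "pb T2 = p + \<beta>2 *\<^sub>R f"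
    using par e(4,5) by blast
  define c1 c2 where "c1 = \<beta>1 - \<alpha>1" and "c2 = \<beta>2 - \<alpha>2"
  have d1: "pb T1 - pa T1 = c1 *\<^sub>R f" and d2: "pb T2 - pa T2 = c2 *\<^sub>R f"
    by (simp_all add: ab1 ab2 c1_def c2_def algebra_simps)
  have c0: "c1 \<noteq> 0" "c2 \<noteq> 0" using sh d1 d2 by (auto simp: shape_def)
  have "c1 * c2 > 0"
  proof (rule ccontr)
    assume "\<not> c1 * c2 > 0"
    then have opp: "c1 * c2 < 0" using c0 by (simp add: less_le not_less)
    define \<mu>1 \<mu>2 where "\<mu>1 = (\<alpha>1 + \<beta>1) / 2" and "\<mu>2 = (\<alpha>2 + \<beta>2) / 2"
    have mu: "0 < \<mu>1" "\<mu>1 < 1" "0 < \<mu>2" "\<mu>2 < 1" using ab1 ab2 c0 by (auto simp: \<mu>1_def \<mu>2_def c1_def c2_def)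
    \<comment> \<open>The piece \<open>S\<close> of the edge contains both midpoints but no vertex,
      hence has positive distance from all other edges.\<close>
    define u v where "u = min \<mu>1 \<mu>2 / 2" and "v = (1 + max \<mu>1 \<mu>2) / 2"
    have uv: "0 < u" "u < \<mu>1" "u < \<mu>2" "\<mu>1 < v" "\<mu>2 < v" "v < 1" using mu by (auto simp: u_def v_def min_def max_def)
    define S where "S = (\<lambda>x. p + x *\<^sub>R f) ` {u..v}"
    define E where "E = (\<Union>k\<in>{..<n} - {e}. edge k)"
    have cS: "compact S" unfolding S_def by (intro compact_continuous_image continuous_intros) auto
    have cE: "closed E" unfolding E_def by (intro closed_UN) (auto simp: compact_edge compact_imp_closed)
    have SE: "S \<inter> E = {}"
    proof (rule ccontr)
      assume "S \<inter> E \<noteq> {}"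
      then obtain y where y: "y \<in> S" "y \<in> E" by blast
      obtain x where x0: "u \<le> x" "x \<le> v" "y = p + x *\<^sub>R f" using y(1) by (auto simp: S_def)
      obtain k where "k < n" "k \<noteq> e" "y \<in> edge k" using y(2) by (auto simp: E_def)
      then have x: "u \<le> x" "x \<le> v" "k < n" "k \<noteq> e" "p + x *\<^sub>R f \<in> edge k" using x0 by auto
      have "p + x *\<^sub>R f \<in> edge e" using x uv unfolding edge_def in_segment p_def f_def
        by (intro CollectI exI[of _ x]) (auto simp: algebra_simps)
      moreover from this have "p + x *\<^sub>R f \<in> verts" using meet x e(1) by blast
      ultimately have "p + x *\<^sub>R f = P e \<or> p + x *\<^sub>R f = Q e" using vert[OF e(1)] by blast
      moreover have "Q e = p + 1 *\<^sub>R f" by (simp add: p_def f_def)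
      ultimately have "x *\<^sub>R f = 0 \<or> (x - 1) *\<^sub>R f = 0" by (auto simp: p_def algebra_simps)
      then show False using f0 x uv by auto
    qed
    obtain \<delta> where del: "\<delta> > 0" "\<And>x y. x \<in> S \<Longrightarrow> y \<in> E \<Longrightarrow> \<delta> \<le> dist x y"
      using separate_compact_closed[OF cS cE SE] by blast
    define N where "N = (norm f)\<^sup>2"
    have N0: "N > 0" using f0 by (simp add: N_def)
    \<comment> \<open>Open rectangles of height \<delta> on the two sides of \<open>S\<close>, in
      coordinates across and along the edge; the sign \<sigma> selects the side.\<close>
    define H where "H \<sigma> = {x. \<sigma> * crs f (x - p) > 0 \<and> \<sigma> * crs f (x - p) < \<delta> * norm f \<and>
       u * N < inner f (x - p) \<and> inner f (x - p) < v * N}" for \<sigma> :: real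
    have conv: "convex (H \<sigma>)" for \<sigma>
    proof -
      have h: "convex {x. a < c * crs f (x - p)}" "convex {x. c * crs f (x - p) < a}" for a c
      proof -
        have e: "c * crs f (x - p) = inner (c *\<^sub>R Complex (- Im f) (Re f)) x - c * crs f p" for x
          by (simp add: crs_def inner_complex_def algebra_simps)
        have "{x. a < c * crs f (x - p)} = {x. inner (c *\<^sub>R Complex (- Im f) (Re f)) x > a + c * crs f p}"
          "{x. c * crs f (x - p) < a} = {x. inner (c *\<^sub>R Complex (- Im f) (Re f)) x < a + c * crs f p}"
          unfolding e by auto
        then show "convex {x. a < c * crs f (x - p)}" "convex {x. c * crs f (x - p) < a}"
          using convex_halfspace_gt convex_halfspace_lt by metis+
      qed
      have i: "convex {x. a < inner f (x - p)}" "convex {x. inner f (x - p) < a}" for a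
      proof -
        have "{x. a < inner f (x - p)} = {x. inner f x > a + inner f p}" "{x. inner f (x - p) < a} = {x. inner f x < a + inner f p}"
          by (auto simp: inner_diff_right)
        then show "convex {x. a < inner f (x - p)}" "convex {x. inner f (x - p) < a}"
          using convex_halfspace_gt convex_halfspace_lt by metis+
      qed
      have "H \<sigma> = {x. 0 < \<sigma> * crs f (x - p)} \<inter> {x. \<sigma> * crs f (x - p) < \<delta> * norm f} \<inter>
         {x. u * N < inner f (x - p)} \<inter> {x. inner f (x - p) < v * N}" by (auto simp: H_def)
      then show ?thesis using h i convex_Int by metis
    qed
    have expand: "x = p + (inner f (x - p) / N) *\<^sub>R f + (crs f (x - p) / N) *\<^sub>R (\<i> * f)" for x
    proof -
      have "N = Re f ^ 2 + Im f ^ 2" by (simp add: N_def cmod_power2)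
      then have "N *\<^sub>R (x - p) = inner f (x - p) *\<^sub>R f + crs f (x - p) *\<^sub>R (\<i> * f)"
        by (simp add: complex_eq_iff crs_def inner_complex_def power2_eq_square algebra_simps)
      then have "(1 / N) *\<^sub>R (N *\<^sub>R (x - p)) = (1 / N) *\<^sub>R (inner f (x - p) *\<^sub>R f + crs f (x - p) *\<^sub>R (\<i> * f))" by simp
      then have "x - p = (inner f (x - p) / N) *\<^sub>R f + (crs f (x - p) / N) *\<^sub>R (\<i> * f)"
        using N0 by (simp only: scaleR_add_right scaleR_scaleR) simp
      then show ?thesis by (simp only: add.assoc) (metis add_diff_cancel_left' diff_add_cancel add.commute)
    qed
    have Hbd: "H \<sigma> \<inter> bd = {}" if s: "\<sigma> = 1 \<or> \<sigma> = - 1" for \<sigma>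
    proof (rule ccontr)
      assume "H \<sigma> \<inter> bd \<noteq> {}"
      then obtain x where x: "x \<in> H \<sigma>" "x \<in> bd" by blast
      have nz: "crs f (x - p) \<noteq> 0" using x by (auto simp: H_def)
      have "x \<notin> edge e"
      proof
        assume "x \<in> edge e"
        then obtain \<alpha> where "x = p + \<alpha> *\<^sub>R f" using par by blast
        then show False using nz by (simp add: crs_simps)
      qed
      then have xE: "x \<in> E" using x(2) by (auto simp: bd_def E_def)
      define y where "y = p + (inner f (x - p) / N) *\<^sub>R f"
      have "inner f (x - p) / N \<in> {u..v}" using x(1) N0 by (auto simp: H_def field_simps)
      then have "y \<in> S" by (auto simp: S_def y_def)
      moreover have "dist y x < \<delta>"
      proof -
        have "dist y x = norm ((crs f (x - p) / N) *\<^sub>R (\<i> * f))"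
          using expand[of x] by (metis y_def dist_commute dist_norm add_diff_cancel_left')
        also have "\<dots> = \<bar>crs f (x - p)\<bar> / norm f" using N0 by (simp add: norm_mult N_def power2_eq_square)
        also have "\<dots> < \<delta>" using x(1) s f0 by (auto simp: H_def divide_less_eq)
        finally show ?thesis .
      qed
      ultimately show False using del(2)[of y x] xE by auto
    qed
    have HD: "H \<sigma> \<inter> D = {}" if s: "\<sigma> = 1 \<or> \<sigma> = - 1" and z: "z \<in> H \<sigma>" "z \<notin> D" for \<sigma> z
      using connected_Int_frontier[OF convex_connected[OF conv[of \<sigma>]], of D] Hbd[OF s] frontier_D z by blast
    have mid: "\<exists>\<epsilon>>0. \<forall>x. dist x (p + \<mu> *\<^sub>R f) < \<epsilon> \<longrightarrow> \<bar>crs f (x - p)\<bar> < \<delta> * norm f \<and> u * N < inner f (x - p) \<and> inner f (x - p) < v * N"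
      if "u < \<mu>" "\<mu> < v" for \<mu>
    proof -
      define W where "W = {x. \<bar>crs f (x - p)\<bar> < \<delta> * norm f \<and> u * N < inner f (x - p) \<and> inner f (x - p) < v * N}"
      have "open W" unfolding W_def by (intro open_Collect_conj open_Collect_less continuous_intros)
      moreover have "inner f f = N" by (simp add: N_def dot_square_norm)
      then have "p + \<mu> *\<^sub>R f \<in> W" using that N0 del f0 by (simp add: W_def crs_simps)
      ultimately show ?thesis unfolding W_def open_dist by (metis (no_types, lifting) mem_Collect_eq)
    qed
    \<comment> \<open>The sector of \<open>T\<close> reaches into the rectangle on its side. That
      rectangle is connected, misses \<open>bd\<close> and has a point outside \<open>D\<close>,
      hence has no point in \<open>D\<close>.\<close>
    have side: "H (- sgn c) \<inter> D = {}" if T: "good T" "shape T" and x: "pa T + (1 / 2) *\<^sub>R (pb T - pa T) = p + \<mu> *\<^sub>R f"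
        and mu: "u < \<mu>" "\<mu> < v" and c: "pb T - pa T = c *\<^sub>R f" "c \<noteq> 0" and al: "pa T = p + \<alpha> *\<^sub>R f" for T \<mu> c \<alpha>
    proof -
      obtain \<epsilon>1 where e1: "\<epsilon>1 > 0" "\<And>x. dist x (p + \<mu> *\<^sub>R f) < \<epsilon>1 \<Longrightarrow> crs (pb T - pa T) (x - pa T) < 0 \<Longrightarrow> x \<in> sreg T"
        using half_disc[OF T(2), of "1 / 2"] x by auto
      obtain \<epsilon>2 where e2: "\<epsilon>2 > 0" "\<And>x. dist x (p + \<mu> *\<^sub>R f) < \<epsilon>2 \<Longrightarrow> \<bar>crs f (x - p)\<bar> < \<delta> * norm f \<and> u * N < inner f (x - p) \<and> inner f (x - p) < v * N"
        using mid[OF mu] by blast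
      define h where "h = min \<epsilon>1 \<epsilon>2 / (2 * norm f)"
      have h: "h > 0" "h * norm f < \<epsilon>1" "h * norm f < \<epsilon>2" using e1(1) e2(1) f0 by (auto simp: h_def min_def)
      define z where "z = p + \<mu> *\<^sub>R f + (- sgn c * h) *\<^sub>R (\<i> * f)"
      have dz: "dist z (p + \<mu> *\<^sub>R f) = h * norm f" using h c by (simp add: z_def dist_norm norm_mult abs_mult abs_sgn_eq)
      have "crs f (\<i> * f) = N" unfolding N_def cmod_power2 by (simp add: crs_def power2_eq_square)
      then have cz: "crs f (z - p) = - sgn c * h * N" by (simp add: z_def crs_simps)
      have "- sgn c * crs f (z - p) = h * N" using c by (simp add: cz sgn_if)
      moreover have "h * N > 0" using h N0 by simp
      ultimately have "- sgn c * crs f (z - p) > 0" by simp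
      then have "z \<in> H (- sgn c)" using e2(2)[of z] dz h N0 c by (auto simp: H_def sgn_if split: if_splits)
      moreover have "z \<in> sreg T"
      proof (rule e1(2))
        show "dist z (p + \<mu> *\<^sub>R f) < \<epsilon>1" using dz h by simp
        have za: "z - pa T = (z - p) - \<alpha> *\<^sub>R f" by (simp add: al)
        have "crs (pb T - pa T) (z - pa T) = c * crs f (z - p)"
          by (simp only: za c crs_scale_left crs_diff_right[of _ "z - p"] crs_scale_right crs_self mult_zero_right diff_zero)
        also have "\<dots> = - (\<bar>c\<bar> * h * N)" by (simp add: cz sgn_if)
        also have "\<dots> < 0" using c h N0 by simp
        finally show "crs (pb T - pa T) (z - pa T) < 0" .
      qed
      then have "z \<notin> D" using sreg_D T(1) by blast
      ultimately show ?thesis using HD[of "- sgn c" z] c by (auto simp: sgn_if)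
    qed
    have x1: "pa T1 + (1 / 2) *\<^sub>R (pb T1 - pa T1) = p + \<mu>1 *\<^sub>R f" and x2: "pa T2 + (1 / 2) *\<^sub>R (pb T2 - pa T2) = p + \<mu>2 *\<^sub>R f"
      unfolding ab1(3,6) ab2(3,6) \<mu>1_def \<mu>2_def by (simp_all add: complex_eq_iff algebra_simps)
    have "H (- sgn c1) \<inter> D = {}" "H (- sgn c2) \<inter> D = {}"
      using side[OF g(1) sh(1) x1 uv(2,4) d1 c0(1) ab1(3)] side[OF g(2) sh(2) x2 uv(3,5) d2 c0(2) ab2(3)] by auto
    moreover have "- sgn c1 = 1 \<and> - sgn c2 = - 1 \<or> - sgn c1 = - 1 \<and> - sgn c2 = 1"
      using opp by (auto simp: sgn_if mult_less_0_iff)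
    ultimately have both: "H 1 \<inter> D = {}" "H (- 1) \<inter> D = {}" by auto
    obtain \<epsilon> where ep: "\<epsilon> > 0" "\<And>x. dist x (p + \<mu>1 *\<^sub>R f) < \<epsilon> \<Longrightarrow> \<bar>crs f (x - p)\<bar> < \<delta> * norm f \<and> u * N < inner f (x - p) \<and> inner f (x - p) < v * N"
      using mid[OF uv(2,4)] by blast
    have "p + \<mu>1 *\<^sub>R f \<in> edge e" using mu unfolding edge_def in_segment p_def f_def
      by (intro CollectI exI[of _ \<mu>1]) (auto simp: algebra_simps)
    then have "p + \<mu>1 *\<^sub>R f \<in> closure D" using edge_bd[OF e(1)] frontier_D by (auto simp: frontier_def)
    then obtain z where z: "z \<in> D" "dist z (p + \<mu>1 *\<^sub>R f) < \<epsilon>" using ep(1) closure_approachable by blast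
    have "open (D \<inter> ball (p + \<mu>1 *\<^sub>R f) \<epsilon>)" using open_D by auto
    then obtain r where r: "r > 0" "ball z r \<subseteq> D \<inter> ball (p + \<mu>1 *\<^sub>R f) \<epsilon>"
      using z open_contains_ball[of "D \<inter> ball (p + \<mu>1 *\<^sub>R f) \<epsilon>"] by (metis IntI dist_commute mem_ball)
    define z' where "z' = (if crs f (z - p) = 0 then z + (r / (2 * norm f)) *\<^sub>R (\<i> * f) else z)"
    have "z' \<in> ball z r" using r f0 by (auto simp: z'_def dist_norm norm_mult)
    then have "z' \<in> D \<inter> ball (p + \<mu>1 *\<^sub>R f) \<epsilon>" using r by blast
    then have z': "z' \<in> D" "dist z' (p + \<mu>1 *\<^sub>R f) < \<epsilon>" by (auto simp: dist_commute)
    have "crs f (\<i> * f) = N" unfolding N_def cmod_power2 by (simp add: crs_def power2_eq_square)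
    then have "crs f (z' - p) \<noteq> 0" using r f0 N0 by (auto simp: z'_def crs_simps)
    then have "z' \<in> H 1 \<or> z' \<in> H (- 1)" using ep(2)[OF z'(2)] by (auto simp: H_def)
    then show False using both z'(1) by blast
  qed
  then have "c2 / c1 > 0" by (auto simp: zero_less_divide_iff zero_less_mult_iff)
  moreover have "pb T2 - pa T2 = (c2 / c1) *\<^sub>R (pb T1 - pa T1)" using d1 d2 c0 by simp
  ultimately show ?thesis using that by blast
qed

text \<open>Equally oriented bases on one edge follow one another in one of two orders or overlap,
  and the sectors of overlapping bases have common points just in front of them.\<close>

lemma edge_used_once:
  assumes g: "good T1" "good T2" and dis: "sreg T1 \<inter> sreg T2 = {}"
    and e: "e < n" "pa T1 \<in> edge e" "pb T1 \<in> edge e" "pa T2 \<in> edge e" "pb T2 \<in> edge e"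
  shows False
proof -
  have sh: "shape T1" "shape T2" using g good_shape by auto
  define D0 where "D0 = pb T1 - pa T1"
  have D00: "D0 \<noteq> 0" using sh by (auto simp: D0_def shape_def)
  obtain c where c: "c > 0" "pb T2 - pa T2 = c *\<^sub>R D0"
    using same_orientation[OF g e] unfolding D0_def by blast
  have "crs D0 (pa T2 - pa T1) = 0"
    using crs_closed_segment[of "pa T1" "P e" "Q e" "pb T1" "pa T2"] e by (simp add: edge_def D0_def)
  then obtain la where "pa T2 - pa T1 = la *\<^sub>R D0" using crs_eq_0_scale D00 by blast
  then have lam: "pa T2 = pa T1 + la *\<^sub>R D0" by (simp add: algebra_simps)
  consider "la \<ge> 1" | "la + c \<le> 0" | "la < 1" "la + c > 0" by linarith
  then show False
  proof cases
    case 1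
    have "pa T2 = pb T1 + (la - 1) *\<^sub>R D0" by (simp add: lam D0_def algebra_simps)
    then show False using not_two_bases_ordered[OF g dis e, of c "la - 1"] c 1 by (simp add: D0_def)
  next
    case 2
    have pb2: "pb T2 = pa T1 + (la + c) *\<^sub>R D0" using c(2) lam by (simp add: algebra_simps)
    have "pb T1 - pa T1 = (1 / c) *\<^sub>R (pb T2 - pa T2)" using c by (simp add: D0_def)
    moreover have "pa T1 = pb T2 + (- (la + c) / c) *\<^sub>R (pb T2 - pa T2)"
      using c(1) unfolding c(2) scaleR_scaleR by (simp add: pb2 add.assoc flip: scaleR_add_left)
    moreover have "0 \<le> - (la + c) / c" using 2 c by simp
    ultimately show False
      using not_two_bases_ordered[OF g(2,1) _ e(1,4,5,2,3), of "1 / c" "- (la + c) / c"] dis c by (simp add: Int_commute)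
  next
    case 3
    \<comment> \<open>The middle of the overlap of the parameter intervals from 0 to 1 and from
      \<open>la\<close> to \<open>la + c\<close>.\<close>
    define m where "m = (max 0 la + min 1 (la + c)) / 2"
    have m: "0 < m" "m < 1" "la < m" "m < la + c" using 3 c by (auto simp: m_def max_def min_def)
    define x0 where "x0 = pa T1 + m *\<^sub>R D0"
    have x0': "x0 = pa T2 + ((m - la) / c) *\<^sub>R (pb T2 - pa T2)"
      using c(1) unfolding c(2) scaleR_scaleR by (simp add: x0_def lam add.assoc flip: scaleR_add_left)
    have m': "0 < (m - la) / c" "(m - la) / c < 1" using m c by auto
    obtain e1 where e1: "e1 > 0" "\<And>x. dist x x0 < e1 \<Longrightarrow> crs D0 (x - pa T1) < 0 \<Longrightarrow> x \<in> sreg T1"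
      using half_disc[OF sh(1) m(1,2)] unfolding x0_def D0_def by blast
    obtain e2 where e2: "e2 > 0" "\<And>x. dist x x0 < e2 \<Longrightarrow> crs (pb T2 - pa T2) (x - pa T2) < 0 \<Longrightarrow> x \<in> sreg T2"
      using half_disc[OF sh(2) m'] unfolding x0' by blast
    define z where "z = x0 + (min e1 e2 / 2) *\<^sub>R cis (t1 T1)"
    have neg: "crs D0 (cis (t1 T1)) < 0" using shape_direction[OF sh(1), of "t1 T1"] sh by (auto simp: D0_def shape_def)
    have ep: "min e1 e2 > 0" using e1 e2 by simp
    have "dist z x0 < e1" "dist z x0 < e2" using ep by (auto simp: z_def dist_norm)
    moreover have "crs D0 (z - pa T1) = (min e1 e2 / 2) * crs D0 (cis (t1 T1))"
      by (simp add: z_def x0_def crs_simps)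
    moreover have "crs (pb T2 - pa T2) (z - pa T2) = c * ((min e1 e2 / 2) * crs D0 (cis (t1 T1)))"
      unfolding c(2) by (simp add: z_def x0_def lam crs_simps)
    moreover have "(min e1 e2 / 2) * crs D0 (cis (t1 T1)) < 0" using ep neg by (simp add: mult_pos_neg)
    ultimately have "z \<in> sreg T1" "z \<in> sreg T2" using c(1)
      by (auto intro!: e1(2) e2(2) simp del: times_divide_eq_left simp: mult_pos_neg)
    then show False using dis by blast
  qed
qed

lemma sys_length:
  assumes "sys ts" shows "length ts \<le> n"
proof -
  have "\<exists>e<n. pa (ts ! i) \<in> edge e \<and> pb (ts ! i) \<in> edge e" if "i < length ts" for i
    using assms that nth_mem[OF that] by (auto simp: sys_def good_def)
  then obtain E where E: "\<And>i. i < length ts \<Longrightarrow> E i < n \<and> pa (ts ! i) \<in> edge (E i) \<and> pb (ts ! i) \<in> edge (E i)" by metis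
  have "inj_on E {..<length ts}"
  proof (rule inj_onI)
    fix i j assume ij: "i \<in> {..<length ts}" "j \<in> {..<length ts}" "E i = E j"
    show "i = j"
    proof (rule ccontr)
      assume "i \<noteq> j"
      then have "sreg (ts ! i) \<inter> sreg (ts ! j) = {}" using disjoint_nth assms ij by (auto simp: sys_def)
      moreover have "good (ts ! i)" "good (ts ! j)" using assms ij by (auto simp: sys_def)
      ultimately show False using edge_used_once[of "ts ! i" "ts ! j" "E i"] E[of i] E[of j] ij by auto
    qed
  qed
  moreover have "E ` {..<length ts} \<subseteq> {..<n}" using E by auto
  ultimately show ?thesis using card_inj_on_le[of E "{..<length ts}" "{..<n}"] by simp
qed

end

section \<open>The convex hull\<close>

lemma oriented_edge:
  fixes S :: "complex set"
  assumes S: "compact S" "convex S" "interior S \<noteq> {}" and e: "e edge_of S"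
  shows "\<exists>a b. a \<noteq> b \<and> e = closed_segment a b \<and> a extreme_point_of S \<and> b extreme_point_of S \<and>
    (\<forall>x\<in>S. crs (b - a) (x - a) \<ge> 0)"
proof -
  have f: "e face_of S" and ad: "aff_dim e = 1" using e by (auto simp: edge_of_def)
  have cc: "compact e" "convex e" "collinear e" "e \<noteq> {}"
    using f ad S face_of_imp_compact face_of_imp_convex by (auto simp: collinear_aff_dim)
  obtain a b where ab: "e = closed_segment a b" using compact_convex_collinear_segment cc by metis
  have ne: "a \<noteq> b" using ad ab by auto
  have ext: "a extreme_point_of S" "b extreme_point_of S"
    using extreme_point_of_face[OF f] ab by (auto simp: extreme_point_of_segment)
  define m where "m = midpoint a b"
  have m: "m \<in> e" "m \<in> open_segment a b" using ne ab by (auto simp: m_def midpoint_in_closed_segment)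
  have "e \<noteq> S"
  proof
    assume "e = S"
    then have "aff_dim S = 1" using ad by simp
    moreover have "aff_dim S = int DIM(complex)" using aff_dim_nonempty_interior S(3) by blast
    ultimately show False by simp
  qed
  then have "m \<notin> rel_interior S" using face_of_disjoint_rel_interior[OF f] m by auto
  moreover have "m \<in> S" using f m face_of_imp_subset by blast
  ultimately obtain c where c: "c \<noteq> 0" "\<And>y. y \<in> S \<Longrightarrow> inner c m \<le> inner c y"
    using supporting_hyperplane_rel_boundary[OF S(2)] by metis
  have aS: "a \<in> S" "b \<in> S" using ext by (auto simp: extreme_point_of_def)
  have mm: "inner c m = (inner c a + inner c b) / 2" by (simp add: m_def midpoint_def inner_simps)
  \<comment> \<open>A linear form whose minimum on \<open>S\<close> is attained at the midpoint of a
    segment in \<open>S\<close> takes the same value at both ends.\<close>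
  have eq: "inner c a = inner c m" using c(2)[OF aS(1)] c(2)[OF aS(2)] mm by argo
  then have eq2: "inner c b = inner c m" using mm by argo
  have "crs (b - a) (\<i> * c) = 0" using eq eq2 by (simp add: crs_def inner_complex_def algebra_simps)
  then obtain k where k: "\<i> * c = k *\<^sub>R (b - a)" using crs_eq_0_scale ne by (metis right_minus_eq)
  have ck: "inner c z = - k * crs (b - a) z" for z
  proof -
    have "inner c z = crs z (\<i> * c)" by (simp add: crs_def inner_complex_def algebra_simps)
    also have "\<dots> = - k * crs (b - a) z" by (simp add: k crs_scale_right crs_commute[of z])
    finally show ?thesis .
  qed
  have k0: "k \<noteq> 0" using k c by auto
  have pos: "- k * crs (b - a) (x - a) \<ge> 0" if "x \<in> S" for x
    using c(2)[OF that] eq ck[of "x - a"] by (simp add: inner_diff_right)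
  show ?thesis
  proof (cases "k < 0")
    case True
    then have "\<forall>x\<in>S. crs (b - a) (x - a) \<ge> 0" using pos by (auto simp: mult_le_0_iff)
    then show ?thesis using ne ab ext by blast
  next
    case False
    have "crs (a - b) (x - b) = - crs (b - a) (x - a)" for x by (simp add: crs_def algebra_simps)
    then have "\<forall>x\<in>S. crs (a - b) (x - b) \<ge> 0" using pos False k0 by (auto simp: mult_le_0_iff)
    moreover have "e = closed_segment b a" unfolding ab by (rule closed_segment_commute)
    ultimately show ?thesis using ne ext by (intro exI[of _ b] exI[of _ a] conjI) simp_all
  qed
qed

text \<open>Orient every edge so that the set is on its left, and send it to its starting point. Two
  edges with the same starting point have parallel, equal directions, and extremality of their other
  ends makes them equal; so the map is injective.\<close>

lemma card_edges_le_extreme_points: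
  fixes S :: "complex set"
  assumes S: "compact S" "convex S" "interior S \<noteq> {}" and V: "finite V" "{x. x extreme_point_of S} \<subseteq> V"
  shows "card {e. e edge_of S} \<le> card V"
proof -
  define R where "R e a b \<longleftrightarrow> a \<noteq> b \<and> e = closed_segment a b \<and> a extreme_point_of S \<and> b extreme_point_of S \<and>
    (\<forall>x\<in>S. crs (b - a) (x - a) \<ge> 0)" for e a b
  have "\<forall>e\<in>{e. e edge_of S}. \<exists>a. \<exists>b. R e a b" using oriented_edge[OF S] unfolding R_def by simp
  from bchoice[OF this] obtain f where f: "\<And>e. e edge_of S \<Longrightarrow> \<exists>b. R e (f e) b" by auto
  have "inj_on f {e. e edge_of S}"
  proof (rule inj_onI)
    fix e e' assume ee: "e \<in> {e. e edge_of S}" "e' \<in> {e. e edge_of S}" "f e = f e'"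
    define a where "a = f e"
    obtain b b' where b: "R e a b" and b': "R e' a b'" using f ee unfolding a_def by (metis mem_Collect_eq)
    have in_S: "b \<in> S" "b' \<in> S" "a \<in> S" using b b' by (auto simp: R_def extreme_point_of_def)
    have ge: "crs (b - a) (b' - a) \<ge> 0" "crs (b' - a) (b - a) \<ge> 0" using b b' in_S by (auto simp: R_def)
    then have "crs (b - a) (b' - a) = 0" using crs_commute[of "b - a"] by simp
    moreover have "b - a \<noteq> 0" using b by (auto simp: R_def)
    ultimately obtain r where r: "b' - a = r *\<^sub>R (b - a)" using crs_eq_0_scale by blast
    have r0: "r \<noteq> 0" using r b' by (auto simp: R_def)
    \<comment> \<open>Opposite directions would squeeze \<open>S\<close> into a line, but it has
      interior points.\<close>
    have "r > 0"
    proof (rule ccontr)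
      assume "\<not> r > 0"
      then have neg: "r < 0" using r0 by simp
      have "crs (b - a) (x - a) = 0" if "x \<in> S" for x
      proof -
        have "crs (b' - a) (x - a) \<ge> 0" using b' that by (auto simp: R_def)
        then have "r * crs (b - a) (x - a) \<ge> 0" by (simp add: r crs_scale_left)
        then have "crs (b - a) (x - a) \<le> 0" using neg by (simp add: zero_le_mult_iff)
        moreover have "crs (b - a) (x - a) \<ge> 0" using b that by (auto simp: R_def)
        ultimately show ?thesis by simp
      qed
      moreover obtain z d where z: "d > 0" "ball z d \<subseteq> S"
        using S(3) mem_interior by (metis ex_in_conv)
      moreover have "z \<in> ball z d" "z + (d / (2 * norm (b - a))) *\<^sub>R (\<i> * (b - a)) \<in> ball z d"
        using z(1) \<open>b - a \<noteq> 0\<close> by (auto simp: dist_norm norm_mult)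
      ultimately have "crs (b - a) (z - a) = 0" "crs (b - a) (z + (d / (2 * norm (b - a))) *\<^sub>R (\<i> * (b - a)) - a) = 0" by blast+
      then have "(d / (2 * norm (b - a))) * crs (b - a) (\<i> * (b - a)) = 0"
        by (simp only: add_diff_eq[symmetric] add.commute[of z] crs_add_right crs_scale_right)
      moreover have "crs (b - a) (\<i> * (b - a)) = (norm (b - a))\<^sup>2"
        unfolding cmod_power2 by (simp add: crs_def power2_eq_square algebra_simps)
      ultimately show False using z(1) \<open>b - a \<noteq> 0\<close> by simp
    qed
    have "\<not> r < 1"
    proof
      assume "r < 1"
      then have "b' \<in> open_segment a b" using \<open>r > 0\<close> r \<open>b - a \<noteq> 0\<close> unfolding in_segment
        by (intro conjI exI[of _ r]) (auto simp: algebra_simps)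
      then show False using b' in_S by (auto simp: R_def extreme_point_of_def)
    qed
    moreover have "\<not> r > 1"
    proof
      assume "r > 1"
      have "b = a + (1 / r) *\<^sub>R (b' - a)" using r r0 by simp
      then have "b = (1 - 1 / r) *\<^sub>R a + (1 / r) *\<^sub>R b'" by (simp add: algebra_simps)
      then have "b \<in> open_segment a b'" using \<open>r > 1\<close> b' unfolding in_segment
        by (intro conjI exI[of _ "1 / r"]) (auto simp: R_def)
      then show False using b in_S by (auto simp: R_def extreme_point_of_def)
    qed
    ultimately have "b' = b" using r by simp
    then show "e = e'" using b b' by (auto simp: R_def)
  qed
  moreover have "f ` {e. e edge_of S} \<subseteq> V" using f V(2) unfolding R_def by blast
  ultimately show ?thesis using card_inj_on_le V(1) by blast
qed

text \<open>\<open>a z\<close> and \<open>b z\<close> are the barycentric coordinates of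
  \<open>z\<close> at \<open>u\<close> and \<open>v\<close>; near \<open>p\<close> the third one is
  positive, so only the two sign conditions matter.\<close>

lemma corner:
  assumes H: "convex H" "p \<in> H" "u \<in> H" "v \<in> H" and k: "crs (u - p) (v - p) > 0"
  obtains e where "e > 0" "\<And>z. dist z p < e \<Longrightarrow> crs (u - p) (z - p) \<ge> 0 \<Longrightarrow> crs (v - p) (z - p) \<le> 0 \<Longrightarrow> z \<in> H"
proof -
  define \<kappa> where "\<kappa> = crs (u - p) (v - p)"
  define a b where "a z = - crs (v - p) (z - p) / \<kappa>" and "b z = crs (u - p) (z - p) / \<kappa>" for z
  define U where "U = {z. a z + b z < 1}"
  have "open U" unfolding U_def a_def b_def
    by (intro open_Collect_less continuous_intros) (use k in \<open>auto simp: \<kappa>_def\<close>)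
  moreover have "p \<in> U" by (simp add: U_def a_def b_def)
  ultimately obtain e where e: "e > 0" "ball p e \<subseteq> U" using open_contains_ball by blast
  have "z \<in> H" if z: "dist z p < e" "crs (u - p) (z - p) \<ge> 0" "crs (v - p) (z - p) \<le> 0" for z
  proof -
    have ab: "a z \<ge> 0" "b z \<ge> 0" using z k by (auto simp: a_def b_def \<kappa>_def divide_nonpos_pos)
    have "a z + b z < 1" using e z by (auto simp: U_def dist_commute subset_iff)
    moreover have "\<kappa> *\<^sub>R (z - p) = (- crs (v - p) (z - p)) *\<^sub>R (u - p) + crs (u - p) (z - p) *\<^sub>R (v - p)"
      by (simp add: \<kappa>_def complex_eq_iff crs_def algebra_simps)
    then have "(1 / \<kappa>) *\<^sub>R (\<kappa> *\<^sub>R (z - p)) = (1 / \<kappa>) *\<^sub>R ((- crs (v - p) (z - p)) *\<^sub>R (u - p) + crs (u - p) (z - p) *\<^sub>R (v - p))" by simp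
    then have "z - p = a z *\<^sub>R (u - p) + b z *\<^sub>R (v - p)"
      using k by (simp only: scaleR_add_right scaleR_scaleR) (simp add: a_def b_def \<kappa>_def)
    then have "z = (1 - (a z + b z)) *\<^sub>R p + a z *\<^sub>R u + b z *\<^sub>R v" by (simp add: algebra_simps)
    moreover have "\<dots> \<in> convex hull {p, u, v}"
      using ab \<open>a z + b z < 1\<close> unfolding convex_hull_3
      by (intro CollectI exI[of _ "1 - (a z + b z)"] exI[of _ "a z"] exI[of _ "b z"]) auto
    moreover have "convex hull {p, u, v} \<subseteq> H" using H by (intro hull_minimal) auto
    ultimately show ?thesis by auto
  qed
  then show ?thesis using that e(1) by blast
qed

section \<open>Closed sectors and the complement of the hull\<close>

context polygon
begin

text \<open>Points of the shared line itself are limits of points on its left, which belong to the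
  sector of \<open>T2\<close>.\<close>

lemma link_cover:
  assumes g: "good T1" "good T2" and l: "link T1 T2" and r: "r > 0"
  obtains U where "open U" "pivot T1 T2 + r *\<^sub>R cis (t1 T2) \<in> U" "U \<subseteq> closure (sreg T1) \<union> closure (sreg T2)"
proof -
  obtain U where U: "open U" "pivot T1 T2 + r *\<^sub>R cis (t1 T2) \<in> U"
    "\<And>z. z \<in> U \<Longrightarrow> lf (pb T1) (t1 T2) z < 0 \<Longrightarrow> z \<in> sreg T1"
    "\<And>z. z \<in> U \<Longrightarrow> lf (pb T1) (t1 T2) z > 0 \<Longrightarrow> z \<in> sreg T2" using link_nbhd[OF g l r] by metis
  have "z \<in> closure (sreg T1) \<union> closure (sreg T2)" if z: "z \<in> U" for z
  proof (cases "lf (pb T1) (t1 T2) z = 0")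
    case False
    then show ?thesis using U(3,4)[OF z] closure_subset by (meson UnI1 UnI2 linorder_neqE_linordered_idom subset_iff)
  next
    case True
    have "z \<in> closure (sreg T2)" unfolding closure_approachable
    proof (intro allI impI)
      fix e :: real assume e: "e > 0"
      obtain d where d: "d > 0" "ball z d \<subseteq> U" using U(1) z open_contains_ball by blast
      define h where "h = min d e / 2"
      have h: "h > 0" "h < d" "h < e" using d e by (auto simp: h_def)
      define y where "y = z + h *\<^sub>R cis (t1 T2 + pi / 2)"
      have "dist y z = h" using h by (simp add: y_def dist_norm)
      moreover from this have "y \<in> U" using d h by (auto simp: dist_commute subset_iff)
      moreover have "lf (pb T1) (t1 T2) y > 0" using True h by (simp add: y_def lf_move)
      ultimately show "\<exists>y\<in>sreg T2. dist y z < e" using U(4) h by blast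
    qed
    then show ?thesis by blast
  qed
  then show ?thesis using that U(1,2) by blast
qed

text \<open>The neighbours of a triangle in the cycle are list members only up to full turns, so
  they are identified by their sectors. \<open>V\<close> has at most one pivot for each
  triangle.\<close>

lemma sys_pivots:
  assumes "sys ts"
  obtains V where "finite V" "card V \<le> length ts"
    "\<And>T. T \<in> set ts \<Longrightarrow> \<exists>T'. good T' \<and> sreg T' \<in> sreg ` set ts \<and> link T' T \<and> pivot T' T \<in> V"
    "\<And>T. T \<in> set ts \<Longrightarrow> \<exists>T'. good T' \<and> sreg T' \<in> sreg ` set ts \<and> link T T' \<and> pivot T T' \<in> V"
proof -
  define m where "m = length ts"
  define nx where "nx i = (if Suc i < m then ts ! Suc i else turn (hd ts))" for i
  define V where "V = (\<lambda>i. pivot (ts ! i) (nx i)) ` {..<m}"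
  have ne: "ts \<noteq> []" and c: "chain (pa (hd ts)) (t1 (hd ts)) ts (pa (hd ts)) (t1 (hd ts) + 2 * pi)"
    and g: "\<And>T. T \<in> set ts \<Longrightarrow> good T" using assms by (auto simp: sys_def closed_chain_def)
  note cn = c[unfolded chain_nth[OF ne]]
  have m0: "m > 0" using ne by (simp add: m_def)
  have hd: "hd ts = ts ! 0" using ne by (simp add: hd_conv_nth)
  have lk: "link (ts ! i) (nx i)" if "i < m" for i
  proof (cases "Suc i < m")
    case True then show ?thesis using cn by (auto simp: nx_def link_def m_def)
  next
    case False
    then have "i = length ts - 1" using that by (simp add: m_def)
    then show ?thesis using cn False by (auto simp: nx_def link_def)
  qed
  have gn: "good (nx i) \<and> sreg (nx i) \<in> sreg ` set ts" for i
    using g ne by (auto simp: nx_def m_def)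
  show ?thesis
  proof (rule that[of V])
    show "finite V" by (simp add: V_def)
    show "card V \<le> length ts" unfolding V_def m_def using card_image_le[of "{..<length ts}"] by simp
    fix T assume T: "T \<in> set ts"
    then obtain i where i: "i < m" "T = ts ! i" by (auto simp: in_set_conv_nth m_def)
    show "\<exists>T'. good T' \<and> sreg T' \<in> sreg ` set ts \<and> link T T' \<and> pivot T T' \<in> V"
      using lk[OF i(1)] gn[of i] i by (auto simp: V_def)
    show "\<exists>T'. good T' \<and> sreg T' \<in> sreg ` set ts \<and> link T' T \<and> pivot T' T \<in> V"
    proof (cases i)
      case 0
      define L where "L = ts ! (m - 1)"
      have L: "L \<in> set ts" using m0 by (simp add: L_def m_def)
      have nx: "nx (m - 1) = turn T" using m0 i 0 hd by (simp add: nx_def)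
      have "link L (turn T)" using lk[of "m - 1"] m0 nx by (simp add: L_def)
      then have "link (tshift (- 1) L) T" by (auto simp: link_def)
      moreover have "pivot (tshift (- 1) L) T = pivot L (turn T)" by (simp add: pivot_def)
      moreover have "pivot L (turn T) \<in> V" using nx m0 unfolding V_def L_def
        by (intro image_eqI[of _ _ "m - 1"]) auto
      ultimately show ?thesis using L g by (intro exI[of _ "tshift (- 1) L"]) auto
    next
      case (Suc j)
      then have "nx j = T" using i by (simp add: nx_def)
      moreover have "j < m" using Suc i by simp
      moreover from this have "ts ! j \<in> set ts" by (simp add: m_def)
      ultimately show ?thesis using lk[of j] g
        by (intro exI[of _ "ts ! j"]) (auto simp: V_def)
    qed
  qed
qed

lemma pivot_hull:
  assumes "good T1" "good T2" "link T1 T2" shows "pivot T1 T2 \<in> convex hull bd"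
  by (rule hull_inc, rule subsetD[OF verts_bd pivot_vertex[OF assms]])

lemma closure_sreg:
  assumes "y \<in> closure (sreg T)"
  shows "lf (pa T) (t1 T) y \<ge> 0" "lf (pb T) (t2 T) y \<le> 0" "crs (pb T - pa T) (y - pa T) \<le> 0"
proof -
  define F where "F = {x. lf (pa T) (t1 T) x \<ge> 0 \<and> lf (pb T) (t2 T) x \<le> 0 \<and> crs (pb T - pa T) (x - pa T) \<le> 0}"
  have "closed F" unfolding F_def lf_def by (intro closed_Collect_conj closed_Collect_le continuous_intros)
  moreover have "sreg T \<subseteq> F" by (auto simp: F_def sreg_def)
  ultimately have "y \<in> F" using assms closure_minimal by blast
  then show "lf (pa T) (t1 T) y \<ge> 0" "lf (pb T) (t2 T) y \<le> 0" "crs (pb T - pa T) (y - pa T) \<le> 0"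
    by (auto simp: F_def)
qed

lemma base_line_segment:
  assumes sh: "shape T" and y: "lf (pa T) (t1 T) y \<ge> 0" "lf (pb T) (t2 T) y \<le> 0" "crs (pb T - pa T) (y - pa T) = 0"
  shows "y \<in> closed_segment (pa T) (pb T)"
proof -
  have "pb T - pa T \<noteq> 0" using sh by (auto simp: shape_def)
  then obtain r where "y - pa T = r *\<^sub>R (pb T - pa T)" using crs_eq_0_scale y(3) by blast
  then have r: "y = pa T + r *\<^sub>R (pb T - pa T)" by (simp add: algebra_simps)
  have "r * crs (cis (t1 T)) (pb T - pa T) \<ge> 0" using y(1) by (simp add: r lf_def crs_scale_right)
  then have "r \<ge> 0" using sh by (simp add: shape_def zero_le_mult_iff)
  have "pa T + r *\<^sub>R (pb T - pa T) - pb T = (r - 1) *\<^sub>R (pb T - pa T)" by (simp add: algebra_simps)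
  then have "(r - 1) * crs (cis (t2 T)) (pb T - pa T) \<le> 0" using y(2) by (simp add: r lf_def crs_scale_right)
  then have "r \<le> 1" using sh by (simp add: shape_def mult_le_0_iff)
  then show ?thesis using \<open>r \<ge> 0\<close> r unfolding in_segment by (intro exI[of _ r]) (auto simp: algebra_simps)
qed

text \<open>A point of this line that is outside the hull must be beyond the pivot, and one that is
  an extreme boundary point must be the pivot; the list of positions serves both arguments.\<close>

lemma left_line_cases:
  assumes g: "good T'" "good T" and l: "link T' T" and y: "lf (pa T) (t1 T) y = 0" "crs (pb T - pa T) (y - pa T) < 0"
  shows "y = pivot T' T \<or> y \<in> open_segment (pa T) (pivot T' T) \<or> (\<exists>r>0. y = pivot T' T + r *\<^sub>R cis (t1 T))"
proof -
  have sh: "shape T" using g good_shape by blast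
  obtain r where r: "y = pa T + r *\<^sub>R cis (t1 T)" using y(1) by (rule lf_zeroE)
  have "crs (pb T - pa T) (cis (t1 T)) < 0" using shape_direction[OF sh, of "t1 T"] sh by (simp add: shape_def)
  moreover have "r * crs (pb T - pa T) (cis (t1 T)) < 0" using y(2) by (simp add: r crs_scale_right)
  ultimately have r0: "r > 0" by (simp add: mult_less_0_iff)
  obtain p where p: "p \<ge> 0" "pivot T' T = pa T + p *\<^sub>R cis (t1 T)" using pivot_cases[OF l] by metis
  consider "r = p" | "r < p" | "r > p" by linarith
  then show ?thesis
  proof cases
    case 2
    have "y = (1 - r / p) *\<^sub>R pa T + (r / p) *\<^sub>R pivot T' T" using 2 r0 by (simp add: r p algebra_simps)
    then have "y \<in> open_segment (pa T) (pivot T' T)" using 2 r0 p(2) unfolding in_segment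
      by (intro conjI exI[of _ "r / p"]) auto
    then show ?thesis by blast
  next
    case 3
    then have "y = pivot T' T + (r - p) *\<^sub>R cis (t1 T)" by (simp add: r p algebra_simps)
    then show ?thesis using 3 by (metis diff_gt_0_iff_gt)
  qed (use r p in auto)
qed

lemma right_line_cases:
  assumes g: "good T" "good T'" and l: "link T T'" and y: "lf (pb T) (t2 T) y = 0" "crs (pb T - pa T) (y - pa T) < 0"
  shows "y = pivot T T' \<or> y \<in> open_segment (pb T) (pivot T T') \<or> (\<exists>r>0. y = pivot T T' + r *\<^sub>R cis (t1 T'))"
proof -
  have sh: "shape T" using g good_shape by blast
  have t: "t1 T' = t2 T" using l by (simp add: link_def)
  obtain r where r: "y = pb T + r *\<^sub>R cis (t2 T)" using y(1) by (rule lf_zeroE)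
  have "crs (pb T - pa T) (cis (t2 T)) < 0" using shape_direction[OF sh, of "t2 T"] sh by (simp add: shape_def)
  moreover have "crs (pb T - pa T) (y - pa T) = crs (pb T - pa T) (pb T - pa T) + r * crs (pb T - pa T) (cis (t2 T))"
    by (simp only: r crs_add_right crs_diff_right crs_scale_right)
  then have "r * crs (pb T - pa T) (cis (t2 T)) < 0" using y(2) by simp
  ultimately have r0: "r > 0" by (simp add: mult_less_0_iff)
  obtain p where p: "p \<ge> 0" "pivot T T' = pb T + p *\<^sub>R cis (t2 T)" using pivot_cases[OF l] t by metis
  consider "r = p" | "r < p" | "r > p" by linarith
  then show ?thesis
  proof cases
    case 2
    have "y = (1 - r / p) *\<^sub>R pb T + (r / p) *\<^sub>R pivot T T'" using 2 r0 by (simp add: r p algebra_simps)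
    then have "y \<in> open_segment (pb T) (pivot T T')" using 2 r0 p(2) unfolding in_segment
      by (intro conjI exI[of _ "r / p"]) auto
    then show ?thesis by blast
  next
    case 3
    then have "y = pivot T T' + (r - p) *\<^sub>R cis (t1 T')" by (simp add: r p t algebra_simps)
    then show ?thesis using 3 by (metis diff_gt_0_iff_gt)
  qed (use r p in auto)
qed

lemma good_base_hull:
  assumes "good T" shows "pa T \<in> convex hull bd" "pb T \<in> convex hull bd"
  using good_bd[OF assms] by (simp_all add: hull_inc)

lemma open_segment_hull: "a \<in> convex hull S \<Longrightarrow> b \<in> convex hull S \<Longrightarrow> open_segment a b \<subseteq> convex hull S"
  by (meson convex_contains_open_segment convex_convex_hull)

text \<open>The union of the closed sectors is open and closed in the complement of the hull, which is connected.\<close>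

lemma sys_covers_outside:
  assumes sys: "sys ts" shows "- (convex hull bd) \<subseteq> (\<Union>T\<in>set ts. closure (sreg T))"
proof -
  define H where "H = convex hull bd"
  define G where "G = (\<Union>T\<in>set ts. closure (sreg T))"
  have g: "\<And>T. T \<in> set ts \<Longrightarrow> good T" and ne: "ts \<noteq> []" using sys by (auto simp: sys_def closed_chain_def)
  obtain V where V: "\<And>T. T \<in> set ts \<Longrightarrow> \<exists>T'. good T' \<and> sreg T' \<in> sreg ` set ts \<and> link T' T \<and> pivot T' T \<in> V"
    "\<And>T. T \<in> set ts \<Longrightarrow> \<exists>T'. good T' \<and> sreg T' \<in> sreg ` set ts \<and> link T T' \<and> pivot T T' \<in> V"
    using sys_pivots[OF sys] by metis
  have bH: "bounded H" unfolding H_def using compact_bd by (simp add: compact_imp_bounded bounded_convex_hull)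
  have con: "connected (- H)"
    by (rule connected_complement_bounded_convex[OF bH]) (simp_all add: H_def)
  have clG: "closed G" unfolding G_def by (intro closed_UN) auto
  \<comment> \<open>Openness: outside the hull such a point is interior to a sector or lies on a
    shared line beyond the pivot, where two neighbouring closed sectors cover a
    neighbourhood.\<close>
  have nb: "\<exists>U. open U \<and> y \<in> U \<and> U \<subseteq> G" if y: "y \<in> G" "y \<notin> H" for y
  proof -
    obtain T where T: "T \<in> set ts" "y \<in> closure (sreg T)" using y by (auto simp: G_def)
    note cl = closure_sreg[OF T(2)]
    have sG: "sreg T \<subseteq> G" using T(1) closure_subset by (auto simp: G_def)
    have neg: "crs (pb T - pa T) (y - pa T) < 0"
    proof (rule ccontr)
      assume "\<not> ?thesis"
      then have "y \<in> closed_segment (pa T) (pb T)"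
        using base_line_segment[OF good_shape[OF g[OF T(1)]] cl(1,2)] cl(3) by simp
      then show False using y(2) good_base_hull[OF g[OF T(1)]] unfolding H_def
        by (meson closed_segment_subset convex_convex_hull subsetD)
    qed
    consider "y \<in> sreg T" | "lf (pa T) (t1 T) y = 0" | "lf (pb T) (t2 T) y = 0"
      using cl neg by (force simp: sreg_def)
    then show ?thesis
    proof cases
      case 1
      then show ?thesis using open_sreg sG by blast
    next
      case 2
      obtain T' where T': "good T'" "sreg T' \<in> sreg ` set ts" "link T' T" using V(1)[OF T(1)] by blast
      obtain r where "r > 0" "y = pivot T' T + r *\<^sub>R cis (t1 T)"
        using left_line_cases[OF T'(1) g[OF T(1)] T'(3) 2 neg] y(2) pivot_hull[OF T'(1) g[OF T(1)] T'(3)]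
          good_base_hull(1)[OF g[OF T(1)]] open_segment_hull unfolding H_def by blast
      then obtain U where "open U" "y \<in> U" "U \<subseteq> closure (sreg T') \<union> closure (sreg T)"
        using link_cover[OF T'(1) g[OF T(1)] T'(3)] by metis
      moreover have "closure (sreg T') \<subseteq> G" "closure (sreg T) \<subseteq> G" using T(1) T'(2) by (auto simp: G_def)
      ultimately show ?thesis by blast
    next
      case 3
      obtain T' where T': "good T'" "sreg T' \<in> sreg ` set ts" "link T T'" using V(2)[OF T(1)] by blast
      obtain r where "r > 0" "y = pivot T T' + r *\<^sub>R cis (t1 T')"
        using right_line_cases[OF g[OF T(1)] T'(1) T'(3) 3 neg] y(2) pivot_hull[OF g[OF T(1)] T'(1) T'(3)]
          good_base_hull(2)[OF g[OF T(1)]] open_segment_hull unfolding H_def by blast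
      then obtain U where "open U" "y \<in> U" "U \<subseteq> closure (sreg T) \<union> closure (sreg T')"
        using link_cover[OF g[OF T(1)] T'(1) T'(3)] by metis
      moreover have "closure (sreg T') \<subseteq> G" "closure (sreg T) \<subseteq> G" using T(1) T'(2) by (auto simp: G_def)
      ultimately show ?thesis by blast
    qed
  qed
  have "openin (top_of_set (- H)) (- H \<inter> G)"
    unfolding openin_subtopology
  proof (intro exI conjI)
    show "openin euclidean (\<Union>{U. open U \<and> U \<subseteq> G})" by (simp add: open_Union)
    show "- H \<inter> G = \<Union>{U. open U \<and> U \<subseteq> G} \<inter> - H" using nb by blast
  qed
  moreover have "closedin (top_of_set (- H)) (- H \<inter> G)" using clG by (simp add: closedin_closed_Int)
  moreover have "- H \<inter> G \<noteq> {}"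
  proof -
    define T where "T = hd ts"
    have T: "T \<in> set ts" using ne by (simp add: T_def)
    have sh: "shape T" using g[OF T] good_shape by blast
    obtain x where x: "x \<in> sreg T" using sreg_nonempty g[OF T] by blast
    obtain B where B: "\<And>z. z \<in> H \<Longrightarrow> norm z \<le> B" using bH by (auto simp: bounded_iff)
    define r where "r = \<bar>B\<bar> + norm x + 1"
    have "x + r *\<^sub>R cis (t1 T) \<in> sreg T"
      using sreg_move[OF sh x, of "t1 T" r] sh by (simp add: r_def shape_def)
    moreover have "norm (r *\<^sub>R cis (t1 T)) - norm (- x) \<le> norm (r *\<^sub>R cis (t1 T) - (- x))" by (rule norm_triangle_ineq2)
    then have "norm (x + r *\<^sub>R cis (t1 T)) > B" by (simp add: r_def add.commute)
    then have "x + r *\<^sub>R cis (t1 T) \<notin> H" using B by force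
    ultimately show ?thesis using T closure_subset by (fastforce simp: G_def)
  qed
  ultimately have "- H \<inter> G = - H" using con by (auto simp: connected_clopen)
  then show ?thesis by (auto simp: G_def H_def)
qed

text \<open>\<open>p\<close> is a limit of points outside the hull that lie in one closed sector. If
  \<open>p\<close> were an end of the base and not a pivot, the base and the pivot would span a
  corner of the hull that contains the closed sector near \<open>p\<close>. If it were elsewhere on
  a side line, it would be inside a segment of the hull or beyond the pivot, where there are no
  boundary points.\<close>

lemma extreme_is_pivot:
  assumes sys: "sys ts" and p: "p extreme_point_of (convex hull bd)"
    and V: "\<And>T. T \<in> set ts \<Longrightarrow> \<exists>T'. good T' \<and> sreg T' \<in> sreg ` set ts \<and> link T' T \<and> pivot T' T \<in> V"
    "\<And>T. T \<in> set ts \<Longrightarrow> \<exists>T'. good T' \<and> sreg T' \<in> sreg ` set ts \<and> link T T' \<and> pivot T T' \<in> V"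
  shows "p \<in> V"
proof (rule ccontr)
  assume pV: "p \<notin> V"
  define H where "H = convex hull bd"
  have g: "\<And>T. T \<in> set ts \<Longrightarrow> good T" using sys by (auto simp: sys_def)
  have pb: "p \<in> bd" using p extreme_point_of_convex_hull by blast
  have pH: "p \<in> H" using pb by (simp add: H_def hull_inc)
  have noseg: "p \<notin> open_segment a b" if "a \<in> H" "b \<in> H" for a b
    using p that by (auto simp: extreme_point_of_def H_def)
  have "p \<notin> interior H" using extreme_point_not_in_interior p by (auto simp: H_def)
  then have "p \<in> closure (- H)" by (simp add: closure_complement)
  moreover have "closure (- H) \<subseteq> (\<Union>T\<in>set ts. closure (- H \<inter> closure (sreg T)))"
  proof (rule closure_minimal)
    show "- H \<subseteq> (\<Union>T\<in>set ts. closure (- H \<inter> closure (sreg T)))"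
    proof
      fix z assume z: "z \<in> - H"
      then obtain T where "T \<in> set ts" "z \<in> closure (sreg T)" using sys_covers_outside[OF sys] by (auto simp: H_def)
      then show "z \<in> (\<Union>T\<in>set ts. closure (- H \<inter> closure (sreg T)))"
        using z closure_subset[of "- H \<inter> closure (sreg T)"] by blast
    qed
  qed (intro closed_UN, auto)
  ultimately obtain T where T: "T \<in> set ts" "p \<in> closure (- H \<inter> closure (sreg T))" by blast
  have sh: "shape T" using g[OF T(1)] good_shape by blast
  have pc: "p \<in> closure (sreg T)" using T(2) closure_mono[of "- H \<inter> closure (sreg T)" "closure (sreg T)"] by auto
  note cl = closure_sreg[OF pc]
  obtain L where L: "good L" "link L T" "pivot L T \<in> V" using V(1)[OF T(1)] by blast
  obtain R where R: "good R" "link T R" "pivot T R \<in> V" using V(2)[OF T(1)] by blast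
  have piv: "pivot L T \<in> H" "pivot T R \<in> H" using pivot_hull g[OF T(1)] L R by (auto simp: H_def)
  have ab: "pa T \<in> H" "pb T \<in> H" using good_base_hull g[OF T(1)] by (auto simp: H_def)
  have conH: "convex H" by (simp add: H_def)
  have near: False if E: "e > 0" "\<And>z. dist z p < e \<Longrightarrow> z \<in> closure (sreg T) \<Longrightarrow> z \<in> H" for e
  proof -
    obtain z where "z \<in> - H \<inter> closure (sreg T)" "dist z p < e" using T(2) E(1) closure_approachable by blast
    then show False using E(2) by blast
  qed
  have d12: "crs (pb T - pa T) (cis (t1 T)) < 0" "crs (pb T - pa T) (cis (t2 T)) < 0"
    using shape_direction[OF sh] sh by (auto simp: shape_def)
  show False
  proof (cases "crs (pb T - pa T) (p - pa T) = 0")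
    case True
    then have "p \<in> closed_segment (pa T) (pb T)" using base_line_segment[OF sh cl(1,2)] by simp
    then have "p = pa T \<or> p = pb T" using noseg[OF ab] by (auto simp: open_segment_def)
    then show False
    proof
      assume pa: "p = pa T"
      obtain r where r: "r \<ge> 0" "pivot L T = pa T + r *\<^sub>R cis (t1 T)" using pivot_cases[OF L(2)] by metis
      have "r > 0" using r pV L(3) pa by (cases "r = 0") auto
      then have "crs (pivot L T - p) (pb T - p) > 0"
        using sh by (simp add: pa r crs_scale_left shape_def)
      then obtain e where e: "e > 0" "\<And>z. dist z p < e \<Longrightarrow> crs (pivot L T - p) (z - p) \<ge> 0 \<Longrightarrow> crs (pb T - p) (z - p) \<le> 0 \<Longrightarrow> z \<in> H"
        using corner[OF conH pH piv(1) ab(2)] by metis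
      show False
      proof (rule near[OF e(1)])
        fix z assume z: "dist z p < e" "z \<in> closure (sreg T)"
        show "z \<in> H" using closure_sreg[OF z(2)] \<open>r > 0\<close> by (intro e(2)[OF z(1)]) (auto simp: pa r lf_def crs_scale_left)
      qed
    next
      assume pa: "p = pb T"
      obtain r where r: "r \<ge> 0" "pivot T R = pb T + r *\<^sub>R cis (t2 T)"
        using pivot_cases[OF R(2)] R(2) by (metis link_def)
      have "r > 0" using r pV R(3) pa by (cases "r = 0") auto
      have "crs (pa T - p) (pivot T R - p) = - (r * crs (pb T - pa T) (cis (t2 T)))"
        by (simp add: pa r crs_scale_right) (simp add: crs_def algebra_simps)
      moreover have "r * crs (pb T - pa T) (cis (t2 T)) < 0" using d12(2) \<open>r > 0\<close> by (rule mult_pos_neg[rotated])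
      ultimately have "crs (pa T - p) (pivot T R - p) > 0" by simp
      then obtain e where e: "e > 0" "\<And>z. dist z p < e \<Longrightarrow> crs (pa T - p) (z - p) \<ge> 0 \<Longrightarrow> crs (pivot T R - p) (z - p) \<le> 0 \<Longrightarrow> z \<in> H"
        using corner[OF conH pH ab(1) piv(2)] by metis
      show False
      proof (rule near[OF e(1)])
        fix z assume z: "dist z p < e" "z \<in> closure (sreg T)"
        have "crs (pa T - pb T) (z - pb T) = - crs (pb T - pa T) (z - pa T)" by (simp add: crs_def algebra_simps)
        then show "z \<in> H" using closure_sreg[OF z(2)] \<open>r > 0\<close>
          by (intro e(2)[OF z(1)]) (auto simp: pa r lf_def crs_scale_left mult_nonneg_nonpos)
      qed
    qed
  next
    case False
    then have neg: "crs (pb T - pa T) (p - pa T) < 0" using cl(3) by simp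
    have "p \<notin> sreg T" using pb g[OF T(1)] by (auto simp: good_def)
    then have "lf (pa T) (t1 T) p = 0 \<or> lf (pb T) (t2 T) p = 0" using cl neg by (force simp: sreg_def)
    then show False
    proof
      assume z: "lf (pa T) (t1 T) p = 0"
      show False using left_line_cases[OF L(1) g[OF T(1)] L(2) z neg] L(3) pV noseg[OF ab(1) piv(1)]
          outer_free[OF L(1) g[OF T(1)] L(2)] pb by auto
    next
      assume z: "lf (pb T) (t2 T) p = 0"
      show False using right_line_cases[OF g[OF T(1)] R(1) R(2) z neg] R(3) pV noseg[OF ab(2) piv(2)]
          outer_free[OF g[OF T(1)] R(1) R(2)] pb by auto
    qed
  qed
qed

lemma hull_bd_subset: "convex hull bd \<subseteq> closure (convex hull D)"
proof (rule hull_minimal)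
  have "bd \<subseteq> closure D" using frontier_D by (auto simp: frontier_def)
  also have "\<dots> \<subseteq> closure (convex hull D)" by (intro closure_mono hull_subset)
  finally show "bd \<subseteq> closure (convex hull D)" .
qed (simp add: convex_closure)

text \<open>The hull of the open set \<open>D\<close> is open, so its complement is the closure of
  the complement of its closure; and the finite union of closed sectors is closed.\<close>

lemma sys_covers_outside_D:
  assumes "sys ts" shows "- (convex hull D) \<subseteq> (\<Union>T\<in>set ts. closure (sreg T))"
proof -
  have "- closure (convex hull D) \<subseteq> (\<Union>T\<in>set ts. closure (sreg T))"
    using sys_covers_outside[OF assms] hull_bd_subset by blast
  then have "closure (- closure (convex hull D)) \<subseteq> (\<Union>T\<in>set ts. closure (sreg T))"
    by (intro closure_minimal closed_UN) auto
  moreover have "closure (- closure (convex hull D)) = - (convex hull D)"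
    using convex_interior_closure[of "convex hull D"] open_convex_hull[OF open_D]
    by (simp add: closure_complement interior_open)
  ultimately show ?thesis by simp
qed

text \<open>Extreme points of the closed hull lie in the closure of \<open>D\<close> but not in the
  open set \<open>D\<close>, hence on \<open>bd\<close>, and are pivots.\<close>

lemma hull_edges_le:
  assumes sys: "sys ts" shows "card {e. e edge_of closure (convex hull D)} \<le> length ts"
proof -
  define S where "S = closure (convex hull D)"
  obtain V where V: "finite V" "card V \<le> length ts"
    "\<And>T. T \<in> set ts \<Longrightarrow> \<exists>T'. good T' \<and> sreg T' \<in> sreg ` set ts \<and> link T' T \<and> pivot T' T \<in> V"
    "\<And>T. T \<in> set ts \<Longrightarrow> \<exists>T'. good T' \<and> sreg T' \<in> sreg ` set ts \<and> link T T' \<and> pivot T T' \<in> V"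
    using sys_pivots[OF sys] by metis
  have bH: "bounded (convex hull D)" using bounded_D bounded_convex_hull by blast
  then have S: "compact S" "convex S" by (auto simp: S_def convex_closure)
  have DS: "D \<subseteq> S" unfolding S_def using hull_subset closure_subset by (metis subset_trans)
  then have "D \<subseteq> interior S" using open_D interior_maximal by blast
  then have int: "interior S \<noteq> {}" using D_ne by blast
  have "S \<subseteq> convex hull (closure D)"
    unfolding S_def using bounded_D
    by (intro closure_minimal hull_mono closure_subset compact_imp_closed compact_convex_hull) simp
  moreover have "convex hull (closure D) \<subseteq> S"
    unfolding S_def by (intro hull_minimal closure_mono hull_subset convex_closure) simp
  ultimately have Seq: "S = convex hull (closure D)" by simp
  have "x \<in> V" if x: "x extreme_point_of S" for x
  proof -
    have "x \<in> closure D" using x extreme_point_of_convex_hull Seq by metis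
    moreover have "x \<notin> D" using extreme_point_not_in_interior x \<open>D \<subseteq> interior S\<close> by blast
    ultimately have "x \<in> bd" using frontier_D open_D by (auto simp: frontier_def interior_open)
    then have "x extreme_point_of (convex hull bd)"
      using x hull_bd_subset hull_inc[of x bd] by (auto simp: extreme_point_of_def S_def)
    then show ?thesis using extreme_is_pivot[OF sys _ V(3,4)] by blast
  qed
  then have "card {e. e edge_of S} \<le> card V"
    by (intro card_edges_le_extreme_points[OF S int V(1)]) auto
  then show ?thesis using V(2) by (simp add: S_def)
qed

end

section \<open>A neutral system with equal ratios\<close>

lemma rat_pos:
  assumes "shape T" shows "rat T > 0"
proof -
  have "sin (t2 T - t1 T) > 0" using assms by (intro sin_gt_zero) (auto simp: shape_def)
  then show ?thesis using assms by (simp add: rat_def shape_def)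
qed

text \<open>A first rotation brings an element without \<open>Q\<close> to the end, a second moves
  the leading elements without \<open>Q\<close> behind it. Then a complete run of \<open>Q\<close>
  stands in front, and both its neighbours in the cycle lack \<open>Q\<close>. The map
  \<open>f\<close> accounts for the change of an element that is moved round.\<close>

lemma cyclic_split:
  assumes "\<exists>x\<in>set xs. Q x" "\<exists>x\<in>set xs. \<not> Q x" and f: "\<And>x. Q (f x) \<longleftrightarrow> Q x"
    and R: "R xs" "\<And>us vs. R (us @ vs) \<Longrightarrow> R (vs @ map f us)"
  obtains as bs where "R (as @ bs)" "as \<noteq> []" "bs \<noteq> []" "\<forall>x\<in>set as. Q x" "\<not> Q (hd bs)" "\<not> Q (last bs)"
    "length (filter Q (as @ bs)) = length (filter Q xs)"
proof -
  have fl: "length (filter Q (map f us)) = length (filter Q us)" for us by (induction us) (auto simp: f)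
  obtain y where y: "y \<in> set xs" "\<not> Q y" using assms by blast
  obtain us vs where uv: "xs = us @ y # vs" using split_list[OF y(1)] by blast
  define ys where "ys = vs @ map f (us @ [y])"
  have "R ys" using R(1) R(2)[of "us @ [y]" vs] by (simp add: ys_def uv)
  have lq: "length (filter Q ys) = length (filter Q xs)" using fl by (simp add: ys_def uv f)
  have "filter Q xs \<noteq> []" using assms(1) by (simp add: filter_empty_conv)
  then have "filter Q ys \<noteq> []" using lq by (metis length_0_conv)
  then have ex: "\<exists>x\<in>set ys. Q x" by (auto simp: filter_empty_conv)
  have yl: "ys \<noteq> []" "\<not> Q (last ys)" using y by (auto simp: ys_def f)
  define us' vs' where "us' = takeWhile (\<lambda>x. \<not> Q x) ys" and "vs' = dropWhile (\<lambda>x. \<not> Q x) ys"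
  have yy: "ys = us' @ vs'" by (simp add: us'_def vs'_def)
  have v: "vs' \<noteq> []" "Q (hd vs')"
    using ex hd_dropWhile[of "\<lambda>x. \<not> Q x" ys] by (auto simp: vs'_def dropWhile_eq_Nil_conv)
  have u: "\<forall>x\<in>set us'. \<not> Q x" by (auto simp: us'_def dest: set_takeWhileD)
  define zs where "zs = vs' @ map f us'"
  have "R zs" using R(2)[of us' vs'] \<open>R ys\<close> yy by (simp add: zs_def)
  have lz: "length (filter Q zs) = length (filter Q xs)" using fl lq yy by (simp add: zs_def)
  have z: "zs \<noteq> []" "Q (hd zs)" "\<not> Q (last zs)"
  proof -
    show "zs \<noteq> []" "Q (hd zs)" using v by (simp_all add: zs_def)
    have "last ys = last vs'" using yy v by simp
    then show "\<not> Q (last zs)" using yl(2) u by (cases "us' = []") (auto simp: zs_def last_map f)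
  qed
  define as bs where "as = takeWhile Q zs" and "bs = dropWhile Q zs"
  have ab: "as @ bs = zs" by (simp add: as_def bs_def)
  have bne: "bs \<noteq> []" using z by (auto simp: bs_def dropWhile_eq_Nil_conv)
  show ?thesis
  proof (rule that)
    show "R (as @ bs)" "length (filter Q (as @ bs)) = length (filter Q xs)" using ab \<open>R zs\<close> lz by simp_all
    show "as \<noteq> []" using z by (cases zs) (auto simp: as_def)
    show "bs \<noteq> []" by (rule bne)
    show "\<forall>x\<in>set as. Q x" by (auto simp: as_def dest: set_takeWhileD)
    show "\<not> Q (hd bs)" using bne hd_dropWhile[of Q zs] by (simp add: bs_def)
    have "last bs = last zs" using ab bne by (metis last_appendR)
    then show "\<not> Q (last bs)" using z by simp
  qed
qed

context polygon
begin

lemma inside_not_bd: "c \<in> D \<Longrightarrow> c \<notin> bd"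
  using open_D frontier_D by (auto simp: frontier_def interior_open)

lemma hits_from_inside:
  assumes cD: "c \<in> D" shows "hits c w"
proof -
  define S where "S = (\<lambda>r. c + r *\<^sub>R cis w) ` {0..}"
  have "connected S" unfolding S_def
    by (intro connected_continuous_image continuous_intros convex_connected) auto
  moreover have "c \<in> S" unfolding S_def by (rule image_eqI[of _ _ 0]) auto
  then have "S \<inter> D \<noteq> {}" using cD by blast
  moreover have "S - D \<noteq> {}"
  proof -
    obtain B where B: "\<And>z. z \<in> D \<Longrightarrow> norm z \<le> B" using bounded_D by (auto simp: bounded_iff)
    define r where "r = \<bar>B\<bar> + norm c + 1"
    have "norm (r *\<^sub>R cis w) - norm (- c) \<le> norm (r *\<^sub>R cis w - (- c))" by (rule norm_triangle_ineq2)
    then have "norm (c + r *\<^sub>R cis w) > B" by (simp add: r_def add.commute)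
    then have "c + r *\<^sub>R cis w \<notin> D" using B by force
    moreover have "c + r *\<^sub>R cis w \<in> S" by (auto simp: S_def r_def)
    ultimately show ?thesis by blast
  qed
  ultimately have "S \<inter> frontier D \<noteq> {}" using connected_Int_frontier by blast
  then obtain r where r: "r \<ge> 0" "c + r *\<^sub>R cis w \<in> bd" using frontier_D by (auto simp: S_def)
  then have "r \<noteq> 0" using inside_not_bd[OF cD] by auto
  then show ?thesis using r by (auto simp: hits_def intro!: exI[of _ r])
qed

text \<open>A vertex farthest from \<open>c\<close> is farthest among all boundary points, because
  the ball through it is convex and contains the edges.\<close>

lemma farvert_exists:
  assumes cD: "c \<in> D" obtains \<beta> where "farvert c \<beta>" "farvert c (\<beta> + 2 * pi)"
proof -
  have "bd \<noteq> {}" using hits_from_inside[OF cD] by (auto simp: hits_def)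
  then have "verts \<noteq> {}" by (auto simp: bd_def verts_def)
  then have "Max (dist c ` verts) \<in> dist c ` verts" using finite_verts by (intro Max_in) auto
  then obtain v where v0: "v \<in> verts" "Max (dist c ` verts) = dist c v" by blast
  have v: "v \<in> verts" "\<And>v'. v' \<in> verts \<Longrightarrow> dist c v' \<le> dist c v"
    using v0 finite_verts by (auto simp flip: v0(2))
  have bdv: "dist c x \<le> dist c v" if xb: "x \<in> bd" for x
  proof -
    obtain i where i: "i < n" "x \<in> closed_segment (P i) (Q i)" using xb by (auto simp: bd_def edge_def)
    have "P i \<in> cball c (dist c v)" "Q i \<in> cball c (dist c v)" using v(2) i by (auto simp: verts_def)
    then have "closed_segment (P i) (Q i) \<subseteq> cball c (dist c v)" by (intro closed_segment_subset) auto
    then show ?thesis using i by auto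
  qed
  obtain \<beta> where b: "v - c = cmod (v - c) *\<^sub>R cis \<beta>" using polar_from[of 0 "v - c"] by metis
  have "v \<noteq> c" using v(1) verts_bd inside_not_bd[OF cD] by blast
  define r where "r = cmod (v - c)"
  have r: "r > 0" "v = c + r *\<^sub>R cis \<beta>" using \<open>v \<noteq> c\<close> b by (simp_all add: r_def algebra_simps)
  have "c + s *\<^sub>R cis \<beta> \<notin> bd" if "s > r" for s
  proof
    assume "c + s *\<^sub>R cis \<beta> \<in> bd"
    then have "dist c (c + s *\<^sub>R cis \<beta>) \<le> dist c v" by (rule bdv)
    also have "dist c v = r" by (simp add: r_def dist_norm norm_minus_commute)
    finally have "dist c (c + s *\<^sub>R cis \<beta>) \<le> r" .
    then show False using that r(1) by (simp add: dist_norm)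
  qed
  then have "far c \<beta> r" using r v(1) verts_bd by (auto simp: far_def)
  then show ?thesis using that[of \<beta>] r v(1) by (auto simp: farvert_def far_def)
qed

text \<open>All lines pass through \<open>c\<close>, so the side of \<open>x\<close> depends only on
  \<open>x - c\<close>; \<open>no_common_side\<close> for this vector and for its negative gives
  neutrality.\<close>

lemma initial_system: "\<exists>ts. sys ts \<and> neutral ts"
proof -
  obtain c where cD: "c \<in> D" using D_ne by blast
  obtain \<beta> where "farvert c \<beta>" "farvert c (\<beta> + 2 * pi)" using farvert_exists[OF cD] by blast
  then obtain ts where ts: "chain c \<beta> ts c (\<beta> + 2 * pi)" "\<forall>T\<in>set ts. good T \<and> centred c T"
    using radial_chain[of c \<beta> "\<beta> + 2 * pi"] inside_not_bd[OF cD] hits_from_inside[OF cD] pi_gt_zero by auto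
  have c: "closed_chain ts" using closed_chainI ts(1) by blast
  have lf: "lf (pa T) (t1 T) x = crs (cis (t1 T)) (x - c)" if T: "T \<in> set ts" for T x
  proof -
    obtain r where "pa T = c + r *\<^sub>R cis (t1 T)" using ts(2) T by (auto simp: centred_def)
    then show ?thesis by (simp add: lf_def crs_simps)
  qed
  have sh: "\<forall>T\<in>set ts. t2 T < t1 T + pi" using ts(2) by (auto simp: good_def shape_def)
  have "(\<exists>T\<in>set ts. lf (pa T) (t1 T) x \<le> 0) \<and> (\<exists>T\<in>set ts. lf (pa T) (t1 T) x \<ge> 0)" for x
  proof (cases "x = c")
    case True
    have "ts \<noteq> []" using c by (simp add: closed_chain_def)
    then obtain T where "T \<in> set ts" by (meson hd_in_set)
    moreover from this have "lf (pa T) (t1 T) x = 0" using lf[of T x] True by simp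
    ultimately show ?thesis by (intro conjI bexI[of _ T]) simp_all
  next
    case False
    then obtain T T' where T: "T \<in> set ts" "crs (cis (t1 T)) (x - c) \<ge> 0" "T' \<in> set ts" "crs (cis (t1 T')) (c - x) \<ge> 0"
      using no_common_side[OF c sh, of "x - c"] no_common_side[OF c sh, of "c - x"] by auto
    have "crs (cis (t1 T')) (x - c) = - crs (cis (t1 T')) (c - x)" by (simp add: crs_def algebra_simps)
    then show ?thesis using T lf by (metis neg_le_0_iff_le)
  qed
  then show ?thesis using c ts(2) unfolding sys_def neutral_def by blast
qed

lemma sys_rotate: "sys (us @ vs) \<Longrightarrow> sys (vs @ map turn us)"
  using closed_chain_rotate by (auto simp: sys_def)

lemma neutral_rotate: "neutral (us @ vs) \<Longrightarrow> neutral (vs @ map turn us)"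
  unfolding neutral_def by (auto simp: ball_Un bex_Un)

lemma diameter_bound:
  obtains R where "R > 0" "\<And>x y. x \<in> bd \<Longrightarrow> y \<in> bd \<Longrightarrow> dist x y \<le> R"
proof -
  obtain e where e: "\<And>x y. x \<in> bd \<Longrightarrow> y \<in> bd \<Longrightarrow> dist x y \<le> e"
    using compact_imp_bounded[OF compact_bd] bounded_two_points[of bd] by blast
  then show ?thesis by (intro that[of "max e 1"]) (auto simp: le_max_iff_disj)
qed

text \<open>At most \<open>n\<close> triangles share a full angle, so one of them has angle at least
  \<open>2 * pi / n\<close>. Its base is bounded by the diameter of \<open>bd\<close>, which bounds
  its area from above.\<close>

lemma sys_large_ratio:
  obtains r0 where "r0 > 0" "\<And>ts. sys ts \<Longrightarrow> \<exists>T\<in>set ts. r0 \<le> rat T"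
proof -
  obtain R where R: "R > 0" "\<And>x y. x \<in> bd \<Longrightarrow> y \<in> bd \<Longrightarrow> dist x y \<le> R"
    using diameter_bound by metis
  define \<alpha> where "\<alpha> = 2 * pi / real n"
  have large: "\<exists>T\<in>set ts. \<alpha> \<le> t2 T - t1 T" if s: "sys ts" for ts
  proof (rule ccontr)
    assume "\<not> ?thesis"
    then have lt: "\<And>T. T \<in> set ts \<Longrightarrow> t2 T - t1 T < \<alpha>" by force
    have ne: "ts \<noteq> []" and c: "chain (pa (hd ts)) (t1 (hd ts)) ts (pa (hd ts)) (t1 (hd ts) + 2 * pi)"
      using s by (auto simp: sys_def closed_chain_def)
    have n0: "n > 0" using sys_length[OF s] ne by (cases ts) auto
    have "(\<Sum>T\<leftarrow>ts. t2 T - t1 T) < (\<Sum>T\<leftarrow>ts. \<alpha>)" using lt ne by (intro sum_list_strict_mono) auto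
    also have "\<dots> = real (length ts) * \<alpha>" by (simp add: sum_list_triv)
    also have "\<dots> \<le> real n * \<alpha>" using sys_length[OF s] by (intro mult_right_mono) (auto simp: \<alpha>_def)
    also have "\<dots> = 2 * pi" using n0 by (simp add: \<alpha>_def)
    finally show False using chain_sum[OF c] by simp
  qed
  have a0: "\<alpha> > 0" "\<alpha> < pi"
  proof -
    obtain ts where s: "sys ts" using initial_system by blast
    then have "ts \<noteq> []" by (auto simp: sys_def closed_chain_def)
    then have "n > 0" using sys_length[OF s] by (cases ts) auto
    then show "\<alpha> > 0" by (simp add: \<alpha>_def)
    obtain T where "T \<in> set ts" "\<alpha> \<le> t2 T - t1 T" using large[OF s] by blast
    moreover from this have "t2 T < t1 T + pi" using s by (auto simp: sys_def good_def shape_def)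
    ultimately show "\<alpha> < pi" by linarith
  qed
  have s0: "sin (\<alpha> / 2) > 0" using a0 by (intro sin_gt_zero) auto
  define r0 where "r0 = 4 * \<alpha> * sin (\<alpha> / 2) / R\<^sup>2"
  show ?thesis
  proof (rule that)
    show "r0 > 0" using a0 s0 R by (simp add: r0_def)
    fix ts assume s: "sys ts"
    obtain T where T: "T \<in> set ts" "\<alpha> \<le> t2 T - t1 T" using large[OF s] by blast
    have g: "good T" using s T by (auto simp: sys_def)
    have sh: "shape T" using g good_shape by blast
    define be where "be = t2 T - t1 T"
    have be: "\<alpha> \<le> be" "be < pi" using T sh by (auto simp: be_def shape_def)
    have r: "rat T > 0" using rat_pos[OF sh] .
    have "norm (pb T - pa T) \<le> R" using R(2)[of "pb T" "pa T"] good_bd[OF g] by (simp add: dist_norm)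
    then have "(norm (pb T - pa T))\<^sup>2 \<le> R\<^sup>2" by (intro power_mono) auto
    then have d: "rat T * (norm (pb T - pa T))\<^sup>2 \<le> rat T * R\<^sup>2" using r by (intro mult_left_mono) auto
    have "sin (\<alpha> / 2) \<le> sin (be / 2)" using be a0 by (intro sin_monotone_2pi_le) auto
    then have "4 * \<alpha> * sin (\<alpha> / 2) \<le> 4 * be * sin (be / 2)" using be a0 s0 by (intro mult_mono) auto
    also have "\<dots> \<le> rat T * (norm (pb T - pa T))\<^sup>2 * cos (be / 2)"
      using rat_angle_bound[OF sh order_refl] r by (simp add: be_def)
    also have "\<dots> \<le> rat T * (norm (pb T - pa T))\<^sup>2 * 1" using r by (intro mult_left_mono) auto
    finally have "4 * \<alpha> * sin (\<alpha> / 2) \<le> rat T * R\<^sup>2" using d by linarith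
    then show "\<exists>T\<in>set ts. r0 \<le> rat T" using T R by (intro bexI[of _ T]) (auto simp: r0_def divide_le_eq)
  qed
qed

theorem equal_ratio_system:
  "\<exists>ts M. sys ts \<and> neutral ts \<and> (\<forall>T\<in>set ts. rat T = M)"
proof -
  obtain r0 where r0: "r0 > 0" "\<And>ts. sys ts \<Longrightarrow> \<exists>T\<in>set ts. r0 \<le> rat T" using sys_large_ratio by metis
  obtain ts0 where ts0: "sys ts0" "neutral ts0" using initial_system by blast
  obtain R where R: "R > 0" "\<And>x y. x \<in> bd \<Longrightarrow> y \<in> bd \<Longrightarrow> dist x y \<le> R"
    using diameter_bound by metis
  \<comment> \<open>Far enough for the ratios of thin triangles to be below \<open>r0\<close>, hence
    below the maximum of any system.\<close>
  define \<rho> where "\<rho> = 2 * R + 1 + 4 / r0"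
  have rho: "\<rho> > 2 * R" using r0(1) by (simp add: \<rho>_def add_pos_pos)
  have hi: "4 / (\<rho> - R)\<^sup>2 < r0"
  proof -
    have q: "4 / r0 > 0" using r0(1) by simp
    have g: "\<rho> - R > 1" "\<rho> - R > 4 / r0" using R(1) q unfolding \<rho>_def by linarith+
    have "(\<rho> - R) * 1 < (\<rho> - R) * (\<rho> - R)" using g by (intro mult_strict_left_mono) auto
    then have "4 / r0 < (\<rho> - R)\<^sup>2" using g(2) by (simp only: power2_eq_square mult_1_right)
    then show ?thesis using r0(1) g by (simp add: divide_less_eq mult.commute)
  qed
  have sh: "shape T" if "sys ts" "T \<in> set ts" for ts T using that good_shape by (auto simp: sys_def)
  have ne: "ts \<noteq> []" if "sys ts" for ts using that by (auto simp: sys_def closed_chain_def)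
  define lo0 where "lo0 = Min (rat ` set ts0)"
  have lo0: "lo0 > 0" "\<And>T. T \<in> set ts0 \<Longrightarrow> lo0 \<le> rat T"
    using rat_pos sh[OF ts0(1)] ne[OF ts0(1)] by (auto simp: lo0_def)
  \<comment> \<open>One lower bound that suits the thin triangles and the starting system and is
    strictly below the maximum of every system.\<close>
  define lo where "lo = min (2 / (\<rho> + 1 + R)\<^sup>2) (min lo0 (r0 / 2))"
  have "\<rho> + 1 + R > 0" using rho R(1) by simp
  then have lo: "lo > 0" "lo \<le> 2 / (\<rho> + 1 + R)\<^sup>2" "lo \<le> lo0" "lo < r0"
    using lo0(1) r0(1) by (auto simp: lo_def)
  define F where "F = {ts. sys ts \<and> neutral ts \<and> (\<forall>T\<in>set ts. lo \<le> rat T)}"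
  define mx where "mx ts = Max (rat ` set ts)" for ts
  have mxI: "mx ts < c" if "sys ts" "\<forall>T\<in>set ts. rat T < c" for ts c
    using that ne by (auto simp: mx_def)
  have mxD: "rat T \<le> mx ts" if "T \<in> set ts" for ts T using that by (auto simp: mx_def)
  have mxr: "r0 \<le> mx ts" if "sys ts" for ts using r0(2)[OF that] mxD order_trans by blast
  have F0: "ts0 \<in> F" using ts0 lo lo0 by (force simp: F_def)
  define M where "M = Inf (mx ` F)"
  have bb: "bdd_below (mx ` F)" using mxr by (intro bdd_belowI[of _ r0]) (auto simp: F_def)
  have Mle: "M \<le> mx ts" if "ts \<in> F" for ts unfolding M_def using that bb by (intro cInf_lower) auto
  have M0: "r0 \<le> M" unfolding M_def using F0 mxr by (intro cInf_greatest) (auto simp: F_def)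
  have "\<exists>ts\<in>F. mx ts < M + inverse (real (Suc k))" for k
  proof -
    have "Inf (mx ` F) < M + inverse (real (Suc k))" by (simp add: M_def)
    then show ?thesis using F0 bb by (subst (asm) cInf_less_iff) auto
  qed
  then obtain X where X: "\<And>k. X k \<in> F" "\<And>k. mx (X k) < M + inverse (real (Suc k))" by metis
  have "\<exists>ts. sys ts \<and> neutral ts \<and> (\<forall>T\<in>set ts. lo \<le> rat T \<and> rat T \<le> M)"
  proof (rule sys_limit[of X n lo "\<lambda>k. M + inverse (real (Suc k))"])
    show "sys (X k)" "neutral (X k)" for k using X(1) by (auto simp: F_def)
    then show "length (X k) \<le> n" for k using sys_length by blast
    show "lo > 0" by (rule lo)
    show "lo \<le> rat T" if "T \<in> set (X k)" for k T using X(1)[of k] that by (auto simp: F_def)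
    show "rat T \<le> M + inverse (real (Suc k))" if "T \<in> set (X k)" for k T
      using mxD[OF that] X(2)[of k] by simp
    have "(\<lambda>k. M + inverse (real (Suc k))) \<longlonglongrightarrow> M + 0" by (intro tendsto_intros LIMSEQ_inverse_real_of_nat)
    then show "(\<lambda>k. M + inverse (real (Suc k))) \<longlonglongrightarrow> M" by simp
  qed
  then obtain ts1 where ts1: "sys ts1 \<and> neutral ts1 \<and> (\<forall>T\<in>set ts1. lo \<le> rat T \<and> rat T \<le> M)" by blast
  define G where "G ts \<longleftrightarrow> sys ts \<and> neutral ts \<and> (\<forall>T\<in>set ts. lo \<le> rat T \<and> rat T \<le> M)" for ts
  have "G ts1" using ts1 by (simp add: G_def)
  then obtain ts where ts: "G ts"
    "\<And>us. G us \<Longrightarrow> length (filter (\<lambda>T. rat T = M) ts) \<le> length (filter (\<lambda>T. rat T = M) us)"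
    using ex_has_least_nat[of G ts1 "\<lambda>us. length (filter (\<lambda>T. rat T = M) us)"] by blast
  \<comment> \<open>A system with all its ratios below \<open>M\<close> would undercut the
    infimum.\<close>
  have "\<exists>T\<in>set ts. rat T = M"
  proof (rule ccontr)
    assume "\<not> ?thesis"
    then have "\<forall>T\<in>set ts. rat T < M" using ts(1) by (force simp: G_def)
    then have "mx ts < M" using mxI ts(1) by (auto simp: G_def)
    moreover have "ts \<in> F" using ts(1) by (auto simp: G_def F_def)
    ultimately show False using Mle by force
  qed
  moreover have "\<not> (\<exists>T\<in>set ts. rat T \<noteq> M)"
  proof
    assume ex: "\<exists>T\<in>set ts. rat T \<noteq> M"
    have rot: "G (vs @ map turn us)" if "G (us @ vs)" for us vs
      using that sys_rotate neutral_rotate by (auto simp: G_def)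
    obtain A B where AB: "G (A @ B)" "A \<noteq> []" "B \<noteq> []" "\<forall>T\<in>set A. rat T = M" "rat (hd B) \<noteq> M" "rat (last B) \<noteq> M"
      "length (filter (\<lambda>T. rat T = M) (A @ B)) = length (filter (\<lambda>T. rat T = M) ts)"
      by (rule cyclic_split[where xs = ts and Q = "\<lambda>T. rat T = M" and f = turn and R = G])
        (use \<open>\<exists>T\<in>set ts. rat T = M\<close> ex ts(1) rot in auto)
    have "rat (hd B) < M" "rat (last B) < M"
      using AB(1,3,5,6) by (auto simp: G_def less_le)
    then obtain us where "G us" "length (filter (\<lambda>T. rat T = M) us) < length (filter (\<lambda>T. rat T = M) (A @ B))"
      using improve[OF R(2) rho _ _ AB(2,3,4), where lo = lo] AB(1) lo hi M0 unfolding G_def by auto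
    then show False using ts(2) AB(7) by force
  qed
  ultimately show ?thesis using ts(1) unfolding G_def by blast
qed

end

section \<open>Back to Euclidean triangles\<close>

text \<open>\<open>content_triangle\<close> speaks about \<open>real^2\<close>; the coordinate map
  carries Lebesgue measure over to the complex plane, box by box.\<close>

lemma lborel_complex_eq:
  "distr lborel borel (\<lambda>x::real^2. Complex (x $ 1) (x $ 2)) = (lborel :: complex measure)"
proof (rule lborel_eqI[symmetric])
  let ?g = "\<lambda>x::real^2. Complex (x $ 1) (x $ 2)"
  have "?g \<in> borel_measurable borel"
    unfolding Complex_eq by (intro borel_measurable_continuous_onI continuous_intros)
  then have g: "?g \<in> borel_measurable lborel" by simp
  fix l u :: complex assume lu: "\<And>b. b \<in> Basis \<Longrightarrow> l \<bullet> b \<le> u \<bullet> b"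
  have le: "Re l \<le> Re u" "Im l \<le> Im u" 
    using lu[of 1] lu[of \<i>] by (auto simp: Basis_complex_def)
  let ?l = "vector [Re l, Im l] :: real^2" and ?u = "vector [Re u, Im u] :: real^2"
  have B: "(Basis :: (real^2) set) = {axis 1 1, axis 2 1}" by (auto simp: Basis_vec_def UNIV_2)
  have ax: "axis 1 1 \<noteq> (axis 2 1 :: real^2)" by (simp add: axis_eq_axis)
  have "?g -` box l u \<inter> space lborel = box ?l ?u"
    by (auto simp: in_box_complex_iff mem_box_cart forall_2)
  then have "emeasure (distr lborel borel ?g) (box l u) = emeasure lborel (box ?l ?u)"
    using g by (subst emeasure_distr) auto
  also have "\<dots> = (\<Prod>b\<in>Basis. (?u - ?l) \<bullet> b)"
    using le by (intro emeasure_lborel_box) (auto simp: B inner_axis)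
  also have "\<dots> = (\<Prod>b\<in>Basis. (u - l) \<bullet> b)"
    using ax by (simp add: B inner_axis Basis_complex_def complex_eq_iff)
  finally show "emeasure (distr lborel borel ?g) (box l u) = (\<Prod>b\<in>Basis. (u - l) \<bullet> b)" .
qed simp

lemma area_convex_hull_3: "measure lebesgue (convex hull {a, b, c}) = \<bar>crs (b - a) (c - a)\<bar> / 2"
proof -
  let ?g = "\<lambda>x::real^2. Complex (x $ 1) (x $ 2)" and ?f = "\<lambda>z. vector [Re z, Im z] :: real^2"
  let ?H = "convex hull {a, b, c}"
  have "?g \<in> borel_measurable borel"
    unfolding Complex_eq by (intro borel_measurable_continuous_onI continuous_intros)
  then have g: "?g \<in> borel_measurable lborel" by simp
  have lin: "linear ?g" by (intro linearI) (auto simp: complex_eq_iff)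
  have inj: "inj ?g" by (intro injI) (simp add: vec_eq_iff forall_2)
  have bor: "?H \<in> sets borel" by (intro borel_compact finite_imp_compact_convex_hull) simp
  have "?H = ?g ` (convex hull {?f a, ?f b, ?f c})"
    unfolding convex_hull_linear_image[OF lin] by simp
  then have pre: "?g -` ?H = convex hull {?f a, ?f b, ?f c}" using inj by (simp add: inj_vimage_image_eq)
  have "measure lebesgue ?H = measure (distr lborel borel ?g) ?H"
    using bor by (simp add: lborel_complex_eq)
  also have "\<dots> = measure lborel (?g -` ?H)" using g bor by (subst measure_distr) auto
  also have "\<dots> = \<bar>crs (b - a) (c - a)\<bar> / 2" unfolding pre content_triangle
    by (simp add: crs_def algebra_simps abs_minus_commute)
  finally show ?thesis .
qed

text \<open>The apex is where the line through \<open>pa T\<close> with direction \<open>t1 T\<close> meets the line through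
  \<open>pb T\<close> with direction \<open>t2 T\<close>.\<close>

definition apex :: "tri \<Rightarrow> complex" where
  "apex T = pa T - (crs (cis (t2 T)) (pb T - pa T) / sin (t2 T - t1 T)) *\<^sub>R cis (t1 T)"

definition to_triangle :: "tri \<Rightarrow> triangle" where
  "to_triangle T = Triangle (apex T) (pa T) (pb T)"

lemma to_triangle_sel [simp]: "base_vertex (to_triangle T) = apex T"
  "base_end1 (to_triangle T) = pa T" "base_end2 (to_triangle T) = pb T"
  by (simp_all add: to_triangle_def)

text \<open>\<open>r\<close> and \<open>s\<close> are the distances from the apex to
  \<open>pa T\<close> and \<open>pb T\<close>, so the area is \<open>r * s * \<sigma> / 2\<close>,
  and the quotient with the base angle becomes \<open>rat T\<close>.\<close>

locale shaped =
  fixes T :: tri and r s \<sigma> :: real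
  assumes shape: "shape T"
  defines "\<sigma> \<equiv> sin (t2 T - t1 T)"
    and "r \<equiv> crs (cis (t2 T)) (pb T - pa T) / \<sigma>" and "s \<equiv> crs (cis (t1 T)) (pb T - pa T) / \<sigma>"
begin

lemma angles: "t1 T < t2 T" "t2 T < t1 T + pi" and \<sigma>_pos: "\<sigma> > 0" and r_pos: "r > 0" and s_pos: "s > 0"
proof -
  show 1: "t1 T < t2 T" "t2 T < t1 T + pi" using shape by (auto simp: shape_def)
  then show 2: "\<sigma> > 0" unfolding \<sigma>_def by (intro sin_gt_zero) auto
  show "r > 0" "s > 0" using 2 shape by (auto simp: r_def s_def shape_def)
qed

lemma pa_apex: "pa T = apex T + r *\<^sub>R cis (t1 T)"
  by (simp add: apex_def r_def \<sigma>_def)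

lemma pb_apex: "pb T = apex T + s *\<^sub>R cis (t2 T)"
proof -
  have "\<sigma> *\<^sub>R (pb T - pa T) = crs (cis (t1 T)) (pb T - pa T) *\<^sub>R cis (t2 T) - crs (cis (t2 T)) (pb T - pa T) *\<^sub>R cis (t1 T)"
    using crs_expand[of "cis (t1 T)" "cis (t2 T)" "pb T - pa T"] crs_commute[of "pb T - pa T"]
    by (simp add: crs_cis \<sigma>_def algebra_simps)
  then have "(1 / \<sigma>) *\<^sub>R (\<sigma> *\<^sub>R (pb T - pa T)) =
    (1 / \<sigma>) *\<^sub>R (crs (cis (t1 T)) (pb T - pa T) *\<^sub>R cis (t2 T) - crs (cis (t2 T)) (pb T - pa T) *\<^sub>R cis (t1 T))" by simp
  then have "pb T - pa T = s *\<^sub>R cis (t2 T) - r *\<^sub>R cis (t1 T)"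
    using \<sigma>_pos by (simp only: scaleR_diff_right scaleR_scaleR) (simp add: r_def s_def)
  then show ?thesis by (simp add: pa_apex algebra_simps)
qed

lemma lf_apex: "lf (pa T) (t1 T) x = crs (cis (t1 T)) (x - apex T)" "lf (pb T) (t2 T) x = crs (cis (t2 T)) (x - apex T)"
  unfolding pa_apex pb_apex lf_base_move by (simp_all add: lf_def)

lemma crs12: "crs (cis (t1 T)) (cis (t2 T)) = \<sigma>" "crs (cis (t2 T)) (cis (t1 T)) = - \<sigma>"
  by (simp_all add: crs_cis \<sigma>_def) (metis minus_diff_eq sin_minus)

lemma crs_apex: "crs (pb T - pa T) (apex T - pa T) = r * s * \<sigma>"
  unfolding pa_apex pb_apex by (simp add: crs_simps crs12)

lemma crs_sides: "crs (pa T - apex T) (pb T - apex T) = r * s * \<sigma>"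
  unfolding pa_apex pb_apex by (simp add: crs_simps crs12)

lemma crs_sides_pos: "r * s * \<sigma> > 0"
  using r_pos s_pos \<sigma>_pos by simp

text \<open>\<open>a\<close> and \<open>b\<close> are the barycentric coordinates at
  \<open>pa T\<close> and \<open>pb T\<close>; the sign of the third one decides the side of the
  base line.\<close>

lemma hull_coords:
  obtains a b where "a = - crs (cis (t2 T)) (x - apex T) / (\<sigma> * r)" "b = crs (cis (t1 T)) (x - apex T) / (\<sigma> * s)"
    "x = (1 - a - b) *\<^sub>R apex T + a *\<^sub>R pa T + b *\<^sub>R pb T" "crs (pb T - pa T) (x - pa T) = (1 - a - b) * (r * s * \<sigma>)"
proof -
  define a b where "a = - crs (cis (t2 T)) (x - apex T) / (\<sigma> * r)" and "b = crs (cis (t1 T)) (x - apex T) / (\<sigma> * s)"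
  have "\<sigma> *\<^sub>R (x - apex T) = (- crs (cis (t2 T)) (x - apex T)) *\<^sub>R cis (t1 T) + crs (cis (t1 T)) (x - apex T) *\<^sub>R cis (t2 T)"
    using crs_expand[of "cis (t1 T)" "cis (t2 T)" "x - apex T"] crs_commute[of "x - apex T"]
    by (simp add: crs12)
  also have "\<dots> = \<sigma> *\<^sub>R (a *\<^sub>R (pa T - apex T) + b *\<^sub>R (pb T - apex T))"
    using \<sigma>_pos r_pos s_pos unfolding pa_apex pb_apex by (simp add: a_def b_def scaleR_add_right scaleR_diff_right)
  finally have "x - apex T = a *\<^sub>R (pa T - apex T) + b *\<^sub>R (pb T - apex T)" using \<sigma>_pos by simp
  then have x: "x = (1 - a - b) *\<^sub>R apex T + a *\<^sub>R pa T + b *\<^sub>R pb T" by (simp add: algebra_simps)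
  have "x - pa T = (1 - a - b) *\<^sub>R (apex T - pa T) + b *\<^sub>R (pb T - pa T)"
    by (subst x) (simp add: algebra_simps)
  then have "crs (pb T - pa T) (x - pa T) = (1 - a - b) * (r * s * \<sigma>)"
    by (simp only: crs_add_right crs_scale_right crs_apex crs_self mult_zero_right add_0_right)
  then show ?thesis using that[of a b] x a_def b_def by blast
qed

abbreviation "tr \<equiv> convex hull {apex T, pa T, pb T}"

lemma hullI:
  assumes "lf (pa T) (t1 T) x \<ge> 0" "lf (pb T) (t2 T) x \<le> 0" "crs (pb T - pa T) (x - pa T) \<ge> 0"
  shows "x \<in> tr"
proof -
  obtain a b where ab: "a = - crs (cis (t2 T)) (x - apex T) / (\<sigma> * r)" "b = crs (cis (t1 T)) (x - apex T) / (\<sigma> * s)"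
    "x = (1 - a - b) *\<^sub>R apex T + a *\<^sub>R pa T + b *\<^sub>R pb T" "crs (pb T - pa T) (x - pa T) = (1 - a - b) * (r * s * \<sigma>)"
    using hull_coords by metis
  have "a \<ge> 0" using assms(2) \<sigma>_pos r_pos unfolding ab(1) lf_apex by (intro divide_nonneg_pos) auto
  moreover have "b \<ge> 0" using assms(1) \<sigma>_pos s_pos unfolding ab(2) lf_apex by (intro divide_nonneg_pos) auto
  moreover have "1 - a - b \<ge> 0" using assms(3) crs_sides_pos unfolding ab(4) by (simp add: zero_le_mult_iff)
  ultimately show ?thesis unfolding convex_hull_3
    by (intro CollectI exI[of _ "1 - a - b"] exI[of _ a] exI[of _ b]) (use ab(3) in auto)
qed

lemma hullD:
  assumes "x \<in> tr" shows "crs (pb T - pa T) (x - pa T) \<ge> 0"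
proof -
  obtain u v w where uvw: "u \<ge> 0" "v \<ge> 0" "w \<ge> 0" "u + v + w = 1" "x = u *\<^sub>R apex T + v *\<^sub>R pa T + w *\<^sub>R pb T"
    using assms unfolding convex_hull_3 by blast
  have v: "v = 1 - u - w" using uvw(4) by simp
  have "x - pa T = u *\<^sub>R (apex T - pa T) + w *\<^sub>R (pb T - pa T)" unfolding uvw(5) v by (simp add: algebra_simps)
  then have "crs (pb T - pa T) (x - pa T) = u * (r * s * \<sigma>)"
    by (simp only: crs_add_right crs_scale_right crs_apex crs_self mult_zero_right add_0_right)
  then show ?thesis using uvw(1) crs_sides_pos by simp
qed

lemma not_collinear: "\<not> collinear {apex T, pa T, pb T}"
proof
  assume "collinear {apex T, pa T, pb T}"
  then obtain u where u: "\<And>x y. x \<in> {apex T, pa T, pb T} \<Longrightarrow> y \<in> {apex T, pa T, pb T} \<Longrightarrow> \<exists>c. x - y = c *\<^sub>R u"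
    unfolding collinear_def by blast
  obtain c d where "pa T - apex T = c *\<^sub>R u" "pb T - apex T = d *\<^sub>R u" using u by (metis insertI1 insert_iff)
  then have "crs (pa T - apex T) (pb T - apex T) = 0" by (simp add: crs_simps)
  then show False using crs_sides crs_sides_pos by linarith
qed

lemma region_eq: "region (to_triangle T) = {v. \<exists>x y z. 0 < x \<and> 0 < y \<and> 0 < z \<and> x + y + z = 1 \<and>
    x *\<^sub>R apex T + y *\<^sub>R pa T + z *\<^sub>R pb T = v}"
  using interior_convex_hull_3_minimal[OF not_collinear] by (simp add: region_def)

lemma region_ne: "region (to_triangle T) \<noteq> {}"
  unfolding region_eq by (auto intro!: exI[of _ "1 / 3 :: real"])

lemma closure_region: "closure (region (to_triangle T)) = tr"
proof -
  have "closure (region (to_triangle T)) = closure tr"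
    using convex_closure_interior[of tr] region_ne by (simp add: region_def)
  then show ?thesis by (simp add: finite_imp_compact_convex_hull compact_imp_closed)
qed

lemma area_region: "area (region (to_triangle T)) = r * s * \<sigma> / 2" "area tr = r * s * \<sigma> / 2"
proof -
  show t: "area tr = r * s * \<sigma> / 2"
    using crs_sides_pos unfolding area_def area_convex_hull_3 crs_sides by simp
  have "negligible (frontier tr)" by (intro negligible_convex_frontier) simp
  then have "measure lebesgue (interior tr) = measure lebesgue tr"
    by (intro measure_interior finite_imp_bounded_convex_hull) auto
  then show "area (region (to_triangle T)) = r * s * \<sigma> / 2" using t by (simp add: area_def region_def)
qed

lemma base_angle_eq: "base_angle (to_triangle T) = t2 T - t1 T"
proof -
  have "(r *\<^sub>R cis (t1 T)) \<bullet> (s *\<^sub>R cis (t2 T)) = r * s * cos (t2 T - t1 T)"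
    by (simp add: inner_complex_def cos_diff algebra_simps)
  then have "base_angle (to_triangle T) = arccos (cos (t2 T - t1 T))"
    using r_pos s_pos unfolding base_angle_def Let_def to_triangle_sel pa_apex pb_apex by simp
  then show ?thesis using angles by (simp add: arccos_cos)
qed

lemma ratio_eq: "base_angle (to_triangle T) / area (region (to_triangle T)) = rat T"
  using \<sigma>_pos unfolding base_angle_eq area_region r_def s_def rat_def
  by (simp add: \<sigma>_def field_simps)

text \<open>The wedge is itself an infinite sector that contains the triangle. Conversely, shrinking
  towards the apex moves any point of the wedge into the triangle, and sectors at the apex are
  invariant under this scaling.\<close>

lemma spanned_sector_eq:
  "spanned_sector (to_triangle T) = {x. lf (pa T) (t1 T) x > 0 \<and> lf (pb T) (t2 T) x < 0}" (is "_ = ?V")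
proof
  define W where "W = {apex T + complex_of_real \<rho> * cis \<theta> | \<rho> \<theta>. 0 < \<rho> \<and> t1 T < \<theta> \<and> \<theta> < t2 T}"
  have VW: "?V = W"
  proof
    show "?V \<subseteq> W"
    proof
      fix x assume x: "x \<in> ?V"
      then have "crs (cis (t1 T)) (x - apex T) > 0" "crs (cis (t2 T)) (x - apex T) < 0" by (auto simp: lf_apex)
      then obtain w where "t1 T < w" "w < t2 T" "x - apex T = cmod (x - apex T) *\<^sub>R cis w" "cmod (x - apex T) > 0"
        using between_directions angles by metis
      then show "x \<in> W" unfolding W_def
        by (intro CollectI exI[of _ "cmod (x - apex T)"] exI[of _ w]) (auto simp: scaleR_conv_of_real algebra_simps)
    qed
    show "W \<subseteq> ?V"
    proof
      fix x assume "x \<in> W"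
      then obtain \<rho> \<theta> where x: "x = apex T + \<rho> *\<^sub>R cis \<theta>" "0 < \<rho>" "t1 T < \<theta>" "\<theta> < t2 T"
        by (auto simp: W_def scaleR_conv_of_real)
      have "sin (\<theta> - t1 T) > 0" "sin (t2 T - \<theta>) > 0" using x angles by (auto intro!: sin_gt_zero)
      moreover have "sin (\<theta> - t2 T) = - sin (t2 T - \<theta>)" by (metis minus_diff_eq sin_minus)
      ultimately show "x \<in> ?V" using x(2) by (auto simp: x(1) lf_apex crs_scale_right crs_cis mult_pos_neg)
    qed
  qed
  have regV: "region (to_triangle T) \<subseteq> ?V"
  proof
    fix v assume "v \<in> region (to_triangle T)"
    then obtain x y z where v: "0 < x" "0 < y" "0 < z" "x + y + z = 1" "v = x *\<^sub>R apex T + y *\<^sub>R pa T + z *\<^sub>R pb T"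
      unfolding region_eq by blast
    have x: "x = 1 - y - z" using v by simp
    have "v - apex T = y *\<^sub>R (r *\<^sub>R cis (t1 T)) + z *\<^sub>R (s *\<^sub>R cis (t2 T))"
      unfolding v(5) x pa_apex pb_apex by (simp add: algebra_simps)
    then show "v \<in> ?V" using v r_pos s_pos \<sigma>_pos
      by (simp add: lf_apex crs_add_right crs_scale_right crs12)
  qed
  have "infinite_sector (apex T) W" unfolding infinite_sector_def W_def
    using angles pi_gt_zero by (intro exI[of _ "t1 T"] exI[of _ "t2 T"]) auto
  then show "spanned_sector (to_triangle T) \<subseteq> ?V"
    using regV VW unfolding spanned_sector_def by (intro Inter_lower) auto
  show "?V \<subseteq> spanned_sector (to_triangle T)"
    unfolding spanned_sector_def
  proof (intro Inter_greatest subsetI)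
    fix U x assume U: "U \<in> {W. infinite_sector (base_vertex (to_triangle T)) W \<and> region (to_triangle T) \<subseteq> W}" and x: "x \<in> ?V"
    obtain a b where ab: "a = - crs (cis (t2 T)) (x - apex T) / (\<sigma> * r)" "b = crs (cis (t1 T)) (x - apex T) / (\<sigma> * s)"
      "x = (1 - a - b) *\<^sub>R apex T + a *\<^sub>R pa T + b *\<^sub>R pb T" using hull_coords by metis
    have "crs (cis (t2 T)) (x - apex T) < 0" "crs (cis (t1 T)) (x - apex T) > 0" using x by (auto simp: lf_apex)
    then have pos: "a > 0" "b > 0" using \<sigma>_pos r_pos s_pos unfolding ab(1,2)
      by (intro divide_pos_pos mult_pos_pos; simp)+
    \<comment> \<open>A shrinking factor that makes the barycentric coordinate at the apex
      positive.\<close>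
    define e where "e = 1 / (1 + a + b)"
    have e: "e > 0" "e * (a + b) < 1" using pos by (simp_all add: e_def field_simps)
    have xa: "x - apex T = a *\<^sub>R (pa T - apex T) + b *\<^sub>R (pb T - apex T)"
      by (subst ab(3)) (simp add: algebra_simps)
    define y where "y = apex T + e *\<^sub>R (x - apex T)"
    have "y \<in> region (to_triangle T)" unfolding region_eq
    proof (intro CollectI exI conjI)
      show "0 < 1 - e * a - e * b" "0 < e * a" "0 < e * b" using e pos by (simp_all add: algebra_simps)
      show "(1 - e * a - e * b) *\<^sub>R apex T + (e * a) *\<^sub>R pa T + (e * b) *\<^sub>R pb T = y"
        unfolding y_def xa by (simp add: algebra_simps)
    qed simp
    then have "y \<in> U" using U by blast
    then obtain \<phi> \<psi> \<rho> \<theta> where s: "U = {apex T + complex_of_real r * cis \<theta> | r \<theta>. 0 < r \<and> \<phi> < \<theta> \<and> \<theta> < \<psi>}"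
      "y = apex T + complex_of_real \<rho> * cis \<theta>" "0 < \<rho>" "\<phi> < \<theta>" "\<theta> < \<psi>"
      using U by (auto simp: infinite_sector_def)
    have "e *\<^sub>R (x - apex T) = \<rho> *\<^sub>R cis \<theta>" using s(2) by (simp add: y_def scaleR_conv_of_real)
    then have "(1 / e) *\<^sub>R (e *\<^sub>R (x - apex T)) = (1 / e) *\<^sub>R (\<rho> *\<^sub>R cis \<theta>)" by simp
    then have "x = apex T + complex_of_real (\<rho> / e) * cis \<theta>"
      using e by (simp add: scaleR_conv_of_real algebra_simps)
    then show "x \<in> U" unfolding s(1) using s(3-5) e by (intro CollectI exI[of _ "\<rho> / e"] exI[of _ \<theta>]) auto
  qed
qed

lemma assoc_sector_eq: "assoc_sector (to_triangle T) = sreg T"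
proof -
  have "x \<in> tr \<longleftrightarrow> \<not> crs (pb T - pa T) (x - pa T) < 0" if "lf (pa T) (t1 T) x > 0" "lf (pb T) (t2 T) x < 0" for x
    using hullI[of x] hullD[of x] that by linarith
  then show ?thesis unfolding assoc_sector_def spanned_sector_eq closure_region sreg_def by blast
qed

lemma sector_sides:
  "k \<ge> 0 \<Longrightarrow> pa T + k *\<^sub>R cis (t1 T) \<in> sector_side1 (to_triangle T)"
  "k \<ge> 0 \<Longrightarrow> pb T + k *\<^sub>R cis (t2 T) \<in> sector_side2 (to_triangle T)"
proof -
  have "pa T - apex T = r *\<^sub>R cis (t1 T)" and pb: "pb T - apex T = s *\<^sub>R cis (t2 T)" using pa_apex pb_apex by simp_all
  then show "k \<ge> 0 \<Longrightarrow> pa T + k *\<^sub>R cis (t1 T) \<in> sector_side1 (to_triangle T)"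
    using r_pos unfolding sector_side1_def ray_away_def by (auto intro!: exI[of _ "k / r"])
  show "k \<ge> 0 \<Longrightarrow> pb T + k *\<^sub>R cis (t2 T) \<in> sector_side2 (to_triangle T)"
    using pb s_pos unfolding sector_side2_def ray_away_def by (auto intro!: exI[of _ "k / s"])
qed

end

section \<open>Admissibility and covering\<close>

context polygon
begin

text \<open>Within the spanned sector \<open>D\<close> avoids the associated sector and so lies in
  the closed triangle. It does have points there, because the midpoint of the base is a boundary
  point of \<open>D\<close>.\<close>

lemma good_admissible:
  assumes g: "good T" and vs: "set vs = verts"
  shows "admissible_triangle vs D (to_triangle T)"
proof -
  interpret shaped T "crs (cis (t2 T)) (pb T - pa T) / sin (t2 T - t1 T)"
    "crs (cis (t1 T)) (pb T - pa T) / sin (t2 T - t1 T)" "sin (t2 T - t1 T)"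
    by unfold_locales (use g good_shape in auto)
  obtain i where i: "i < n" "pa T \<in> edge i" "pb T \<in> edge i" using g by (auto simp: good_def)
  have "closed_segment (pa T) (pb T) \<subseteq> edge i" using i by (simp add: edge_def subset_closed_segment)
  then have base: "closed_segment (pa T) (pb T) \<subseteq> frontier D" using edge_bd[OF i(1)] frontier_D by auto
  define m where "m = pa T + (1 / 2) *\<^sub>R (pb T - pa T)"
  define U where "U = {x. lf (pa T) (t1 T) x > 0 \<and> lf (pb T) (t2 T) x < 0}"
  have oU: "open U" unfolding U_def lf_def by (intro open_Collect_conj open_Collect_less continuous_intros)
  have mU: "m \<in> U"
  proof -
    have "lf (pa T) (t1 T) m = crs (cis (t1 T)) (pb T - pa T) / 2" by (simp add: m_def lf_def crs_scale_right)
    moreover have "m - pb T = - ((1 / 2) *\<^sub>R (pb T - pa T))" by (simp add: m_def complex_eq_iff field_simps)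
    then have "lf (pb T) (t2 T) m = - (crs (cis (t2 T)) (pb T - pa T) / 2)"
      unfolding lf_def by (simp only: crs_minus_right crs_scale_right mult_1_left times_divide_eq_left)
    ultimately show ?thesis using shape by (simp add: U_def shape_def)
  qed
  have seg: "pa T + u *\<^sub>R (pb T - pa T) = (1 - u) *\<^sub>R pa T + u *\<^sub>R pb T" for u by (simp add: algebra_simps)
  have "m \<in> closed_segment (pa T) (pb T)" unfolding in_segment
    using seg[of "1 / 2"] by (intro exI[of _ "1 / 2"]) (simp add: m_def)
  then have "m \<in> closure D" using base by (auto simp: frontier_def)
  then obtain z where z: "z \<in> U \<inter> D" using mU oU closure_iff_nhds_not_empty[of m D] by blast
  have "U \<inter> D \<subseteq> tr"
  proof
    fix x assume x: "x \<in> U \<inter> D"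
    then have "x \<notin> sreg T" using sreg_D[OF g] by blast
    then have "crs (pb T - pa T) (x - pa T) \<ge> 0" using x by (auto simp: U_def sreg_def)
    then show "x \<in> tr" using x by (intro hullI) (auto simp: U_def)
  qed
  then have "U \<inter> D \<subseteq> region (to_triangle T)"
    using oU open_D unfolding region_def to_triangle_sel by (intro interior_maximal) auto
  then have "region (to_triangle T) \<inter> D \<noteq> {}" using z by blast
  moreover obtain k l where "k \<ge> 0" "pa T + k *\<^sub>R cis (t1 T) \<in> verts" "l \<ge> 0" "pb T + l *\<^sub>R cis (t2 T) \<in> verts"
    using g by (auto simp: good_def)
  then have "sector_side1 (to_triangle T) \<inter> verts \<noteq> {}" "sector_side2 (to_triangle T) \<inter> verts \<noteq> {}"
    using sector_sides by blast+
  ultimately show ?thesis unfolding admissible_triangle_def vs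
    using not_collinear base sreg_D[OF g] by (simp add: nondegenerate_def base_def assoc_sector_eq)
qed

text \<open>\<open>x\<close> lies in a closed spanned sector. If it were beyond the base, a short
  step along the middle direction would stay in \<open>D\<close> and enter the open associated
  sector.\<close>

lemma neutral_covers:
  assumes s: "sys ts" "neutral ts" and x: "x \<in> D"
  shows "\<exists>T\<in>set ts. x \<in> closure (region (to_triangle T))"
proof -
  obtain T where T: "T \<in> set ts" "lf (pa T) (t1 T) x \<ge> 0" "lf (pb T) (t2 T) x \<le> 0"
    using exists_left_right[of ts x] s by (auto simp: sys_def neutral_def)
  have g: "good T" using s T by (auto simp: sys_def)
  interpret shaped T "crs (cis (t2 T)) (pb T - pa T) / sin (t2 T - t1 T)"
    "crs (cis (t1 T)) (pb T - pa T) / sin (t2 T - t1 T)" "sin (t2 T - t1 T)"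
    by unfold_locales (use g good_shape in auto)
  have "crs (pb T - pa T) (x - pa T) \<ge> 0"
  proof (rule ccontr)
    assume "\<not> ?thesis"
    then have neg: "crs (pb T - pa T) (x - pa T) < 0" by simp
    obtain e where e: "e > 0" "ball x e \<subseteq> D" using open_D x open_contains_ball by blast
    define w where "w = (t1 T + t2 T) / 2"
    have w: "t1 T < w" "w < t2 T" using angles by (auto simp: w_def)
    define y where "y = x + (e / 2) *\<^sub>R cis w"
    have "y \<in> ball x e" using e by (simp add: y_def dist_norm)
    then have "y \<in> D" using e by blast
    moreover have "y \<in> sreg T"
    proof -
      have sw: "sin (w - t1 T) > 0" "sin (t2 T - w) > 0" using w angles by (auto intro!: sin_gt_zero)
      have "lf (pa T) (t1 T) y = lf (pa T) (t1 T) x + (e / 2) * sin (w - t1 T)" by (simp add: y_def lf_move)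
      moreover have "(e / 2) * sin (w - t1 T) > 0" using e(1) sw(1) by simp
      moreover have "sin (w - t2 T) = - sin (t2 T - w)" by (metis minus_diff_eq sin_minus)
      then have "lf (pb T) (t2 T) y = lf (pb T) (t2 T) x - (e / 2) * sin (t2 T - w)" by (simp add: y_def lf_move)
      moreover have "(e / 2) * sin (t2 T - w) > 0" using e(1) sw(2) by simp
      moreover have "crs (pb T - pa T) (cis w) < 0" using shape_direction[OF shape] w by simp
      then have "(e / 2) * crs (pb T - pa T) (cis w) < 0" using e(1) by (intro mult_pos_neg) auto
      moreover have "crs (pb T - pa T) (y - pa T) = crs (pb T - pa T) (x - pa T) + (e / 2) * crs (pb T - pa T) (cis w)"
        by (simp only: y_def crs_add_right crs_diff_right crs_scale_right)
      ultimately have "lf (pa T) (t1 T) y > 0" "lf (pb T) (t2 T) y < 0" "crs (pb T - pa T) (y - pa T) < 0"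
        using T(2,3) neg by argo+
      then show ?thesis by (simp add: sreg_def)
    qed
    ultimately show False using sreg_D[OF g] by blast
  qed
  then show ?thesis using hullI T closure_region by blast
qed

end

lemma ngon_polygon:
  assumes "ngon n vs D"
  shows "polygon n (\<lambda>i. vs ! i) (\<lambda>i. vs ! (Suc i mod n)) D"
    and "(!) vs ` {..<n} \<union> (\<lambda>i. vs ! (Suc i mod n)) ` {..<n} = set vs"
proof -
  have n: "3 \<le> n" "length vs = n" "distinct vs"
    and sd: "\<And>i j. i < n \<Longrightarrow> j < n \<Longrightarrow> i \<noteq> j \<Longrightarrow> side vs i \<inter> side vs j = side_ends vs i \<inter> side_ends vs j"
    and jd: "jordan_domain D" and fr: "frontier D = (\<Union>i<n. side vs i)"
    using assms by (auto simp: ngon_def)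
  obtain \<gamma> where g: "simple_path \<gamma>" "pathfinish \<gamma> = pathstart \<gamma>" "D = inside (path_image \<gamma>)"
    using jd by (auto simp: jordan_domain_def)
  note J = Jordan_inside_outside[OF g(1,2)]
  have md: "Suc i mod n < n" for i using n by simp
  have set_vs: "set vs = (!) vs ` {..<n}" using n(2) by (auto simp: set_conv_nth)
  show verts: "(!) vs ` {..<n} \<union> (\<lambda>i. vs ! (Suc i mod n)) ` {..<n} = set vs"
    using set_vs md by auto
  have side: "side vs i = closed_segment (vs ! i) (vs ! (Suc i mod n))"
    and ends: "side_ends vs i = {vs ! i, vs ! (Suc i mod n)}" for i
    by (simp_all add: side_def side_ends_def n(2))
  show "polygon n (\<lambda>i. vs ! i) (\<lambda>i. vs ! (Suc i mod n)) D"
  proof (unfold_locales, unfold verts)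
    fix i assume i: "i < n"
    have "i \<noteq> Suc i mod n" using i n(1) by (cases "Suc i < n") (auto simp: mod_Suc)
    then show "vs ! i \<noteq> vs ! (Suc i mod n)" using n i md by (simp add: nth_eq_iff_index_eq)
    show "x = vs ! i \<or> x = vs ! (Suc i mod n)"
      if xv: "x \<in> set vs" and xs: "x \<in> closed_segment (vs ! i) (vs ! (Suc i mod n))" for x
    proof -
      obtain k where k: "k < n" "x = vs ! k" using xv set_vs by auto
      show ?thesis
      proof (cases "k = i")
        case False
        have "x \<in> side vs k" using k by (simp add: side)
        then have "x \<in> side_ends vs i" using xs sd[OF k(1) i False] by (auto simp: side)
        then show ?thesis by (simp add: ends)
      qed (use k in simp)
    qed
    show "x \<in> set vs" if "j < n" "i \<noteq> j" "x \<in> closed_segment (vs ! i) (vs ! (Suc i mod n))"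
      "x \<in> closed_segment (vs ! j) (vs ! (Suc j mod n))" for j x
    proof -
      have "x \<in> side_ends vs i" using sd[OF i that(1,2)] that(3,4) by (auto simp: side)
      then show ?thesis using i md set_vs unfolding ends by blast
    qed
  next
    show "open D" "connected D" "bounded D" "D \<noteq> {}" using J g(3) by auto
    show "frontier D = (\<Union>i<n. closed_segment (vs ! i) (vs ! (Suc i mod n)))" using fr by (simp add: side)
    moreover have "frontier D = path_image \<gamma>" using J g(3) by auto
    ultimately show "connected (\<Union>i<n. closed_segment (vs ! i) (vs ! (Suc i mod n)))"
      using g(1) by (metis connected_path_image simple_path_imp_path)
  qed
qed

theorem theorem4:
  fixes D :: "complex set" and vs :: "complex list" and n nhat :: nat
  assumes "ngon n vs D"
    and "card (hull_sides D) = nhat"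
    and "3 \<le> nhat"
  shows "\<exists>m T. nhat \<le> m \<and> m \<le> n \<and>
           proportional_system vs D m T \<and>
           D \<subseteq> (\<Union>i\<in>{1..m}. closure (region (T i))) \<and>
           area D \<le> (\<Sum>i=1..m. area (region (T i)))"
proof -
  interpret polygon n "\<lambda>i. vs ! i" "\<lambda>i. vs ! (Suc i mod n)" D
    "\<lambda>i. closed_segment (vs ! i) (vs ! (Suc i mod n))" "(!) vs ` {..<n} \<union> (\<lambda>i. vs ! (Suc i mod n)) ` {..<n}"
    "\<Union>i<n. closed_segment (vs ! i) (vs ! (Suc i mod n))"
    using ngon_polygon(1)[OF assms(1)] by simp_all
  have verts: "set vs = (!) vs ` {..<n} \<union> (\<lambda>i. vs ! (Suc i mod n)) ` {..<n}"
    using ngon_polygon(2)[OF assms(1)] by simp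
  obtain ts M where ts: "sys ts" "neutral ts" "\<forall>T\<in>set ts. rat T = M" using equal_ratio_system by blast
  define m where "m = length ts"
  \<comment> \<open>Systems are numbered from 1, lists from 0.\<close>
  define T where "T i = to_triangle (ts ! (i - 1))" for i
  have in_ts: "ts ! (i - 1) \<in> set ts" if "i \<in> {1..m}" for i using that by (auto simp: m_def)
  have ball: "(\<exists>i\<in>{1..m}. R (ts ! (i - 1))) \<longleftrightarrow> (\<exists>x\<in>set ts. R x)" for R
  proof
    assume "\<exists>x\<in>set ts. R x"
    then obtain j where "j < m" "R (ts ! j)" by (auto simp: in_set_conv_nth m_def)
    then show "\<exists>i\<in>{1..m}. R (ts ! (i - 1))" by (intro bexI[of _ "Suc j"]) auto
  qed (use in_ts in blast)
  have good: "good (ts ! (i - 1))" if "i \<in> {1..m}" for i using in_ts[OF that] ts(1) by (auto simp: sys_def)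
  have sh: "shaped (ts ! (i - 1))" if "i \<in> {1..m}" for i
    using good[OF that] good_shape by unfold_locales
  have sec: "assoc_sector (T i) = sreg (ts ! (i - 1))" if "i \<in> {1..m}" for i
    using shaped.assoc_sector_eq[OF sh[OF that]] by (simp add: T_def)
  have "admissible_system vs D m T"
    unfolding admissible_system_def
  proof (intro conjI ballI impI)
    show "admissible_triangle vs D (T i)" if "i \<in> {1..m}" for i
      unfolding T_def using good_admissible[OF good[OF that] verts] .
    show "assoc_sector (T i) \<inter> assoc_sector (T j) = {}" if "i \<in> {1..m}" "j \<in> {1..m}" "i \<noteq> j" for i j
    proof -
      have "i - 1 < length ts" "j - 1 < length ts" "i - 1 \<noteq> j - 1" using that by (auto simp: m_def)
      then show ?thesis using disjoint_nth[of ts "i - 1" "j - 1"] ts(1) sec that by (simp add: sys_def)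
    qed
    show "- (convex hull D) \<subseteq> (\<Union>i\<in>{1..m}. closure (assoc_sector (T i)))"
    proof
      fix x assume "x \<in> - (convex hull D)"
      then have "\<exists>S\<in>set ts. x \<in> closure (sreg S)" using sys_covers_outside_D[OF ts(1)] by blast
      then show "x \<in> (\<Union>i\<in>{1..m}. closure (assoc_sector (T i)))"
        using ball[of "\<lambda>S. x \<in> closure (sreg S)"] sec by auto
    qed
  qed
  moreover have "base_angle (T i) / area (region (T i)) = M" if "i \<in> {1..m}" for i
    using shaped.ratio_eq[OF sh[OF that]] ts(3) in_ts[OF that] by (simp add: T_def)
  ultimately have prp: "proportional_system vs D m T" unfolding proportional_system_def by blast
  have cover: "D \<subseteq> (\<Union>i\<in>{1..m}. closure (region (T i)))"
  proof
    fix x assume "x \<in> D"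
    then have "\<exists>S\<in>set ts. x \<in> closure (region (to_triangle S))" using neutral_covers[OF ts(1,2)] by blast
    then show "x \<in> (\<Union>i\<in>{1..m}. closure (region (T i)))"
      using ball[of "\<lambda>S. x \<in> closure (region (to_triangle S))"] by (auto simp: T_def)
  qed
  have cl: "closure (region (T i)) \<in> lmeasurable" "measure lebesgue (closure (region (T i))) = area (region (T i))"
    if "i \<in> {1..m}" for i
  proof -
    note e = shaped.closure_region[OF sh[OF that]] shaped.area_region[OF sh[OF that]]
    show "closure (region (T i)) \<in> lmeasurable" unfolding T_def e(1)
      by (intro lmeasurable_compact finite_imp_compact_convex_hull) simp
    show "measure lebesgue (closure (region (T i))) = area (region (T i))"
      unfolding T_def e(1,2) using e(3) by (simp add: area_def)
  qed
  have "area D \<le> measure lebesgue (\<Union>i\<in>{1..m}. closure (region (T i)))"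
    unfolding area_def using cover open_D cl(1)
    by (intro measure_mono_fmeasurable fmeasurable.finite_UN) auto
  also have "\<dots> \<le> (\<Sum>i=1..m. measure lebesgue (closure (region (T i))))"
    using cl(1) by (intro measure_UNION_le) (auto simp: fmeasurableD)
  also have "\<dots> = (\<Sum>i=1..m. area (region (T i)))" using cl(2) by (intro sum.cong) auto
  finally have "area D \<le> (\<Sum>i=1..m. area (region (T i)))" .
  moreover have "nhat \<le> m" using hull_edges_le[OF ts(1)] assms(2) by (simp add: hull_sides_def m_def)
  moreover have "m \<le> n" using sys_length[OF ts(1)] by (simp add: m_def)
  ultimately show ?thesis using prp cover by blast
qed

end
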